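(* Let $T_3$ be a tetrahedron ($3$-simplex) in $\mathbb{R}^3$. Then $$v_3^{(3)}(T_3)=\frac{733}{12600000}+\frac{79\pi^2}{2424922500},\qquad v_3^{(5)}(T_3)=\frac{5125739}{4356374400000}-\frac{547\pi^2}{8943995970000}.$$
   Context: For a $d$-dimensional compact convex body $K_d\subset\mathbb{R}^d$ and $k\ge 1$, the volumetric moment is $v_d^{(k)}(K_d)=\mathbb{E}[\Delta_d^k]/(\operatorname{vol}_d K_d)^k$, where $\Delta_d=\operatorname{vol}_d\operatorname{conv}(\mathbf{X}_0,\ldots,\mathbf{X}_d)$ and $\mathbf{X}_0,\ldots,\mathbf{X}_d$ are independent uniformly distributed random points in $K_d$. It is invariant under nondegenerate affine transformations of $K_d$. *)

theory Defs
  imports "HOL-Probability.Probability"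
begin

text \<open>The ambient dimension $d$ is \<open>DIM('a)\<close>. The points $X_0, \dots, X_d$, independent and uniformly
  distributed on \<open>K\<close>, are the coordinates of a point of the product probability space;
  \<open>measure lborel\<close> is $d$-dimensional volume.\<close>

definition iid_uniform_points :: "'a::euclidean_space set \<Rightarrow> (nat \<Rightarrow> 'a) measure" where
  "iid_uniform_points K = (\<Pi>\<^sub>M i\<in>{0..DIM('a)}. uniform_measure lborel K)"

definition random_simplex_volume :: "(nat \<Rightarrow> 'a::euclidean_space) \<Rightarrow> real" where
  "random_simplex_volume X = measure lborel (convex hull (X ` {0..DIM('a)}))"

definition volumetric_moment :: "nat \<Rightarrow> 'a::euclidean_space set \<Rightarrow> real" where
  "volumetric_moment k K =
     prob_space.expectation (iid_uniform_points K) (\<lambda>X. random_simplex_volume X ^ k) / measure lborel K ^ k"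

end

theory Submission
  imports Defs
begin

text \<open>By affine invariance only the standard tetrahedron matters. There the volume of the
  random simplex, relative to the tetrahedron, is the absolute value of a 4x4 determinant whose rows
  are the barycentric coordinates of the four points (\<open>volumetric_moment_simplex3\<close>).
  Multiplying every row by an independent Gamma variable turns all sixteen entries into independent
  standard exponential variables, at the price of a factor (k+3)! per row
  (\<open>nn_integral_det4_std3_exponential\<close>). The volumetric moment is therefore 6^4 /
  (k+3)!^4 times the k-th absolute moment of the determinant of an exponential random matrix.

  Three of the rows span a hyperplane r = t . z. Passing from their r-coordinates to z
  (\<open>nn_integral_det4_hyperplane\<close>) factors the determinant and leaves an integral over z
  of two functions: \<open>plane_moment\<close>, of order k+1, for the 3x3 determinant of the rows
  in the hyperplane, and \<open>distance_moment\<close>, of order k, for the linear form r - t . z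
  of the remaining row. For odd k the order k+1 is even, so the absolute value disappears from the
  first function and it becomes a finite expression in joint moments of one row
  (\<open>plane_moment_transform\<close>).

  The signs of the normal (1, -z) decide how the hyperplane cuts the positive orthant. If they split
  as 1 + 3, the section is a triangular cone, the rows again have independent exponential
  coordinates, and everything reduces to Beta integrals with rational value
  (\<open>nn_integral_hyperplanes_ppp\<close>); the four classes of this kind contribute equally
  (\<open>nn_integral_hyperplanes_mmp\<close>). If they split as 2 + 2, the section is a
  quadrilateral cone. In suitable coordinates a row then consists of two independent asymmetric
  Laplace variables and one exponential variable (\<open>row_transform_quad\<close>), and the
  determinant moment is a polynomial in X = 4\<alpha>(1-\<alpha>) and Y = 4\<beta>(1-\<beta>) for
  the two Laplace parameters (\<open>quad_moment_4\<close>, \<open>quad_moment_6\<close>).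

  For the quadrilateral classes the positive and negative parts of the linear form contribute
  equally, and two further symmetries cut the domain down to a quarter
  (\<open>nn_integral_hyperplanes_mpp\<close>, \<open>nn_integral_mixed_density_fold\<close>). A
  rational substitution onto the unit cube (\<open>mixed_density_unit\<close>) gives an integrand
  that is polynomial in t, and after integration over t there remains the double integral of P(u,v)
  / (1 - u v)^(k+5) with an explicit polynomial P. Expanding in powers of u v turns it into a series
  of a rational function of m (\<open>nn_integral_bipoly_over_power\<close>). Its simple poles sum
  to rational numbers by telescoping, and its double poles produce zeta(2) = pi^2/6, which is the
  source of the terms with pi^2 (\<open>partial_fraction_sums\<close>,
  \<open>bipoly_3_series\<close>, \<open>bipoly_5_series\<close>).\<close>

section \<open>Linear changes of variables in Lebesgue integrals\<close>

text \<open>Lebesgue measure is determined by its values on boxes. The preimage of a box under A is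
  its image under the inverse matrix, and the volume of a linear image of a box is known.\<close>

lemma lborel_linear:
  fixes A :: "real^'n::{finite,wellorder}^'n::{finite,wellorder}"
  assumes "det A \<noteq> 0"
  shows "lborel = density (distr lborel borel ((*v) A)) (\<lambda>_. ennreal \<bar>det A\<bar>)"
proof (rule lborel_eqI)
  have [measurable]: "((*v) A) \<in> borel \<rightarrow>\<^sub>M borel"
    by (intro borel_measurable_continuous_onI linear_continuous_on) simp
  obtain A' where AA: "A ** A' = mat 1" "A' ** A = mat 1"
    using assms by (auto simp: invertible_det_nz[symmetric] invertible_def)
  fix l u :: "real^'n::{finite,wellorder}"
  assume lu: "\<And>b. b \<in> Basis \<Longrightarrow> l \<bullet> b \<le> u \<bullet> b"
  have vim: "((*v) A) -` box l u = ((*v) A') ` box l u"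
  proof (intro set_eqI iffI)
    fix x assume "x \<in> ((*v) A) -` box l u"
    moreover have "x = A' *v (A *v x)"
      by (simp add: matrix_vector_mul_assoc AA)
    ultimately show "x \<in> ((*v) A') ` box l u" by blast
  next
    fix x assume "x \<in> ((*v) A') ` box l u"
    then show "x \<in> ((*v) A) -` box l u"
      by (auto simp: matrix_vector_mul_assoc AA)
  qed
  have meas[measurable]: "((*v) A) -` box l u \<in> sets borel"
    using measurable_sets[of "(*v) A" borel borel "box l u"] by simp
  have bdd: "bounded (((*v) A) -` box l u)"
    unfolding vim by (intro bounded_linear_image) (auto intro: linear_conv_bounded_linear[THEN iffD1])
  have "measure lborel (((*v) A) -` box l u) = \<bar>det A'\<bar> * measure lborel (box l u)"
  proof -
    have "measure lebesgue (((*v) A') ` box l u)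
        = \<bar>det (matrix ((*v) A'))\<bar> * measure lebesgue (box l u)"
      by (rule measure_lebesgue_linear_transformation) auto
    then show ?thesis
      unfolding vim[symmetric] by simp
  qed
  also have "det A' = 1 / det A"
    using AA(1) by (metis det_I det_mul assms nonzero_eq_divide_eq mult.commute)
  finally have *: "\<bar>det A\<bar> * measure lborel (((*v) A) -` box l u) = measure lborel (box l u)"
    using assms by (simp add: abs_divide field_simps)
  have fin: "emeasure lborel (((*v) A) -` box l u) \<noteq> \<infinity>"
    using emeasure_bounded_finite[OF bdd] by simp
  have "emeasure (density (distr lborel borel ((*v) A)) (\<lambda>_. ennreal \<bar>det A\<bar>)) (box l u)
      = ennreal \<bar>det A\<bar> * emeasure lborel (((*v) A) -` box l u)"
    by (simp add: emeasure_density_const emeasure_distr)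
  also have "\<dots> = ennreal (measure lborel (box l u))"
    using fin by (simp add: emeasure_eq_ennreal_measure flip: ennreal_mult *)
  also have "\<dots> = (\<Prod>b\<in>Basis. (u - l) \<bullet> b)"
    using lu by (simp add: emeasure_eq_ennreal_measure[symmetric])
  finally show "emeasure (density (distr lborel borel ((*v) A)) (\<lambda>_. ennreal \<bar>det A\<bar>)) (box l u)
      = (\<Prod>b\<in>Basis. (u - l) \<bullet> b)" .
qed simp

lemma nn_integral_lborel_linear:
  fixes A :: "real^'n::{finite,wellorder}^'n::{finite,wellorder}"
  assumes "det A \<noteq> 0" and [measurable]: "f \<in> borel_measurable borel"
  shows "(\<integral>\<^sup>+x. f x \<partial>lborel) = ennreal \<bar>det A\<bar> * (\<integral>\<^sup>+x. f (A *v x) \<partial>lborel)"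
proof -
  have [measurable]: "((*v) A) \<in> borel \<rightarrow>\<^sub>M borel"
    by (intro borel_measurable_continuous_onI linear_continuous_on) simp
  show ?thesis
    by (subst lborel_linear[OF assms(1)]) (simp add: nn_integral_density nn_integral_distr nn_integral_cmult)
qed

lemma measurable_vec_nth [measurable]: "(\<lambda>x::real^'n. x $ i) \<in> borel_measurable borel"
  by (intro borel_measurable_continuous_onI continuous_intros)

lemma vector_3_eq: "(vector [a, b, c] :: real^3) = a *\<^sub>R axis 1 1 + b *\<^sub>R axis 2 1 + c *\<^sub>R axis 3 1"
  by (simp add: vec_eq_iff forall_3 axis_def)

lemma measurable_vector_3 [measurable (raw)]:
  assumes "f \<in> borel_measurable M" "g \<in> borel_measurable M" "h \<in> borel_measurable M"
  shows "(\<lambda>x. vector [f x, g x, h x] :: real^3) \<in> borel_measurable M"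
  unfolding vector_3_eq using assms by measurable

lemma nn_integral_lborel_prod2:
  fixes f :: "'a::euclidean_space \<times> 'b::euclidean_space \<Rightarrow> ennreal"
  assumes [measurable]: "f \<in> borel_measurable borel"
  shows "(\<integral>\<^sup>+x. f x \<partial>lborel) = (\<integral>\<^sup>+a. \<integral>\<^sup>+b. f (a, b) \<partial>lborel \<partial>lborel)"
proof -
  have "f \<in> borel_measurable (lborel \<Otimes>\<^sub>M lborel)"
    unfolding lborel_prod by simp
  then show ?thesis
    unfolding lborel_prod[symmetric] by (subst lborel.nn_integral_fst) simp_all
qed

lemma Basis_vec_3: "(Basis :: (real^3) set) = {axis 1 1, axis 2 1, axis 3 1}"
  by (auto simp: Basis_vec_def UNIV_3)

text \<open>The map from nested pairs of reals to vectors carries boxes to boxes of the same volume,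
  hence Lebesgue measure to Lebesgue measure; iterated integration follows from the product
  case.\<close>

lemma nn_integral_lborel_vec3:
  fixes f :: "real^3 \<Rightarrow> ennreal"
  assumes [measurable]: "f \<in> borel_measurable borel"
  shows "(\<integral>\<^sup>+x. f x \<partial>lborel) = (\<integral>\<^sup>+a. \<integral>\<^sup>+b. \<integral>\<^sup>+c. f (vector [a, b, c]) \<partial>lborel \<partial>lborel \<partial>lborel)"
proof -
  let ?v = "\<lambda>(a, b, c). vector [a, b, c] :: real^3"
  have [measurable]: "?v \<in> borel \<rightarrow>\<^sub>M borel"
    unfolding borel_prod[symmetric] by measurable
  have "lborel = distr lborel borel ?v"
  proof (rule lborel_eqI)
    fix l u :: "real^3" assume lu: "\<And>b. b \<in> Basis \<Longrightarrow> l \<bullet> b \<le> u \<bullet> b"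
    have vim: "?v -` box l u = box (l$1) (u$1) \<times> box (l$2) (u$2) \<times> box (l$3) (u$3)"
      by (auto simp: mem_box_cart forall_3)
    have "emeasure (distr lborel borel ?v) (box l u) = emeasure (lborel :: (real \<times> real \<times> real) measure)
      (box (l$1) (u$1) \<times> box (l$2) (u$2) \<times> box (l$3) (u$3))"
      by (simp add: emeasure_distr vim)
    also have "\<dots> = (\<Prod>b\<in>Basis. (u - l) \<bullet> b)"
    proof -
      have "l $ i \<le> u $ i" for i
        using lu[of "axis i 1"] by (simp add: inner_axis axis_in_Basis_iff)
      moreover have "emeasure (lborel :: (real \<times> real) measure) (A \<times> B) = emeasure lborel A * emeasure lborel B"
        if "A \<in> sets borel" "B \<in> sets borel" for A B
        unfolding lborel_prod[symmetric] using that by (simp add: lborel.emeasure_pair_measure_Times)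
      moreover have "emeasure (lborel :: (real \<times> real \<times> real) measure) (A \<times> B) = emeasure lborel A * emeasure lborel B"
        if "A \<in> sets borel" "B \<in> sets borel" for A B
        unfolding lborel_prod[symmetric, where 'b="real \<times> real"] using that by (simp add: lborel.emeasure_pair_measure_Times)
      moreover have "(\<Prod>b\<in>Basis. (u - l) \<bullet> b) = (u$1 - l$1) * ((u$2 - l$2) * (u$3 - l$3))"
        by (simp add: Basis_vec_3 inner_axis axis_eq_axis)
      ultimately show ?thesis
        by (simp add: ennreal_mult borel_Times)
    qed
    finally show "emeasure (distr lborel borel ?v) (box l u) = (\<Prod>b\<in>Basis. (u - l) \<bullet> b)" .
  qed simp
  then have "(\<integral>\<^sup>+x. f x \<partial>lborel) = (\<integral>\<^sup>+x. f x \<partial>distr lborel borel ?v)" by simp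
  also have "\<dots> = (\<integral>\<^sup>+x. f (?v x) \<partial>lborel)"
    by (simp add: nn_integral_distr)
  also have "\<dots> = (\<integral>\<^sup>+a. \<integral>\<^sup>+b. \<integral>\<^sup>+c. f (vector [a, b, c]) \<partial>lborel \<partial>lborel \<partial>lborel)"
  proof -
    have "(\<lambda>x. f (?v x)) \<in> borel_measurable borel" by measurable
    moreover have "(\<lambda>x. f (case x of (b, c) \<Rightarrow> vector [a, b, c])) \<in> borel_measurable borel" for a
      unfolding borel_prod[symmetric] by measurable
    ultimately show ?thesis
      by (simp add: nn_integral_lborel_prod2)
  qed
  finally show ?thesis .
qed

section \<open>Volumes of tetrahedra and reduction to the standard simplex\<close>

definition triple :: "real^3 \<Rightarrow> real^3 \<Rightarrow> real^3 \<Rightarrow> real" where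
  "triple x y z = x$1 * (y$2 * z$3 - y$3 * z$2) + x$2 * (y$3 * z$1 - y$1 * z$3)
     + x$3 * (y$1 * z$2 - y$2 * z$1)"

lemma measurable_triple [measurable (raw)]:
  assumes "f \<in> borel_measurable M" "g \<in> borel_measurable M" "h \<in> borel_measurable M"
  shows "(\<lambda>x. triple (f x) (g x) (h x)) \<in> borel_measurable M"
  unfolding triple_def using assms by measurable

lemma det_columns_triple: "det (\<chi> i j. (vector [x, y, z] :: (real^3)^3) $ j $ i) = triple x y z"
  by (simp add: det_3 triple_def algebra_simps)

lemma det_rows_triple: "det (vector [x, y, z] :: real^3^3) = triple x y z"
  by (simp add: det_3 triple_def algebra_simps)

lemma triple_matrix_mult: "triple (A *v x) (A *v y) (A *v z) = det A * triple x y z"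
  by (simp add: triple_def det_3 matrix_vector_mult_def sum_3 algebra_simps)

text \<open>The tetrahedron is a translate of the image of the standard simplex under the matrix
  whose columns are the three edge vectors at \<open>a\<close>, and the standard simplex has volume
  1/3!.\<close>

lemma measure_convex_hull_4:
  fixes a b c d :: "real^3"
  shows "measure lborel (convex hull {a, b, c, d}) = \<bar>triple (b - a) (c - a) (d - a)\<bar> / 6"
proof -
  define M where "M = (\<chi> i j. (vector [b - a, c - a, d - a] :: (real^3)^3) $ j $ i)"
  define std where "std = (convex hull insert 0 Basis :: (real^3) set)"
  have compact: "compact std" unfolding std_def
    by (intro finite_imp_compact_convex_hull) auto
  have col: "M *v axis 1 1 = b - a" "M *v axis 2 1 = c - a" "M *v axis 3 1 = d - a"
    by (auto simp: M_def matrix_vector_mult_basis column_def vec_eq_iff)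
  have "measure lebesgue (convex hull {a, b, c, d}) = measure lebesgue ((+) (-a) ` (convex hull {a, b, c, d}))"
    by (rule measure_translation [symmetric])
  also have "(+) (-a) ` (convex hull {a, b, c, d}) = convex hull ((+) (-a) ` {a, b, c, d})"
    by (rule convex_hull_translation [symmetric])
  also have "(+) (-a) ` {a, b, c, d} = ((*v) M) ` (insert 0 Basis)"
    by (simp add: Basis_vec_3 col)
  also have "convex hull (((*v) M) ` (insert 0 Basis)) = ((*v) M) ` std"
    unfolding std_def by (rule convex_hull_linear_image [symmetric]) auto
  also have "measure lebesgue (((*v) M) ` std) = \<bar>det M\<bar> * measure lebesgue std"
    using compact by (subst measure_lebesgue_linear_transformation)
      (auto intro: finite_imp_bounded_convex_hull dest: compact_imp_closed simp: std_def)
  also have "measure lebesgue std = measure lborel std" using compact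
    by (intro measure_completion) (auto dest: compact_imp_closed)
  also have "measure lborel std = 1 / fact CARD(3)" unfolding std_def
    by (simp add: content_std_simplex)
  finally have "measure lebesgue (convex hull {a, b, c, d}) = \<bar>triple (b - a) (c - a) (d - a)\<bar> / 6"
    by (simp add: M_def det_columns_triple fact_numeral)
  moreover have "measure lebesgue (convex hull {a, b, c, d}) = measure lborel (convex hull {a, b, c, d})"
    using finite_imp_compact_convex_hull[of "{a,b,c,d}"] by (intro measure_completion) (auto dest: compact_imp_closed)
  ultimately show ?thesis by simp
qed

definition std3 :: "(real^3) set" where
  "std3 = {x. 0 \<le> x$1 \<and> 0 \<le> x$2 \<and> 0 \<le> x$3 \<and> x$1 + x$2 + x$3 \<le> 1}"

lemma measurable_std3 [measurable]: "std3 \<in> sets borel"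
  unfolding std3_def by measurable

lemma std3_eq_convex_hull: "std3 = convex hull (insert 0 Basis)"
  unfolding std_simplex std3_def by (auto simp: Basis_vec_3 inner_axis axis_eq_axis)

lemma triple_diff_matrix_mult:
  "triple (A *v x - A *v w) (A *v y - A *v w) (A *v z - A *v w) = det A * triple (x - w) (y - w) (z - w)"
  by (simp add: triple_matrix_mult flip: matrix_vector_mult_diff_distrib)

text \<open>The edge vectors at one vertex serve as the columns of B. The volume is recorded as well
  because it normalises the uniform law.\<close>

lemma simplex3_obtain_affine:
  fixes T :: "(real^3) set"
  assumes "3 simplex T"
  obtains v B where "det B \<noteq> 0" "T = (\<lambda>x. v + B *v x) ` std3"
    "measure lborel T = \<bar>det B\<bar> / 6"
proof -
  obtain C where C: "\<not> affine_dependent C" "int (card C) = 3 + 1" "T = convex hull C"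
    using assms by (auto simp: simplex_def)
  then have "card C = 4" by simp
  then obtain a b c d where Ceq: "C = {a, b, c, d}"
    by (auto simp: card_Suc_eq numeral_eq_Suc)
  define B where "B = (\<chi> i j. (vector [b - a, c - a, d - a] :: (real^3)^3) $ j $ i)"
  have col: "B *v axis 1 1 = b - a" "B *v axis 2 1 = c - a" "B *v axis 3 1 = d - a"
    by (auto simp: B_def matrix_vector_mult_basis column_def vec_eq_iff)
  have T: "T = (\<lambda>x. a + B *v x) ` std3"
  proof -
    have "(\<lambda>x. a + B *v x) ` std3 = (+) a ` (((*v) B) ` (convex hull (insert 0 Basis)))"
      by (simp add: std3_eq_convex_hull image_image)
    also have "\<dots> = convex hull ((+) a ` ((*v) B) ` (insert 0 Basis))"
      by (simp only: convex_hull_linear_image[OF matrix_vector_mul_linear] convex_hull_translation)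
    also have "(+) a ` ((*v) B) ` (insert 0 Basis) = C"
      by (simp add: Basis_vec_3 col Ceq)
    finally show ?thesis using C by simp
  qed
  have meas: "measure lborel T = \<bar>det B\<bar> / 6"
    unfolding C(3) Ceq measure_convex_hull_4 by (simp add: B_def det_columns_triple)
  \<comment> \<open>A vanishing determinant would make T a null set, whereas the hull of four
    affinely independent points of a three-dimensional space has nonempty interior.\<close>
  have "det B \<noteq> 0"
  proof
    assume "det B = 0"
    then have "measure lborel T = 0" using meas by simp
    moreover have comp: "compact T"
      unfolding C(3) Ceq by (intro finite_imp_compact_convex_hull) auto
    ultimately have "emeasure lborel T = 0"
      using emeasure_bounded_finite[OF compact_imp_bounded[OF comp]] by (simp add: emeasure_eq_ennreal_measure)
    then have "T \<in> null_sets lborel"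
      using comp by (auto intro!: null_setsI dest: compact_imp_closed)
    then have "negligible T"
      by (simp add: negligible_iff_null_sets null_sets_completionI)
    then have "negligible (interior T)"
      using interior_subset negligible_subset by blast
    then have "interior T = {}"
      using open_not_negligible by blast
    moreover have "interior (convex hull C) \<noteq> {}"
      using C \<open>card C = 4\<close> interior_convex_hull_eq_empty[of C] by simp
    ultimately show False using C by simp
  qed
  then show ?thesis using that T meas by blast
qed

lemma nn_integral_lborel_affine:
  fixes B :: "real^'n::{finite,wellorder}^'n::{finite,wellorder}"
  assumes "det B \<noteq> 0" and [measurable]: "f \<in> borel_measurable borel"
  shows "(\<integral>\<^sup>+x. f x \<partial>lborel) = ennreal \<bar>det B\<bar> * (\<integral>\<^sup>+x. f (v + B *v x) \<partial>lborel)"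
proof -
  have "(\<integral>\<^sup>+x. f x \<partial>lborel) = (\<integral>\<^sup>+x. f x \<partial>distr lborel borel ((+) v))"
    by (simp add: lborel_distr_plus)
  also have "\<dots> = (\<integral>\<^sup>+x. f (v + x) \<partial>lborel)"
    by (simp add: nn_integral_distr)
  also have "\<dots> = ennreal \<bar>det B\<bar> * (\<integral>\<^sup>+x. f (v + B *v x) \<partial>lborel)"
    by (rule nn_integral_lborel_linear[OF assms(1)]) measurable
  finally show ?thesis .
qed

text \<open>The Jacobian of the affine map cancels against the normalisation by the volume of T;
  what remains is 6, the density of the uniform law on the standard simplex.\<close>

lemma nn_integral_uniform_simplex:
  assumes B: "det B \<noteq> 0" "T = (\<lambda>x. v + B *v x) ` std3" "measure lborel T = \<bar>det B\<bar> / 6"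
    and T[measurable]: "T \<in> sets borel"
    and [measurable]: "f \<in> borel_measurable borel"
  shows "(\<integral>\<^sup>+x. f x \<partial>uniform_measure lborel T) = 6 * (\<integral>\<^sup>+x. f (v + B *v x) * indicator std3 x \<partial>lborel)"
proof -
  have inj: "B *v x = B *v y \<longleftrightarrow> x = y" for x y
    using B(1) inj_matrix_vector_mult[of B] by (auto simp: invertible_det_nz inj_def)
  have ind: "indicator T (v + B *v x) = (indicator std3 x :: ennreal)" for x
    unfolding B(2) by (auto simp: indicator_def inj)
  have em: "emeasure lborel T = ennreal (\<bar>det B\<bar> / 6)"
    using B by (metis divide_eq_0_iff abs_eq_0 emeasure_eq_ennreal_measure measure_def enn2real_top zero_neq_numeral)
  have "(\<integral>\<^sup>+x. f x \<partial>uniform_measure lborel T) = (\<integral>\<^sup>+x. f x * indicator T x \<partial>lborel) / emeasure lborel T"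
    by (intro nn_integral_uniform_measure) auto
  also have "(\<integral>\<^sup>+x. f x * indicator T x \<partial>lborel)
      = ennreal \<bar>det B\<bar> * (\<integral>\<^sup>+x. f (v + B *v x) * indicator std3 x \<partial>lborel)"
    by (subst nn_integral_lborel_affine[OF B(1), of _ v]) (simp_all add: ind)
  also have "ennreal \<bar>det B\<bar> * (\<integral>\<^sup>+x. f (v + B *v x) * indicator std3 x \<partial>lborel) / emeasure lborel T
      = (ennreal \<bar>det B\<bar> / ennreal (\<bar>det B\<bar> / 6)) * (\<integral>\<^sup>+x. f (v + B *v x) * indicator std3 x \<partial>lborel)"
    by (simp add: em divide_ennreal_def ac_simps)
  also have "ennreal \<bar>det B\<bar> / ennreal (\<bar>det B\<bar> / 6) = 6"
    using B(1) by (simp add: divide_ennreal)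
  finally show ?thesis .
qed

text \<open>Each of the four uniform points contributes a density 6. The factor (|det B|/6)^k coming
  from the volume of the random simplex cancels against the k-th power of the volume of T. The value
  is kept as an \<open>ennreal\<close> integral, the form on which all later changes of variables
  and exchanges of integrals operate.\<close>

lemma volumetric_moment_simplex3:
  fixes T :: "(real^3) set"
  assumes "3 simplex T"
  shows "volumetric_moment k T = enn2real (6^4 *
    (\<integral>\<^sup>+a. (\<integral>\<^sup>+b. (\<integral>\<^sup>+c. (\<integral>\<^sup>+d. ennreal (\<bar>triple (b - a) (c - a) (d - a)\<bar> ^ k)
       * indicator std3 d \<partial>lborel) * indicator std3 c \<partial>lborel) * indicator std3 b \<partial>lborel) * indicator std3 a \<partial>lborel))"
proof -
  obtain v B where B: "det B \<noteq> 0" "T = (\<lambda>x. v + B *v x) ` std3" "measure lborel T = \<bar>det B\<bar> / 6"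
    using simplex3_obtain_affine[OF assms] .
  have T[measurable]: "T \<in> sets borel"
  proof -
    have "compact std3"
      unfolding std3_eq_convex_hull by (intro finite_imp_compact_convex_hull) auto
    then have "compact T"
      unfolding B(2) by (intro compact_continuous_image continuous_intros linear_continuous_on) auto
    then show ?thesis by (auto dest: compact_imp_closed)
  qed
  define U where "U = uniform_measure lborel T"
  have setsU[measurable_cong]: "sets U = sets borel" by (simp add: U_def)
  have em: "emeasure lborel T \<noteq> 0" "emeasure lborel T \<noteq> \<infinity>"
    using B by (auto simp: measure_def)
  interpret U: prob_space U
    unfolding U_def using em by (rule prob_space_uniform_measure)
  interpret P: product_sigma_finite "\<lambda>_::nat. U" ..
  define V where "V = (\<lambda>a b c d :: real^3. \<bar>triple (b - a) (c - a) (d - a)\<bar>)"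
  have [measurable]: "(\<lambda>x. V (f x) (g x) (h x) (j x)) \<in> borel_measurable M"
    if "f \<in> borel_measurable M" "g \<in> borel_measurable M" "h \<in> borel_measurable M" "j \<in> borel_measurable M"
    for f g h j and M :: "'z measure"
    unfolding V_def using that by measurable
  have V_aff: "V (v + B *v a) (v + B *v b) (v + B *v c) (v + B *v d) = \<bar>det B\<bar> * V a b c d" for a b c d
    by (simp add: V_def triple_diff_matrix_mult abs_mult)
  have ran: "{0..DIM(real^3)} = {0, 1, 2, 3 :: nat}" by auto
  have vol: "random_simplex_volume X = V (X 0) (X 1) (X 2) (X 3) / 6" for X :: "nat \<Rightarrow> real^3"
  proof -
    have "X ` {0..DIM(real^3)} = {X 0, X 1, X 2, X 3}" unfolding ran by auto
    then show ?thesis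
      unfolding random_simplex_volume_def V_def by (simp only: measure_convex_hull_4)
  qed
  have U_int: "(\<integral>\<^sup>+x. f x \<partial>U) = 6 * (\<integral>\<^sup>+x. f (v + B *v x) * indicator std3 x \<partial>lborel)"
    if "f \<in> borel_measurable borel" for f
    unfolding U_def by (rule nn_integral_uniform_simplex[OF B T that])
  have Bv[measurable]: "(\<lambda>x. v + B *v x) \<in> borel_measurable borel"
    by (intro borel_measurable_continuous_onI continuous_intros linear_continuous_on) auto
  define J where "J = (\<integral>\<^sup>+a. (\<integral>\<^sup>+b. (\<integral>\<^sup>+c. (\<integral>\<^sup>+d. ennreal (V a b c d ^ k)
       * indicator std3 d \<partial>lborel) * indicator std3 c \<partial>lborel) * indicator std3 b \<partial>lborel) * indicator std3 a \<partial>lborel)"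
  have "(\<integral>\<^sup>+X. ennreal (random_simplex_volume X ^ k) \<partial>iid_uniform_points T)
      = (\<integral>\<^sup>+X. ennreal ((V (X 0) (X 1) (X 2) (X 3) / 6) ^ k) \<partial>(\<Pi>\<^sub>M i\<in>{0, 1, 2, 3::nat}. U))"
    unfolding iid_uniform_points_def U_def[symmetric] ran vol ..
  also have "\<dots> = (\<integral>\<^sup>+a. \<integral>\<^sup>+b. \<integral>\<^sup>+c. \<integral>\<^sup>+d. ennreal ((V a b c d / 6) ^ k) \<partial>U \<partial>U \<partial>U \<partial>U)"
  proof -
    have "(\<integral>\<^sup>+X. f (X 0) (X 1) (X 2) (X 3) \<partial>(\<Pi>\<^sub>M i\<in>{0, 1, 2, 3::nat}. U))
      = (\<integral>\<^sup>+a. \<integral>\<^sup>+b. \<integral>\<^sup>+c. \<integral>\<^sup>+d. f a b c d \<partial>U \<partial>U \<partial>U \<partial>U)"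
      if [measurable]: "\<And>f1 f2 f3 f4 (M :: (nat \<Rightarrow> real^3) measure). f1 \<in> borel_measurable M \<Longrightarrow> f2 \<in> borel_measurable M \<Longrightarrow>
        f3 \<in> borel_measurable M \<Longrightarrow> f4 \<in> borel_measurable M \<Longrightarrow> (\<lambda>x. f (f1 x) (f2 x) (f3 x) (f4 x)) \<in> borel_measurable M"
       "\<And>a b c. f a b c \<in> borel_measurable borel"
      for f :: "real^3 \<Rightarrow> real^3 \<Rightarrow> real^3 \<Rightarrow> real^3 \<Rightarrow> ennreal"
      apply (subst P.product_nn_integral_insert_rev)
      apply simp
      apply simp
      apply measurable
      apply simp
      apply (intro nn_integral_cong)
      apply (subst P.product_nn_integral_insert_rev)
      apply simp
      apply simp
      apply measurable
      apply simp
      apply (intro nn_integral_cong)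
      apply (subst P.product_nn_integral_insert_rev)
      apply simp
      apply simp
      apply measurable
      apply simp
      apply (intro nn_integral_cong)
      apply (rule P.product_nn_integral_singleton)
      apply (subst measurable_cong_sets[OF setsU refl])
      apply (rule that(2))
      done
    note this[of "\<lambda>a b c d. ennreal ((V a b c d / 6) ^ k)"]
    then show ?thesis by simp
  qed
  also have "\<dots> = 6 * (\<integral>\<^sup>+a. (6 * (\<integral>\<^sup>+b. (6 * (\<integral>\<^sup>+c. (6 * (\<integral>\<^sup>+d. ennreal ((\<bar>det B\<bar> * V a b c d / 6) ^ k)
       * indicator std3 d \<partial>lborel)) * indicator std3 c \<partial>lborel)) * indicator std3 b \<partial>lborel)) * indicator std3 a \<partial>lborel)"
    by (simp add: U_int V_aff)
  also have "\<dots> = 6 * (\<integral>\<^sup>+a. (6 * (\<integral>\<^sup>+b. (6 * (\<integral>\<^sup>+c. (6 * (\<integral>\<^sup>+d. ennreal ((\<bar>det B\<bar> / 6) ^ k) * (ennreal (V a b c d ^ k)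
       * indicator std3 d) \<partial>lborel)) * indicator std3 c \<partial>lborel)) * indicator std3 b \<partial>lborel)) * indicator std3 a \<partial>lborel)"
    by (simp add: power_mult_distrib power_divide ennreal_mult[symmetric] V_def flip: mult.assoc)
  also have "\<dots> = ennreal ((\<bar>det B\<bar> / 6) ^ k) * (6^4 * J)"
    unfolding J_def
    by (simp add: nn_integral_cmult mult.assoc numeral_eq_Suc) (simp add: nn_integral_cmult mult.assoc mult.left_commute)
  finally have eq: "(\<integral>\<^sup>+X. ennreal (random_simplex_volume X ^ k) \<partial>iid_uniform_points T)
     = ennreal ((\<bar>det B\<bar> / 6) ^ k) * (6^4 * J)" .
  have m: "(\<lambda>X. random_simplex_volume X ^ k) \<in> borel_measurable (iid_uniform_points T)"
    unfolding vol iid_uniform_points_def U_def[symmetric] ran by measurable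
  \<comment> \<open>For a nonnegative measurable function the Bochner integral is
    \<open>enn2real\<close> of the nonnegative integral even when the latter is infinite, so
    integrability does not have to be settled at this point.\<close>
  have "volumetric_moment k T = enn2real (\<integral>\<^sup>+X. ennreal (random_simplex_volume X ^ k) \<partial>iid_uniform_points T) / (\<bar>det B\<bar> / 6) ^ k"
    unfolding volumetric_moment_def B(3)
    by (subst integral_eq_nn_integral[OF m]) (auto simp: random_simplex_volume_def)
  also have "\<dots> = enn2real (6^4 * J)"
    unfolding eq using B(1) by (simp add: enn2real_mult)
  finally show ?thesis unfolding J_def V_def .
qed

section \<open>Rows with independent exponential entries\<close>

text \<open>The determinant of the 4x4 matrix with rows (ri, ti), expanded along the first column so
  that its minors are the triple products of the t-parts.\<close>

definition det4 :: "real \<Rightarrow> real^3 \<Rightarrow> real \<Rightarrow> real^3 \<Rightarrow> real \<Rightarrow> real^3 \<Rightarrow> real \<Rightarrow> real^3 \<Rightarrow> real" where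
  "det4 r0 t0 r1 t1 r2 t2 r3 t3 =
     r0 * triple t1 t2 t3 - r1 * triple t0 t2 t3 + r2 * triple t0 t1 t3 - r3 * triple t0 t1 t2"

definition csum :: "real^3 \<Rightarrow> real" where "csum t = t$1 + t$2 + t$3"

text \<open>Joint density of four independent standard exponential variables. The first one is kept
  apart because hyperplanes will be written as graphs r = t . z.\<close>

definition row_density :: "real \<Rightarrow> real^3 \<Rightarrow> real" where
  "row_density r t = (if 0 \<le> r \<and> 0 \<le> t$1 \<and> 0 \<le> t$2 \<and> 0 \<le> t$3 then exp (- (r + csum t)) else 0)"

lemma measurable_csum [measurable (raw)]:
  assumes [measurable]: "f \<in> borel_measurable M"
  shows "(\<lambda>x. csum (f x)) \<in> borel_measurable M"
  unfolding csum_def by measurable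

lemma measurable_row_density [measurable (raw)]:
  assumes [measurable]: "f \<in> borel_measurable M" "g \<in> borel_measurable M"
  shows "(\<lambda>x. row_density (f x) (g x)) \<in> borel_measurable M"
  unfolding row_density_def by measurable

lemma measurable_det4 [measurable (raw)]:
  assumes [measurable]: "f0 \<in> borel_measurable M" "g0 \<in> borel_measurable M" "f1 \<in> borel_measurable M" "g1 \<in> borel_measurable M"
    "f2 \<in> borel_measurable M" "g2 \<in> borel_measurable M" "f3 \<in> borel_measurable M" "g3 \<in> borel_measurable M"
  shows "(\<lambda>x. det4 (f0 x) (g0 x) (f1 x) (g1 x) (f2 x) (g2 x) (f3 x) (g3 x)) \<in> borel_measurable M"
  unfolding det4_def by measurable

lemma row_density_nonneg [simp]: "0 \<le> row_density r t"
  by (simp add: row_density_def)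

lemma triple_diff_eq_det4: "triple (b - a) (c - a) (d - a) = det4 1 a 1 b 1 c 1 d"
  by (simp add: det4_def triple_def algebra_simps)

text \<open>Adding the other three columns to the first one does not change a determinant. This
  passes between the constant first column of the points of the simplex and their barycentric
  coordinates.\<close>

lemma det4_add_csum:
  "det4 (r0 + csum t0) t0 (r1 + csum t1) t1 (r2 + csum t2) t2 (r3 + csum t3) t3 = det4 r0 t0 r1 t1 r2 t2 r3 t3"
  by (simp add: det4_def csum_def triple_def algebra_simps)

lemma det4_scale:
  "det4 (s * r0) (s *\<^sub>R t0) r1 t1 r2 t2 r3 t3 = s * det4 r0 t0 r1 t1 r2 t2 r3 t3"
  "det4 r0 t0 (s * r1) (s *\<^sub>R t1) r2 t2 r3 t3 = s * det4 r0 t0 r1 t1 r2 t2 r3 t3"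
  "det4 r0 t0 r1 t1 (s * r2) (s *\<^sub>R t2) r3 t3 = s * det4 r0 t0 r1 t1 r2 t2 r3 t3"
  "det4 r0 t0 r1 t1 r2 t2 (s * r3) (s *\<^sub>R t3) = s * det4 r0 t0 r1 t1 r2 t2 r3 t3"
  by (simp_all add: det4_def triple_def algebra_simps)

lemma nn_integral_scale3:
  assumes "s > 0" and [measurable]: "f \<in> borel_measurable borel"
  shows "(\<integral>\<^sup>+x. f x \<partial>(lborel :: (real^3) measure)) = ennreal (s ^ 3) * (\<integral>\<^sup>+x. f (s *\<^sub>R x) \<partial>lborel)"
proof -
  have 1: "mat s *v x = s *\<^sub>R x" for x :: "real^3"
    by (simp add: vec_eq_iff matrix_vector_mult_def mat_def if_distrib[where f="\<lambda>y. y * _"] cong: if_cong)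
  have 2: "det (mat s :: real^3^3) = s ^ 3"
    by (simp add: det_3 mat_def power3_eq_cube)
  show ?thesis
    using nn_integral_lborel_linear[of "mat s :: real^3^3" f] assms by (simp add: 1 2)
qed

text \<open>Coordinates with independent exponential laws: their sum is Gamma distributed and independent of
  the normalised point, which is uniform on the simplex.\<close>

lemma nn_integral_std3_exponential:
  fixes h :: "real \<Rightarrow> real^3 \<Rightarrow> ennreal"
  assumes hm[measurable]: "(\<lambda>(s, x). h s x) \<in> borel_measurable (borel \<Otimes>\<^sub>M borel)"
    and hom: "\<And>s x. s > 0 \<Longrightarrow> h s (s *\<^sub>R x) = ennreal (s ^ k) * h 1 x"
  shows "(\<integral>\<^sup>+t. \<integral>\<^sup>+r. ennreal (row_density r t) * h (r + csum t) t \<partial>lborel \<partial>lborel)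
     = fact (k + 3) * (\<integral>\<^sup>+x. h 1 x * indicator std3 x \<partial>lborel)"
proof -
  have [measurable]: "(\<lambda>x. h (f x) (g x)) \<in> borel_measurable M"
    if [measurable]: "f \<in> borel_measurable M" "g \<in> borel_measurable M" for f g and M :: "'z measure"
    by measurable
  define J where "J = (\<integral>\<^sup>+x. h 1 x * indicator std3 x \<partial>lborel)"
  have "(\<integral>\<^sup>+t. \<integral>\<^sup>+r. ennreal (row_density r t) * h (r + csum t) t \<partial>lborel \<partial>lborel)
      = (\<integral>\<^sup>+t. \<integral>\<^sup>+s. ennreal (row_density (s - csum t) t) * h s t \<partial>lborel \<partial>lborel)"
  proof (rule nn_integral_cong)
    fix t :: "real^3"
    have "(\<lambda>r. ennreal (row_density r t) * h (r + csum t) t) \<in> borel_measurable borel" by measurable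
    \<comment> \<open>The new variable s is the sum of all four coordinates of the row.\<close>
    from nn_integral_real_affine[OF this, of 1 "- csum t"]
    show "(\<integral>\<^sup>+r. ennreal (row_density r t) * h (r + csum t) t \<partial>lborel)
        = (\<integral>\<^sup>+s. ennreal (row_density (s - csum t) t) * h s t \<partial>lborel)"
      by (simp add: add.commute[of "- csum t"])
  qed
  also have "\<dots> = (\<integral>\<^sup>+s. \<integral>\<^sup>+t. ennreal (row_density (s - csum t) t) * h s t \<partial>lborel \<partial>lborel)"
    by (intro lborel_pair.Fubini') measurable
  also have "\<dots> = (\<integral>\<^sup>+s. ennreal (s ^ (k + 3) * exp (- s)) * indicator {0..} s * J \<partial>lborel)"
  proof (intro nn_integral_cong_AE, use AE_lborel_singleton[of "0::real"] in eventually_elim)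
    fix s :: real assume "s \<noteq> 0"
    show "(\<integral>\<^sup>+t. ennreal (row_density (s - csum t) t) * h s t \<partial>lborel) = ennreal (s ^ (k + 3) * exp (- s)) * indicator {0..} s * J"
    proof (cases "s > 0")
      case True
      \<comment> \<open>With t = s x the Jacobian s^3 and the homogeneity factor s^k combine to
        s^(k+3) exp(-s), whose integral over s is the factor (k+3)!.\<close>
      have "(\<integral>\<^sup>+t. ennreal (row_density (s - csum t) t) * h s t \<partial>lborel)
         = ennreal (s ^ 3) * (\<integral>\<^sup>+x. ennreal (row_density (s - csum (s *\<^sub>R x)) (s *\<^sub>R x)) * h s (s *\<^sub>R x) \<partial>lborel)"
        by (rule nn_integral_scale3[OF True]) measurable
      also have "(\<integral>\<^sup>+x. ennreal (row_density (s - csum (s *\<^sub>R x)) (s *\<^sub>R x)) * h s (s *\<^sub>R x) \<partial>lborel)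
         = (\<integral>\<^sup>+x. ennreal (s ^ k * exp (- s)) * (h 1 x * indicator std3 x) \<partial>lborel)"
      proof (intro nn_integral_cong)
        fix x :: "real^3"
        have "s - csum (s *\<^sub>R x) = s * (1 - (x$1 + x$2 + x$3))"
          by (simp add: csum_def algebra_simps)
        then have "row_density (s - csum (s *\<^sub>R x)) (s *\<^sub>R x) = exp (- s) * indicator std3 x"
          using True by (auto simp: row_density_def std3_def indicator_def zero_le_mult_iff)
        then show "ennreal (row_density (s - csum (s *\<^sub>R x)) (s *\<^sub>R x)) * h s (s *\<^sub>R x)
          = ennreal (s ^ k * exp (- s)) * (h 1 x * indicator std3 x)"
          using True by (simp add: hom ennreal_mult ac_simps indicator_def)
      qed
      also have "\<dots> = ennreal (s ^ k * exp (- s)) * J"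
        unfolding J_def by (simp add: nn_integral_cmult)
      finally show ?thesis
        using True by (simp add: power_add ennreal_mult ac_simps)
    next
      case False
      then have "row_density (s - csum t) t = 0" for t
        using \<open>s \<noteq> 0\<close> by (auto simp: row_density_def csum_def)
      then show ?thesis using False \<open>s \<noteq> 0\<close> by simp
    qed
  qed
  also have "\<dots> = (\<integral>\<^sup>+s. ennreal (s ^ (k + 3) * exp (- s)) * indicator {0..} s \<partial>lborel) * J"
    by (simp add: nn_integral_multc)
  also have "\<dots> = fact (k + 3) * J"
    by (simp only: nn_intergal_power_times_exp_Ici of_nat_fact ennreal_fact)
  finally show ?thesis unfolding J_def .
qed

text \<open>The scale of one row is randomised at a time, starting from the innermost. The partial
  integrals \<open>V3\<close>, \<open>V2\<close>, \<open>V1\<close> remain homogeneous of degree k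
  in each row not yet treated, so \<open>nn_integral_std3_exponential\<close> applies four times,
  and each time yields (k+3)!.\<close>

lemma nn_integral_det4_std3_exponential:
  defines "w \<equiv> \<lambda>r t. ennreal (row_density r t)"
  shows "(fact (k + 3)) ^ 4 * (\<integral>\<^sup>+a. (\<integral>\<^sup>+b. (\<integral>\<^sup>+c. (\<integral>\<^sup>+d. ennreal (\<bar>triple (b - a) (c - a) (d - a)\<bar> ^ k)
       * indicator std3 d \<partial>lborel) * indicator std3 c \<partial>lborel) * indicator std3 b \<partial>lborel) * indicator std3 a \<partial>lborel)
     = (\<integral>\<^sup>+t0. \<integral>\<^sup>+r0. w r0 t0 * (\<integral>\<^sup>+t1. \<integral>\<^sup>+r1. w r1 t1 * (\<integral>\<^sup>+t2. \<integral>\<^sup>+r2. w r2 t2 * (\<integral>\<^sup>+t3. \<integral>\<^sup>+r3. w r3 t3 *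
          ennreal (\<bar>det4 r0 t0 r1 t1 r2 t2 r3 t3\<bar> ^ k) \<partial>lborel \<partial>lborel) \<partial>lborel \<partial>lborel) \<partial>lborel \<partial>lborel) \<partial>lborel \<partial>lborel)"
proof -
  define V where "V = (\<lambda>r0 t0 r1 t1 r2 t2 r3 t3. ennreal (\<bar>det4 r0 t0 r1 t1 r2 t2 r3 t3\<bar> ^ k))"
  have [measurable]: "(\<lambda>x. V (f0 x) (g0 x) (f1 x) (g1 x) (f2 x) (g2 x) (f3 x) (g3 x)) \<in> borel_measurable M"
    if [measurable]: "f0 \<in> borel_measurable M" "g0 \<in> borel_measurable M" "f1 \<in> borel_measurable M" "g1 \<in> borel_measurable M"
    "f2 \<in> borel_measurable M" "g2 \<in> borel_measurable M" "f3 \<in> borel_measurable M" "g3 \<in> borel_measurable M"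
    for f0 g0 f1 g1 f2 g2 f3 g3 and M :: "'z measure"
    unfolding V_def by measurable
  have [measurable]: "(\<lambda>x. w (f x) (g x)) \<in> borel_measurable M"
    if [measurable]: "f \<in> borel_measurable M" "g \<in> borel_measurable M" for f g and M :: "'z measure"
    unfolding w_def by measurable
  have Vs: "s > 0 \<Longrightarrow> V s (s *\<^sub>R t0) r1 t1 r2 t2 r3 t3 = ennreal (s ^ k) * V 1 t0 r1 t1 r2 t2 r3 t3"
    "s > 0 \<Longrightarrow> V r0 t0 s (s *\<^sub>R t1) r2 t2 r3 t3 = ennreal (s ^ k) * V r0 t0 1 t1 r2 t2 r3 t3"
    "s > 0 \<Longrightarrow> V r0 t0 r1 t1 s (s *\<^sub>R t2) r3 t3 = ennreal (s ^ k) * V r0 t0 r1 t1 1 t2 r3 t3"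
    "s > 0 \<Longrightarrow> V r0 t0 r1 t1 r2 t2 s (s *\<^sub>R t3) = ennreal (s ^ k) * V r0 t0 r1 t1 r2 t2 1 t3"
    for s r0 t0 r1 t1 r2 t2 r3 t3
    unfolding V_def using det4_scale[of s 1, simplified] det4_scale(2)[of _ _ s 1, simplified]
      det4_scale(3)[of _ _ _ _ s 1, simplified] det4_scale(4)[of _ _ _ _ _ _ s 1, simplified]
    by (simp_all add: abs_mult power_mult_distrib ennreal_mult)
  define V3 where "V3 = (\<lambda>r0 t0 r1 t1 r2 t2. \<integral>\<^sup>+t3. \<integral>\<^sup>+r3. w r3 t3 * V r0 t0 r1 t1 r2 t2 (r3 + csum t3) t3 \<partial>lborel \<partial>lborel)"
  define V2 where "V2 = (\<lambda>r0 t0 r1 t1. \<integral>\<^sup>+t2. \<integral>\<^sup>+r2. w r2 t2 * V3 r0 t0 r1 t1 (r2 + csum t2) t2 \<partial>lborel \<partial>lborel)"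
  define V1 where "V1 = (\<lambda>r0 t0. \<integral>\<^sup>+t1. \<integral>\<^sup>+r1. w r1 t1 * V2 r0 t0 (r1 + csum t1) t1 \<partial>lborel \<partial>lborel)"
  have [measurable]: "(\<lambda>x. V3 (f0 x) (g0 x) (f1 x) (g1 x) (f2 x) (g2 x)) \<in> borel_measurable M"
    if [measurable]: "f0 \<in> borel_measurable M" "g0 \<in> borel_measurable M" "f1 \<in> borel_measurable M" "g1 \<in> borel_measurable M"
    "f2 \<in> borel_measurable M" "g2 \<in> borel_measurable M"
    for f0 g0 f1 g1 f2 g2 and M :: "'z measure"
    unfolding V3_def by measurable
  have [measurable]: "(\<lambda>x. V2 (f0 x) (g0 x) (f1 x) (g1 x)) \<in> borel_measurable M"
    if [measurable]: "f0 \<in> borel_measurable M" "g0 \<in> borel_measurable M" "f1 \<in> borel_measurable M" "g1 \<in> borel_measurable M"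
    for f0 g0 f1 g1 and M :: "'z measure"
    unfolding V2_def by measurable
  have [measurable]: "(\<lambda>x. V1 (f0 x) (g0 x)) \<in> borel_measurable M"
    if [measurable]: "f0 \<in> borel_measurable M" "g0 \<in> borel_measurable M"
    for f0 g0 and M :: "'z measure"
    unfolding V1_def by measurable
  have V3s: "s > 0 \<Longrightarrow> V3 s (s *\<^sub>R t0) r1 t1 r2 t2 = ennreal (s ^ k) * V3 1 t0 r1 t1 r2 t2"
    "s > 0 \<Longrightarrow> V3 r0 t0 s (s *\<^sub>R t1) r2 t2 = ennreal (s ^ k) * V3 r0 t0 1 t1 r2 t2"
    "s > 0 \<Longrightarrow> V3 r0 t0 r1 t1 s (s *\<^sub>R t2) = ennreal (s ^ k) * V3 r0 t0 r1 t1 1 t2"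
    for s r0 t0 r1 t1 r2 t2
    unfolding V3_def by (simp_all add: Vs mult.left_commute[of "w _ _"] nn_integral_cmult)
  have V2s: "s > 0 \<Longrightarrow> V2 s (s *\<^sub>R t0) r1 t1 = ennreal (s ^ k) * V2 1 t0 r1 t1"
    "s > 0 \<Longrightarrow> V2 r0 t0 s (s *\<^sub>R t1) = ennreal (s ^ k) * V2 r0 t0 1 t1"
    for s r0 t0 r1 t1
    unfolding V2_def by (simp_all add: V3s mult.left_commute[of "w _ _"] nn_integral_cmult)
  have V1s: "s > 0 \<Longrightarrow> V1 s (s *\<^sub>R t0) = ennreal (s ^ k) * V1 1 t0" for s t0
    unfolding V1_def by (simp_all add: V2s mult.left_commute[of "w _ _"] nn_integral_cmult)
  have V3: "V3 r0 t0 r1 t1 r2 t2 = fact (k + 3) * (\<integral>\<^sup>+d. V r0 t0 r1 t1 r2 t2 1 d * indicator std3 d \<partial>lborel)"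
    for r0 t0 r1 t1 r2 t2
    unfolding V3_def w_def by (rule nn_integral_std3_exponential) (measurable, simp add: Vs)
  have V2: "V2 r0 t0 r1 t1 = fact (k + 3) * (\<integral>\<^sup>+d. V3 r0 t0 r1 t1 1 d * indicator std3 d \<partial>lborel)"
    for r0 t0 r1 t1
    unfolding V2_def w_def by (rule nn_integral_std3_exponential) (measurable, simp add: V3s)
  have V1: "V1 r0 t0 = fact (k + 3) * (\<integral>\<^sup>+d. V2 r0 t0 1 d * indicator std3 d \<partial>lborel)"
    for r0 t0
    unfolding V1_def w_def by (rule nn_integral_std3_exponential) (measurable, simp add: V2s)
  have V0: "(\<integral>\<^sup>+t0. \<integral>\<^sup>+r0. w r0 t0 * V1 (r0 + csum t0) t0 \<partial>lborel \<partial>lborel)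
     = fact (k + 3) * (\<integral>\<^sup>+d. V1 1 d * indicator std3 d \<partial>lborel)"
    unfolding w_def by (rule nn_integral_std3_exponential) (measurable, simp add: V1s)
  define K :: ennreal where "K = fact (k + 3)"
  define I3 where "I3 = (\<lambda>a b c. \<integral>\<^sup>+d. V 1 a 1 b 1 c 1 d * indicator std3 d \<partial>lborel)"
  have [measurable]: "(\<lambda>x. I3 (f x) (g x) (h x)) \<in> borel_measurable M"
    if [measurable]: "f \<in> borel_measurable M" "g \<in> borel_measurable M" "h \<in> borel_measurable M"
    for f g h and M :: "'z measure"
    unfolding I3_def by measurable
  define I2 where "I2 = (\<lambda>a b. \<integral>\<^sup>+c. I3 a b c * indicator std3 c \<partial>lborel)"
  have [measurable]: "(\<lambda>x. I2 (f x) (g x)) \<in> borel_measurable M"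
    if [measurable]: "f \<in> borel_measurable M" "g \<in> borel_measurable M" for f g and M :: "'z measure"
    unfolding I2_def by measurable
  define I1 where "I1 = (\<lambda>a. \<integral>\<^sup>+b. I2 a b * indicator std3 b \<partial>lborel)"
  have [measurable]: "(\<lambda>x. I1 (f x)) \<in> borel_measurable M"
    if [measurable]: "f \<in> borel_measurable M" for f and M :: "'z measure"
    unfolding I1_def by measurable
  have e3: "V3 1 a 1 b 1 c = K * I3 a b c" for a b c
    unfolding V3 I3_def K_def ..
  have e2: "V2 1 a 1 b = K * (K * I2 a b)" for a b
    unfolding V2 e3 I2_def K_def[symmetric] by (simp add: mult.assoc nn_integral_cmult)
  have e1: "V1 1 a = K * (K * (K * I1 a))" for a
    unfolding V1 e2 I1_def K_def[symmetric] by (simp add: mult.assoc nn_integral_cmult)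
  have "(\<integral>\<^sup>+t0. \<integral>\<^sup>+r0. w r0 t0 * V1 (r0 + csum t0) t0 \<partial>lborel \<partial>lborel)
     = K ^ 4 * (\<integral>\<^sup>+a. I1 a * indicator std3 a \<partial>lborel)"
    unfolding V0 e1 K_def[symmetric] by (simp add: mult.assoc nn_integral_cmult power4_eq_xxxx)
  then show ?thesis
    unfolding V1_def V2_def V3_def V_def det4_add_csum triple_diff_eq_det4 w_def K_def I1_def I2_def I3_def by (rule sym)
qed

section \<open>The hyperplane spanned by three rows\<close>

lemma AE_hyperplane_3:
  fixes a b c :: real
  assumes "a \<noteq> 0 \<or> b \<noteq> 0 \<or> c \<noteq> 0"
  shows "AE x in (lborel :: (real^3) measure). a * x$1 + b * x$2 + c * x$3 \<noteq> 0"
proof -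
  let ?v = "vector [a, b, c] :: real^3"
  have "?v \<noteq> 0" using assms by (simp add: vec_eq_iff forall_3)
  then have "negligible {x. ?v \<bullet> x = 0}" by (intro negligible_hyperplane) auto
  moreover have "{x. ?v \<bullet> x = 0} = {x::real^3. a * x$1 + b * x$2 + c * x$3 = 0}"
    by (simp add: inner_vec_def sum_3)
  ultimately have "{x::real^3. a * x$1 + b * x$2 + c * x$3 = 0} \<in> null_sets lebesgue"
    by (simp add: negligible_iff_null_sets)
  then have "AE x in lebesgue. x \<notin> {x::real^3. a * x$1 + b * x$2 + c * x$3 = (0::real)}"
    by (rule AE_not_in)
  then show ?thesis by (simp add: AE_completion_iff)
qed

text \<open>The triple product is a linear form in z whose coefficients are the components of the
  cross product of x and y. If x$1 is nonzero, the third component x$1 * y$2 - x$2 * y$1 is nonzero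
  for almost every y, and then the form vanishes only on a plane.\<close>

lemma AE_triple_nonzero: "AE x in lborel. AE y in lborel. AE z in lborel. triple x y z \<noteq> 0"
proof -
  have "AE x in (lborel :: (real^3) measure). 1 * x$1 + 0 * x$2 + 0 * x$3 \<noteq> 0"
    by (rule AE_hyperplane_3) simp
  then show ?thesis
  proof eventually_elim
    fix x :: "real^3" assume "1 * x$1 + 0 * x$2 + 0 * x$3 \<noteq> 0"
    then have "AE y in (lborel :: (real^3) measure). (- x$2) * y$1 + x$1 * y$2 + 0 * y$3 \<noteq> 0"
      by (intro AE_hyperplane_3) simp
    then show "AE y in lborel. AE z in lborel. triple x y z \<noteq> 0"
    proof eventually_elim
      fix y :: "real^3" assume "(- x$2) * y$1 + x$1 * y$2 + 0 * y$3 \<noteq> 0"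
      then have "AE z in (lborel :: (real^3) measure). (x$2 * y$3 - x$3 * y$2) * z$1 + (x$3 * y$1 - x$1 * y$3) * z$2
         + (x$1 * y$2 - x$2 * y$1) * z$3 \<noteq> 0"
        by (intro AE_hyperplane_3) (simp add: algebra_simps)
      then show "AE z in lborel. triple x y z \<noteq> 0"
        by eventually_elim (simp add: triple_def algebra_simps)
    qed
  qed
qed

text \<open>Subtracting the combination of the t-columns with coefficients z from the first column
  clears the entries of rows 1 to 3 and leaves r0 - t0 . z in row 0.\<close>

lemma det4_inner:
  "det4 r0 t0 (t1 \<bullet> z) t1 (t2 \<bullet> z) t2 (t3 \<bullet> z) t3 = (r0 - t0 \<bullet> z) * triple t1 t2 t3"
  by (simp add: det4_def triple_def inner_vec_def sum_3 algebra_simps)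

text \<open>The substitution (r1, r2, r3) = A z, where A has rows t1, t2, t3 and determinant equal
  to their triple product.\<close>

lemma nn_integral_rows_linear:
  assumes "triple t1 t2 t3 \<noteq> 0"
    and f: "\<And>f1 f2 f3 (M :: (real^3) measure). f1 \<in> borel_measurable M \<Longrightarrow> f2 \<in> borel_measurable M \<Longrightarrow>
        f3 \<in> borel_measurable M \<Longrightarrow> (\<lambda>x. f (f1 x) (f2 x) (f3 x)) \<in> borel_measurable M"
  shows "(\<integral>\<^sup>+r1. \<integral>\<^sup>+r2. \<integral>\<^sup>+r3. f r1 r2 r3 \<partial>lborel \<partial>lborel \<partial>lborel)
    = ennreal \<bar>triple t1 t2 t3\<bar> * (\<integral>\<^sup>+z. f (t1 \<bullet> z) (t2 \<bullet> z) (t3 \<bullet> z) \<partial>lborel)"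
proof -
  have fm: "(\<lambda>x::real^3. f (x$1) (x$2) (x$3)) \<in> borel_measurable borel"
    by (rule f) measurable
  let ?A = "vector [t1, t2, t3] :: real^3^3"
  have A: "(?A *v z) $ 1 = t1 \<bullet> z" "(?A *v z) $ 2 = t2 \<bullet> z" "(?A *v z) $ 3 = t3 \<bullet> z" for z
    by (simp_all add: matrix_vector_mult_def inner_vec_def)
  have "(\<integral>\<^sup>+r1. \<integral>\<^sup>+r2. \<integral>\<^sup>+r3. f r1 r2 r3 \<partial>lborel \<partial>lborel \<partial>lborel)
     = (\<integral>\<^sup>+x. f (x$1) (x$2) (x$3) \<partial>(lborel :: (real^3) measure))"
    by (subst nn_integral_lborel_vec3[OF fm]) simp
  also have "\<dots> = ennreal \<bar>triple t1 t2 t3\<bar> * (\<integral>\<^sup>+z. f (t1 \<bullet> z) (t2 \<bullet> z) (t3 \<bullet> z) \<partial>lborel)"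
    using nn_integral_lborel_linear[of ?A, OF _ fm] assms(1) by (simp add: det_rows_triple A)
  finally show ?thesis .
qed

text \<open>Three rows constrained to the hyperplane r = t . z, weighted by the exponential density.
  It is used with n = k + 1: k powers of the triple product come from the determinant and one from
  the Jacobian of the passage to z.\<close>

definition plane_moment :: "nat \<Rightarrow> real^3 \<Rightarrow> ennreal" where
  "plane_moment n z = (\<integral>\<^sup>+t1. \<integral>\<^sup>+t2. \<integral>\<^sup>+t3. ennreal (row_density (t1 \<bullet> z) t1) *
     (ennreal (row_density (t2 \<bullet> z) t2) * (ennreal (row_density (t3 \<bullet> z) t3) * ennreal (\<bar>triple t1 t2 t3\<bar> ^ n)))
     \<partial>lborel \<partial>lborel \<partial>lborel)"

text \<open>Up to the length of the normal, the k-th moment of the distance of an exponential row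
  from the hyperplane r = t . z.\<close>

definition distance_moment :: "nat \<Rightarrow> real^3 \<Rightarrow> ennreal" where
  "distance_moment k z = (\<integral>\<^sup>+t. \<integral>\<^sup>+r. ennreal (row_density r t) * ennreal (\<bar>r - t \<bullet> z\<bar> ^ k) \<partial>lborel \<partial>lborel)"

lemma measurable_plane_moment [measurable (raw)]:
  assumes [measurable]: "f \<in> borel_measurable M"
  shows "(\<lambda>x. plane_moment n (f x)) \<in> borel_measurable M"
  unfolding plane_moment_def by measurable

lemma measurable_distance_moment [measurable (raw)]:
  assumes [measurable]: "f \<in> borel_measurable M"
  shows "(\<lambda>x. distance_moment n (f x)) \<in> borel_measurable M"
  unfolding distance_moment_def by measurable

text \<open>The rows \<open>1, 2, 3\<close> span a hyperplane through the origin, \<open>r = t \<bullet> z\<close>; passing from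
  \<open>(r1, r2, r3)\<close> to \<open>z\<close> is the affine Blaschke--Petkantschin formula.\<close>

lemma nn_integral_det4_hyperplane:
  defines "w \<equiv> \<lambda>r t. ennreal (row_density r t)"
  shows "(\<integral>\<^sup>+t0. \<integral>\<^sup>+r0. w r0 t0 * (\<integral>\<^sup>+t1. \<integral>\<^sup>+r1. w r1 t1 * (\<integral>\<^sup>+t2. \<integral>\<^sup>+r2. w r2 t2 * (\<integral>\<^sup>+t3. \<integral>\<^sup>+r3. w r3 t3 *
          ennreal (\<bar>det4 r0 t0 r1 t1 r2 t2 r3 t3\<bar> ^ k) \<partial>lborel \<partial>lborel) \<partial>lborel \<partial>lborel) \<partial>lborel \<partial>lborel) \<partial>lborel \<partial>lborel)
     = (\<integral>\<^sup>+z. plane_moment (Suc k) z * distance_moment k z \<partial>lborel)"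
proof -
  define V where "V = (\<lambda>r0 t0 r1 t1 r2 t2 r3 t3. ennreal (\<bar>det4 r0 t0 r1 t1 r2 t2 r3 t3\<bar> ^ k))"
  have [measurable]: "(\<lambda>x. V (f0 x) (g0 x) (f1 x) (g1 x) (f2 x) (g2 x) (f3 x) (g3 x)) \<in> borel_measurable M"
    if [measurable]: "f0 \<in> borel_measurable M" "g0 \<in> borel_measurable M" "f1 \<in> borel_measurable M" "g1 \<in> borel_measurable M"
    "f2 \<in> borel_measurable M" "g2 \<in> borel_measurable M" "f3 \<in> borel_measurable M" "g3 \<in> borel_measurable M"
    for f0 g0 f1 g1 f2 g2 f3 g3 and M :: "'z measure"
    unfolding V_def by measurable
  have [measurable]: "(\<lambda>x. w (f x) (g x)) \<in> borel_measurable M"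
    if [measurable]: "f \<in> borel_measurable M" "g \<in> borel_measurable M" for f g and M :: "'z measure"
    unfolding w_def by measurable
  \<comment> \<open>With row 0 fixed, the t-integrals are moved outside, the three r-integrals are
    replaced by one over z, and z is then moved to the outermost place.\<close>
  have step: "(\<integral>\<^sup>+t1. \<integral>\<^sup>+r1. w r1 t1 * (\<integral>\<^sup>+t2. \<integral>\<^sup>+r2. w r2 t2 * (\<integral>\<^sup>+t3. \<integral>\<^sup>+r3. w r3 t3 *
          V r0 t0 r1 t1 r2 t2 r3 t3 \<partial>lborel \<partial>lborel) \<partial>lborel \<partial>lborel) \<partial>lborel \<partial>lborel)
       = (\<integral>\<^sup>+z. plane_moment (Suc k) z * ennreal (\<bar>r0 - t0 \<bullet> z\<bar> ^ k) \<partial>lborel)" for r0 t0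
  proof -
    define G where "G = (\<lambda>r1 t1 r2 t2 r3 t3. w r1 t1 * (w r2 t2 * (w r3 t3 * V r0 t0 r1 t1 r2 t2 r3 t3)))"
    have [measurable]: "(\<lambda>x. G (f1 x) (g1 x) (f2 x) (g2 x) (f3 x) (g3 x)) \<in> borel_measurable M"
      if [measurable]: "f1 \<in> borel_measurable M" "g1 \<in> borel_measurable M"
      "f2 \<in> borel_measurable M" "g2 \<in> borel_measurable M" "f3 \<in> borel_measurable M" "g3 \<in> borel_measurable M"
      for f1 g1 f2 g2 f3 g3 and M :: "'z measure"
      unfolding G_def by measurable
    have "(\<integral>\<^sup>+t1. \<integral>\<^sup>+r1. w r1 t1 * (\<integral>\<^sup>+t2. \<integral>\<^sup>+r2. w r2 t2 * (\<integral>\<^sup>+t3. \<integral>\<^sup>+r3. w r3 t3 *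
          V r0 t0 r1 t1 r2 t2 r3 t3 \<partial>lborel \<partial>lborel) \<partial>lborel \<partial>lborel) \<partial>lborel \<partial>lborel)
       = (\<integral>\<^sup>+t1. \<integral>\<^sup>+r1. \<integral>\<^sup>+t2. \<integral>\<^sup>+r2. \<integral>\<^sup>+t3. \<integral>\<^sup>+r3. G r1 t1 r2 t2 r3 t3
           \<partial>lborel \<partial>lborel \<partial>lborel \<partial>lborel \<partial>lborel \<partial>lborel)"
      unfolding G_def by (simp add: nn_integral_cmult)
    also have "\<dots> = (\<integral>\<^sup>+t1. \<integral>\<^sup>+r1. \<integral>\<^sup>+t2. \<integral>\<^sup>+t3. \<integral>\<^sup>+r2. \<integral>\<^sup>+r3. G r1 t1 r2 t2 r3 t3
           \<partial>lborel \<partial>lborel \<partial>lborel \<partial>lborel \<partial>lborel \<partial>lborel)"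
      by (intro nn_integral_cong lborel_pair.Fubini') measurable
    also have "\<dots> = (\<integral>\<^sup>+t1. \<integral>\<^sup>+t2. \<integral>\<^sup>+r1. \<integral>\<^sup>+t3. \<integral>\<^sup>+r2. \<integral>\<^sup>+r3. G r1 t1 r2 t2 r3 t3
           \<partial>lborel \<partial>lborel \<partial>lborel \<partial>lborel \<partial>lborel \<partial>lborel)"
      by (rule nn_integral_cong, rule lborel_pair.Fubini') measurable
    also have "\<dots> = (\<integral>\<^sup>+t1. \<integral>\<^sup>+t2. \<integral>\<^sup>+t3. \<integral>\<^sup>+r1. \<integral>\<^sup>+r2. \<integral>\<^sup>+r3. G r1 t1 r2 t2 r3 t3
           \<partial>lborel \<partial>lborel \<partial>lborel \<partial>lborel \<partial>lborel \<partial>lborel)"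
      by (rule nn_integral_cong, rule nn_integral_cong, rule lborel_pair.Fubini') measurable
    also have "\<dots> = (\<integral>\<^sup>+t1. \<integral>\<^sup>+t2. \<integral>\<^sup>+t3. ennreal \<bar>triple t1 t2 t3\<bar> *
           (\<integral>\<^sup>+z. G (t1 \<bullet> z) t1 (t2 \<bullet> z) t2 (t3 \<bullet> z) t3 \<partial>lborel) \<partial>lborel \<partial>lborel \<partial>lborel)"
    proof (rule nn_integral_cong_AE, use AE_triple_nonzero in eventually_elim)
      fix t1 :: "real^3" assume "AE t2 in lborel. AE t3 in lborel. triple t1 t2 t3 \<noteq> 0"
      then show "(\<integral>\<^sup>+t2. \<integral>\<^sup>+t3. \<integral>\<^sup>+r1. \<integral>\<^sup>+r2. \<integral>\<^sup>+r3. G r1 t1 r2 t2 r3 t3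
           \<partial>lborel \<partial>lborel \<partial>lborel \<partial>lborel \<partial>lborel) = (\<integral>\<^sup>+t2. \<integral>\<^sup>+t3. ennreal \<bar>triple t1 t2 t3\<bar> *
           (\<integral>\<^sup>+z. G (t1 \<bullet> z) t1 (t2 \<bullet> z) t2 (t3 \<bullet> z) t3 \<partial>lborel) \<partial>lborel \<partial>lborel)"
      proof (intro nn_integral_cong_AE, eventually_elim)
        fix t2 :: "real^3" assume "AE t3 in lborel. triple t1 t2 t3 \<noteq> 0"
        then show "(\<integral>\<^sup>+t3. \<integral>\<^sup>+r1. \<integral>\<^sup>+r2. \<integral>\<^sup>+r3. G r1 t1 r2 t2 r3 t3
           \<partial>lborel \<partial>lborel \<partial>lborel \<partial>lborel) = (\<integral>\<^sup>+t3. ennreal \<bar>triple t1 t2 t3\<bar> *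
           (\<integral>\<^sup>+z. G (t1 \<bullet> z) t1 (t2 \<bullet> z) t2 (t3 \<bullet> z) t3 \<partial>lborel) \<partial>lborel)"
        proof (intro nn_integral_cong_AE, eventually_elim)
          fix t3 :: "real^3" assume "triple t1 t2 t3 \<noteq> 0"
          then show "(\<integral>\<^sup>+r1. \<integral>\<^sup>+r2. \<integral>\<^sup>+r3. G r1 t1 r2 t2 r3 t3 \<partial>lborel \<partial>lborel \<partial>lborel) = ennreal \<bar>triple t1 t2 t3\<bar> *
           (\<integral>\<^sup>+z. G (t1 \<bullet> z) t1 (t2 \<bullet> z) t2 (t3 \<bullet> z) t3 \<partial>lborel)"
          proof (rule nn_integral_rows_linear)
            show "(\<lambda>x. G (f1 x) t1 (f2 x) t2 (f3 x) t3) \<in> borel_measurable M"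
              if [measurable]: "f1 \<in> borel_measurable M" "f2 \<in> borel_measurable M" "f3 \<in> borel_measurable M"
              for f1 f2 f3 and M :: "(real^3) measure"
              by measurable
          qed
        qed
      qed
    qed
    also have "\<dots> = (\<integral>\<^sup>+t1. \<integral>\<^sup>+t2. \<integral>\<^sup>+t3. \<integral>\<^sup>+z. ennreal \<bar>triple t1 t2 t3\<bar> *
           G (t1 \<bullet> z) t1 (t2 \<bullet> z) t2 (t3 \<bullet> z) t3 \<partial>lborel \<partial>lborel \<partial>lborel \<partial>lborel)"
      by (simp add: nn_integral_cmult)
    also have "\<dots> = (\<integral>\<^sup>+t1. \<integral>\<^sup>+t2. \<integral>\<^sup>+z. \<integral>\<^sup>+t3. ennreal \<bar>triple t1 t2 t3\<bar> *
           G (t1 \<bullet> z) t1 (t2 \<bullet> z) t2 (t3 \<bullet> z) t3 \<partial>lborel \<partial>lborel \<partial>lborel \<partial>lborel)"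
      by (rule nn_integral_cong, rule nn_integral_cong, rule lborel_pair.Fubini') measurable
    also have "\<dots> = (\<integral>\<^sup>+t1. \<integral>\<^sup>+z. \<integral>\<^sup>+t2. \<integral>\<^sup>+t3. ennreal \<bar>triple t1 t2 t3\<bar> *
           G (t1 \<bullet> z) t1 (t2 \<bullet> z) t2 (t3 \<bullet> z) t3 \<partial>lborel \<partial>lborel \<partial>lborel \<partial>lborel)"
      by (rule nn_integral_cong, rule lborel_pair.Fubini') measurable
    also have "\<dots> = (\<integral>\<^sup>+z. \<integral>\<^sup>+t1. \<integral>\<^sup>+t2. \<integral>\<^sup>+t3. ennreal \<bar>triple t1 t2 t3\<bar> *
           G (t1 \<bullet> z) t1 (t2 \<bullet> z) t2 (t3 \<bullet> z) t3 \<partial>lborel \<partial>lborel \<partial>lborel \<partial>lborel)"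
      by (rule lborel_pair.Fubini') measurable
    \<comment> \<open>The Jacobian supplies the power of the triple product beyond the k that
      \<open>det4_inner\<close> gives; the factor depending on row 0 separates.\<close>
    also have "\<dots> = (\<integral>\<^sup>+z. \<integral>\<^sup>+t1. \<integral>\<^sup>+t2. \<integral>\<^sup>+t3. (w (t1 \<bullet> z) t1 *
      (w (t2 \<bullet> z) t2 * (w (t3 \<bullet> z) t3 * ennreal (\<bar>triple t1 t2 t3\<bar> ^ Suc k)))) * ennreal (\<bar>r0 - t0 \<bullet> z\<bar> ^ k)
           \<partial>lborel \<partial>lborel \<partial>lborel \<partial>lborel)"
    proof -
      have "ennreal \<bar>triple t1 t2 t3\<bar> * G (t1 \<bullet> z) t1 (t2 \<bullet> z) t2 (t3 \<bullet> z) t3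
         = (w (t1 \<bullet> z) t1 * (w (t2 \<bullet> z) t2 * (w (t3 \<bullet> z) t3 * ennreal (\<bar>triple t1 t2 t3\<bar> ^ Suc k)))) *
             ennreal (\<bar>r0 - t0 \<bullet> z\<bar> ^ k)" for t1 t2 t3 z
        unfolding G_def V_def det4_inner abs_mult power_mult_distrib power_Suc
        by (simp add: ennreal_mult ac_simps)
      then show ?thesis by simp
    qed
    also have "\<dots> = (\<integral>\<^sup>+z. plane_moment (Suc k) z * ennreal (\<bar>r0 - t0 \<bullet> z\<bar> ^ k) \<partial>lborel)"
      unfolding plane_moment_def w_def by (simp add: nn_integral_multc del: power_Suc)
    finally show ?thesis .
  qed
  have "(\<integral>\<^sup>+t0. \<integral>\<^sup>+r0. w r0 t0 * (\<integral>\<^sup>+z. plane_moment (Suc k) z * ennreal (\<bar>r0 - t0 \<bullet> z\<bar> ^ k) \<partial>lborel) \<partial>lborel \<partial>lborel)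
     = (\<integral>\<^sup>+t0. \<integral>\<^sup>+r0. \<integral>\<^sup>+z. plane_moment (Suc k) z * (w r0 t0 * ennreal (\<bar>r0 - t0 \<bullet> z\<bar> ^ k)) \<partial>lborel \<partial>lborel \<partial>lborel)"
    by (simp add: nn_integral_cmult[symmetric] mult.left_commute)
  also have "\<dots> = (\<integral>\<^sup>+t0. \<integral>\<^sup>+z. \<integral>\<^sup>+r0. plane_moment (Suc k) z * (w r0 t0 * ennreal (\<bar>r0 - t0 \<bullet> z\<bar> ^ k)) \<partial>lborel \<partial>lborel \<partial>lborel)"
    by (rule nn_integral_cong, rule lborel_pair.Fubini') measurable
  also have "\<dots> = (\<integral>\<^sup>+z. \<integral>\<^sup>+t0. \<integral>\<^sup>+r0. plane_moment (Suc k) z * (w r0 t0 * ennreal (\<bar>r0 - t0 \<bullet> z\<bar> ^ k)) \<partial>lborel \<partial>lborel \<partial>lborel)"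
    by (rule lborel_pair.Fubini') measurable
  also have "\<dots> = (\<integral>\<^sup>+z. plane_moment (Suc k) z * distance_moment k z \<partial>lborel)"
    unfolding distance_moment_def w_def by (simp add: nn_integral_cmult)
  finally show ?thesis
    unfolding step[unfolded V_def] .
qed

section \<open>Even moments of 3x3 determinants with independent rows\<close>

lemma has_bochner_integral_pair_times:
  fixes f :: "'a \<Rightarrow> real" and g :: "'b \<Rightarrow> real"
  assumes "sigma_finite_measure M" "sigma_finite_measure N"
    and f: "has_bochner_integral M f a" and g: "has_bochner_integral N g b"
  shows "has_bochner_integral (M \<Otimes>\<^sub>M N) (\<lambda>q. f (fst q) * g (snd q)) (a * b)"
proof -
  interpret pair_sigma_finite M N
    using assms by (simp add: pair_sigma_finite_def)
  have [measurable]: "f \<in> borel_measurable M" "g \<in> borel_measurable N"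
    using f g by (auto dest: borel_measurable_has_bochner_integral)
  have int: "integrable M f" "integrable N g" and eq: "integral\<^sup>L M f = a" "integral\<^sup>L N g = b"
    using f g by (auto simp: has_bochner_integral_iff)
  have "integrable (M \<Otimes>\<^sub>M N) (\<lambda>q. f (fst q) * g (snd q))"
    using int by (intro Fubini_integrable) (auto simp: abs_mult)
  moreover have "integral\<^sup>L (M \<Otimes>\<^sub>M N) (\<lambda>q. f (fst q) * g (snd q)) = a * b"
    using calculation by (subst integral_fst'[symmetric]) (simp_all add: eq)
  ultimately show ?thesis by (simp add: has_bochner_integral_iff)
qed

text \<open>The summands may have either sign, but f and each of its partial integrals are
  nonnegative. Hence at each of the three stages the nonnegative integral equals the Bochner
  integral, which can be taken term by term.\<close>

lemma nn_integral_3_sum_products: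
  fixes u v w :: "'s \<Rightarrow> 'a \<Rightarrow> real"
  assumes f: "\<And>x y z. f x y z = (\<Sum>s\<in>S. c s * (u s x * v s y * w s z))"
    and nonneg: "\<And>x y z. 0 \<le> f x y z"
    and u: "\<And>s. s \<in> S \<Longrightarrow> has_bochner_integral M (u s) (U s)"
    and v: "\<And>s. s \<in> S \<Longrightarrow> has_bochner_integral M (v s) (V s)"
    and w: "\<And>s. s \<in> S \<Longrightarrow> has_bochner_integral M (w s) (W s)"
  shows "(\<integral>\<^sup>+x. \<integral>\<^sup>+y. \<integral>\<^sup>+z. ennreal (f x y z) \<partial>M \<partial>M \<partial>M) = ennreal (\<Sum>s\<in>S. c s * (U s * V s * W s))"
proof -
  have nn: "(\<integral>\<^sup>+x. ennreal (g x) \<partial>M) = ennreal a \<and> 0 \<le> a"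
    if "has_bochner_integral M g a" "\<And>x. 0 \<le> g x" for g a
    using that by (auto simp: has_bochner_integral_iff nn_integral_eq_integral intro!: integral_nonneg)
  have 3: "(\<integral>\<^sup>+z. ennreal (f x y z) \<partial>M) = ennreal (\<Sum>s\<in>S. c s * (u s x * v s y * W s)) \<and> 0 \<le> (\<Sum>s\<in>S. c s * (u s x * v s y * W s))" for x y
    using nonneg w by (intro nn) (auto simp: f intro!: has_bochner_integral_sum has_bochner_integral_mult_right)
  have 2: "(\<integral>\<^sup>+y. ennreal (\<Sum>s\<in>S. c s * (u s x * v s y * W s)) \<partial>M) = ennreal (\<Sum>s\<in>S. c s * (u s x * V s * W s))
      \<and> 0 \<le> (\<Sum>s\<in>S. c s * (u s x * V s * W s))" for x
    using 3 v by (intro nn) (auto intro!: has_bochner_integral_sum has_bochner_integral_mult_right has_bochner_integral_mult_left)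
  have 1: "(\<integral>\<^sup>+x. ennreal (\<Sum>s\<in>S. c s * (u s x * V s * W s)) \<partial>M) = ennreal (\<Sum>s\<in>S. c s * (U s * V s * W s))
      \<and> 0 \<le> (\<Sum>s\<in>S. c s * (U s * V s * W s))"
    using 2 u by (intro nn) (auto intro!: has_bochner_integral_sum has_bochner_integral_mult_right has_bochner_integral_mult_left)
  show ?thesis
    using 1 2 3 by simp
qed

definition det3 :: "real \<times> real \<times> real \<Rightarrow> real \<times> real \<times> real \<Rightarrow> real \<times> real \<times> real \<Rightarrow> real" where
  "det3 = (\<lambda>(l1, x1, y1) (l2, x2, y2) (l3, x3, y3).
     l1 * (x2 * y3 - y2 * x3) + x1 * (y2 * l3 - l2 * y3) + y1 * (l2 * x3 - x2 * l3))"

text \<open>The \<open>n\<close>-th moment of the determinant of three independent rows whose joint moments are \<open>\<mu>\<close>.\<close>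

definition det_moment :: "nat \<Rightarrow> (nat \<Rightarrow> nat \<Rightarrow> nat \<Rightarrow> real) \<Rightarrow> real" where
  "det_moment n \<mu> = (\<Sum>i\<le>n. \<Sum>j\<le>n-i. \<Sum>p\<le>i. \<Sum>q\<le>j. \<Sum>r\<le>n-i-j.
     real ((n choose i) * (n-i choose j) * (i choose p) * (j choose q) * (n-i-j choose r)) *
     (-1) ^ ((i-p) + (j-q) + (n-i-j-r)) *
     (\<mu> i j (n-i-j) * \<mu> ((j-q) + r) (p + (n-i-j-r)) ((i-p) + q) * \<mu> (q + (n-i-j-r)) ((i-p) + r) (p + (j-q))))"

lemma diff_power_binomial:
  fixes a b :: real
  shows "(a - b) ^ n = (\<Sum>k\<le>n. real (n choose k) * a ^ k * ((-1) ^ (n-k) * b ^ (n-k)))"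
  using binomial_ring[of a "-b" n] by (simp add: power_minus[of b])

lemma sum_product_3:
  fixes a :: "'a \<Rightarrow> real"
  shows "k * (sum a P * sum b Q * sum c R) = (\<Sum>p\<in>P. \<Sum>q\<in>Q. \<Sum>r\<in>R. k * (a p * b q * c r))"
  by (simp flip: sum_distrib_left sum_distrib_right)

text \<open>Expansion along the first row by the trinomial formula with exponents i, j, n-i-j,
  followed by the binomial formula for each 2x2 cofactor with indices p, q, r. In every term the
  exponents belonging to any one row add up to n.\<close>

lemma det3_power:
  "det3 (l1, x1, y1) (l2, x2, y2) (l3, x3, y3) ^ n = (\<Sum>i\<le>n. \<Sum>j\<le>n-i. \<Sum>p\<le>i. \<Sum>q\<le>j. \<Sum>r\<le>n-i-j.
     real ((n choose i) * (n-i choose j) * (i choose p) * (j choose q) * (n-i-j choose r)) *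
     (-1) ^ ((i-p) + (j-q) + (n-i-j-r)) *
     ((l1 ^ i * x1 ^ j * y1 ^ (n-i-j)) * (l2 ^ ((j-q) + r) * x2 ^ (p + (n-i-j-r)) * y2 ^ ((i-p) + q)) *
      (l3 ^ (q + (n-i-j-r)) * x3 ^ ((i-p) + r) * y3 ^ (p + (j-q)))))"
proof -
  define A where "A = x2 * y3 - y2 * x3"
  define B where "B = y2 * l3 - l2 * y3"
  define C where "C = l2 * x3 - x2 * l3"
  have A: "A ^ m = (\<Sum>p\<le>m. real (m choose p) * (-1) ^ (m-p) * ((x2 ^ p * y2 ^ (m-p)) * (y3 ^ p * x3 ^ (m-p))))" for m
    unfolding A_def diff_power_binomial by (simp add: power_mult_distrib ac_simps)
  have B: "B ^ m = (\<Sum>p\<le>m. real (m choose p) * (-1) ^ (m-p) * ((y2 ^ p * l2 ^ (m-p)) * (l3 ^ p * y3 ^ (m-p))))" for m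
    unfolding B_def diff_power_binomial by (simp add: power_mult_distrib ac_simps)
  have C: "C ^ m = (\<Sum>p\<le>m. real (m choose p) * (-1) ^ (m-p) * ((l2 ^ p * x2 ^ (m-p)) * (x3 ^ p * l3 ^ (m-p))))" for m
    unfolding C_def diff_power_binomial by (simp add: power_mult_distrib ac_simps)
  have "det3 (l1, x1, y1) (l2, x2, y2) (l3, x3, y3) ^ n = (l1 * A + (x1 * B + y1 * C)) ^ n"
    by (simp add: det3_def A_def B_def C_def add.assoc)
  also have "\<dots> = (\<Sum>i\<le>n. real (n choose i) * (l1 * A) ^ i * (\<Sum>j\<le>n-i. real (n-i choose j) * (x1 * B) ^ j * (y1 * C) ^ (n-i-j)))"
    by (simp add: binomial_ring)
  also have "\<dots> = (\<Sum>i\<le>n. \<Sum>j\<le>n-i. real (n choose i) * real (n-i choose j) * (l1 ^ i * x1 ^ j * y1 ^ (n-i-j)) *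
      (A ^ i * B ^ j * C ^ (n-i-j)))"
    by (simp add: sum_distrib_left power_mult_distrib ac_simps)
  also have "\<dots> = (\<Sum>i\<le>n. \<Sum>j\<le>n-i. \<Sum>p\<le>i. \<Sum>q\<le>j. \<Sum>r\<le>n-i-j. real (n choose i) * real (n-i choose j) * (l1 ^ i * x1 ^ j * y1 ^ (n-i-j)) *
      ((real (i choose p) * (-1) ^ (i-p) * ((x2 ^ p * y2 ^ (i-p)) * (y3 ^ p * x3 ^ (i-p)))) *
       (real (j choose q) * (-1) ^ (j-q) * ((y2 ^ q * l2 ^ (j-q)) * (l3 ^ q * y3 ^ (j-q)))) *
       (real (n-i-j choose r) * (-1) ^ (n-i-j-r) * ((l2 ^ r * x2 ^ (n-i-j-r)) * (x3 ^ r * l3 ^ (n-i-j-r))))))"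
    unfolding A B C by (simp only: sum_product_3)
  also have "\<dots> = (\<Sum>i\<le>n. \<Sum>j\<le>n-i. \<Sum>p\<le>i. \<Sum>q\<le>j. \<Sum>r\<le>n-i-j.
     real ((n choose i) * (n-i choose j) * (i choose p) * (j choose q) * (n-i-j choose r)) *
     (-1) ^ ((i-p) + (j-q) + (n-i-j-r)) *
     ((l1 ^ i * x1 ^ j * y1 ^ (n-i-j)) * (l2 ^ ((j-q) + r) * x2 ^ (p + (n-i-j-r)) * y2 ^ ((i-p) + q)) *
      (l3 ^ (q + (n-i-j-r)) * x3 ^ ((i-p) + r) * y3 ^ (p + (j-q)))))"
    unfolding power_add of_nat_mult by (intro sum.cong refl) (simp only: ac_simps)
  finally show ?thesis .
qed

text \<open>For even n the power is nonnegative, so its signed expansion can be integrated term by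
  term; only joint moments of total degree n occur.\<close>

lemma nn_integral_det3_power:
  fixes M :: "'a measure" and l x y :: "'a \<Rightarrow> real"
  assumes mom: "\<And>a b c. a + b + c = n \<Longrightarrow> has_bochner_integral M (\<lambda>q. l q ^ a * x q ^ b * y q ^ c) (\<mu> a b c)"
    and "even n"
  shows "(\<integral>\<^sup>+q1. \<integral>\<^sup>+q2. \<integral>\<^sup>+q3. ennreal (det3 (l q1, x q1, y q1) (l q2, x q2, y q2) (l q3, x q3, y q3) ^ n) \<partial>M \<partial>M \<partial>M)
    = ennreal (det_moment n \<mu>)"
proof -
  define S where "S = (SIGMA i:{..n}. SIGMA j:{..n-i}. {..i} \<times> {..j} \<times> {..n-i-j})"
  have S_sum: "(\<Sum>i\<le>n. \<Sum>j\<le>n-i. \<Sum>p\<le>i. \<Sum>q\<le>j. \<Sum>r\<le>n-i-j. g i j p q r) = (\<Sum>(i, j, p, q, r)\<in>S. g i j p q r)"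
    for g :: "nat \<Rightarrow> nat \<Rightarrow> nat \<Rightarrow> nat \<Rightarrow> nat \<Rightarrow> real"
    unfolding S_def by (simp add: sum.Sigma sum.cartesian_product split_def)
  let ?c = "\<lambda>(i, j, p, q, r). real ((n choose i) * (n-i choose j) * (i choose p) * (j choose q) * (n-i-j choose r)) *
     (-1) ^ ((i-p) + (j-q) + (n-i-j-r))"
  let ?u = "\<lambda>(i, j, p, q, r) z. l z ^ i * x z ^ j * y z ^ (n-i-j)"
  let ?v = "\<lambda>(i, j, p, q, r) z. l z ^ ((j-q) + r) * x z ^ (p + (n-i-j-r)) * y z ^ ((i-p) + q)"
  let ?w = "\<lambda>(i, j, p, q, r) z. l z ^ (q + (n-i-j-r)) * x z ^ ((i-p) + r) * y z ^ (p + (j-q))"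
  let ?U = "\<lambda>(i, j, p, q, r). \<mu> i j (n-i-j)"
  let ?V = "\<lambda>(i, j, p, q, r). \<mu> ((j-q) + r) (p + (n-i-j-r)) ((i-p) + q)"
  let ?W = "\<lambda>(i, j, p, q, r). \<mu> (q + (n-i-j-r)) ((i-p) + r) (p + (j-q))"
  have "(\<integral>\<^sup>+q1. \<integral>\<^sup>+q2. \<integral>\<^sup>+q3. ennreal (det3 (l q1, x q1, y q1) (l q2, x q2, y q2) (l q3, x q3, y q3) ^ n) \<partial>M \<partial>M \<partial>M)
    = ennreal (\<Sum>s\<in>S. ?c s * (?U s * ?V s * ?W s))"
  proof (rule nn_integral_3_sum_products)
    show "det3 (l q1, x q1, y q1) (l q2, x q2, y q2) (l q3, x q3, y q3) ^ n = (\<Sum>s\<in>S. ?c s * (?u s q1 * ?v s q2 * ?w s q3))" for q1 q2 q3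
      unfolding det3_power S_sum by (simp add: split_def)
    show "0 \<le> det3 (l q1, x q1, y q1) (l q2, x q2, y q2) (l q3, x q3, y q3) ^ n" for q1 q2 q3
      using \<open>even n\<close> by (rule zero_le_even_power)
    fix s assume "s \<in> S"
    then show "has_bochner_integral M (?u s) (?U s)" "has_bochner_integral M (?v s) (?V s)" "has_bochner_integral M (?w s) (?W s)"
      unfolding S_def by (auto simp: mom)
  qed
  also have "(\<Sum>s\<in>S. ?c s * (?U s * ?V s * ?W s)) = det_moment n \<mu>"
    unfolding det_moment_def S_sum by (simp add: split_def)
  finally show ?thesis .
qed

text \<open>Here \<psi> parametrises the rows of the hyperplane so that the weight becomes \<theta>
  times the measure \<nu>, and the triple product of three such rows is \<theta> times a determinant
  in the coordinates l, x, y. The factor \<theta> thus occurs three times as a Jacobian and n times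
  in the determinant, whence the exponent n + 3.\<close>

lemma plane_moment_transform:
  fixes \<nu> :: "'a measure" and l x y :: "'a \<Rightarrow> real" and \<psi> :: "'a \<Rightarrow> real^3"
  assumes "sigma_finite_measure \<nu>"
    and row: "\<And>f. f \<in> borel_measurable borel \<Longrightarrow>
      (\<integral>\<^sup>+t. ennreal (row_density (t \<bullet> z) t) * f t \<partial>lborel) = ennreal \<theta> * (\<integral>\<^sup>+q. f (\<psi> q) \<partial>\<nu>)"
    and tri: "\<And>q1 q2 q3. triple (\<psi> q1) (\<psi> q2) (\<psi> q3) = \<theta> * det3 (l q1, x q1, y q1) (l q2, x q2, y q2) (l q3, x q3, y q3)"
    and mom: "\<And>a b c. a + b + c = n \<Longrightarrow> has_bochner_integral \<nu> (\<lambda>q. l q ^ a * x q ^ b * y q ^ c) (\<mu> a b c)"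
    and \<psi>[measurable]: "\<psi> \<in> borel_measurable \<nu>"
    and "even n" "0 < \<theta>"
  shows "plane_moment n z = ennreal (\<theta> ^ (n + 3) * det_moment n \<mu>)"
proof -
  interpret sigma_finite_measure \<nu> by fact
  have "0 \<le> \<theta>" using \<open>0 < \<theta>\<close> by simp
  define D where "D = (\<lambda>q1 q2 q3. det3 (l q1, x q1, y q1) (l q2, x q2, y q2) (l q3, x q3, y q3))"
  define V where "V = (\<lambda>t1 t2 t3. ennreal (\<bar>triple t1 t2 t3\<bar> ^ n))"
  have [measurable]: "(\<lambda>x. V (f1 x) (f2 x) (f3 x)) \<in> borel_measurable M"
    if [measurable]: "f1 \<in> borel_measurable M" "f2 \<in> borel_measurable M" "f3 \<in> borel_measurable M"
    for f1 f2 f3 and M :: "'z measure"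
    unfolding V_def by measurable
  let ?w = "\<lambda>t. ennreal (row_density (t \<bullet> z) t)"
  have row_3: "(\<integral>\<^sup>+t3. ?w t3 * V t1 t2 t3 \<partial>lborel) = ennreal \<theta> * (\<integral>\<^sup>+q3. V t1 t2 (\<psi> q3) \<partial>\<nu>)" for t1 t2
    by (rule row) measurable
  have row_2: "(\<integral>\<^sup>+t2. ?w t2 * (ennreal \<theta> * (\<integral>\<^sup>+q3. V t1 t2 (\<psi> q3) \<partial>\<nu>)) \<partial>lborel)
      = ennreal \<theta> * (\<integral>\<^sup>+q2. ennreal \<theta> * (\<integral>\<^sup>+q3. V t1 (\<psi> q2) (\<psi> q3) \<partial>\<nu>) \<partial>\<nu>)" for t1
    by (rule row) measurable
  have "plane_moment n z = (\<integral>\<^sup>+t1. ?w t1 * (\<integral>\<^sup>+t2. ?w t2 * (\<integral>\<^sup>+t3. ?w t3 * V t1 t2 t3 \<partial>lborel) \<partial>lborel) \<partial>lborel)"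
    unfolding plane_moment_def V_def by (simp add: nn_integral_cmult)
  also have "\<dots> = (\<integral>\<^sup>+t1. ?w t1 * (\<integral>\<^sup>+t2. ?w t2 * (ennreal \<theta> * (\<integral>\<^sup>+q3. V t1 t2 (\<psi> q3) \<partial>\<nu>)) \<partial>lborel) \<partial>lborel)"
    by (subst row_3) (rule refl)
  also have "\<dots> = (\<integral>\<^sup>+t1. ?w t1 * (ennreal \<theta> * (\<integral>\<^sup>+q2. ennreal \<theta> * (\<integral>\<^sup>+q3. V t1 (\<psi> q2) (\<psi> q3) \<partial>\<nu>) \<partial>\<nu>)) \<partial>lborel)"
    by (subst row_2) (rule refl)
  also have "\<dots> = ennreal \<theta> * (\<integral>\<^sup>+q1. ennreal \<theta> * (\<integral>\<^sup>+q2. ennreal \<theta> * (\<integral>\<^sup>+q3. V (\<psi> q1) (\<psi> q2) (\<psi> q3) \<partial>\<nu>) \<partial>\<nu>) \<partial>\<nu>)"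
    by (rule row) measurable
  also have "\<dots> = ennreal \<theta> * (ennreal \<theta> * (ennreal \<theta> * (\<integral>\<^sup>+q1. \<integral>\<^sup>+q2. \<integral>\<^sup>+q3. V (\<psi> q1) (\<psi> q2) (\<psi> q3) \<partial>\<nu> \<partial>\<nu> \<partial>\<nu>)))"
    by (simp add: nn_integral_cmult)
  also have "(\<integral>\<^sup>+q1. \<integral>\<^sup>+q2. \<integral>\<^sup>+q3. V (\<psi> q1) (\<psi> q2) (\<psi> q3) \<partial>\<nu> \<partial>\<nu> \<partial>\<nu>)
     = (\<integral>\<^sup>+q1. \<integral>\<^sup>+q2. \<integral>\<^sup>+q3. ennreal (\<theta> ^ n) * ennreal (D q1 q2 q3 ^ n) \<partial>\<nu> \<partial>\<nu> \<partial>\<nu>)"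
  proof -
    have "V (\<psi> q1) (\<psi> q2) (\<psi> q3) = ennreal (\<theta> ^ n) * ennreal (D q1 q2 q3 ^ n)" for q1 q2 q3
    proof -
      have "\<bar>\<theta> * D q1 q2 q3\<bar> ^ n = \<theta> ^ n * D q1 q2 q3 ^ n"
        using \<open>even n\<close> by (simp add: power_even_abs power_mult_distrib)
      moreover have "V (\<psi> q1) (\<psi> q2) (\<psi> q3) = ennreal (\<bar>\<theta> * D q1 q2 q3\<bar> ^ n)"
        unfolding V_def tri D_def ..
      ultimately show ?thesis
        using \<open>0 \<le> \<theta>\<close> zero_le_even_power[OF \<open>even n\<close>, of "D q1 q2 q3"] by (simp add: ennreal_mult)
    qed
    then show ?thesis by simp
  qed
  also have "\<dots> = ennreal (\<theta> ^ n) * (\<integral>\<^sup>+q1. \<integral>\<^sup>+q2. \<integral>\<^sup>+q3. ennreal (D q1 q2 q3 ^ n) \<partial>\<nu> \<partial>\<nu> \<partial>\<nu>)"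
  proof -
    \<comment> \<open>Measurability of the even power of D is read off from \<open>V\<close>
      composed with \<psi>, divided by \<theta>^n.\<close>
    define W where "W = (\<lambda>q1 q2 q3. ennreal (D q1 q2 q3 ^ n))"
    have [measurable]: "(\<lambda>q. W (f1 q) (f2 q) (f3 q)) \<in> borel_measurable M"
      if [measurable]: "f1 \<in> measurable M \<nu>" "f2 \<in> measurable M \<nu>" "f3 \<in> measurable M \<nu>" for f1 f2 f3 and M :: "'z measure"
    proof -
      have "(\<lambda>q. V (\<psi> (f1 q)) (\<psi> (f2 q)) (\<psi> (f3 q)) / ennreal (\<theta> ^ n)) \<in> borel_measurable M"
        by measurable
      moreover have "V (\<psi> (f1 q)) (\<psi> (f2 q)) (\<psi> (f3 q)) / ennreal (\<theta> ^ n) = ennreal (D (f1 q) (f2 q) (f3 q) ^ n)" for q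
      proof -
        have "\<bar>\<theta> * D (f1 q) (f2 q) (f3 q)\<bar> ^ n = \<theta> ^ n * D (f1 q) (f2 q) (f3 q) ^ n"
          using \<open>even n\<close> by (simp add: power_even_abs power_mult_distrib)
        moreover have "V (\<psi> (f1 q)) (\<psi> (f2 q)) (\<psi> (f3 q)) = ennreal (\<bar>\<theta> * D (f1 q) (f2 q) (f3 q)\<bar> ^ n)"
          unfolding V_def tri D_def ..
        moreover have "\<theta> ^ n > 0"
          using \<open>0 < \<theta>\<close> by simp
        ultimately show ?thesis
          using zero_le_even_power[OF \<open>even n\<close>, of "D (f1 q) (f2 q) (f3 q)"] \<open>0 < \<theta>\<close>
          by (simp add: divide_ennreal)
      qed
      ultimately show ?thesis by (simp add: W_def)
    qed
    have "(\<integral>\<^sup>+q1. \<integral>\<^sup>+q2. \<integral>\<^sup>+q3. ennreal (\<theta> ^ n) * W q1 q2 q3 \<partial>\<nu> \<partial>\<nu> \<partial>\<nu>)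
       = ennreal (\<theta> ^ n) * (\<integral>\<^sup>+q1. \<integral>\<^sup>+q2. \<integral>\<^sup>+q3. W q1 q2 q3 \<partial>\<nu> \<partial>\<nu> \<partial>\<nu>)"
      by (simp add: nn_integral_cmult cong: nn_integral_cong_simp)
    then show ?thesis unfolding W_def .
  qed
  also have "(\<integral>\<^sup>+q1. \<integral>\<^sup>+q2. \<integral>\<^sup>+q3. ennreal (D q1 q2 q3 ^ n) \<partial>\<nu> \<partial>\<nu> \<partial>\<nu>) = ennreal (det_moment n \<mu>)"
    unfolding D_def by (rule nn_integral_det3_power[OF mom \<open>even n\<close>])
  moreover have "\<theta> ^ (n + 3) * det_moment n \<mu> = \<theta> * (\<theta> * (\<theta> * (\<theta> ^ n * det_moment n \<mu>)))"
    by (simp add: power_add power3_eq_cube)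
  ultimately show ?thesis
    using \<open>0 \<le> \<theta>\<close> by (simp only: ennreal_mult' zero_le_power)
qed

section \<open>Exponential and asymmetric Laplace laws\<close>

definition exp_law :: "real measure" where
  "exp_law = density lborel (\<lambda>x. ennreal (if 0 \<le> x then exp (- x) else 0))"

text \<open>For \<open>0 < \<alpha> < 1\<close> the asymmetric Laplace law with density \<open>exp (- lap_abs \<alpha> x)\<close> is a probability measure.\<close>

definition lap_abs :: "real \<Rightarrow> real \<Rightarrow> real" where
  "lap_abs \<alpha> x = (if 0 \<le> x then x / \<alpha> else - x / (1 - \<alpha>))"

definition lap_law :: "real \<Rightarrow> real measure" where
  "lap_law \<alpha> = density lborel (\<lambda>x. ennreal (exp (- lap_abs \<alpha> x)))"

text \<open>The i-th moment of the Laplace law divided by i!.\<close>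

definition lap_mom :: "nat \<Rightarrow> real \<Rightarrow> real" where
  "lap_mom i \<alpha> = \<alpha> ^ Suc i + (-1) ^ i * (1 - \<alpha>) ^ Suc i"

lemma measurable_lap_abs [measurable (raw)]:
  assumes [measurable]: "f \<in> borel_measurable M"
  shows "(\<lambda>x. lap_abs \<alpha> (f x)) \<in> borel_measurable M"
  unfolding lap_abs_def by measurable

lemma sets_exp_law [measurable_cong, simp]: "sets exp_law = sets borel"
  by (simp add: exp_law_def)

lemma sets_lap_law [measurable_cong, simp]: "sets (lap_law \<alpha>) = sets borel"
  by (simp add: lap_law_def)

lemma sigma_finite_exp_law: "sigma_finite_measure exp_law"
  unfolding exp_law_def by (subst sigma_finite_measure.sigma_finite_iff_density_finite[OF sigma_finite_lborel]) auto

lemma sigma_finite_lap_law: "sigma_finite_measure (lap_law \<alpha>)"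
  unfolding lap_law_def by (subst sigma_finite_measure.sigma_finite_iff_density_finite[OF sigma_finite_lborel]) auto

interpretation exp_law: sigma_finite_measure exp_law by (rule sigma_finite_exp_law)
interpretation lap_law: sigma_finite_measure "lap_law \<alpha>" by (rule sigma_finite_lap_law)

lemma has_bochner_integral_lborel_power_exp:
  "has_bochner_integral lborel (\<lambda>x::real. x ^ n * exp (- x) * indicator {0..} x) (fact n)"
proof (rule has_bochner_integral_nn_integral)
  show "(\<integral>\<^sup>+x. ennreal (x ^ n * exp (- x) * indicator {0..} x) \<partial>lborel) = ennreal (fact n)"
    using nn_intergal_power_times_exp_Ici[of n] by (simp add: ennreal_mult'' ennreal_indicator)
qed (auto simp: indicator_def)

lemma exp_law_moment: "has_bochner_integral exp_law (\<lambda>x. x ^ n) (fact n)"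
  unfolding exp_law_def
proof (rule has_bochner_integral_density)
  show "has_bochner_integral lborel (\<lambda>x. (if 0 \<le> x then exp (- x) else 0) *\<^sub>R x ^ n) (fact n :: real)"
    using has_bochner_integral_lborel_power_exp[of n]
    by (rule has_bochner_integral_cong[THEN iffD1, rotated -1]) (auto simp: indicator_def)
qed auto

text \<open>On the positive half line put x = \<alpha> s and on the negative one x = -(1-\<alpha>)
  s; in both cases \<open>lap_abs\<close> equals s, and each half gives a multiple of the Gamma
  integral (b+i)!.\<close>

lemma lap_law_moment:
  assumes "0 < \<alpha>" "\<alpha> < 1"
  shows "has_bochner_integral (lap_law \<alpha>) (\<lambda>x. lap_abs \<alpha> x ^ b * x ^ i) (fact (b + i) * lap_mom i \<alpha>)"
  unfolding lap_law_def
proof (rule has_bochner_integral_density)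
  let ?g = "\<lambda>x::real. x ^ (b + i) * exp (- x) * indicator {0..} x"
  have 1: "has_bochner_integral lborel (\<lambda>x. ?g (0 + c * x)) (fact (b + i) /\<^sub>R \<bar>c\<bar>)" if "c \<noteq> 0" for c
    using lborel_has_bochner_integral_real_affine_iff[OF that, of ?g "fact (b + i)" 0] has_bochner_integral_lborel_power_exp by blast
  have "has_bochner_integral lborel (\<lambda>x. \<alpha> ^ i * ?g (0 + (1 / \<alpha>) * x) + (- (1 - \<alpha>)) ^ i * ?g (0 + (- 1 / (1 - \<alpha>)) * x))
     (\<alpha> ^ i * (fact (b + i) /\<^sub>R \<bar>1 / \<alpha>\<bar>) + (- (1 - \<alpha>)) ^ i * (fact (b + i) /\<^sub>R \<bar>- 1 / (1 - \<alpha>)\<bar>))"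
    using assms by (intro has_bochner_integral_add has_bochner_integral_mult_right 1) auto
  also have "\<alpha> ^ i * (fact (b + i) /\<^sub>R \<bar>1 / \<alpha>\<bar>) + (- (1 - \<alpha>)) ^ i * (fact (b + i) /\<^sub>R \<bar>- 1 / (1 - \<alpha>)\<bar>) = fact (b + i) * lap_mom i \<alpha>"
    using assms power_minus[of "1 - \<alpha>" i] by (simp add: lap_mom_def algebra_simps)
  finally have "has_bochner_integral lborel (\<lambda>x. \<alpha> ^ i * ?g (0 + (1 / \<alpha>) * x) + (- (1 - \<alpha>)) ^ i * ?g (0 + (- 1 / (1 - \<alpha>)) * x))
     (fact (b + i) * lap_mom i \<alpha>)" .
  then show "has_bochner_integral lborel (\<lambda>x. exp (- lap_abs \<alpha> x) *\<^sub>R (lap_abs \<alpha> x ^ b * x ^ i)) (fact (b + i) * lap_mom i \<alpha>)"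
  proof (rule has_bochner_integralI_AE)
    \<comment> \<open>Both rescaled exponential densities include the origin, so x = 0 is discarded
      as a null set.\<close>
    show "AE x in lborel. \<alpha> ^ i * ?g (0 + (1 / \<alpha>) * x) + (- (1 - \<alpha>)) ^ i * ?g (0 + (- 1 / (1 - \<alpha>)) * x)
       = exp (- lap_abs \<alpha> x) *\<^sub>R (lap_abs \<alpha> x ^ b * x ^ i)"
      using AE_lborel_singleton[of "0::real"]
    proof eventually_elim
      fix x :: real assume "x \<noteq> 0"
      show "\<alpha> ^ i * ?g (0 + (1 / \<alpha>) * x) + (- (1 - \<alpha>)) ^ i * ?g (0 + (- 1 / (1 - \<alpha>)) * x)
       = exp (- lap_abs \<alpha> x) *\<^sub>R (lap_abs \<alpha> x ^ b * x ^ i)"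
      proof (cases "x > 0")
        case True
        have "\<alpha> ^ i * (x / \<alpha>) ^ (b + i) = (x / \<alpha>) ^ b * x ^ i"
          using assms by (simp add: power_add power_divide field_simps)
        then show ?thesis
          using True assms by (simp add: lap_abs_def indicator_def field_simps divide_le_0_iff mult_le_0_iff)
      next
        case False
        with \<open>x \<noteq> 0\<close> have "x < 0" by simp
        have "(- (1 - \<alpha>)) ^ i * (- x / (1 - \<alpha>)) ^ (b + i) = (- x / (1 - \<alpha>)) ^ b * ((- (1 - \<alpha>)) * (- x / (1 - \<alpha>))) ^ i"
          unfolding power_mult_distrib power_add by (simp only: ac_simps)
        also have "(- (1 - \<alpha>)) * (- x / (1 - \<alpha>)) = x"
          using assms by (simp add: field_simps)
        finally have eq: "(- (1 - \<alpha>)) ^ i * (- x / (1 - \<alpha>)) ^ (b + i) = (- x / (1 - \<alpha>)) ^ b * x ^ i" .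
        have g0: "?g (0 + (1 / \<alpha>) * x) = 0"
          using \<open>x < 0\<close> assms by (simp add: indicator_def zero_le_divide_iff)
        have g1: "?g (0 + (- 1 / (1 - \<alpha>)) * x) = (- x / (1 - \<alpha>)) ^ (b + i) * exp (- lap_abs \<alpha> x)"
          using \<open>x < 0\<close> assms by (simp add: indicator_def zero_le_divide_iff divide_le_0_iff lap_abs_def)
        have "lap_abs \<alpha> x = - x / (1 - \<alpha>)"
          using \<open>x < 0\<close> by (simp add: lap_abs_def)
        then show ?thesis
          unfolding g0 g1 mult.assoc[symmetric] eq by simp
      qed
    qed
  qed auto
qed auto

definition lap_prod :: "real \<Rightarrow> real \<Rightarrow> (real \<times> real \<times> real) measure" where
  "lap_prod \<alpha> \<beta> = lap_law \<alpha> \<Otimes>\<^sub>M (lap_law \<beta> \<Otimes>\<^sub>M exp_law)"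

lemma sigma_finite_pair_measure':
  "sigma_finite_measure M \<Longrightarrow> sigma_finite_measure N \<Longrightarrow> sigma_finite_measure (M \<Otimes>\<^sub>M N)"
  by (rule sigma_finite_pair_measure)

lemma sets_lap_prod [measurable_cong, simp]: "sets (lap_prod \<alpha> \<beta>) = sets borel"
proof -
  have "sets (lap_prod \<alpha> \<beta>) = sets (borel \<Otimes>\<^sub>M (borel \<Otimes>\<^sub>M borel))"
    unfolding lap_prod_def by (intro sets_pair_measure_cong) auto
  then show ?thesis unfolding borel_prod .
qed

lemma sigma_finite_lap_prod: "sigma_finite_measure (lap_prod \<alpha> \<beta>)"
  unfolding lap_prod_def by (intro sigma_finite_pair_measure' sigma_finite_lap_law sigma_finite_exp_law)

lemma has_bochner_integral_triple_times:
  assumes "sigma_finite_measure M" "sigma_finite_measure N" "sigma_finite_measure K"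
    and f: "has_bochner_integral M f a" and g: "has_bochner_integral N g b" and h: "has_bochner_integral K h (c :: real)"
  shows "has_bochner_integral (M \<Otimes>\<^sub>M (N \<Otimes>\<^sub>M K)) (\<lambda>(x, y, z). f x * (g y * h z)) (a * (b * c))"
  using has_bochner_integral_pair_times[OF assms(1) sigma_finite_pair_measure'[OF assms(2,3)] f
      has_bochner_integral_pair_times[OF assms(2,3) g h]]
  by (simp add: split_def)

text \<open>Given the signs of x and y, the three summands r, \<open>lap_abs \<alpha> x\<close>,
  \<open>lap_abs \<beta> y\<close> act as independent Gamma variables, and the m-th power of their
  sum contributes (N+m)!/N! with N = a+b+i+c+j+2. The induction splits off one factor of the sum:
  its summands raise a, b or c by one and carry the weights a+1, b+i+1, c+j+1, which add up to
  N+1.\<close>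

lemma lap_prod_moment_aux:
  assumes "0 < \<alpha>" "\<alpha> < 1" "0 < \<beta>" "\<beta> < 1"
  shows "has_bochner_integral (lap_prod \<alpha> \<beta>)
     (\<lambda>(x, y, r). (r + lap_abs \<alpha> x + lap_abs \<beta> y) ^ m * ((lap_abs \<alpha> x ^ b * x ^ i) * ((lap_abs \<beta> y ^ c * y ^ j) * r ^ a)))
     (fact (a + b + i + c + j + m + 2) / fact (a + b + i + c + j + 2) *
       ((fact (b + i) * lap_mom i \<alpha>) * ((fact (c + j) * lap_mom j \<beta>) * fact a)))"
proof (induction m arbitrary: a b c)
  case 0
  then show ?case
    using has_bochner_integral_triple_times[OF sigma_finite_lap_law sigma_finite_lap_law sigma_finite_exp_law
      lap_law_moment[OF assms(1,2), of b i] lap_law_moment[OF assms(3,4), of c j] exp_law_moment[of a]]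
    by (simp add: lap_prod_def)
next
  case (Suc m)
  let ?T = "\<lambda>a b c. (\<lambda>(x, y, r). (r + lap_abs \<alpha> x + lap_abs \<beta> y) ^ m * ((lap_abs \<alpha> x ^ b * x ^ i) * ((lap_abs \<beta> y ^ c * y ^ j) * r ^ a)))"
  let ?P = "lap_mom i \<alpha> * lap_mom j \<beta>"
  have "has_bochner_integral (lap_prod \<alpha> \<beta>) (\<lambda>q. ?T (Suc a) b c q + ?T a (Suc b) c q + ?T a b (Suc c) q)
    (fact (Suc a + b + i + c + j + m + 2) / fact (Suc a + b + i + c + j + 2) *
       ((fact (b + i) * lap_mom i \<alpha>) * ((fact (c + j) * lap_mom j \<beta>) * fact (Suc a))) +
     fact (a + Suc b + i + c + j + m + 2) / fact (a + Suc b + i + c + j + 2) *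
       ((fact (Suc b + i) * lap_mom i \<alpha>) * ((fact (c + j) * lap_mom j \<beta>) * fact a)) +
     fact (a + b + i + Suc c + j + m + 2) / fact (a + b + i + Suc c + j + 2) *
       ((fact (b + i) * lap_mom i \<alpha>) * ((fact (Suc c + j) * lap_mom j \<beta>) * fact a)))"
    by (intro has_bochner_integral_add Suc.IH)
  also have "(\<lambda>q. ?T (Suc a) b c q + ?T a (Suc b) c q + ?T a b (Suc c) q) =
     (\<lambda>(x, y, r). (r + lap_abs \<alpha> x + lap_abs \<beta> y) ^ Suc m * ((lap_abs \<alpha> x ^ b * x ^ i) * ((lap_abs \<beta> y ^ c * y ^ j) * r ^ a)))"
    by (auto simp: fun_eq_iff algebra_simps)
  also have "fact (Suc a + b + i + c + j + m + 2) / fact (Suc a + b + i + c + j + 2) *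
       ((fact (b + i) * lap_mom i \<alpha>) * ((fact (c + j) * lap_mom j \<beta>) * fact (Suc a))) +
     fact (a + Suc b + i + c + j + m + 2) / fact (a + Suc b + i + c + j + 2) *
       ((fact (Suc b + i) * lap_mom i \<alpha>) * ((fact (c + j) * lap_mom j \<beta>) * fact a)) +
     fact (a + b + i + Suc c + j + m + 2) / fact (a + b + i + Suc c + j + 2) *
       ((fact (b + i) * lap_mom i \<alpha>) * ((fact (Suc c + j) * lap_mom j \<beta>) * fact a))
     = fact (a + b + i + c + j + Suc m + 2) / fact (a + b + i + c + j + 2) *
       ((fact (b + i) * lap_mom i \<alpha>) * ((fact (c + j) * lap_mom j \<beta>) * fact a))"
  proof -
    define N where "N = a + b + i + c + j + 2"
    define F :: real where "F = fact N"
    define G :: real where "G = fact (N + Suc m)"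
    define A :: real where "A = fact (b + i) * lap_mom i \<alpha> * (fact (c + j) * lap_mom j \<beta>) * fact a"
    have "F > 0" by (simp add: F_def)
    have sum: "real (Suc a) + real (Suc (b + i)) + real (Suc (c + j)) = real (Suc N)"
      by (simp add: N_def)
    have "G / (real (Suc N) * F) * (A * real (Suc a)) + G / (real (Suc N) * F) * (A * real (Suc (b + i)))
       + G / (real (Suc N) * F) * (A * real (Suc (c + j)))
       = G / (real (Suc N) * F) * A * (real (Suc a) + real (Suc (b + i)) + real (Suc (c + j)))"
      by (simp only: distrib_left mult.assoc)
    also have "\<dots> = G / F * A"
      unfolding sum using \<open>F > 0\<close> by (simp add: field_simps del: of_nat_Suc)
    finally have eq: "G / (real (Suc N) * F) * (A * real (Suc a)) + G / (real (Suc N) * F) * (A * real (Suc (b + i)))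
       + G / (real (Suc N) * F) * (A * real (Suc (c + j))) = G / F * A" .
    have idx: "Suc a + b + i + c + j + m + 2 = N + Suc m" "a + Suc b + i + c + j + m + 2 = N + Suc m"
      "a + b + i + Suc c + j + m + 2 = N + Suc m" "a + b + i + c + j + Suc m + 2 = N + Suc m"
      "Suc a + b + i + c + j + 2 = Suc N" "a + Suc b + i + c + j + 2 = Suc N" "a + b + i + Suc c + j + 2 = Suc N"
      "a + b + i + c + j + 2 = N" "Suc b + i = Suc (b + i)" "Suc c + j = Suc (c + j)"
      by (simp_all add: N_def)
    show ?thesis
      unfolding idx fact_Suc G_def[symmetric] using eq
      by (simp add: F_def A_def ac_simps del: of_nat_Suc)
  qed
  finally show ?case .
qed

lemma lap_prod_moment:
  assumes "0 < \<alpha>" "\<alpha> < 1" "0 < \<beta>" "\<beta> < 1"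
  shows "has_bochner_integral (lap_prod \<alpha> \<beta>)
     (\<lambda>q. (snd (snd q) + lap_abs \<alpha> (fst q) + lap_abs \<beta> (fst (snd q))) ^ m * fst q ^ i * fst (snd q) ^ j)
     (fact (i + j + m + 2) / fact (i + j + 2) * (fact i * lap_mom i \<alpha> * (fact j * lap_mom j \<beta>)))"
  using lap_prod_moment_aux[OF assms, of m 0 i 0 j 0] by (simp add: split_def ac_simps)

lemma nn_integral_lap_prod:
  fixes f :: "real \<times> real \<times> real \<Rightarrow> ennreal"
  assumes [measurable]: "f \<in> borel_measurable borel"
  shows "(\<integral>\<^sup>+q. f q \<partial>lap_prod \<alpha> \<beta>) = (\<integral>\<^sup>+x. \<integral>\<^sup>+y. \<integral>\<^sup>+r. ennreal (exp (- lap_abs \<alpha> x)) * (ennreal (exp (- lap_abs \<beta> y)) *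
     (ennreal (if 0 \<le> r then exp (- r) else 0) * f (x, y, r))) \<partial>lborel \<partial>lborel \<partial>lborel)"
proof -
  have [measurable]: "(\<lambda>x. f (f1 x, f2 x, f3 x)) \<in> borel_measurable M"
    if [measurable]: "f1 \<in> borel_measurable M" "f2 \<in> borel_measurable M" "f3 \<in> borel_measurable M"
    for f1 f2 f3 and M :: "'z measure"
    by (rule measurable_compose[OF _ assms]) (simp add: borel_prod[symmetric])
  have fm: "f \<in> borel_measurable (lap_law \<alpha> \<Otimes>\<^sub>M (lap_law \<beta> \<Otimes>\<^sub>M exp_law))"
    using assms sets_lap_prod[of \<alpha> \<beta>] unfolding lap_prod_def by (simp cong: measurable_cong_sets)
  interpret P: sigma_finite_measure "lap_law \<beta> \<Otimes>\<^sub>M exp_law"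
    by (intro sigma_finite_pair_measure' sigma_finite_lap_law sigma_finite_exp_law)
  have "(\<integral>\<^sup>+q. f q \<partial>lap_prod \<alpha> \<beta>) = (\<integral>\<^sup>+x. \<integral>\<^sup>+q. f (x, q) \<partial>(lap_law \<beta> \<Otimes>\<^sub>M exp_law) \<partial>lap_law \<alpha>)"
    unfolding lap_prod_def using fm by (simp add: P.nn_integral_fst)
  also have "\<dots> = (\<integral>\<^sup>+x. \<integral>\<^sup>+y. \<integral>\<^sup>+r. f (x, y, r) \<partial>exp_law \<partial>lap_law \<beta> \<partial>lap_law \<alpha>)"
    by (intro nn_integral_cong exp_law.nn_integral_fst[symmetric] measurable_Pair2[OF fm])
  also have "\<dots> = (\<integral>\<^sup>+x. ennreal (exp (- lap_abs \<alpha> x)) * (\<integral>\<^sup>+y. ennreal (exp (- lap_abs \<beta> y)) *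
     (\<integral>\<^sup>+r. ennreal (if 0 \<le> r then exp (- r) else 0) * f (x, y, r) \<partial>lborel) \<partial>lborel) \<partial>lborel)"
    unfolding exp_law_def lap_law_def by (simp add: nn_integral_density)
  also have "\<dots> = (\<integral>\<^sup>+x. \<integral>\<^sup>+y. \<integral>\<^sup>+r. ennreal (exp (- lap_abs \<alpha> x)) * (ennreal (exp (- lap_abs \<beta> y)) *
     (ennreal (if 0 \<le> r then exp (- r) else 0) * f (x, y, r))) \<partial>lborel \<partial>lborel \<partial>lborel)"
    by (simp add: nn_integral_cmult)
  finally show ?thesis .
qed

section \<open>Plane moments for triangular and quadrilateral sections\<close>

text \<open>The substitution u = a t1, X = b t2 - u, Y = c t3 - u, with X = sx x, Y = sy y and u =
  sr r + m X + m Y. It is triangular, so one-dimensional affine substitutions suffice once the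
  u-integral has been moved innermost, where its shift may depend on x and y. In the application m
  is the negative part.\<close>

lemma nn_integral_quad_subst:
  fixes g :: "real \<Rightarrow> real \<Rightarrow> real \<Rightarrow> ennreal" and a b c sx sy sr :: real
  assumes gm: "\<And>f1 f2 f3 (M :: (real \<times> real) measure). f1 \<in> borel_measurable M \<Longrightarrow> f2 \<in> borel_measurable M \<Longrightarrow>
      f3 \<in> borel_measurable M \<Longrightarrow> (\<lambda>x. g (f1 x) (f2 x) (f3 x)) \<in> borel_measurable M"
    and gm': "(\<lambda>(x, y, z). g x y z) \<in> borel_measurable borel"
    and [measurable]: "m \<in> borel_measurable borel"
    and pos: "0 < a" "0 < b" "0 < c" "0 < sx" "0 < sy" "0 < sr"
  shows "(\<integral>\<^sup>+t1. \<integral>\<^sup>+t2. \<integral>\<^sup>+t3. g t1 t2 t3 \<partial>lborel \<partial>lborel \<partial>lborel) = ennreal (sx * sy * sr / (a * b * c)) *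
     (\<integral>\<^sup>+x. \<integral>\<^sup>+y. \<integral>\<^sup>+r. g ((sr * r + m (sx * x) + m (sy * y)) / a) ((sx * x + (sr * r + m (sx * x) + m (sy * y))) / b)
        ((sy * y + (sr * r + m (sx * x) + m (sy * y))) / c) \<partial>lborel \<partial>lborel \<partial>lborel)"
proof -
  have [measurable]: "(\<lambda>x. g (f1 x) (f2 x) (f3 x)) \<in> borel_measurable M"
    if [measurable]: "f1 \<in> borel_measurable M" "f2 \<in> borel_measurable M" "f3 \<in> borel_measurable M"
    for f1 f2 f3 and M :: "'z measure"
  proof -
    have "(\<lambda>x. (f1 x, f2 x, f3 x)) \<in> M \<rightarrow>\<^sub>M borel"
      by (simp add: borel_prod[symmetric])
    from measurable_compose[OF this gm'] show ?thesis by simp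
  qed
  have aff: "(\<integral>\<^sup>+x. f x \<partial>lborel) = ennreal k * (\<integral>\<^sup>+x. f (t + k * x) \<partial>lborel)"
    if "f \<in> borel_measurable borel" "k > 0" for f and t k :: real
    using nn_integral_real_affine[OF that(1), of k t] that(2) by simp
  have "(\<integral>\<^sup>+t1. \<integral>\<^sup>+t2. \<integral>\<^sup>+t3. g t1 t2 t3 \<partial>lborel \<partial>lborel \<partial>lborel)
     = ennreal (1/a) * (\<integral>\<^sup>+u. \<integral>\<^sup>+t2. \<integral>\<^sup>+t3. g (u / a) t2 t3 \<partial>lborel \<partial>lborel \<partial>lborel)"
  proof -
    have "(\<lambda>t1. \<integral>\<^sup>+t2. \<integral>\<^sup>+t3. g t1 t2 t3 \<partial>lborel \<partial>lborel) \<in> borel_measurable borel" by measurable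
    from aff[OF this, of "1/a" 0] pos show ?thesis by simp
  qed
  also have "(\<integral>\<^sup>+u. \<integral>\<^sup>+t2. \<integral>\<^sup>+t3. g (u / a) t2 t3 \<partial>lborel \<partial>lborel \<partial>lborel)
     = (\<integral>\<^sup>+u. ennreal (1/b) * (\<integral>\<^sup>+x. \<integral>\<^sup>+t3. g (u / a) ((x + u) / b) t3 \<partial>lborel \<partial>lborel) \<partial>lborel)"
  proof (rule nn_integral_cong)
    fix u :: real
    have "(\<lambda>t2. \<integral>\<^sup>+t3. g (u / a) t2 t3 \<partial>lborel) \<in> borel_measurable borel" by measurable
    from aff[OF this, of "1/b" "u/b"] pos
    show "(\<integral>\<^sup>+t2. \<integral>\<^sup>+t3. g (u / a) t2 t3 \<partial>lborel \<partial>lborel) = ennreal (1/b) * (\<integral>\<^sup>+x. \<integral>\<^sup>+t3. g (u / a) ((x + u) / b) t3 \<partial>lborel \<partial>lborel)"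
      by (simp add: add_divide_distrib add.commute)
  qed
  also have "\<dots> = (\<integral>\<^sup>+u. ennreal (1/b) * (\<integral>\<^sup>+x. ennreal (1/c) * (\<integral>\<^sup>+y. g (u / a) ((x + u) / b) ((y + u) / c) \<partial>lborel) \<partial>lborel) \<partial>lborel)"
  proof -
    have "(\<integral>\<^sup>+t3. g (u / a) ((x + u) / b) t3 \<partial>lborel) = ennreal (1/c) * (\<integral>\<^sup>+y. g (u / a) ((x + u) / b) ((y + u) / c) \<partial>lborel)" for u x
    proof -
      have "(\<lambda>t3. g (u / a) ((x + u) / b) t3) \<in> borel_measurable borel" by measurable
      from aff[OF this, of "1/c" "u/c"] pos show ?thesis
        by (simp add: add_divide_distrib add.commute)
    qed
    then show ?thesis by simp
  qed
  also have "\<dots> = ennreal (1/b) * (ennreal (1/c) * (\<integral>\<^sup>+u. \<integral>\<^sup>+x. \<integral>\<^sup>+y. g (u / a) ((x + u) / b) ((y + u) / c) \<partial>lborel \<partial>lborel \<partial>lborel))"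
    by (simp add: nn_integral_cmult)
  also have "(\<integral>\<^sup>+u. \<integral>\<^sup>+x. \<integral>\<^sup>+y. g (u / a) ((x + u) / b) ((y + u) / c) \<partial>lborel \<partial>lborel \<partial>lborel)
     = (\<integral>\<^sup>+x. \<integral>\<^sup>+u. \<integral>\<^sup>+y. g (u / a) ((x + u) / b) ((y + u) / c) \<partial>lborel \<partial>lborel \<partial>lborel)"
    by (rule lborel_pair.Fubini') measurable
  also have "\<dots> = (\<integral>\<^sup>+x. \<integral>\<^sup>+y. \<integral>\<^sup>+u. g (u / a) ((x + u) / b) ((y + u) / c) \<partial>lborel \<partial>lborel \<partial>lborel)"
    by (rule nn_integral_cong, rule lborel_pair.Fubini') measurable
  also have "\<dots> = ennreal sx * (\<integral>\<^sup>+x. \<integral>\<^sup>+y. \<integral>\<^sup>+u. g (u / a) ((sx * x + u) / b) ((y + u) / c) \<partial>lborel \<partial>lborel \<partial>lborel)"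
  proof -
    have "(\<lambda>x. \<integral>\<^sup>+y. \<integral>\<^sup>+u. g (u / a) ((x + u) / b) ((y + u) / c) \<partial>lborel \<partial>lborel) \<in> borel_measurable borel" by measurable
    from aff[OF this, of sx 0] pos show ?thesis by simp
  qed
  also have "(\<integral>\<^sup>+x. \<integral>\<^sup>+y. \<integral>\<^sup>+u. g (u / a) ((sx * x + u) / b) ((y + u) / c) \<partial>lborel \<partial>lborel \<partial>lborel)
     = (\<integral>\<^sup>+x. ennreal sy * (\<integral>\<^sup>+y. \<integral>\<^sup>+u. g (u / a) ((sx * x + u) / b) ((sy * y + u) / c) \<partial>lborel \<partial>lborel) \<partial>lborel)"
  proof (rule nn_integral_cong)
    fix x :: real
    have "(\<lambda>y. \<integral>\<^sup>+u. g (u / a) ((sx * x + u) / b) ((y + u) / c) \<partial>lborel) \<in> borel_measurable borel" by measurable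
    from aff[OF this pos(5), of 0]
    show "(\<integral>\<^sup>+y. \<integral>\<^sup>+u. g (u / a) ((sx * x + u) / b) ((y + u) / c) \<partial>lborel \<partial>lborel)
      = ennreal sy * (\<integral>\<^sup>+y. \<integral>\<^sup>+u. g (u / a) ((sx * x + u) / b) ((sy * y + u) / c) \<partial>lborel \<partial>lborel)"
      by simp
  qed
  also have "\<dots> = (\<integral>\<^sup>+x. ennreal sy * (\<integral>\<^sup>+y. ennreal sr * (\<integral>\<^sup>+r. g ((sr * r + m (sx * x) + m (sy * y)) / a) ((sx * x + (sr * r + m (sx * x) + m (sy * y))) / b)
        ((sy * y + (sr * r + m (sx * x) + m (sy * y))) / c) \<partial>lborel) \<partial>lborel) \<partial>lborel)"
  proof -
    have "(\<integral>\<^sup>+u. g (u / a) ((sx * x + u) / b) ((sy * y + u) / c) \<partial>lborel) =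
       ennreal sr * (\<integral>\<^sup>+r. g ((sr * r + m (sx * x) + m (sy * y)) / a) ((sx * x + (sr * r + m (sx * x) + m (sy * y))) / b)
        ((sy * y + (sr * r + m (sx * x) + m (sy * y))) / c) \<partial>lborel)" for x y
    proof -
      have "(\<lambda>u. g (u / a) ((sx * x + u) / b) ((sy * y + u) / c)) \<in> borel_measurable borel" by measurable
      from aff[OF this pos(6), of "m (sx * x) + m (sy * y)"] show ?thesis
        by (simp add: ac_simps)
    qed
    then show ?thesis by simp
  qed
  also have "\<dots> = ennreal sy * (ennreal sr * (\<integral>\<^sup>+x. \<integral>\<^sup>+y. \<integral>\<^sup>+r. g ((sr * r + m (sx * x) + m (sy * y)) / a) ((sx * x + (sr * r + m (sx * x) + m (sy * y))) / b)
        ((sy * y + (sr * r + m (sx * x) + m (sy * y))) / c) \<partial>lborel \<partial>lborel \<partial>lborel))"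
    by (simp add: nn_integral_cmult)
  moreover have "sx * sy * sr / (a * b * c) = 1 / a * (1 / b * (1 / c * (sx * (sy * sr))))"
    by simp
  ultimately show ?thesis
    using pos by (simp only: ennreal_mult' zero_le_divide_1_iff less_imp_le mult.assoc)
qed

lemma nn_integral_simplicial_subst:
  fixes g :: "real \<Rightarrow> real \<Rightarrow> real \<Rightarrow> ennreal"
  assumes gm: "(\<lambda>(x, y, z). g x y z) \<in> borel_measurable borel"
    and pos: "0 < kx" "0 < ky" "0 < kr"
  shows "(\<integral>\<^sup>+t1. \<integral>\<^sup>+t2. \<integral>\<^sup>+t3. g t1 t2 t3 \<partial>lborel \<partial>lborel \<partial>lborel) = ennreal (kx * ky * kr) *
     (\<integral>\<^sup>+x. \<integral>\<^sup>+y. \<integral>\<^sup>+r. g (kx * x) (ky * y) (kr * r + p * x + q * y) \<partial>lborel \<partial>lborel \<partial>lborel)"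
proof -
  have [measurable]: "(\<lambda>x. g (f1 x) (f2 x) (f3 x)) \<in> borel_measurable M"
    if [measurable]: "f1 \<in> borel_measurable M" "f2 \<in> borel_measurable M" "f3 \<in> borel_measurable M"
    for f1 f2 f3 and M :: "'z measure"
  proof -
    have "(\<lambda>x. (f1 x, f2 x, f3 x)) \<in> M \<rightarrow>\<^sub>M borel"
      by (simp add: borel_prod[symmetric])
    from measurable_compose[OF this gm] show ?thesis by simp
  qed
  have aff: "(\<integral>\<^sup>+x. f x \<partial>lborel) = ennreal k * (\<integral>\<^sup>+x. f (t + k * x) \<partial>lborel)"
    if "f \<in> borel_measurable borel" "k > 0" for f and t k :: real
    using nn_integral_real_affine[OF that(1), of k t] that(2) by simp
  have 1: "(\<integral>\<^sup>+t1. \<integral>\<^sup>+t2. \<integral>\<^sup>+t3. g t1 t2 t3 \<partial>lborel \<partial>lborel \<partial>lborel)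
     = ennreal kx * (\<integral>\<^sup>+x. \<integral>\<^sup>+t2. \<integral>\<^sup>+t3. g (kx * x) t2 t3 \<partial>lborel \<partial>lborel \<partial>lborel)"
  proof -
    have "(\<lambda>t1. \<integral>\<^sup>+t2. \<integral>\<^sup>+t3. g t1 t2 t3 \<partial>lborel \<partial>lborel) \<in> borel_measurable borel" by measurable
    from aff[OF this pos(1), of 0] show ?thesis by simp
  qed
  have 2: "(\<integral>\<^sup>+t2. \<integral>\<^sup>+t3. g (kx * x) t2 t3 \<partial>lborel \<partial>lborel)
     = ennreal ky * (\<integral>\<^sup>+y. \<integral>\<^sup>+t3. g (kx * x) (ky * y) t3 \<partial>lborel \<partial>lborel)" for x
  proof -
    have "(\<lambda>t2. \<integral>\<^sup>+t3. g (kx * x) t2 t3 \<partial>lborel) \<in> borel_measurable borel" by measurable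
    from aff[OF this pos(2), of 0] show ?thesis by simp
  qed
  have 3: "(\<integral>\<^sup>+t3. g (kx * x) (ky * y) t3 \<partial>lborel)
     = ennreal kr * (\<integral>\<^sup>+r. g (kx * x) (ky * y) (kr * r + p * x + q * y) \<partial>lborel)" for x y
  proof -
    have "(\<lambda>t3. g (kx * x) (ky * y) t3) \<in> borel_measurable borel" by measurable
    from aff[OF this pos(3), of "p * x + q * y"] show ?thesis by (simp add: ac_simps)
  qed
  have "(\<integral>\<^sup>+t1. \<integral>\<^sup>+t2. \<integral>\<^sup>+t3. g t1 t2 t3 \<partial>lborel \<partial>lborel \<partial>lborel)
     = ennreal kx * (ennreal ky * (ennreal kr * (\<integral>\<^sup>+x. \<integral>\<^sup>+y. \<integral>\<^sup>+r. g (kx * x) (ky * y) (kr * r + p * x + q * y) \<partial>lborel \<partial>lborel \<partial>lborel)))"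
    unfolding 1 2 3 by (simp add: nn_integral_cmult)
  then show ?thesis
    using pos by (simp only: ennreal_mult' less_imp_le mult_nonneg_nonneg mult.assoc)
qed

definition exp_prod :: "(real \<times> real \<times> real) measure" where
  "exp_prod = exp_law \<Otimes>\<^sub>M (exp_law \<Otimes>\<^sub>M exp_law)"

lemma sets_exp_prod [measurable_cong, simp]: "sets exp_prod = sets borel"
proof -
  have "sets exp_prod = sets (borel \<Otimes>\<^sub>M (borel \<Otimes>\<^sub>M borel))"
    unfolding exp_prod_def by (intro sets_pair_measure_cong) auto
  then show ?thesis unfolding borel_prod .
qed

lemma sigma_finite_exp_prod: "sigma_finite_measure exp_prod"
  unfolding exp_prod_def by (intro sigma_finite_pair_measure' sigma_finite_exp_law)

lemma exp_prod_moment: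
  "has_bochner_integral exp_prod (\<lambda>q. fst q ^ a * fst (snd q) ^ b * snd (snd q) ^ c) (fact a * fact b * fact c)"
  using has_bochner_integral_triple_times[OF sigma_finite_exp_law sigma_finite_exp_law sigma_finite_exp_law
      exp_law_moment[of a] exp_law_moment[of b] exp_law_moment[of c]]
  by (simp add: exp_prod_def split_def mult.assoc)

lemma nn_integral_exp_prod:
  fixes f :: "real \<times> real \<times> real \<Rightarrow> ennreal"
  assumes [measurable]: "f \<in> borel_measurable borel"
  defines "e \<equiv> \<lambda>r::real. ennreal (if 0 \<le> r then exp (- r) else 0)"
  shows "(\<integral>\<^sup>+q. f q \<partial>exp_prod) = (\<integral>\<^sup>+x. \<integral>\<^sup>+y. \<integral>\<^sup>+r. e x * (e y * (e r * f (x, y, r))) \<partial>lborel \<partial>lborel \<partial>lborel)"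
proof -
  have [measurable]: "(\<lambda>x. f (f1 x, f2 x, f3 x)) \<in> borel_measurable M"
    if [measurable]: "f1 \<in> borel_measurable M" "f2 \<in> borel_measurable M" "f3 \<in> borel_measurable M"
    for f1 f2 f3 and M :: "'z measure"
    by (rule measurable_compose[OF _ assms(1)]) (simp add: borel_prod[symmetric])
  have [measurable]: "e \<in> borel_measurable borel" unfolding e_def by measurable
  have fm: "f \<in> borel_measurable (exp_law \<Otimes>\<^sub>M (exp_law \<Otimes>\<^sub>M exp_law))"
    using assms(1) sets_exp_prod unfolding exp_prod_def by (simp cong: measurable_cong_sets)
  interpret P: sigma_finite_measure "exp_law \<Otimes>\<^sub>M exp_law"
    by (intro sigma_finite_pair_measure' sigma_finite_exp_law)
  have "(\<integral>\<^sup>+q. f q \<partial>exp_prod) = (\<integral>\<^sup>+x. \<integral>\<^sup>+q. f (x, q) \<partial>(exp_law \<Otimes>\<^sub>M exp_law) \<partial>exp_law)"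
    unfolding exp_prod_def using fm by (simp add: P.nn_integral_fst)
  also have "\<dots> = (\<integral>\<^sup>+x. \<integral>\<^sup>+y. \<integral>\<^sup>+r. f (x, y, r) \<partial>exp_law \<partial>exp_law \<partial>exp_law)"
    by (intro nn_integral_cong exp_law.nn_integral_fst[symmetric] measurable_Pair2[OF fm])
  also have "\<dots> = (\<integral>\<^sup>+x. e x * (\<integral>\<^sup>+y. e y * (\<integral>\<^sup>+r. e r * f (x, y, r) \<partial>lborel) \<partial>lborel) \<partial>lborel)"
  proof -
    have el: "exp_law = density lborel e" by (simp add: exp_law_def e_def)
    show ?thesis unfolding el by (simp add: nn_integral_density)
  qed
  also have "\<dots> = (\<integral>\<^sup>+x. \<integral>\<^sup>+y. \<integral>\<^sup>+r. e x * (e y * (e r * f (x, y, r))) \<partial>lborel \<partial>lborel \<partial>lborel)"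
    by (simp add: nn_integral_cmult)
  finally show ?thesis .
qed

text \<open>The hypothesis \<open>dens\<close> says that in suitably scaled coordinates along the
  three edges of the section the row has independent standard exponential entries. Jacobian and
  determinant factor are both kx ky kr.\<close>

lemma plane_moment_simplicial:
  assumes pos: "0 < kx" "0 < ky" "0 < kr" and "even n"
    and dens: "\<And>x y r. row_density (vector [kx * x, ky * y, kr * r + p * x + q * y] \<bullet> z) (vector [kx * x, ky * y, kr * r + p * x + q * y])
       = (if 0 \<le> x \<and> 0 \<le> y \<and> 0 \<le> r then exp (- (x + y + r)) else 0)"
  shows "plane_moment n z = ennreal ((kx * ky * kr) ^ (n + 3) * det_moment n (\<lambda>a b c. fact a * fact b * fact c))"
proof (rule plane_moment_transform[OF sigma_finite_exp_prod, where l=fst and x="\<lambda>q. fst (snd q)" and y="\<lambda>q. snd (snd q)"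
      and \<psi>="\<lambda>(x, y, r). vector [kx * x, ky * y, kr * r + p * x + q * y]"])
  let ?\<psi> = "\<lambda>(x, y, r). vector [kx * x, ky * y, kr * r + p * x + q * y] :: real^3"
  fix f :: "real^3 \<Rightarrow> ennreal" assume [measurable]: "f \<in> borel_measurable borel"
  let ?g = "\<lambda>t1 t2 t3. ennreal (row_density (vector [t1, t2, t3] \<bullet> z) (vector [t1, t2, t3])) * f (vector [t1, t2, t3])"
  have "(\<integral>\<^sup>+t. ennreal (row_density (t \<bullet> z) t) * f t \<partial>lborel) = (\<integral>\<^sup>+t1. \<integral>\<^sup>+t2. \<integral>\<^sup>+t3. ?g t1 t2 t3 \<partial>lborel \<partial>lborel \<partial>lborel)"
    by (subst nn_integral_lborel_vec3) simp_all
  also have "\<dots> = ennreal (kx * ky * kr) *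
     (\<integral>\<^sup>+x. \<integral>\<^sup>+y. \<integral>\<^sup>+r. ?g (kx * x) (ky * y) (kr * r + p * x + q * y) \<partial>lborel \<partial>lborel \<partial>lborel)"
    by (rule nn_integral_simplicial_subst[OF _ pos]) (simp add: borel_prod[symmetric] split_def)
  also have "(\<integral>\<^sup>+x. \<integral>\<^sup>+y. \<integral>\<^sup>+r. ?g (kx * x) (ky * y) (kr * r + p * x + q * y) \<partial>lborel \<partial>lborel \<partial>lborel)
     = (\<integral>\<^sup>+t. f (?\<psi> t) \<partial>exp_prod)"
  proof -
    let ?e = "\<lambda>r::real. ennreal (if 0 \<le> r then exp (- r) else 0)"
    have "?g (kx * x) (ky * y) (kr * r + p * x + q * y) = ?e x * (?e y * (?e r * f (?\<psi> (x, y, r))))" for x y r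
      unfolding dens by (auto simp: exp_add[symmetric] ennreal_mult[symmetric] mult.assoc[symmetric])
    moreover have "(\<lambda>t. f (?\<psi> t)) \<in> borel_measurable borel"
      by (simp add: borel_prod[symmetric] split_def)
    ultimately show ?thesis
      by (simp only: nn_integral_exp_prod)
  qed
  finally show "(\<integral>\<^sup>+t. ennreal (row_density (t \<bullet> z) t) * f t \<partial>lborel) = ennreal (kx * ky * kr) * (\<integral>\<^sup>+t. f (?\<psi> t) \<partial>exp_prod)" .
next
  show "triple ((\<lambda>(x, y, r). vector [kx * x, ky * y, kr * r + p * x + q * y]) q1)
      ((\<lambda>(x, y, r). vector [kx * x, ky * y, kr * r + p * x + q * y]) q2)
      ((\<lambda>(x, y, r). vector [kx * x, ky * y, kr * r + p * x + q * y]) q3) =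
     kx * ky * kr * det3 (fst q1, fst (snd q1), snd (snd q1)) (fst q2, fst (snd q2), snd (snd q2)) (fst q3, fst (snd q3), snd (snd q3))"
    for q1 q2 q3 :: "real \<times> real \<times> real"
    by (cases q1; cases q2; cases q3) (simp add: triple_def det3_def algebra_simps)
  show "has_bochner_integral exp_prod (\<lambda>q. fst q ^ a * fst (snd q) ^ b * snd (snd q) ^ c) (fact a * fact b * fact c)" for a b c
    by (rule exp_prod_moment)
  show "(\<lambda>(x, y, r). vector [kx * x, ky * y, kr * r + p * x + q * y] :: real^3) \<in> borel_measurable exp_prod"
    unfolding exp_prod_def by (simp add: split_def)
qed (use assms in auto)

lemma inner_vec3: "vector [a, b, c] \<bullet> (vector [x, y, z] :: real^3) = a * x + b * y + c * z"
  by (simp add: inner_vec_def sum_3)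

text \<open>The coordinate r is separated from t1, t2, t3. The edges of the section lie in the
  coordinate planes (r, ti), and scaling by 1/(1+a), 1/(1+b), 1/(1+c) makes the sum of all four
  coordinates equal to x + y + r.\<close>

lemma plane_moment_ppp:
  assumes "0 < a" "0 < b" "0 < c" "even n"
  shows "plane_moment n (vector [a, b, c]) = ennreal ((1 / ((1 + a) * (1 + b) * (1 + c))) ^ (n + 3) *
    det_moment n (\<lambda>a b c. fact a * fact b * fact c))"
proof -
  have "plane_moment n (vector [a, b, c]) = ennreal ((1 / (1 + a) * (1 / (1 + b)) * (1 / (1 + c))) ^ (n + 3) *
    det_moment n (\<lambda>a b c. fact a * fact b * fact c))"
  proof (rule plane_moment_simplicial[where p=0 and q=0])
    fix x y r :: real
    let ?v = "vector [1 / (1 + a) * x, 1 / (1 + b) * y, 1 / (1 + c) * r + 0 * x + 0 * y] :: real^3"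
    have 1: "?v \<bullet> vector [a, b, c] = a / (1 + a) * x + b / (1 + b) * y + c / (1 + c) * r"
      unfolding inner_vec3 by (simp add: mult.commute)
    have 2: "?v \<bullet> vector [a, b, c] + csum ?v = x + y + r"
    proof -
      have "?v \<bullet> vector [a, b, c] + csum ?v = (a / (1 + a) + 1 / (1 + a)) * x + (b / (1 + b) + 1 / (1 + b)) * y + (c / (1 + c) + 1 / (1 + c)) * r"
        unfolding 1 by (simp add: csum_def algebra_simps)
      also have "\<dots> = x + y + r"
        using assms by (simp flip: add_divide_distrib) (simp add: add.commute)
      finally show ?thesis .
    qed
    show "row_density (?v \<bullet> vector [a, b, c]) ?v = (if 0 \<le> x \<and> 0 \<le> y \<and> 0 \<le> r then exp (- (x + y + r)) else 0)"
      unfolding row_density_def 2 unfolding 1 using assms by (auto simp: zero_le_divide_iff intro!: add_nonneg_nonneg)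
  qed (use assms in auto)
  then show ?thesis by (simp add: mult.assoc)
qed

text \<open>Now t3 is the separated coordinate. The edges of the section lie in the planes (t1, t3),
  (t2, t3) and (r, t3), which explains the contributions p x and q y to the third
  coordinate.\<close>

lemma plane_moment_mmp:
  assumes "0 < a" "0 < b" "0 < c" "even n"
  shows "plane_moment n (vector [-a, -b, c]) = ennreal ((c\<^sup>2 / ((a + c) * (b + c) * (1 + c))) ^ (n + 3) *
    det_moment n (\<lambda>a b c. fact a * fact b * fact c))"
proof -
  have "plane_moment n (vector [-a, -b, c]) = ennreal ((c / (a + c) * (c / (b + c)) * (1 / (1 + c))) ^ (n + 3) *
    det_moment n (\<lambda>a b c. fact a * fact b * fact c))"
  proof (rule plane_moment_simplicial[where p="a / (a + c)" and q="b / (b + c)"])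
    fix x y r :: real
    let ?v = "vector [c / (a + c) * x, c / (b + c) * y, 1 / (1 + c) * r + a / (a + c) * x + b / (b + c) * y] :: real^3"
    have 1: "?v \<bullet> vector [-a, -b, c] = c / (1 + c) * r"
      unfolding inner_vec3 by (simp add: algebra_simps)
    have 2: "c / (1 + c) * r + csum ?v = x + y + r"
    proof -
      have "c / (1 + c) * r + csum ?v = (c / (1 + c) + 1 / (1 + c)) * r + (c / (a + c) + a / (a + c)) * x + (c / (b + c) + b / (b + c)) * y"
        by (simp add: csum_def algebra_simps)
      also have "\<dots> = x + y + r"
        using assms by (simp flip: add_divide_distrib) (simp add: add.commute)
      finally show ?thesis .
    qed
    show "row_density (?v \<bullet> vector [-a, -b, c]) ?v = (if 0 \<le> x \<and> 0 \<le> y \<and> 0 \<le> r then exp (- (x + y + r)) else 0)"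
      unfolding 1 row_density_def 2 using assms by (auto simp: zero_le_mult_iff zero_le_divide_iff)
  qed (use assms in auto)
  then show ?thesis by (simp add: mult.assoc power2_eq_square)
qed

text \<open>In the coordinates u = a t1, X = b t2 - u, Y = c t3 - u the hyperplane gives
  r-coordinate X + Y + u, and the sum of all four coordinates is S u + w11 X + w12 Y. Positivity of
  the row bounds u below by max 0 (-X) + max 0 (-Y). Measuring u from that bound leaves an
  exponential variable and two terms that are piecewise linear in X and in Y separately, that is, an
  exponential law times two asymmetric Laplace laws.\<close>

lemma row_transform_quad:
  fixes a b c :: real
  assumes pos: "0 < a" "0 < b" "0 < c"
  defines "w11 \<equiv> 1 + 1 / b" and "w12 \<equiv> 1 + 1 / c" and "w21 \<equiv> 1 / a + 1 / b" and "w22 \<equiv> 1 / a + 1 / c"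
    and "S \<equiv> 1 + 1 / a + 1 / b + 1 / c"
  defines "sx \<equiv> S / (w11 * w22)" and "sy \<equiv> S / (w12 * w21)"
  defines "u \<equiv> \<lambda>x y r. 1 / S * r + max 0 (- (sx * x)) + max 0 (- (sy * y))"
  shows quad_density: "row_density ((vector [u x y r / a, (sx * x + u x y r) / b, (sy * y + u x y r) / c] :: real^3) \<bullet> vector [-a, b, c])
       (vector [u x y r / a, (sx * x + u x y r) / b, (sy * y + u x y r) / c])
       = exp (- lap_abs (w22 / S) x) * (exp (- lap_abs (w21 / S) y) * (if 0 \<le> r then exp (- r) else 0))"
    and quad_linear: "S * u x y r = r + lap_abs (w22 / S) x + lap_abs (w21 / S) y - w11 * (sx * x) - w12 * (sy * y)"
proof -
  have wpos: "0 < w11" "0 < w12" "0 < w21" "0 < w22" "0 < S"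
    using pos by (auto simp: w11_def w12_def w21_def w22_def S_def intro!: add_pos_pos)
  have Ssum: "S = w11 + w22" "S = w12 + w21"
    by (simp_all add: w11_def w12_def w21_def w22_def S_def)
  have spos: "0 < sx" "0 < sy"
    using wpos by (auto simp: sx_def sy_def)
  \<comment> \<open>Since S = w11 + w22, the right side has slope w11 in X for positive X and -w22
    for negative X; the scale sx makes these the two slopes of \<open>lap_abs\<close> in x.\<close>
  have lapx: "lap_abs (w22 / S) x = S * max 0 (- (sx * x)) + w11 * (sx * x)"
  proof -
    have eq1: "1 - w22 / S = w11 / S" using wpos Ssum by (simp add: field_simps)
    have eq2: "w11 * (sx * x) = x / (w22 / S)" and eq3: "w22 * (sx * x) = x / (w11 / S)"
      using wpos by (simp_all add: sx_def)
    have eq4: "S * - (sx * x) + w11 * (sx * x) = - (w22 * (sx * x))"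
      unfolding Ssum(1) by (simp add: algebra_simps)
    show ?thesis
    proof (cases "0 \<le> x")
      case True
      then have "- (sx * x) \<le> 0" using spos by simp
      then have "max 0 (- (sx * x)) = 0" by (rule max_absorb1)
      then show ?thesis using True eq1 eq2 eq3 eq4 by (simp add: lap_abs_def)
    next
      case False
      then have "sx * x \<le> 0" using spos by (simp add: mult_le_0_iff)
      then have "max 0 (- (sx * x)) = - (sx * x)" by (simp add: max_def)
      then show ?thesis using False eq1 eq2 eq3 eq4 unfolding lap_abs_def by simp
    qed
  qed
  have lapy: "lap_abs (w21 / S) y = S * max 0 (- (sy * y)) + w12 * (sy * y)"
  proof -
    have eq1: "1 - w21 / S = w12 / S" using wpos Ssum by (simp add: field_simps)
    have eq2: "w12 * (sy * y) = y / (w21 / S)" and eq3: "w21 * (sy * y) = y / (w12 / S)"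
      using wpos by (simp_all add: sy_def)
    have eq4: "S * - (sy * y) + w12 * (sy * y) = - (w21 * (sy * y))"
      unfolding Ssum(2) by (simp add: algebra_simps)
    show ?thesis
    proof (cases "0 \<le> y")
      case True
      then have "- (sy * y) \<le> 0" using spos by simp
      then have "max 0 (- (sy * y)) = 0" by (rule max_absorb1)
      then show ?thesis using True eq1 eq2 eq3 eq4 by (simp add: lap_abs_def)
    next
      case False
      then have "sy * y \<le> 0" using spos by (simp add: mult_le_0_iff)
      then have "max 0 (- (sy * y)) = - (sy * y)" by (simp add: max_def)
      then show ?thesis using False eq1 eq2 eq3 eq4 unfolding lap_abs_def by simp
    qed
  qed
  have Su: "S * u x y r = r + S * max 0 (- (sx * x)) + S * max 0 (- (sy * y))"
    using wpos by (simp add: u_def algebra_simps)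
  show lin: "S * u x y r = r + lap_abs (w22 / S) x + lap_abs (w21 / S) y - w11 * (sx * x) - w12 * (sy * y)"
    unfolding Su lapx lapy by simp
  define U where "U = u x y r"
  define X where "X = sx * x"
  define Y where "Y = sy * y"
  let ?v = "vector [U / a, (X + U) / b, (Y + U) / c] :: real^3"
  have inn: "?v \<bullet> vector [-a, b, c] = X + Y + U"
    unfolding inner_vec3 using pos by simp
  have "X + Y + U + csum ?v = S * U + w11 * X + w12 * Y"
    by (simp add: csum_def S_def w11_def w12_def add_divide_distrib algebra_simps)
  also have "\<dots> = r + lap_abs (w22 / S) x + lap_abs (w21 / S) y"
    using lin by (simp add: U_def X_def Y_def)
  finally have ex: "X + Y + U + csum ?v = r + lap_abs (w22 / S) x + lap_abs (w21 / S) y" .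
  have U: "U = 1 / S * r + max 0 (- X) + max 0 (- Y)"
    by (simp add: U_def u_def X_def Y_def)
  have rS: "0 \<le> 1 / S * r \<longleftrightarrow> 0 \<le> r"
    using wpos by (simp add: zero_le_divide_iff)
  \<comment> \<open>The maximum of the four lower bounds 0, -X, -Y, -X-Y for U is the sum of the
    negative parts of X and Y.\<close>
  have cond: "0 \<le> X + Y + U \<and> 0 \<le> U \<and> 0 \<le> X + U \<and> 0 \<le> Y + U \<longleftrightarrow> 0 \<le> r"
    unfolding rS[symmetric] U by (auto simp: max_def)
  have "row_density (?v \<bullet> vector [-a, b, c]) ?v = (if 0 \<le> r then exp (- (r + lap_abs (w22 / S) x + lap_abs (w21 / S) y)) else 0)"
    unfolding inn row_density_def ex using cond pos by (auto simp: zero_le_divide_iff)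
  also have "\<dots> = exp (- lap_abs (w22 / S) x) * (exp (- lap_abs (w21 / S) y) * (if 0 \<le> r then exp (- r) else 0))"
    by (simp add: exp_add[symmetric])
  finally show "row_density ((vector [u x y r / a, (sx * x + u x y r) / b, (sy * y + u x y r) / c] :: real^3) \<bullet> vector [-a, b, c])
       (vector [u x y r / a, (sx * x + u x y r) / b, (sy * y + u x y r) / c])
       = exp (- lap_abs (w22 / S) x) * (exp (- lap_abs (w21 / S) y) * (if 0 \<le> r then exp (- r) else 0))"
    unfolding U_def X_def Y_def .
qed

text \<open>The determinant moment for rows (l, x, y), where l is the sum of the four coordinates
  and x, y are the Laplace variables. Only exponents with m + i + j = n occur, so the factorial
  (i+j+m+2)! from \<open>lap_prod_moment\<close> is the constant (n+2)!.\<close>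

definition quad_moment :: "nat \<Rightarrow> real \<Rightarrow> real \<Rightarrow> real" where
  "quad_moment n \<alpha> \<beta> = det_moment n (\<lambda>m i j. fact (n + 2) / fact (i + j + 2) *
     (fact i * lap_mom i \<alpha> * (fact j * lap_mom j \<beta>)))"

lemma det_moment_cong:
  assumes "\<And>i j k. i + j + k = n \<Longrightarrow> \<mu> i j k = \<nu> i j k"
  shows "det_moment n \<mu> = det_moment n \<nu>"
  unfolding det_moment_def by (intro sum.cong refl arg_cong2[where f="(*)"] assms) auto

text \<open>The section is quadrilateral, with t1 and r on one side of the hyperplane equation and
  t2, t3 on the other. The lemma applies \<open>plane_moment_transform\<close> to the coordinates of
  \<open>row_transform_quad\<close>, with \<theta> the product of the scale factors.\<close>

lemma plane_moment_mpp:
  fixes a b c :: real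
  assumes pos: "0 < a" "0 < b" "0 < c" and "even n"
  defines "S \<equiv> 1 + 1 / a + 1 / b + 1 / c"
  defines "\<theta> \<equiv> S / ((1 + 1 / b) * (1 + 1 / c) * (1 / a + 1 / b) * (1 / a + 1 / c) * (a * b * c))"
  shows "plane_moment n (vector [-a, b, c]) = ennreal (\<theta> ^ (n + 3) *
    quad_moment n ((1 / a + 1 / c) / S) ((1 / a + 1 / b) / S))"
proof -
  define w11 where "w11 = 1 + 1 / b"
  define w12 where "w12 = 1 + 1 / c"
  define w21 where "w21 = 1 / a + 1 / b"
  define w22 where "w22 = 1 / a + 1 / c"
  define sx where "sx = S / (w11 * w22)"
  define sy where "sy = S / (w12 * w21)"
  define u where "u = (\<lambda>x y r. 1 / S * r + max 0 (- (sx * x)) + max 0 (- (sy * y)))"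
  define \<alpha> where "\<alpha> = w22 / S"
  define \<beta> where "\<beta> = w21 / S"
  define \<psi> where "\<psi> = (\<lambda>(x, y, r). vector [u x y r / a, (sx * x + u x y r) / b, (sy * y + u x y r) / c] :: real^3)"
  define l where "l = (\<lambda>q. snd (snd q) + lap_abs \<alpha> (fst q) + lap_abs \<beta> (fst (snd q)))"
  have wpos: "0 < w11" "0 < w12" "0 < w21" "0 < w22" "0 < S"
    using pos by (auto simp: w11_def w12_def w21_def w22_def S_def intro!: add_pos_pos)
  have Ssum: "S = w11 + w22" "S = w12 + w21"
    by (simp_all add: w11_def w12_def w21_def w22_def S_def)
  have spos: "0 < sx" "0 < sy"
    using wpos by (auto simp: sx_def sy_def)
  have \<alpha>\<beta>: "0 < \<alpha>" "\<alpha> < 1" "0 < \<beta>" "\<beta> < 1"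
    using wpos Ssum by (auto simp: \<alpha>_def \<beta>_def field_simps)
  have \<theta>: "sx * sy * (1 / S) / (a * b * c) = \<theta>"
    using wpos pos unfolding \<theta>_def sx_def sy_def w11_def[symmetric] w12_def[symmetric] w21_def[symmetric] w22_def[symmetric]
    by (simp add: field_simps)
  have "0 < \<theta>"
    unfolding \<theta>[symmetric] using spos wpos pos by simp
  have ueq: "1 / S * r + max 0 (- (sx * x)) + max 0 (- (sy * y)) = u x y r" for x y r
    by (simp add: u_def)
  note qdens = quad_density[OF pos, folded w11_def w12_def w21_def w22_def S_def, folded sx_def sy_def, unfolded ueq, folded \<alpha>_def \<beta>_def]
  note qlin = quad_linear[OF pos, folded w11_def w12_def w21_def w22_def S_def, folded sx_def sy_def, unfolded ueq, folded \<alpha>_def \<beta>_def]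
  have [measurable]: "(\<lambda>x. u (f1 x) (f2 x) (f3 x)) \<in> borel_measurable M"
    if [measurable]: "f1 \<in> borel_measurable M" "f2 \<in> borel_measurable M" "f3 \<in> borel_measurable M"
    for f1 f2 f3 and M :: "'z measure"
    unfolding u_def by measurable
  have \<psi>m: "\<psi> \<in> borel_measurable borel"
    unfolding \<psi>_def by (simp add: borel_prod[symmetric] split_def)
  have "plane_moment n (vector [-a, b, c]) = ennreal (\<theta> ^ (n + 3) * det_moment n
     (\<lambda>m i j. fact (i + j + m + 2) / fact (i + j + 2) * (fact i * lap_mom i \<alpha> * (fact j * lap_mom j \<beta>))))"
  proof (rule plane_moment_transform[OF sigma_finite_lap_prod[of \<alpha> \<beta>], where l=l and x=fst and y="\<lambda>q. fst (snd q)" and \<psi>=\<psi>])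
    fix f :: "real^3 \<Rightarrow> ennreal" assume [measurable]: "f \<in> borel_measurable borel"
    let ?z = "vector [-a, b, c] :: real^3"
    define g where "g = (\<lambda>t1 t2 t3. ennreal (row_density (vector [t1, t2, t3] \<bullet> ?z) (vector [t1, t2, t3])) * f (vector [t1, t2, t3]))"
    have [measurable]: "(\<lambda>x. g (f1 x) (f2 x) (f3 x)) \<in> borel_measurable M"
      if [measurable]: "f1 \<in> borel_measurable M" "f2 \<in> borel_measurable M" "f3 \<in> borel_measurable M"
      for f1 f2 f3 and M :: "'z measure"
      unfolding g_def by measurable
    have "(\<integral>\<^sup>+t. ennreal (row_density (t \<bullet> ?z) t) * f t \<partial>lborel) = (\<integral>\<^sup>+t1. \<integral>\<^sup>+t2. \<integral>\<^sup>+t3. g t1 t2 t3 \<partial>lborel \<partial>lborel \<partial>lborel)"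
      unfolding g_def by (subst nn_integral_lborel_vec3) simp_all
    also have "\<dots> = ennreal (sx * sy * (1 / S) / (a * b * c)) *
       (\<integral>\<^sup>+x. \<integral>\<^sup>+y. \<integral>\<^sup>+r. g (u x y r / a) ((sx * x + u x y r) / b) ((sy * y + u x y r) / c) \<partial>lborel \<partial>lborel \<partial>lborel)"
      unfolding u_def
      by (rule nn_integral_quad_subst) (use pos spos wpos in \<open>auto simp: borel_prod[symmetric] split_def\<close>)
    also have "(\<integral>\<^sup>+x. \<integral>\<^sup>+y. \<integral>\<^sup>+r. g (u x y r / a) ((sx * x + u x y r) / b) ((sy * y + u x y r) / c) \<partial>lborel \<partial>lborel \<partial>lborel)
       = (\<integral>\<^sup>+t. f (\<psi> t) \<partial>lap_prod \<alpha> \<beta>)"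
    proof -
      have "g (u x y r / a) ((sx * x + u x y r) / b) ((sy * y + u x y r) / c) = ennreal (exp (- lap_abs \<alpha> x)) * (ennreal (exp (- lap_abs \<beta> y)) *
         (ennreal (if 0 \<le> r then exp (- r) else 0) * f (\<psi> (x, y, r))))" for x y r
        unfolding g_def qdens by (simp add: ennreal_mult mult.assoc \<psi>_def)
      moreover have "(\<lambda>t. f (\<psi> t)) \<in> borel_measurable borel"
        using \<psi>m by measurable
      ultimately show ?thesis
        by (simp only: nn_integral_lap_prod)
    qed
    finally show "(\<integral>\<^sup>+t. ennreal (row_density (t \<bullet> ?z) t) * f t \<partial>lborel) = ennreal \<theta> * (\<integral>\<^sup>+t. f (\<psi> t) \<partial>lap_prod \<alpha> \<beta>)"
      unfolding \<theta> .
  next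
    show "triple (\<psi> q1) (\<psi> q2) (\<psi> q3) = \<theta> * det3 (l q1, fst q1, fst (snd q1)) (l q2, fst q2, fst (snd q2)) (l q3, fst q3, fst (snd q3))"
      for q1 q2 q3
    proof -
      obtain x1 y1 r1 x2 y2 r2 x3 y3 r3 where q: "q1 = (x1, y1, r1)" "q2 = (x2, y2, r2)" "q3 = (x3, y3, r3)"
        by (metis prod_cases3)
      have ul: "u x y r = (l (x, y, r) - w11 * (sx * x) - w12 * (sy * y)) / S" for x y r
        using qlin[of x y r] wpos by (simp add: l_def field_simps)
      define u1 where "u1 = u x1 y1 r1"
      define u2 where "u2 = u x2 y2 r2"
      define u3 where "u3 = u x3 y3 r3"
      have "triple (\<psi> q1) (\<psi> q2) (\<psi> q3) = sx * sy / (a * b * c) * det3 (u1, x1, y1) (u2, x2, y2) (u3, x3, y3)"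
        using pos unfolding q \<psi>_def prod.case u1_def[symmetric] u2_def[symmetric] u3_def[symmetric]
        by (simp add: triple_def det3_def field_simps)
      \<comment> \<open>Each u is l/S minus a fixed linear combination of x and y, and such a
        combination of columns does not affect the determinant.\<close>
      also have "det3 (u1, x1, y1) (u2, x2, y2) (u3, x3, y3) = 1 / S * det3 (l q1, x1, y1) (l q2, x2, y2) (l q3, x3, y3)"
      proof -
        have "det3 ((k1 - w11 * (sx * x1) - w12 * (sy * y1)) / S, x1, y1) ((k2 - w11 * (sx * x2) - w12 * (sy * y2)) / S, x2, y2)
            ((k3 - w11 * (sx * x3) - w12 * (sy * y3)) / S, x3, y3) = 1 / S * det3 (k1, x1, y1) (k2, x2, y2) (k3, x3, y3)" for k1 k2 k3
          unfolding divide_inverse by (simp add: det3_def algebra_simps)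
        then show ?thesis unfolding u1_def u2_def u3_def ul q .
      qed
      finally show ?thesis unfolding \<theta>[symmetric] q by simp
    qed
    show "has_bochner_integral (lap_prod \<alpha> \<beta>) (\<lambda>q. l q ^ m * fst q ^ i * fst (snd q) ^ j)
       (fact (i + j + m + 2) / fact (i + j + 2) * (fact i * lap_mom i \<alpha> * (fact j * lap_mom j \<beta>)))" for m i j
      unfolding l_def by (rule lap_prod_moment[OF \<alpha>\<beta>])
    show "\<psi> \<in> borel_measurable (lap_prod \<alpha> \<beta>)"
      using \<psi>m by (simp cong: measurable_cong_sets)
  qed fact+
  also have "det_moment n (\<lambda>m i j. fact (i + j + m + 2) / fact (i + j + 2) * (fact i * lap_mom i \<alpha> * (fact j * lap_mom j \<beta>)))
     = quad_moment n \<alpha> \<beta>"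
    unfolding quad_moment_def by (rule det_moment_cong) (simp add: add.commute add.left_commute)
  finally show ?thesis
    unfolding \<alpha>_def \<beta>_def w21_def w22_def .
qed

section \<open>Explicit determinant moments of orders four and six\<close>

lemma sum_atMost_expand:
  fixes f :: "nat \<Rightarrow> real"
  shows "sum f {..0} = f 0" "sum f {..Suc 0} = f 0 + f 1" "sum f {..2} = f 0 + f 1 + f 2"
    "sum f {..3} = f 0 + f 1 + f 2 + f 3" "sum f {..4} = f 0 + f 1 + f 2 + f 3 + f 4"
    "sum f {..5} = f 0 + f 1 + f 2 + f 3 + f 4 + f 5" "sum f {..6} = f 0 + f 1 + f 2 + f 3 + f 4 + f 5 + f 6"
  by (simp_all add: numeral_eq_Suc)

lemma binomial_table:
  fixes n :: nat
  shows "3 choose 2 = (3::nat)" "4 choose 2 = (6::nat)" "4 choose 3 = (4::nat)" "5 choose 2 = (10::nat)" "5 choose 3 = (10::nat)" "5 choose 4 = (5::nat)" "6 choose 2 = (15::nat)" "6 choose 3 = (20::nat)" "6 choose 4 = (15::nat)" "6 choose 5 = (6::nat)"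
  by (simp_all add: numeral_eq_Suc)

text \<open>The slice with a fixed exponent i of the first entry; evaluating slice by slice keeps
  the numerical expansions small.\<close>

definition det_moment_part :: "nat \<Rightarrow> (nat \<Rightarrow> nat \<Rightarrow> nat \<Rightarrow> real) \<Rightarrow> nat \<Rightarrow> real" where
  "det_moment_part n \<mu> i = (\<Sum>j\<le>n-i. \<Sum>p\<le>i. \<Sum>q\<le>j. \<Sum>r\<le>n-i-j.
     real ((n choose i) * (n-i choose j) * (i choose p) * (j choose q) * (n-i-j choose r)) *
     (-1) ^ ((i-p) + (j-q) + (n-i-j-r)) *
     (\<mu> i j (n-i-j) * \<mu> ((j-q) + r) (p + (n-i-j-r)) ((i-p) + q) * \<mu> (q + (n-i-j-r)) ((i-p) + r) (p + (j-q))))"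

lemma det_moment_parts: "det_moment n \<mu> = sum (det_moment_part n \<mu>) {..n}"
  by (simp add: det_moment_def det_moment_part_def)

text \<open>In the centred parameter c = 2\<alpha> - 1 the moments are even or odd polynomials in c
  according to the parity of i.\<close>

lemma lap_mom_centred:
  assumes "\<alpha> = (1 + c) / 2"
  shows "lap_mom 0 \<alpha> = 1" "lap_mom (Suc 0) \<alpha> = c" "lap_mom 2 \<alpha> = (1 + 3 * c^2) / 4" "lap_mom 3 \<alpha> = c * (1 + c^2) / 2" "lap_mom 4 \<alpha> = (1 + 10 * c^2 + 5 * c^4) / 16" "lap_mom 5 \<alpha> = c * (3 + 10 * c^2 + 3 * c^4) / 16" "lap_mom 6 \<alpha> = (1 + 21 * c^2 + 35 * c^4 + 7 * c^6) / 64"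
  unfolding assms lap_mom_def by (simp_all add: power_numeral_reduce) (simp_all add: field_simps)

lemma lap_mom_centred_Suc:
  assumes "\<alpha> = (1 + c) / 2"
  shows "lap_mom (Suc (Suc 0)) \<alpha> = (1 + 3 * c^2) / 4" "lap_mom (Suc (Suc (Suc 0))) \<alpha> = c * (1 + c^2) / 2" "lap_mom (Suc (Suc (Suc (Suc 0)))) \<alpha> = (1 + 10 * c^2 + 5 * c^4) / 16" "lap_mom (Suc (Suc (Suc (Suc (Suc 0))))) \<alpha> = c * (3 + 10 * c^2 + 3 * c^4) / 16" "lap_mom (Suc (Suc (Suc (Suc (Suc (Suc 0)))))) \<alpha> = (1 + 21 * c^2 + 35 * c^4 + 7 * c^6) / 64"
  using lap_mom_centred[OF assms] by (simp_all add: eval_nat_numeral)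

lemma det_moment_4_fact: "det_moment 4 (\<lambda>a b c. fact a * fact b * fact c) = 51840"
proof -
  have p0: "det_moment_part 4 (\<lambda>a b c. fact a * fact b * fact c) 0 = 40320"
    by (simp add: det_moment_part_def sum_atMost_expand binomial_table fact_numeral)
  have p1: "det_moment_part 4 (\<lambda>a b c. fact a * fact b * fact c) (Suc 0) = -9216"
    by (simp add: det_moment_part_def sum_atMost_expand binomial_table fact_numeral)
  have p2: "det_moment_part 4 (\<lambda>a b c. fact a * fact b * fact c) 2 = 6912"
    by (simp add: det_moment_part_def sum_atMost_expand binomial_table fact_numeral)
  have p3: "det_moment_part 4 (\<lambda>a b c. fact a * fact b * fact c) 3 = -9216"
    by (simp add: det_moment_part_def sum_atMost_expand binomial_table fact_numeral)
  have p4: "det_moment_part 4 (\<lambda>a b c. fact a * fact b * fact c) 4 = 23040"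
    by (simp add: det_moment_part_def sum_atMost_expand binomial_table fact_numeral)
  show ?thesis
    by (simp add: det_moment_parts sum_atMost_expand p0 p1 p2 p3 p4)
qed

text \<open>The moment is invariant under \<alpha> to 1-\<alpha> and \<beta> to 1-\<beta>, hence a
  polynomial in c^2 = 1 - X and d^2 = 1 - Y. The terms other than the constant are divisible by X Y,
  and the constant is the value \<open>det_moment_4_fact\<close> of the triangular case.\<close>

lemma quad_moment_4:
  assumes X: "X = 4 * \<alpha> * (1 - \<alpha>)" and Y: "Y = 4 * \<beta> * (1 - \<beta>)"
  shows "quad_moment 4 \<alpha> \<beta> = 51840 - 42120 * X * Y + 4860 * X * Y * (X + Y)"
proof -
  define c where "c = 2 * \<alpha> - 1"
  define d where "d = 2 * \<beta> - 1"
  have \<alpha>: "\<alpha> = (1 + c) / 2" and \<beta>: "\<beta> = (1 + d) / 2" by (simp_all add: c_def d_def)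
  note L = lap_mom_centred[OF \<alpha>] lap_mom_centred_Suc[OF \<alpha>] lap_mom_centred[OF \<beta>] lap_mom_centred_Suc[OF \<beta>]
  define \<mu> where "\<mu> = (\<lambda>(m::nat) (i::nat) (j::nat). fact (4 + 2) / fact (i + j + 2) * (fact i * lap_mom i \<alpha> * (fact j * lap_mom j \<beta>)))"
  have XY: "X = 1 - c^2" "Y = 1 - d^2"
    unfolding X Y c_def d_def by (simp_all add: power2_eq_square algebra_simps)
  have p0: "det_moment_part 4 \<mu> 0 = 8235 + 42390 * d^2 + 20655 * d^4 + 42390 * c^2 + 100980 * c^2 * d^2 + 51030 * c^2 * d^4 + 20655 * c^4 + 51030 * c^4 * d^2 + 25515 * c^4 * d^4"
    by (simp add: \<mu>_def det_moment_part_def sum_atMost_expand binomial_table fact_numeral) (simp add: L, algebra)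
  have p1: "det_moment_part 4 \<mu> (Suc 0) = -60480 * d^2 - 51840 * d^4 - 60480 * c^2 - 324000 * c^2 * d^2 - 220320 * c^2 * d^4 - 51840 * c^4 - 220320 * c^4 * d^2 - 116640 * c^4 * d^4"
    by (simp add: \<mu>_def det_moment_part_def sum_atMost_expand binomial_table fact_numeral) (simp add: L, algebra)
  have p2: "det_moment_part 4 \<mu> 2 = 9450 + 56700 * d^2 + 59130 * d^4 + 56700 * c^2 + 448200 * c^2 * d^2 + 341820 * c^2 * d^4 + 59130 * c^4 + 341820 * c^4 * d^2 + 182250 * c^4 * d^4"
    by (simp add: \<mu>_def det_moment_part_def sum_atMost_expand binomial_table fact_numeral) (simp add: L, algebra)
  have p3: "det_moment_part 4 \<mu> 3 = -28080 * d^2 - 32400 * d^4 - 28080 * c^2 - 388800 * c^2 * d^2 - 239760 * c^2 * d^4 - 32400 * c^4 - 239760 * c^4 * d^2 - 116640 * c^4 * d^4"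
    by (simp add: \<mu>_def det_moment_part_def sum_atMost_expand binomial_table fact_numeral) (simp add: L, algebra)
  have p4: "det_moment_part 4 \<mu> 4 = 1755 + 17010 * d^2 + 9315 * d^4 + 17010 * c^2 + 140940 * c^2 * d^2 + 62370 * c^2 * d^4 + 9315 * c^4 + 62370 * c^4 * d^2 + 25515 * c^4 * d^4"
    by (simp add: \<mu>_def det_moment_part_def sum_atMost_expand binomial_table fact_numeral) (simp add: L, algebra)
  have "quad_moment 4 \<alpha> \<beta> = det_moment_part 4 \<mu> 0 + det_moment_part 4 \<mu> (Suc 0) + det_moment_part 4 \<mu> 2 + det_moment_part 4 \<mu> 3 + det_moment_part 4 \<mu> 4"
    unfolding quad_moment_def \<mu>_def[symmetric] det_moment_parts by (simp add: sum_atMost_expand)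
  then show ?thesis
    unfolding p0 p1 p2 p3 p4 XY by algebra
qed

lemma det_moment_6_fact: "det_moment 6 (\<lambda>a b c. fact a * fact b * fact c) = 1559900160"
proof -
  have p0: "det_moment_part 6 (\<lambda>a b c. fact a * fact b * fact c) 0 = 1169925120"
    by (simp add: det_moment_part_def sum_atMost_expand binomial_table fact_numeral)
  have p1: "det_moment_part 6 (\<lambda>a b c. fact a * fact b * fact c) (Suc 0) = -178329600"
    by (simp add: det_moment_part_def sum_atMost_expand binomial_table fact_numeral)
  have p2: "det_moment_part 6 (\<lambda>a b c. fact a * fact b * fact c) 2 = 78105600"
    by (simp add: det_moment_part_def sum_atMost_expand binomial_table fact_numeral)
  have p3: "det_moment_part 6 (\<lambda>a b c. fact a * fact b * fact c) 3 = -61378560"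
    by (simp add: det_moment_part_def sum_atMost_expand binomial_table fact_numeral)
  have p4: "det_moment_part 6 (\<lambda>a b c. fact a * fact b * fact c) 4 = 85017600"
    by (simp add: det_moment_part_def sum_atMost_expand binomial_table fact_numeral)
  have p5: "det_moment_part 6 (\<lambda>a b c. fact a * fact b * fact c) 5 = -186624000"
    by (simp add: det_moment_part_def sum_atMost_expand binomial_table fact_numeral)
  have p6: "det_moment_part 6 (\<lambda>a b c. fact a * fact b * fact c) 6 = 653184000"
    by (simp add: det_moment_part_def sum_atMost_expand binomial_table fact_numeral)
  show ?thesis
    by (simp add: det_moment_parts sum_atMost_expand p0 p1 p2 p3 p4 p5 p6)
qed

text \<open>The same mechanism as in order four; the constant term is the triangular value
  \<open>det_moment_6_fact\<close>.\<close>

lemma quad_moment_6: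
  assumes X: "X = 4 * \<alpha> * (1 - \<alpha>)" and Y: "Y = 4 * \<beta> * (1 - \<beta>)"
  shows "quad_moment 6 \<alpha> \<beta> = 1559900160 - 2551772160 * X * Y + 683665920 * X * Y * (X + Y) - 48988800 * X * Y * (X^2 + Y^2) - 47355840 * X^2 * Y^2"
proof -
  define c where "c = 2 * \<alpha> - 1"
  define d where "d = 2 * \<beta> - 1"
  have \<alpha>: "\<alpha> = (1 + c) / 2" and \<beta>: "\<beta> = (1 + d) / 2" by (simp_all add: c_def d_def)
  note L = lap_mom_centred[OF \<alpha>] lap_mom_centred_Suc[OF \<alpha>] lap_mom_centred[OF \<beta>] lap_mom_centred_Suc[OF \<beta>]
  define \<mu> where "\<mu> = (\<lambda>(m::nat) (i::nat) (j::nat). fact (6 + 2) / fact (i + j + 2) * (fact i * lap_mom i \<alpha> * (fact j * lap_mom j \<beta>)))"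
  have XY: "X = 1 - c^2" "Y = 1 - d^2"
    unfolding X Y c_def d_def by (simp_all add: power2_eq_square algebra_simps)
  have p0: "det_moment_part 6 \<mu> 0 = 64864800 + 687204000 * d^2 + 1091633760 * d^4 + 223261920 * d^6 + 687204000 * c^2 + 2002281120 * c^2 * d^2 + 2712618720 * c^2 * d^4 + 653637600 * c^2 * d^6 + 1091633760 * c^4 + 2712618720 * c^4 * d^2 + 3154425120 * c^4 * d^4 + 763408800 * c^4 * d^6 + 223261920 * c^6 + 653637600 * c^6 * d^2 + 763408800 * c^6 * d^4 + 188606880 * c^6 * d^6"
    by (simp add: \<mu>_def det_moment_part_def sum_atMost_expand binomial_table fact_numeral) (simp add: L, algebra)
  have p1: "det_moment_part 6 \<mu> (Suc 0) = -814302720 * d^2 - 2246952960 * d^4 - 666247680 * d^6 - 814302720 * c^2 - 7515970560 * c^2 * d^2 - 13486072320 * c^2 * d^4 - 3951037440 * c^2 * d^6 - 2246952960 * c^4 - 13486072320 * c^4 * d^2 - 18614292480 * c^4 * d^4 - 5075965440 * c^4 * d^6 - 666247680 * c^6 - 3951037440 * c^6 * d^2 - 5075965440 * c^6 * d^4 - 1280240640 * c^6 * d^6"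
    by (simp add: \<mu>_def det_moment_part_def sum_atMost_expand binomial_table fact_numeral) (simp add: L, algebra)
  have p2: "det_moment_part 6 \<mu> 2 = 105840000 + 1129101120 * d^2 + 2646846720 * d^4 + 1022414400 * d^6 + 1129101120 * c^2 + 16262104320 * c^2 * d^2 + 28821925440 * c^2 * d^4 + 9507818880 * c^2 * d^6 + 2646846720 * c^4 + 28821925440 * c^4 * d^2 + 45268191360 * c^4 * d^4 + 13489519680 * c^4 * d^6 + 1022414400 * c^6 + 9507818880 * c^6 * d^2 + 13489519680 * c^6 * d^4 + 3413975040 * c^6 * d^6"
    by (simp add: \<mu>_def det_moment_part_def sum_atMost_expand binomial_table fact_numeral) (simp add: L, algebra)
  have p3: "det_moment_part 6 \<mu> 3 = -932238720 * d^2 - 2169296640 * d^4 - 962720640 * d^6 - 932238720 * c^2 - 20377163520 * c^2 * d^2 - 36281105280 * c^2 * d^4 - 12152125440 * c^2 * d^6 - 2169296640 * c^4 - 36281105280 * c^4 * d^2 - 63818979840 * c^4 * d^4 - 18845447040 * c^4 * d^6 - 962720640 * c^6 - 12152125440 * c^6 * d^2 - 18845447040 * c^6 * d^4 - 4618010880 * c^6 * d^6"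
    by (simp add: \<mu>_def det_moment_part_def sum_atMost_expand binomial_table fact_numeral) (simp add: L, algebra)
  have p4: "det_moment_part 6 \<mu> 4 = 53978400 + 784274400 * d^2 + 1586239200 * d^4 + 594669600 * d^6 + 784274400 * c^2 + 13271882400 * c^2 * d^2 + 28583604000 * c^2 * d^4 + 8831138400 * c^2 * d^6 + 1586239200 * c^4 + 28583604000 * c^4 * d^2 + 55552845600 * c^4 * d^4 + 14664434400 * c^4 * d^6 + 594669600 * c^6 + 8831138400 * c^6 * d^2 + 14664434400 * c^6 * d^4 + 3343485600 * c^6 * d^6"
    by (simp add: \<mu>_def det_moment_part_def sum_atMost_expand binomial_table fact_numeral) (simp add: L, algebra)
  have p5: "det_moment_part 6 \<mu> 5 = -174182400 * d^2 - 609638400 * d^4 - 203212800 * d^6 - 174182400 * c^2 - 6096384000 * c^2 * d^2 - 14224896000 * c^2 * d^4 - 3599769600 * c^2 * d^6 - 609638400 * c^4 - 14224896000 * c^4 * d^2 - 26766028800 * c^4 * d^4 - 5951232000 * c^4 * d^6 - 203212800 * c^6 - 3599769600 * c^6 * d^2 - 5951232000 * c^6 * d^4 - 1219276800 * c^6 * d^6"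
    by (simp add: \<mu>_def det_moment_part_def sum_atMost_expand binomial_table fact_numeral) (simp add: L, algebra)
  have p6: "det_moment_part 6 \<mu> 6 = 5443200 + 111585600 * d^2 + 190512000 * d^4 + 40824000 * d^6 + 111585600 * c^2 + 2152785600 * c^2 * d^2 + 3431937600 * c^2 * d^4 + 661348800 * c^2 * d^6 + 190512000 * c^4 + 3431937600 * c^4 * d^2 + 5176483200 * c^4 * d^4 + 955281600 * c^4 * d^6 + 40824000 * c^6 + 661348800 * c^6 * d^2 + 955281600 * c^6 * d^4 + 171460800 * c^6 * d^6"
    by (simp add: \<mu>_def det_moment_part_def sum_atMost_expand binomial_table fact_numeral) (simp add: L, algebra)
  have "quad_moment 6 \<alpha> \<beta> = det_moment_part 6 \<mu> 0 + det_moment_part 6 \<mu> (Suc 0) + det_moment_part 6 \<mu> 2 + det_moment_part 6 \<mu> 3 + det_moment_part 6 \<mu> 4 + det_moment_part 6 \<mu> 5 + det_moment_part 6 \<mu> 6"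
    unfolding quad_moment_def \<mu>_def[symmetric] det_moment_parts by (simp add: sum_atMost_expand)
  then show ?thesis
    unfolding p0 p1 p2 p3 p4 p5 p6 XY by algebra
qed

section \<open>Moments of the linear form of the fourth row\<close>

interpretation exp_pair: pair_sigma_finite exp_law exp_law ..

lemma distance_moment_exp_law:
  "distance_moment k (vector [z1, z2, z3]) =
    (\<integral>\<^sup>+x. \<integral>\<^sup>+y. \<integral>\<^sup>+w. \<integral>\<^sup>+r. ennreal (\<bar>r - (z1 * x + z2 * y + z3 * w)\<bar> ^ k) \<partial>exp_law \<partial>exp_law \<partial>exp_law \<partial>exp_law)"
proof -
  define e where "e = (\<lambda>r::real. ennreal (if 0 \<le> r then exp (- r) else 0))"
  have [measurable]: "e \<in> borel_measurable borel" unfolding e_def by measurable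
  define V where "V = (\<lambda>x y w r. ennreal (\<bar>r - (z1 * x + z2 * y + z3 * w)\<bar> ^ k))"
  have [measurable]: "(\<lambda>q. V (f1 q) (f2 q) (f3 q) (f4 q)) \<in> borel_measurable M"
    if [measurable]: "f1 \<in> borel_measurable M" "f2 \<in> borel_measurable M" "f3 \<in> borel_measurable M" "f4 \<in> borel_measurable M"
    for f1 f2 f3 f4 and M :: "'z measure"
    unfolding V_def by measurable
  have el: "exp_law = density lborel e" by (simp add: exp_law_def e_def)
  have rd: "ennreal (row_density r (vector [x, y, w])) = e x * (e y * (e w * e r))" for r x y w
    by (auto simp: row_density_def csum_def e_def ennreal_mult[symmetric] exp_add[symmetric])
  have "distance_moment k (vector [z1, z2, z3]) =
    (\<integral>\<^sup>+x. \<integral>\<^sup>+y. \<integral>\<^sup>+w. \<integral>\<^sup>+r. e x * (e y * (e w * (e r * V x y w r))) \<partial>lborel \<partial>lborel \<partial>lborel \<partial>lborel)"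
    unfolding distance_moment_def
    by (subst nn_integral_lborel_vec3) (simp_all add: rd V_def inner_vec3 mult.assoc mult.commute[of _ z1] mult.commute[of _ z2] mult.commute[of _ z3])
  also have "\<dots> = (\<integral>\<^sup>+x. e x * (\<integral>\<^sup>+y. e y * (\<integral>\<^sup>+w. e w * (\<integral>\<^sup>+r. e r * V x y w r \<partial>lborel) \<partial>lborel) \<partial>lborel) \<partial>lborel)"
    by (simp add: nn_integral_cmult)
  also have "\<dots> = (\<integral>\<^sup>+x. \<integral>\<^sup>+y. \<integral>\<^sup>+w. \<integral>\<^sup>+r. V x y w r \<partial>exp_law \<partial>exp_law \<partial>exp_law \<partial>exp_law)"
    unfolding el by (simp add: nn_integral_density)
  finally show ?thesis unfolding V_def .
qed

text \<open>The substitution m (s - B) reduces to the Gamma integral and releases exp(-m B).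
  Positivity of k makes the integrand vanish to the left of B.\<close>

lemma has_bochner_integral_shifted_power_exp:
  fixes B m :: real
  assumes "0 \<le> B" "0 < m" "0 < k"
  shows "has_bochner_integral lborel (\<lambda>s. max 0 (s - B) ^ k * exp (- m * s)) (fact k * exp (- m * B) / m ^ Suc k)"
proof -
  let ?g = "\<lambda>x::real. x ^ k * exp (- x) * indicator {0..} x"
  have "has_bochner_integral lborel (\<lambda>s. ?g (- m * B + m * s)) (fact k /\<^sub>R \<bar>m\<bar>)"
    using lborel_has_bochner_integral_real_affine_iff[of m ?g "fact k" "- m * B"] assms
      has_bochner_integral_lborel_power_exp[of k] by simp
  then have "has_bochner_integral lborel (\<lambda>s. exp (- m * B) / m ^ k * ?g (- m * B + m * s)) (exp (- m * B) / m ^ k * (fact k /\<^sub>R \<bar>m\<bar>))"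
    by (rule has_bochner_integral_mult_right)
  also have "exp (- m * B) / m ^ k * (fact k /\<^sub>R \<bar>m\<bar>) = fact k * exp (- m * B) / m ^ Suc k"
    using assms by (simp add: field_simps)
  also have "(\<lambda>s. exp (- m * B) / m ^ k * ?g (- m * B + m * s)) = (\<lambda>s. max 0 (s - B) ^ k * exp (- m * s))"
  proof
    fix s :: real
    have eq: "- m * B + m * s = m * (s - B)" by (simp add: algebra_simps)
    show "exp (- m * B) / m ^ k * ?g (- m * B + m * s) = max 0 (s - B) ^ k * exp (- m * s)"
    proof (cases "B \<le> s")
      case True
      have "exp (- m * B) * exp (- (m * (s - B))) = exp (- m * s)"
        by (simp add: exp_add[symmetric] algebra_simps)
      moreover have "(m * (s - B)) ^ k = m ^ k * max 0 (s - B) ^ k"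
        using True by (simp add: power_mult_distrib max_def)
      ultimately show ?thesis
        unfolding eq using True assms by (simp add: field_simps)
    next
      case False
      then have "\<not> 0 \<le> m * (s - B)" using assms by (simp add: zero_le_mult_iff)
      then show ?thesis unfolding eq using False assms by (simp add: max_def)
    qed
  qed
  finally show ?thesis .
qed

lemma exp_law_has_bochner_integralI:
  assumes "has_bochner_integral lborel (\<lambda>x. f x * exp (- x) * indicator {0..} x) a" "f \<in> borel_measurable borel"
  shows "has_bochner_integral exp_law f (a :: real)"
  unfolding exp_law_def
proof (rule has_bochner_integral_density)
  have "(\<lambda>x. f x * exp (- x) * indicator {0..} x) = (\<lambda>x. (if 0 \<le> x then exp (- x) else 0) *\<^sub>R f x)"
    by (auto simp: fun_eq_iff indicator_def)
  then show "has_bochner_integral lborel (\<lambda>x. (if 0 \<le> x then exp (- x) else 0) *\<^sub>R f x) a"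
    using assms(1) by simp
qed (use assms(2) in auto)

lemma exp_law_exp:
  assumes "0 \<le> a"
  shows "has_bochner_integral exp_law (\<lambda>x. exp (- (a * x))) (1 / (1 + a))"
proof (rule exp_law_has_bochner_integralI)
  let ?g = "\<lambda>x::real. x ^ 0 * exp (- x) * indicator {0..} x"
  have "has_bochner_integral lborel (\<lambda>s. ?g (0 + (1 + a) * s)) (fact 0 /\<^sub>R \<bar>1 + a\<bar>)"
    using lborel_has_bochner_integral_real_affine_iff[of "1 + a" ?g "fact 0" 0] assms
      has_bochner_integral_lborel_power_exp[of 0] by simp
  also have "(\<lambda>s. ?g (0 + (1 + a) * s)) = (\<lambda>x. exp (- (a * x)) * exp (- x) * indicator {0..} x)"
  proof
    fix s :: real
    have "0 \<le> (1 + a) * s \<longleftrightarrow> 0 \<le> s" using assms by (simp add: zero_le_mult_iff)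
    moreover have "exp (- ((1 + a) * s)) = exp (- (a * s)) * exp (- s)"
      by (simp add: exp_add[symmetric] algebra_simps)
    ultimately show "?g (0 + (1 + a) * s) = exp (- (a * s)) * exp (- s) * indicator {0..} s"
      by (simp add: indicator_def)
  qed
  finally show "has_bochner_integral lborel (\<lambda>x. exp (- (a * x)) * exp (- x) * indicator {0..} x) (1 / (1 + a))"
    using assms by (simp add: divide_inverse)
qed auto

text \<open>Lack of memory: the threshold B is exceeded with probability exp(-B), and the excess is
  again standard exponential.\<close>

lemma exp_law_pos_part_power:
  assumes "0 \<le> B" "0 < k"
  shows "has_bochner_integral exp_law (\<lambda>r. max 0 (r - B) ^ k) (fact k * exp (- B))"
proof (rule exp_law_has_bochner_integralI)
  have "(\<lambda>s. max 0 (s - B) ^ k * exp (- 1 * s)) = (\<lambda>x. max 0 (x - B) ^ k * exp (- x) * indicator {0..} x)"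
    using assms by (auto simp: fun_eq_iff indicator_def max_def)
  then show "has_bochner_integral lborel (\<lambda>x. max 0 (x - B) ^ k * exp (- x) * indicator {0..} x) (fact k * exp (- B))"
    using has_bochner_integral_shifted_power_exp[of B 1 k] assms by simp
qed auto

lemma exp_law_shifted_power:
  "has_bochner_integral exp_law (\<lambda>r. (r - B) ^ k) (fact k * (\<Sum>i\<le>k. (- B) ^ i / fact i))"
proof -
  have "has_bochner_integral exp_law (\<lambda>r. \<Sum>i\<le>k. (of_nat (k choose i) * (- B) ^ i) * r ^ (k - i)) (\<Sum>i\<le>k. (of_nat (k choose i) * (- B) ^ i) * fact (k - i))"
    by (intro has_bochner_integral_sum has_bochner_integral_mult_right exp_law_moment)
  also have "(\<lambda>r. \<Sum>i\<le>k. (of_nat (k choose i) * (- B) ^ i) * r ^ (k - i)) = (\<lambda>r. (r - B) ^ k)"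
    by (rule ext, subst diff_conv_add_uminus, subst add.commute, subst binomial_ring) simp
  also have "(\<Sum>i\<le>k. (of_nat (k choose i) * (- B) ^ i) * fact (k - i)) = fact k * (\<Sum>i\<le>k. (- B) ^ i / fact i)"
    unfolding sum_distrib_left by (intro sum.cong refl) (simp add: binomial_fact)
  finally show ?thesis .
qed

lemma odd_abs_power_eq:
  fixes y :: real
  assumes "odd k"
  shows "\<bar>y\<bar> ^ k = 2 * max 0 y ^ k - y ^ k"
proof (cases "0 \<le> y")
  case False
  have "k > 0" using assms by (simp add: odd_pos)
  with False assms show ?thesis by (simp add: max_def)
qed (simp add: max_def)

text \<open>For odd k one has |y|^k = 2 max(0,y)^k - y^k. The first term gives the exponential and
  the second a polynomial in B.\<close>

lemma exp_law_abs_power: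
  assumes "0 \<le> B" "odd k"
  shows "has_bochner_integral exp_law (\<lambda>r. \<bar>r - B\<bar> ^ k) (fact k * (2 * exp (- B) - (\<Sum>i\<le>k. (- B) ^ i / fact i)))"
proof -
  have "has_bochner_integral exp_law (\<lambda>r. 2 * max 0 (r - B) ^ k - (r - B) ^ k)
     (2 * (fact k * exp (- B)) - fact k * (\<Sum>i\<le>k. (- B) ^ i / fact i))"
    using assms by (intro has_bochner_integral_diff has_bochner_integral_mult_right exp_law_pos_part_power exp_law_shifted_power)
      (auto simp: odd_pos)
  then show ?thesis
    using assms(2) by (simp add: odd_abs_power_eq algebra_simps)
qed

text \<open>The complete homogeneous symmetric polynomial of degree i in a, b, c.\<close>

definition complete_sum :: "nat \<Rightarrow> real \<Rightarrow> real \<Rightarrow> real \<Rightarrow> real" where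
  "complete_sum i a b c = (\<Sum>j\<le>i. \<Sum>l\<le>i-j. a ^ j * b ^ l * c ^ (i-j-l))"

text \<open>The factorials in the multinomial coefficients cancel against the moments of the
  exponential variables, so every monomial gets coefficient 1.\<close>

lemma exp_prod_linear_power:
  "has_bochner_integral exp_prod (\<lambda>(x, y, w). (a * x + b * y + c * w) ^ i / fact i) (complete_sum i a b c)"
proof -
  have "has_bochner_integral exp_prod (\<lambda>q. \<Sum>j\<le>i. \<Sum>l\<le>i-j. (a ^ j * b ^ l * c ^ (i-j-l) / (fact j * fact l * fact (i-j-l))) *
      (fst q ^ j * fst (snd q) ^ l * snd (snd q) ^ (i-j-l)))
     (\<Sum>j\<le>i. \<Sum>l\<le>i-j. (a ^ j * b ^ l * c ^ (i-j-l) / (fact j * fact l * fact (i-j-l))) * (fact j * fact l * fact (i-j-l)))"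
    by (intro has_bochner_integral_sum has_bochner_integral_mult_right exp_prod_moment)
  also have "(\<Sum>j\<le>i. \<Sum>l\<le>i-j. (a ^ j * b ^ l * c ^ (i-j-l) / (fact j * fact l * fact (i-j-l))) * (fact j * fact l * fact (i-j-l)))
     = complete_sum i a b c"
    unfolding complete_sum_def by simp
  also have "(\<lambda>q. \<Sum>j\<le>i. \<Sum>l\<le>i-j. (a ^ j * b ^ l * c ^ (i-j-l) / (fact j * fact l * fact (i-j-l))) *
      (fst q ^ j * fst (snd q) ^ l * snd (snd q) ^ (i-j-l))) = (\<lambda>(x, y, w). (a * x + b * y + c * w) ^ i / fact i)"
  proof (rule ext, clarify)
    fix x y w :: real
    have "(a * x + b * y + c * w) ^ i = (a * x + (b * y + c * w)) ^ i" by (simp add: add.assoc)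
    also have "\<dots> = (\<Sum>j\<le>i. real (i choose j) * (a * x) ^ j * (\<Sum>l\<le>i-j. real (i-j choose l) * (b * y) ^ l * (c * w) ^ (i-j-l)))"
      by (simp add: binomial_ring)
    finally have "(a * x + b * y + c * w) ^ i / fact i = (\<Sum>j\<le>i. \<Sum>l\<le>i-j. real (i choose j) * real (i-j choose l) / fact i *
       ((a * x) ^ j * (b * y) ^ l * (c * w) ^ (i-j-l)))"
      by (simp add: sum_distrib_left sum_divide_distrib ac_simps)
    also have "\<dots> = (\<Sum>j\<le>i. \<Sum>l\<le>i-j. (a ^ j * b ^ l * c ^ (i-j-l) / (fact j * fact l * fact (i-j-l))) * (x ^ j * y ^ l * w ^ (i-j-l)))"
      by (intro sum.cong refl) (simp add: binomial_fact power_mult_distrib ac_simps)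
    finally show "(\<Sum>j\<le>i. \<Sum>l\<le>i-j. (a ^ j * b ^ l * c ^ (i-j-l) / (fact j * fact l * fact (i-j-l))) *
      (fst (x, y, w) ^ j * fst (snd (x, y, w)) ^ l * snd (snd (x, y, w)) ^ (i-j-l))) = (a * x + b * y + c * w) ^ i / fact i"
      by simp
  qed
  finally show ?thesis .
qed

lemma AE_exp_law_nonneg: "AE x in exp_law. 0 \<le> x"
  unfolding exp_law_def by (subst AE_density) auto

lemma nn_integral_exp_prod_iterated:
  fixes f :: "real \<times> real \<times> real \<Rightarrow> ennreal"
  assumes "f \<in> borel_measurable borel"
  shows "(\<integral>\<^sup>+q. f q \<partial>exp_prod) = (\<integral>\<^sup>+x. \<integral>\<^sup>+y. \<integral>\<^sup>+w. f (x, y, w) \<partial>exp_law \<partial>exp_law \<partial>exp_law)"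
proof -
  have fm: "f \<in> borel_measurable (exp_law \<Otimes>\<^sub>M (exp_law \<Otimes>\<^sub>M exp_law))"
    using assms(1) sets_exp_prod unfolding exp_prod_def by (simp cong: measurable_cong_sets)
  have sf: "sigma_finite_measure (exp_law \<Otimes>\<^sub>M exp_law)"
    by (intro sigma_finite_pair_measure' sigma_finite_exp_law)
  have "(\<integral>\<^sup>+q. f q \<partial>exp_prod) = (\<integral>\<^sup>+x. \<integral>\<^sup>+q. f (x, q) \<partial>(exp_law \<Otimes>\<^sub>M exp_law) \<partial>exp_law)"
    unfolding exp_prod_def using fm by (simp add: sigma_finite_measure.nn_integral_fst[OF sf])
  also have "\<dots> = (\<integral>\<^sup>+x. \<integral>\<^sup>+y. \<integral>\<^sup>+r. f (x, y, r) \<partial>exp_law \<partial>exp_law \<partial>exp_law)"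
    by (intro nn_integral_cong exp_law.nn_integral_fst[symmetric] measurable_Pair2[OF fm])
  finally show ?thesis .
qed

text \<open>Conditionally on t the form is r - B with B = t . z nonnegative, so
  \<open>exp_law_abs_power\<close> applies. Averaging over t turns exp(-B) into a product of Laplace
  transforms and the powers of B into complete symmetric polynomials.\<close>

lemma distance_moment_ppp:
  assumes pos: "0 \<le> a" "0 \<le> b" "0 \<le> c" and "odd k"
  defines "v \<equiv> fact k * (2 / ((1 + a) * (1 + b) * (1 + c)) - (\<Sum>i\<le>k. (-1) ^ i * complete_sum i a b c))"
  shows "distance_moment k (vector [a, b, c]) = ennreal v" and "0 \<le> v"
proof -
  define Q where "Q = (\<lambda>B::real. fact k * (2 * exp (- B) - (\<Sum>i\<le>k. (- B) ^ i / fact i)))"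
  have Q: "(\<integral>\<^sup>+r. ennreal (\<bar>r - B\<bar> ^ k) \<partial>exp_law) = ennreal (Q B) \<and> 0 \<le> Q B" if "0 \<le> B" for B
  proof -
    have "has_bochner_integral exp_law (\<lambda>r. \<bar>r - B\<bar> ^ k) (Q B)"
      using exp_law_abs_power[OF that \<open>odd k\<close>] by (simp add: Q_def)
    then have "integrable exp_law (\<lambda>r. \<bar>r - B\<bar> ^ k)" "integral\<^sup>L exp_law (\<lambda>r. \<bar>r - B\<bar> ^ k) = Q B"
      by (auto simp: has_bochner_integral_iff)
    moreover have "0 \<le> integral\<^sup>L exp_law (\<lambda>r. \<bar>r - B\<bar> ^ k)"
      by (intro Bochner_Integration.integral_nonneg) simp
    ultimately show ?thesis by (simp add: nn_integral_eq_integral)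
  qed
  let ?B = "\<lambda>q. a * fst q + b * fst (snd q) + c * snd (snd q)"
  have e: "has_bochner_integral exp_prod (\<lambda>q. exp (- ?B q)) (1 / ((1 + a) * (1 + b) * (1 + c)))"
    using has_bochner_integral_triple_times[OF sigma_finite_exp_law sigma_finite_exp_law sigma_finite_exp_law
      exp_law_exp[OF pos(1)] exp_law_exp[OF pos(2)] exp_law_exp[OF pos(3)]]
    by (simp add: exp_prod_def split_def exp_add[symmetric] algebra_simps)
  have p: "has_bochner_integral exp_prod (\<lambda>q. ?B q ^ i / fact i) (complete_sum i a b c)" for i
    using exp_prod_linear_power[of a b c i] by (simp add: split_def)
  have "has_bochner_integral exp_prod (\<lambda>q. fact k * (2 * exp (- ?B q) - (\<Sum>i\<le>k. (-1) ^ i * (?B q ^ i / fact i))))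
    (fact k * (2 * (1 / ((1 + a) * (1 + b) * (1 + c))) - (\<Sum>i\<le>k. (-1) ^ i * complete_sum i a b c)))"
    by (intro has_bochner_integral_mult_right has_bochner_integral_diff has_bochner_integral_sum e p)
  also have "(\<lambda>q. fact k * (2 * exp (- ?B q) - (\<Sum>i\<le>k. (-1) ^ i * (?B q ^ i / fact i)))) = (\<lambda>q. Q (?B q))"
    unfolding Q_def power_minus[of "?B _"] by simp
  finally have hb: "has_bochner_integral exp_prod (\<lambda>q. Q (?B q)) v"
    by (simp add: v_def)
  have Bm: "?B \<in> borel_measurable borel"
    by (simp add: borel_prod[symmetric])
  have ae: "AE x in exp_law. AE y in exp_law. AE w in exp_law. 0 \<le> ?B (x, y, w)"
    using AE_exp_law_nonneg
  proof eventually_elim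
    fix x :: real assume x: "0 \<le> x"
    show "AE y in exp_law. AE w in exp_law. 0 \<le> ?B (x, y, w)"
      using AE_exp_law_nonneg
    proof eventually_elim
      fix y :: real assume y: "0 \<le> y"
      show "AE w in exp_law. 0 \<le> ?B (x, y, w)"
        using AE_exp_law_nonneg by eventually_elim (use x y pos in simp)
    qed
  qed
  have AE: "AE q in exp_prod. 0 \<le> ?B q"
  proof -
    interpret P: sigma_finite_measure "exp_law \<Otimes>\<^sub>M exp_law"
      by (intro sigma_finite_pair_measure' sigma_finite_exp_law)
    interpret PP: pair_sigma_finite exp_law "exp_law \<Otimes>\<^sub>M exp_law" ..
    have "AE x in exp_law. AE q in exp_law \<Otimes>\<^sub>M exp_law. 0 \<le> ?B (x, q)"
      using ae
    proof eventually_elim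
      fix x assume x: "AE y in exp_law. AE w in exp_law. 0 \<le> ?B (x, y, w)"
      show "AE q in exp_law \<Otimes>\<^sub>M exp_law. 0 \<le> ?B (x, q)"
      proof (rule exp_pair.AE_pair_measure)
        show "AE y in exp_law. AE w in exp_law. 0 \<le> ?B (x, y, w)" by (rule x)
      qed measurable
    qed
    then have ae2: "AE x in exp_law. AE q in exp_law \<Otimes>\<^sub>M exp_law. 0 \<le> ?B (x, q)" .
    show ?thesis
      unfolding exp_prod_def
    proof (rule PP.AE_pair_measure)
      show "AE x in exp_law. AE q in exp_law \<Otimes>\<^sub>M exp_law. 0 \<le> ?B (x, q)" by (rule ae2)
    qed measurable
  qed
  have "distance_moment k (vector [a, b, c]) = (\<integral>\<^sup>+q. \<integral>\<^sup>+r. ennreal (\<bar>r - ?B q\<bar> ^ k) \<partial>exp_law \<partial>exp_prod)"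
    unfolding distance_moment_exp_law
    by (subst nn_integral_exp_prod_iterated) (auto simp: borel_prod[symmetric])
  also have "\<dots> = (\<integral>\<^sup>+q. ennreal (Q (?B q)) \<partial>exp_prod)"
    using AE by (intro nn_integral_cong_AE) (auto simp: Q)
  also have "\<dots> = ennreal v"
    using hb AE by (subst nn_integral_eq_integral) (auto simp: has_bochner_integral_iff Q)
  finally show "distance_moment k (vector [a, b, c]) = ennreal v" .
  show "0 \<le> v"
    using hb AE by (auto simp: has_bochner_integral_iff Q intro!: integral_nonneg_AE)
qed

text \<open>The k-th moment of the positive part of r + a x - b y - c w for independent standard
  exponential variables, when a differs from 1. At a = 1 division by zero makes it 0, which is not
  the limiting value.\<close>

definition pos_distance :: "nat \<Rightarrow> real \<Rightarrow> real \<Rightarrow> real \<Rightarrow> real" where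
  "pos_distance k a b c = fact k * (1 / ((1 + b) * (1 + c)) - a ^ (k + 3) / ((a + b) * (a + c))) / (1 - a)"

lemma nn_integral_exp_law:
  assumes "f \<in> borel_measurable borel"
  shows "(\<integral>\<^sup>+x. f x \<partial>exp_law) = (\<integral>\<^sup>+x. ennreal (if 0 \<le> x then exp (- x) else 0) * f x \<partial>lborel)"
  unfolding exp_law_def using assms by (subst nn_integral_density) auto

text \<open>The density of \<open>r + a x\<close> for independent standard exponential \<open>r\<close> and \<open>x\<close>.\<close>

lemma nn_integral_exp_law_sum:
  fixes f :: "real \<Rightarrow> ennreal"
  assumes a: "0 < a" "a \<noteq> 1" and [measurable]: "f \<in> borel_measurable borel"
  shows "(\<integral>\<^sup>+x. \<integral>\<^sup>+r. f (r + a * x) \<partial>exp_law \<partial>exp_law)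
    = (\<integral>\<^sup>+s. ennreal (if 0 \<le> s then (exp (- (s / a)) - exp (- s)) / (a - 1) else 0) * f s \<partial>lborel)"
proof -
  define e where "e = (\<lambda>r::real. ennreal (if 0 \<le> r then exp (- r) else 0))"
  have [measurable]: "e \<in> borel_measurable borel" unfolding e_def by measurable
  have "(\<integral>\<^sup>+x. \<integral>\<^sup>+r. f (r + a * x) \<partial>exp_law \<partial>exp_law) = (\<integral>\<^sup>+x. e x * (\<integral>\<^sup>+r. e r * f (r + a * x) \<partial>lborel) \<partial>lborel)"
    by (simp add: nn_integral_exp_law e_def)
  also have "\<dots> = (\<integral>\<^sup>+x. e x * (\<integral>\<^sup>+s. e (s - a * x) * f s \<partial>lborel) \<partial>lborel)"
  proof -
    have "(\<integral>\<^sup>+r. e r * f (r + a * x) \<partial>lborel) = (\<integral>\<^sup>+s. e (s - a * x) * f s \<partial>lborel)" for x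
    proof -
      have "(\<lambda>r. e r * f (r + a * x)) \<in> borel_measurable borel" by measurable
      from nn_integral_real_affine[OF this, of 1 "- (a * x)"] show ?thesis
        by (simp add: add.commute[of "- (a * x)"])
    qed
    then show ?thesis by simp
  qed
  also have "\<dots> = (\<integral>\<^sup>+x. \<integral>\<^sup>+s. e x * e (s - a * x) * f s \<partial>lborel \<partial>lborel)"
    by (simp add: nn_integral_cmult mult.assoc)
  also have "\<dots> = (\<integral>\<^sup>+s. \<integral>\<^sup>+x. e x * e (s - a * x) * f s \<partial>lborel \<partial>lborel)"
    by (rule lborel_pair.Fubini') measurable
  also have "\<dots> = (\<integral>\<^sup>+s. (\<integral>\<^sup>+x. e x * e (s - a * x) \<partial>lborel) * f s \<partial>lborel)"
    by (simp add: nn_integral_multc)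
  also have "\<dots> = (\<integral>\<^sup>+s. ennreal (if 0 \<le> s then (exp (- (s / a)) - exp (- s)) / (a - 1) else 0) * f s \<partial>lborel)"
  proof -
    have "(\<integral>\<^sup>+x. e x * e (s - a * x) \<partial>lborel) = ennreal (if 0 \<le> s then (exp (- (s / a)) - exp (- s)) / (a - 1) else 0)" for s
    proof (cases "0 \<le> s")
      case True
      have "e x * e (s - a * x) = ennreal (exp (- s) * exp ((a - 1) * x)) * indicator {0..s / a} x" for x
      proof (cases "0 \<le> x \<and> a * x \<le> s")
        case True
        then have "x \<le> s / a" using a by (simp add: field_simps)
        then show ?thesis
          using True by (simp add: e_def ennreal_mult[symmetric] exp_add[symmetric] algebra_simps)
      next
        case False
        then have "x < 0 \<or> s / a < x" using a by (auto simp: field_simps not_le)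
        then show ?thesis
          using False by (auto simp: e_def indicator_def)
      qed
      then have "(\<integral>\<^sup>+x. e x * e (s - a * x) \<partial>lborel) = (\<integral>\<^sup>+x. ennreal (exp (- s) * exp ((a - 1) * x)) * indicator {0..s / a} x \<partial>lborel)"
        by simp
      also have "\<dots> = ennreal (exp (- s) * (exp ((a - 1) * (s / a)) / (a - 1)) - exp (- s) * (exp ((a - 1) * 0) / (a - 1)))"
        using True a by (intro nn_integral_FTC_Icc) (auto intro!: derivative_eq_intros)
      also have "exp (- s) * (exp ((a - 1) * (s / a)) / (a - 1)) - exp (- s) * (exp ((a - 1) * 0) / (a - 1)) = (exp (- (s / a)) - exp (- s)) / (a - 1)"
      proof -
        have "(a - 1) * (s / a) = s - s / a" using a by (simp add: field_simps)
        then have "exp (- s) * exp ((a - 1) * (s / a)) = exp (- (s / a))"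
          by (simp add: exp_add[symmetric])
        then show ?thesis by (simp add: diff_divide_distrib)
      qed
      finally show ?thesis using True by simp
    next
      case False
      then have "\<not> (0 \<le> x \<and> 0 \<le> s - a * x)" for x
        using a by (smt (verit) mult_nonneg_nonneg)
      then have z: "(\<lambda>x. e x * e (s - a * x)) = (\<lambda>_. 0)"
        by (auto simp: e_def fun_eq_iff)
      show ?thesis unfolding z using False by simp
    qed
    then show ?thesis by simp
  qed
  finally show ?thesis .
qed

text \<open>The density of r + a x is a difference of two exponentials divided by a - 1, nonnegative
  on either side of a = 1; each exponential is integrated against the shifted power.\<close>

lemma nn_integral_exp_law_sum_power:
  assumes a: "0 < a" "a \<noteq> 1" and "0 \<le> B" "0 < k"
  shows "(\<integral>\<^sup>+x. \<integral>\<^sup>+r. ennreal (max 0 (r + a * x - B) ^ k) \<partial>exp_law \<partial>exp_law)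
     = ennreal (fact k * (a ^ Suc k * exp (- (1 / a * B)) - exp (- B)) / (a - 1))"
    and "0 \<le> fact k * (a ^ Suc k * exp (- (1 / a * B)) - exp (- B)) / (a - 1)"
proof -
  define \<kappa> where "\<kappa> = (\<lambda>s. (exp (- (s / a)) - exp (- s)) / (a - 1))"
  have \<kappa>: "0 \<le> \<kappa> s" if "0 \<le> s" for s
  proof (cases "a > 1")
    case True
    then have "s / a \<le> s" using that mult_right_mono[of 1 a s] by (simp add: field_simps)
    then show ?thesis using True by (simp add: \<kappa>_def)
  next
    case False
    then have "s \<le> s / a" using that a mult_right_mono[of a 1 s] by (simp add: field_simps)
    then show ?thesis using False a by (auto simp: \<kappa>_def intro: divide_nonpos_neg)
  qed
  have "has_bochner_integral lborel (\<lambda>s. (max 0 (s - B) ^ k * exp (- (1 / a) * s) - max 0 (s - B) ^ k * exp (- 1 * s)) / (a - 1))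
     ((fact k * exp (- (1 / a) * B) / (1 / a) ^ Suc k - fact k * exp (- 1 * B) / 1 ^ Suc k) / (a - 1))"
    using assms by (intro has_bochner_integral_divide has_bochner_integral_diff has_bochner_integral_shifted_power_exp) auto
  also have "(fact k * exp (- (1 / a) * B) / (1 / a) ^ Suc k - fact k * exp (- 1 * B) / 1 ^ Suc k) / (a - 1)
     = fact k * (a ^ Suc k * exp (- (1 / a * B)) - exp (- B)) / (a - 1)"
    using a by (simp add: power_one_over algebra_simps)
  also have "(\<lambda>s. (max 0 (s - B) ^ k * exp (- (1 / a) * s) - max 0 (s - B) ^ k * exp (- 1 * s)) / (a - 1)) = (\<lambda>s. max 0 (s - B) ^ k * \<kappa> s)"
    by (auto simp: \<kappa>_def fun_eq_iff right_diff_distrib diff_divide_distrib)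
  finally have hb: "has_bochner_integral lborel (\<lambda>s. max 0 (s - B) ^ k * \<kappa> s) (fact k * (a ^ Suc k * exp (- (1 / a * B)) - exp (- B)) / (a - 1))" .
  have nn: "0 \<le> max 0 (s - B) ^ k * \<kappa> s" for s
  proof (cases "B \<le> s")
    case True
    then show ?thesis using \<kappa>[of s] assms by simp
  qed (use assms in \<open>simp add: max_def zero_power\<close>)
  have "(\<integral>\<^sup>+x. \<integral>\<^sup>+r. ennreal (max 0 (r + a * x - B) ^ k) \<partial>exp_law \<partial>exp_law)
     = (\<integral>\<^sup>+s. ennreal (if 0 \<le> s then (exp (- (s / a)) - exp (- s)) / (a - 1) else 0) * ennreal (max 0 (s - B) ^ k) \<partial>lborel)"
    by (rule nn_integral_exp_law_sum[OF a]) measurable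
  also have "\<dots> = (\<integral>\<^sup>+s. ennreal (max 0 (s - B) ^ k * \<kappa> s) \<partial>lborel)"
  proof (intro nn_integral_cong)
    fix s
    show "ennreal (if 0 \<le> s then (exp (- (s / a)) - exp (- s)) / (a - 1) else 0) * ennreal (max 0 (s - B) ^ k) = ennreal (max 0 (s - B) ^ k * \<kappa> s)"
    proof (cases "0 \<le> s")
      case True
      then show ?thesis using \<kappa>[OF True] unfolding \<kappa>_def by (simp add: ennreal_mult[symmetric] mult.commute)
    qed (use assms in \<open>simp add: max_def zero_power\<close>)
  qed
  also have "\<dots> = ennreal (fact k * (a ^ Suc k * exp (- (1 / a * B)) - exp (- B)) / (a - 1))"
    using hb nn by (simp add: has_bochner_integral_iff nn_integral_eq_integral)
  finally show "(\<integral>\<^sup>+x. \<integral>\<^sup>+r. ennreal (max 0 (r + a * x - B) ^ k) \<partial>exp_law \<partial>exp_law)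
     = ennreal (fact k * (a ^ Suc k * exp (- (1 / a * B)) - exp (- B)) / (a - 1))" .
  have "0 \<le> integral\<^sup>L lborel (\<lambda>s. max 0 (s - B) ^ k * \<kappa> s)"
    using nn by (intro Bochner_Integration.integral_nonneg)
  then show "0 \<le> fact k * (a ^ Suc k * exp (- (1 / a * B)) - exp (- B)) / (a - 1)"
    using hb by (simp add: has_bochner_integral_iff)
qed

text \<open>With B = b y + c w, averaging replaces exp(-B) by 1/((1+b)(1+c)) and exp(-B/a) by
  a^2/((a+b)(a+c)).\<close>

lemma nn_integral_pos_distance:
  assumes pos: "0 < a" "a \<noteq> 1" "0 < b" "0 < c" "0 < k"
  shows "(\<integral>\<^sup>+y. \<integral>\<^sup>+w. \<integral>\<^sup>+x. \<integral>\<^sup>+r. ennreal (max 0 (r + a * x - (b * y + c * w)) ^ k) \<partial>exp_law \<partial>exp_law \<partial>exp_law \<partial>exp_law)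
     = ennreal (pos_distance k a b c)" and "0 \<le> pos_distance k a b c"
proof -
  define P where "P = (\<lambda>B. fact k * (a ^ Suc k * exp (- (1 / a * B)) - exp (- B)) / (a - 1))"
  have Pn: "0 \<le> P B" and Pi: "(\<integral>\<^sup>+x. \<integral>\<^sup>+r. ennreal (max 0 (r + a * x - B) ^ k) \<partial>exp_law \<partial>exp_law) = ennreal (P B)"
    if "0 \<le> B" for B
    unfolding P_def using nn_integral_exp_law_sum_power[of a B k] that pos by auto
  let ?B = "\<lambda>q. b * fst q + c * snd q"
  have hb: "has_bochner_integral (exp_law \<Otimes>\<^sub>M exp_law) (\<lambda>q. exp (- (d * ?B q))) (1 / ((1 + d * b) * (1 + d * c)))" if "0 < d" for d
    using has_bochner_integral_pair_times[OF sigma_finite_exp_law sigma_finite_exp_law exp_law_exp[of "d * b"] exp_law_exp[of "d * c"]]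
      that pos by (simp add: exp_add[symmetric] algebra_simps)
  have "has_bochner_integral (exp_law \<Otimes>\<^sub>M exp_law) (\<lambda>q. fact k * (a ^ Suc k * exp (- (1 / a * ?B q)) - exp (- (1 * ?B q))) / (a - 1))
     (fact k * (a ^ Suc k * (1 / ((1 + 1 / a * b) * (1 + 1 / a * c))) - 1 / ((1 + 1 * b) * (1 + 1 * c))) / (a - 1))"
    using pos by (intro has_bochner_integral_divide has_bochner_integral_diff has_bochner_integral_mult_right hb) auto
  also have "fact k * (a ^ Suc k * (1 / ((1 + 1 / a * b) * (1 + 1 / a * c))) - 1 / ((1 + 1 * b) * (1 + 1 * c))) / (a - 1) = pos_distance k a b c"
  proof -
    have "a ^ Suc k * (1 / ((1 + 1 / a * b) * (1 + 1 / a * c))) = a ^ (k + 3) / ((a + b) * (a + c))"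
    proof -
      have "(1 + 1 / a * b) * (1 + 1 / a * c) = (a + b) * (a + c) / a\<^sup>2"
        using pos by (simp add: field_simps power2_eq_square)
      then show ?thesis by (simp add: power_add power2_eq_square power3_eq_cube)
    qed
    then show ?thesis
      unfolding pos_distance_def using pos by (simp add: divide_simps) (simp add: algebra_simps)
  qed
  finally have P: "has_bochner_integral (exp_law \<Otimes>\<^sub>M exp_law) (\<lambda>q. P (?B q)) (pos_distance k a b c)"
    by (simp add: P_def)
  have Bpos: "AE q in exp_law \<Otimes>\<^sub>M exp_law. 0 \<le> ?B q"
  proof (rule exp_pair.AE_pair_measure)
    show "AE x in exp_law. AE y in exp_law. 0 \<le> ?B (x, y)"
      using AE_exp_law_nonneg
    proof eventually_elim
      fix x :: real assume x: "0 \<le> x"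
      show "AE y in exp_law. 0 \<le> ?B (x, y)"
        using AE_exp_law_nonneg by eventually_elim (use x pos in simp)
    qed
  qed measurable
  have "(\<integral>\<^sup>+y. \<integral>\<^sup>+w. \<integral>\<^sup>+x. \<integral>\<^sup>+r. ennreal (max 0 (r + a * x - (b * y + c * w)) ^ k) \<partial>exp_law \<partial>exp_law \<partial>exp_law \<partial>exp_law)
     = (\<integral>\<^sup>+q. \<integral>\<^sup>+x. \<integral>\<^sup>+r. ennreal (max 0 (r + a * x - ?B q) ^ k) \<partial>exp_law \<partial>exp_law \<partial>(exp_law \<Otimes>\<^sub>M exp_law))"
    by (subst exp_law.nn_integral_fst[symmetric]) auto
  also have "\<dots> = (\<integral>\<^sup>+q. ennreal (P (?B q)) \<partial>(exp_law \<Otimes>\<^sub>M exp_law))"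
    by (rule nn_integral_cong_AE, use Bpos in eventually_elim) (rule Pi)
  also have "\<dots> = ennreal (pos_distance k a b c)"
  proof -
    have "AE q in exp_law \<Otimes>\<^sub>M exp_law. 0 \<le> P (?B q)"
      using Bpos by eventually_elim (rule Pn)
    then show ?thesis
      using P by (subst nn_integral_eq_integral) (auto simp: has_bochner_integral_iff)
  qed
  finally show "(\<integral>\<^sup>+y. \<integral>\<^sup>+w. \<integral>\<^sup>+x. \<integral>\<^sup>+r. ennreal (max 0 (r + a * x - (b * y + c * w)) ^ k) \<partial>exp_law \<partial>exp_law \<partial>exp_law \<partial>exp_law)
     = ennreal (pos_distance k a b c)" .
  have "AE q in exp_law \<Otimes>\<^sub>M exp_law. 0 \<le> P (?B q)"
    using Bpos by eventually_elim (rule Pn)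
  then have "0 \<le> integral\<^sup>L (exp_law \<Otimes>\<^sub>M exp_law) (\<lambda>q. P (?B q))"
    by (intro integral_nonneg_AE)
  then show "0 \<le> pos_distance k a b c"
    using P by (simp add: has_bochner_integral_iff)
qed

text \<open>The absolute power is the sum of the powers of the positive and the negative part. The
  negative part is b times a form of the same shape, in which y has coefficient 1 and c/b plays the
  role of a; therefore b and c must differ.\<close>

lemma distance_moment_mpp:
  assumes pos: "0 < a" "a \<noteq> 1" "0 < b" "0 < c" "b \<noteq> c" "0 < k"
  shows "distance_moment k (vector [-a, b, c]) = ennreal (pos_distance k a b c) + ennreal (b ^ k * pos_distance k (c / b) (1 / b) (a / b))"
proof -
  define V where "V = (\<lambda>x y w r. ennreal (max 0 (r + a * x - (b * y + c * w)) ^ k))"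
  define W where "W = (\<lambda>x y w r. ennreal (max 0 (y + c / b * w - (1 / b * r + a / b * x)) ^ k))"
  have [measurable]: "(\<lambda>q. V (f1 q) (f2 q) (f3 q) (f4 q)) \<in> borel_measurable M"
    if [measurable]: "f1 \<in> borel_measurable M" "f2 \<in> borel_measurable M" "f3 \<in> borel_measurable M" "f4 \<in> borel_measurable M"
    for f1 f2 f3 f4 and M :: "'z measure"
    unfolding V_def by measurable
  have [measurable]: "(\<lambda>q. W (f1 q) (f2 q) (f3 q) (f4 q)) \<in> borel_measurable M"
    if [measurable]: "f1 \<in> borel_measurable M" "f2 \<in> borel_measurable M" "f3 \<in> borel_measurable M" "f4 \<in> borel_measurable M"
    for f1 f2 f3 f4 and M :: "'z measure"
    unfolding W_def by measurable
  have split: "ennreal (\<bar>r - (- a * x + b * y + c * w)\<bar> ^ k) = V x y w r + ennreal (b ^ k) * W x y w r" for x y w r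
  proof -
    define Y where "Y = r + a * x - (b * y + c * w)"
    have "\<bar>r - (- a * x + b * y + c * w)\<bar> = \<bar>Y\<bar>" by (simp add: Y_def algebra_simps)
    moreover have "\<bar>Y\<bar> ^ k = max 0 Y ^ k + max 0 (- Y) ^ k"
      using pos by (cases "0 \<le> Y") (auto simp: max_def)
    moreover have "max 0 (- Y) = b * max 0 (y + c / b * w - (1 / b * r + a / b * x))"
    proof -
      have "- Y = b * (y + c / b * w - (1 / b * r + a / b * x))"
        using pos by (simp add: Y_def field_simps)
      then show ?thesis using pos by (simp add: max_def zero_le_mult_iff)
    qed
    ultimately show ?thesis
      using pos by (simp add: V_def W_def Y_def[symmetric] power_mult_distrib ennreal_mult[symmetric] ennreal_plus[symmetric] del: ennreal_plus)
  qed
  have "distance_moment k (vector [-a, b, c]) = (\<integral>\<^sup>+x. \<integral>\<^sup>+y. \<integral>\<^sup>+w. \<integral>\<^sup>+r. V x y w r \<partial>exp_law \<partial>exp_law \<partial>exp_law \<partial>exp_law)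
     + ennreal (b ^ k) * (\<integral>\<^sup>+x. \<integral>\<^sup>+y. \<integral>\<^sup>+w. \<integral>\<^sup>+r. W x y w r \<partial>exp_law \<partial>exp_law \<partial>exp_law \<partial>exp_law)"
    unfolding distance_moment_exp_law split by (simp add: nn_integral_add nn_integral_cmult)
  also have "(\<integral>\<^sup>+x. \<integral>\<^sup>+y. \<integral>\<^sup>+w. \<integral>\<^sup>+r. V x y w r \<partial>exp_law \<partial>exp_law \<partial>exp_law \<partial>exp_law)
     = (\<integral>\<^sup>+y. \<integral>\<^sup>+x. \<integral>\<^sup>+w. \<integral>\<^sup>+r. V x y w r \<partial>exp_law \<partial>exp_law \<partial>exp_law \<partial>exp_law)"
    by (rule exp_pair.Fubini') measurable
  also have "\<dots> = (\<integral>\<^sup>+y. \<integral>\<^sup>+w. \<integral>\<^sup>+x. \<integral>\<^sup>+r. V x y w r \<partial>exp_law \<partial>exp_law \<partial>exp_law \<partial>exp_law)"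
    by (rule nn_integral_cong, rule exp_pair.Fubini') measurable
  also have "\<dots> = ennreal (pos_distance k a b c)"
    unfolding V_def by (rule nn_integral_pos_distance) (use pos in auto)
  also have "(\<integral>\<^sup>+x. \<integral>\<^sup>+y. \<integral>\<^sup>+w. \<integral>\<^sup>+r. W x y w r \<partial>exp_law \<partial>exp_law \<partial>exp_law \<partial>exp_law)
     = (\<integral>\<^sup>+x. \<integral>\<^sup>+y. \<integral>\<^sup>+r. \<integral>\<^sup>+w. W x y w r \<partial>exp_law \<partial>exp_law \<partial>exp_law \<partial>exp_law)"
    by (rule nn_integral_cong, rule nn_integral_cong, rule exp_pair.Fubini') measurable
  also have "\<dots> = (\<integral>\<^sup>+x. \<integral>\<^sup>+r. \<integral>\<^sup>+y. \<integral>\<^sup>+w. W x y w r \<partial>exp_law \<partial>exp_law \<partial>exp_law \<partial>exp_law)"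
    by (rule nn_integral_cong, rule exp_pair.Fubini') measurable
  also have "\<dots> = (\<integral>\<^sup>+r. \<integral>\<^sup>+x. \<integral>\<^sup>+y. \<integral>\<^sup>+w. W x y w r \<partial>exp_law \<partial>exp_law \<partial>exp_law \<partial>exp_law)"
    by (rule exp_pair.Fubini') measurable
  also have "\<dots> = (\<integral>\<^sup>+r. \<integral>\<^sup>+x. \<integral>\<^sup>+w. \<integral>\<^sup>+y. W x y w r \<partial>exp_law \<partial>exp_law \<partial>exp_law \<partial>exp_law)"
    by (rule nn_integral_cong, rule nn_integral_cong, rule exp_pair.Fubini') measurable
  also have "\<dots> = ennreal (pos_distance k (c / b) (1 / b) (a / b))"
    unfolding W_def by (rule nn_integral_pos_distance) (use pos in auto)
  finally show ?thesis
    using pos by (simp add: ennreal_mult')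
qed

section \<open>Integration over half lines and the octants of z\<close>

definition half_line :: "real measure" where
  "half_line = density lborel (indicator {0<..})"

lemma sets_half_line [measurable_cong, simp]: "sets half_line = sets borel"
  by (simp add: half_line_def)

lemma sigma_finite_half_line: "sigma_finite_measure half_line"
  unfolding half_line_def
  by (subst sigma_finite_measure.sigma_finite_iff_density_finite[OF sigma_finite_lborel]) (auto simp: indicator_def)

interpretation half_line: sigma_finite_measure half_line by (rule sigma_finite_half_line)
interpretation half_pair: pair_sigma_finite half_line half_line ..

lemma AE_half_line: "AE x in half_line. 0 < x"
  unfolding half_line_def by (subst AE_density) (auto simp: indicator_def)

lemma AE_half_line_lborel: "(AE x in lborel. P x) \<Longrightarrow> AE x in half_line. P x"
  unfolding half_line_def by (subst AE_density) auto

lemma nn_integral_half_line: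
  assumes "f \<in> borel_measurable borel"
  shows "(\<integral>\<^sup>+x. f x \<partial>half_line) = (\<integral>\<^sup>+x. f x * indicator {0<..} x \<partial>lborel)"
  unfolding half_line_def using assms by (subst nn_integral_density) (auto simp: mult.commute)

lemma nn_integral_half_line_cong:
  assumes "\<And>x. 0 < x \<Longrightarrow> f x = g x"
  shows "(\<integral>\<^sup>+x. f x \<partial>half_line) = (\<integral>\<^sup>+x. g x \<partial>half_line)"
  by (rule nn_integral_cong_AE, use AE_half_line in eventually_elim) (rule assms)

lemma nn_integral_half_line_split:
  assumes [measurable]: "f \<in> borel_measurable borel"
  shows "(\<integral>\<^sup>+x. f x \<partial>lborel) = (\<integral>\<^sup>+x. f x \<partial>half_line) + (\<integral>\<^sup>+x. f (- x) \<partial>half_line)"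
proof -
  have "(\<integral>\<^sup>+x. f x \<partial>lborel) = (\<integral>\<^sup>+x. f x * indicator {0<..} x + f x * indicator {..<0} x \<partial>lborel)"
    by (rule nn_integral_cong_AE, use AE_lborel_singleton[of "0::real"] in eventually_elim) (auto simp: indicator_def)
  also have "\<dots> = (\<integral>\<^sup>+x. f x * indicator {0<..} x \<partial>lborel) + (\<integral>\<^sup>+x. f x * indicator {..<0} x \<partial>lborel)"
    by (rule nn_integral_add) auto
  also have "(\<integral>\<^sup>+x. f x * indicator {..<0} x \<partial>lborel) = (\<integral>\<^sup>+x. f (- x) * indicator {0<..} x \<partial>lborel)"
    by (subst nn_integral_real_affine[where c="-1" and t=0]) (auto intro!: nn_integral_cong simp: indicator_def)
  finally show ?thesis by (simp add: nn_integral_half_line)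
qed

lemma nn_integral_half_line_scale:
  assumes [measurable]: "f \<in> borel_measurable borel" and "0 < c"
  shows "(\<integral>\<^sup>+x. f x \<partial>half_line) = ennreal c * (\<integral>\<^sup>+x. f (c * x) \<partial>half_line)"
proof -
  have "(\<lambda>x. f x * indicator {0<..} x) \<in> borel_measurable borel" by measurable
  from nn_integral_real_affine[OF this, of c 0] \<open>0 < c\<close>
  show ?thesis by (simp add: nn_integral_half_line indicator_def zero_less_mult_iff)
qed

text \<open>Continuity from below of the two measures with densities f and g. It extends
  substitution rules for compact intervals to unbounded or open ranges.\<close>

lemma nn_integral_incseq_cong:
  fixes A :: "nat \<Rightarrow> 'a set" and B :: "nat \<Rightarrow> 'b set"
  assumes [measurable]: "f \<in> borel_measurable M" "g \<in> borel_measurable N" "\<And>i. A i \<in> sets M" "\<And>i. B i \<in> sets N"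
    and "incseq A" "incseq B" "(\<Union>i. A i) = A'" "(\<Union>i. B i) = B'"
    and eq: "\<And>i. (\<integral>\<^sup>+x. f x * indicator (A i) x \<partial>M) = (\<integral>\<^sup>+x. g x * indicator (B i) x \<partial>N)"
  shows "(\<integral>\<^sup>+x. f x * indicator A' x \<partial>M) = (\<integral>\<^sup>+x. g x * indicator B' x \<partial>N)"
proof -
  have fA: "(\<integral>\<^sup>+x. f x * indicator X x \<partial>M) = emeasure (density M f) X" if "X \<in> sets M" for X
    using that assms by (simp add: emeasure_density)
  have gB: "(\<integral>\<^sup>+x. g x * indicator X x \<partial>N) = emeasure (density N g) X" if "X \<in> sets N" for X
    using that assms by (simp add: emeasure_density)
  have "(\<integral>\<^sup>+x. f x * indicator A' x \<partial>M) = (SUP i. emeasure (density M f) (A i))"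
    using assms by (subst fA) (auto intro!: SUP_emeasure_incseq[symmetric])
  also have "\<dots> = (SUP i. emeasure (density N g) (B i))"
    using eq by (simp add: fA gB)
  also have "\<dots> = (\<integral>\<^sup>+x. g x * indicator B' x \<partial>N)"
    using assms by (subst gB) (auto intro!: SUP_emeasure_incseq)
  finally show ?thesis .
qed

lemma nn_integral_half_line_inverse:
  assumes [measurable]: "f \<in> borel_measurable borel"
  shows "(\<integral>\<^sup>+x. f x \<partial>half_line) = (\<integral>\<^sup>+x. ennreal (1 / x\<^sup>2) * f (1 / x) \<partial>half_line)"
proof -
  \<comment> \<open>The map -1/x is increasing from the negative to the positive half line, whereas
    1/x is decreasing and would not suit the substitution rule; the reflection is undone
    afterwards.\<close>
  have "(\<integral>\<^sup>+x. f x * indicator {0<..} x \<partial>lborel) = (\<integral>\<^sup>+x. (f (- 1 / x) * ennreal (1 / x\<^sup>2)) * indicator {..<0} x \<partial>lborel)"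
  proof (rule nn_integral_incseq_cong[where A="\<lambda>i. {1 / (real i + 2)..real i + 2}" and B="\<lambda>i. {- (real i + 2)..- (1 / (real i + 2))}"])
    have mono: "1 / (real j + 2) \<le> 1 / (real i + 2)" if "i \<le> j" for i j
      using that by (intro divide_left_mono) auto
    have arch: "\<exists>i. 1 / (real i + 2) \<le> x \<and> x \<le> real i + 2" if "0 < x" for x
    proof -
      obtain i :: nat where i: "max x (1 / x) \<le> real i" using real_arch_simple by blast
      then have "1 / x \<le> real i + 2" "x \<le> real i + 2" by auto
      then have "1 / (real i + 2) \<le> x" using that by (simp add: field_simps)
      then show ?thesis using \<open>x \<le> real i + 2\<close> by blast
    qed
    have pos: "0 < 1 / (real i + 2)" for i by simp
    show "incseq (\<lambda>i. {1 / (real i + 2)..real i + 2})" "incseq (\<lambda>i. {- (real i + 2)..- (1 / (real i + 2))})"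
      using mono by (auto simp: incseq_def intro: order_trans)
    show "(\<Union>i. {1 / (real i + 2)..real i + 2}) = {0<..}"
      using arch by (auto intro: less_le_trans[OF pos])
    show "(\<Union>i. {- (real i + 2)..- (1 / (real i + 2))}) = {..<0}"
    proof (intro set_eqI iffI)
      fix x assume "x \<in> (\<Union>i. {- (real i + 2)..- (1 / (real i + 2))})"
      then show "x \<in> {..<0}" using pos by (auto intro: le_less_trans simp del: divide_less_0_iff zero_less_divide_iff)
    next
      fix x :: real assume "x \<in> {..<0}"
      then obtain i where "1 / (real i + 2) \<le> - x \<and> - x \<le> real i + 2" using arch[of "- x"] by auto
      then have "x \<in> {- (real i + 2)..- (1 / (real i + 2))}" by auto
      then show "x \<in> (\<Union>i. {- (real i + 2)..- (1 / (real i + 2))})" by blast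
    qed
    fix i :: nat
    define K where "K = real i + 2"
    have K: "2 \<le> K" by (simp add: K_def)
    have "1 / K \<le> 1 / 2" using K by (intro divide_left_mono) auto
    then have lt: "- K < - (1 / K)" using K by linarith
    have neg: "x < 0" if "x \<in> {- K..- (1 / K)}" for x
      using that K by (auto intro: le_less_trans)
    have e: "- 1 / (- K) = 1 / K" "- 1 / (- (1 / K)) = K" using K by simp_all
    have sub: "(\<integral>\<^sup>+x. f x * indicator {- 1 / (- K)..- 1 / (- (1 / K))} x \<partial>lborel)
        = (\<integral>\<^sup>+x. f (- 1 / x) * ennreal (1 / x\<^sup>2) * indicator {- K..- (1 / K)} x \<partial>lborel)"
    proof (rule nn_integral_substitution_aux[where g="\<lambda>x. - 1 / x"])
      show "((\<lambda>x. - 1 / x) has_real_derivative 1 / x\<^sup>2) (at x)" if "x \<in> {- K..- (1 / K)}" for x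
        using neg[OF that] by (auto intro!: derivative_eq_intros simp: power2_eq_square)
      show "continuous_on {- K..- (1 / K)} (\<lambda>x. 1 / x\<^sup>2)"
        using neg by (force intro!: continuous_intros)
    qed (use lt in auto)
    show "(\<integral>\<^sup>+x. f x * indicator {1 / (real i + 2)..real i + 2} x \<partial>lborel)
       = (\<integral>\<^sup>+x. (f (- 1 / x) * ennreal (1 / x\<^sup>2)) * indicator {- (real i + 2)..- (1 / (real i + 2))} x \<partial>lborel)"
      using sub unfolding e unfolding K_def .
  qed auto
  also have "\<dots> = (\<integral>\<^sup>+x. ennreal (1 / x\<^sup>2) * f (1 / x) * indicator {0<..} x \<partial>lborel)"
    by (subst nn_integral_real_affine[where c="-1" and t=0]) (auto intro!: nn_integral_cong simp: indicator_def mult.commute)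
  finally show ?thesis by (simp add: nn_integral_half_line)
qed

definition swap12 :: "real^3 \<Rightarrow> real^3" where "swap12 z = vector [z$2, z$1, z$3]"
definition swap23 :: "real^3 \<Rightarrow> real^3" where "swap23 z = vector [z$1, z$3, z$2]"

lemma nn_integral_swap:
  assumes [measurable]: "f \<in> borel_measurable borel"
  shows "(\<integral>\<^sup>+x. f (swap12 x) \<partial>lborel) = (\<integral>\<^sup>+x. f x \<partial>lborel)"
    "(\<integral>\<^sup>+x. f (swap23 x) \<partial>lborel) = (\<integral>\<^sup>+x. f x \<partial>lborel)"
proof -
  let ?A = "vector [vector [0, 1, 0], vector [1, 0, 0], vector [0, 0, 1]] :: real^3^3"
  let ?B = "vector [vector [1, 0, 0], vector [0, 0, 1], vector [0, 1, 0]] :: real^3^3"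
  have "?A *v x = swap12 x" "?B *v x = swap23 x" for x
    by (simp_all add: swap12_def swap23_def vec_eq_iff forall_3 matrix_vector_mult_def sum_3)
  moreover have "det ?A = -1" "det ?B = -1"
    by (simp_all add: det_3)
  ultimately show "(\<integral>\<^sup>+x. f (swap12 x) \<partial>lborel) = (\<integral>\<^sup>+x. f x \<partial>lborel)"
    "(\<integral>\<^sup>+x. f (swap23 x) \<partial>lborel) = (\<integral>\<^sup>+x. f x \<partial>lborel)"
    using nn_integral_lborel_linear[of ?A f] nn_integral_lborel_linear[of ?B f] by simp_all
qed

lemma measurable_swap [measurable (raw)]:
  assumes [measurable]: "f \<in> borel_measurable M"
  shows "(\<lambda>x. swap12 (f x)) \<in> borel_measurable M" "(\<lambda>x. swap23 (f x)) \<in> borel_measurable M"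
  unfolding swap12_def swap23_def by measurable

lemma row_density_swap:
  "row_density (t \<bullet> swap12 z) t = row_density (swap12 t \<bullet> z) (swap12 t)"
  "row_density (t \<bullet> swap23 z) t = row_density (swap23 t \<bullet> z) (swap23 t)"
  "row_density r (swap12 t) = row_density r t" "row_density r (swap23 t) = row_density r t"
  "t \<bullet> swap12 z = swap12 t \<bullet> z" "t \<bullet> swap23 z = swap23 t \<bullet> z"
  by (auto simp: row_density_def swap12_def swap23_def csum_def inner_vec_def sum_3 algebra_simps)

lemma abs_triple_swap:
  "\<bar>triple (swap12 x) (swap12 y) (swap12 z)\<bar> = \<bar>triple x y z\<bar>"
  "\<bar>triple (swap23 x) (swap23 y) (swap23 z)\<bar> = \<bar>triple x y z\<bar>"
proof -
  have "triple (swap12 x) (swap12 y) (swap12 z) = - triple x y z" "triple (swap23 x) (swap23 y) (swap23 z) = - triple x y z"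
    by (simp_all add: triple_def swap12_def swap23_def algebra_simps)
  then show "\<bar>triple (swap12 x) (swap12 y) (swap12 z)\<bar> = \<bar>triple x y z\<bar>"
    "\<bar>triple (swap23 x) (swap23 y) (swap23 z)\<bar> = \<bar>triple x y z\<bar>" by simp_all
qed

lemma plane_moment_eq_iterated:
  "plane_moment n z = (\<integral>\<^sup>+t1. ennreal (row_density (t1 \<bullet> z) t1) * (\<integral>\<^sup>+t2. ennreal (row_density (t2 \<bullet> z) t2) *
     (\<integral>\<^sup>+t3. ennreal (row_density (t3 \<bullet> z) t3) * ennreal (\<bar>triple t1 t2 t3\<bar> ^ n) \<partial>lborel) \<partial>lborel) \<partial>lborel)"
  unfolding plane_moment_def by (simp add: nn_integral_cmult)

text \<open>Permuting the coordinates of z amounts to permuting those of every row, which preserves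
  the density and changes the triple product at most in sign.\<close>

lemma plane_moment_swap:
  "plane_moment n (swap12 z) = plane_moment n z" "plane_moment n (swap23 z) = plane_moment n z"
proof -
  define V where "V = (\<lambda>x y z. ennreal (\<bar>triple x y z\<bar> ^ n))"
  have Vs: "V x y z = V (swap12 x) (swap12 y) (swap12 z)" "V x y z = V (swap23 x) (swap23 y) (swap23 z)" for x y z
    by (simp_all add: V_def abs_triple_swap)
  have [measurable]: "(\<lambda>q. V (f1 q) (f2 q) (f3 q)) \<in> borel_measurable M"
    if [measurable]: "f1 \<in> borel_measurable M" "f2 \<in> borel_measurable M" "f3 \<in> borel_measurable M"
    for f1 f2 f3 and M :: "'z measure"
    unfolding V_def by measurable
  let ?w = "\<lambda>t. ennreal (row_density (t \<bullet> z) t)"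
  define G3 where "G3 = (\<lambda>t1 t2. \<integral>\<^sup>+t3. ?w t3 * V t1 t2 t3 \<partial>lborel)"
  have [measurable]: "(\<lambda>q. G3 (f1 q) (f2 q)) \<in> borel_measurable M"
    if [measurable]: "f1 \<in> borel_measurable M" "f2 \<in> borel_measurable M" for f1 f2 and M :: "'z measure"
    unfolding G3_def by measurable
  define G2 where "G2 = (\<lambda>t1. \<integral>\<^sup>+t2. ?w t2 * G3 t1 t2 \<partial>lborel)"
  have [measurable]: "(\<lambda>q. G2 (f1 q)) \<in> borel_measurable M"
    if [measurable]: "f1 \<in> borel_measurable M" for f1 and M :: "'z measure"
    unfolding G2_def by measurable
  have z: "plane_moment n z = (\<integral>\<^sup>+t1. ?w t1 * G2 t1 \<partial>lborel)"
    unfolding plane_moment_eq_iterated G2_def G3_def V_def ..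
  have m3: "(\<lambda>t3. ?w t3 * V t1 t2 t3) \<in> borel_measurable borel" for t1 t2 by measurable
  have m2: "(\<lambda>t2. ?w t2 * G3 t1 t2) \<in> borel_measurable borel" for t1 by measurable
  have m1: "(\<lambda>t1. ?w t1 * G2 t1) \<in> borel_measurable borel" by measurable
  have i3: "(\<integral>\<^sup>+t3. ?w (swap12 t3) * V (swap12 t1) (swap12 t2) (swap12 t3) \<partial>lborel) = G3 (swap12 t1) (swap12 t2)" for t1 t2
    using nn_integral_swap(1)[OF m3[of "swap12 t1" "swap12 t2"]] by (simp add: G3_def)
  have i2: "(\<integral>\<^sup>+t2. ?w (swap12 t2) * G3 (swap12 t1) (swap12 t2) \<partial>lborel) = G2 (swap12 t1)" for t1
    using nn_integral_swap(1)[OF m2[of "swap12 t1"]] by (simp add: G2_def)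
  have "plane_moment n (swap12 z) = (\<integral>\<^sup>+t1. ?w (swap12 t1) * (\<integral>\<^sup>+t2. ?w (swap12 t2) *
     (\<integral>\<^sup>+t3. ?w (swap12 t3) * V (swap12 t1) (swap12 t2) (swap12 t3) \<partial>lborel) \<partial>lborel) \<partial>lborel)"
    unfolding plane_moment_eq_iterated row_density_swap(1) V_def by (simp add: abs_triple_swap)
  also have "\<dots> = (\<integral>\<^sup>+t1. ?w t1 * G2 t1 \<partial>lborel)"
    unfolding i3 i2 by (rule nn_integral_swap(1)[OF m1])
  finally show "plane_moment n (swap12 z) = plane_moment n z" unfolding z .
  have i3: "(\<integral>\<^sup>+t3. ?w (swap23 t3) * V (swap23 t1) (swap23 t2) (swap23 t3) \<partial>lborel) = G3 (swap23 t1) (swap23 t2)" for t1 t2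
    using nn_integral_swap(2)[OF m3[of "swap23 t1" "swap23 t2"]] by (simp add: G3_def)
  have i2: "(\<integral>\<^sup>+t2. ?w (swap23 t2) * G3 (swap23 t1) (swap23 t2) \<partial>lborel) = G2 (swap23 t1)" for t1
    using nn_integral_swap(2)[OF m2[of "swap23 t1"]] by (simp add: G2_def)
  have "plane_moment n (swap23 z) = (\<integral>\<^sup>+t1. ?w (swap23 t1) * (\<integral>\<^sup>+t2. ?w (swap23 t2) *
     (\<integral>\<^sup>+t3. ?w (swap23 t3) * V (swap23 t1) (swap23 t2) (swap23 t3) \<partial>lborel) \<partial>lborel) \<partial>lborel)"
    unfolding plane_moment_eq_iterated row_density_swap(2) V_def by (simp add: abs_triple_swap)
  also have "\<dots> = (\<integral>\<^sup>+t1. ?w t1 * G2 t1 \<partial>lborel)"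
    unfolding i3 i2 by (rule nn_integral_swap(2)[OF m1])
  finally show "plane_moment n (swap23 z) = plane_moment n z" unfolding z .
qed

lemma distance_moment_swap:
  "distance_moment k (swap12 z) = distance_moment k z" "distance_moment k (swap23 z) = distance_moment k z"
proof -
  define G where "G = (\<lambda>t. \<integral>\<^sup>+r. ennreal (row_density r t) * ennreal (\<bar>r - t \<bullet> z\<bar> ^ k) \<partial>lborel)"
  have G: "G \<in> borel_measurable borel" unfolding G_def by measurable
  have "distance_moment k (swap12 z) = (\<integral>\<^sup>+t. G (swap12 t) \<partial>lborel)" "distance_moment k (swap23 z) = (\<integral>\<^sup>+t. G (swap23 t) \<partial>lborel)"
    unfolding distance_moment_def G_def row_density_swap by simp_all
  then show "distance_moment k (swap12 z) = distance_moment k z" "distance_moment k (swap23 z) = distance_moment k z"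
    unfolding nn_integral_swap[OF G] by (simp_all add: distance_moment_def G_def)
qed

text \<open>With all coefficients negative, t . z is negative for nonzero t in the positive orthant,
  so the hyperplane meets the closed orthant of rows only at the origin.\<close>

lemma plane_moment_mmm:
  assumes "0 < a" "0 < b" "0 < c"
  shows "plane_moment n (vector [-a, -b, -c]) = 0"
proof -
  have "AE t in (lborel :: (real^3) measure). 1 * t$1 + 0 * t$2 + 0 * t$3 \<noteq> 0"
    by (rule AE_hyperplane_3) simp
  then have "AE t in (lborel :: (real^3) measure). row_density (t \<bullet> vector [-a, -b, -c]) t = 0"
  proof eventually_elim
    fix t :: "real^3" assume t: "1 * t$1 + 0 * t$2 + 0 * t$3 \<noteq> 0"
    have "t \<bullet> vector [-a, -b, -c] = - (a * t$1 + b * t$2 + c * t$3)"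
      by (simp add: inner_vec_def sum_3 algebra_simps)
    moreover have "0 < a * t$1 + b * t$2 + c * t$3" if "0 \<le> t$1" "0 \<le> t$2" "0 \<le> t$3"
      using that t assms by (intro add_pos_nonneg mult_pos_pos mult_nonneg_nonneg) auto
    ultimately show "row_density (t \<bullet> vector [-a, -b, -c]) t = 0"
      by (auto simp: row_density_def)
  qed
  then have "plane_moment n (vector [-a, -b, -c]) = (\<integral>\<^sup>+t. 0 \<partial>(lborel :: (real^3) measure))"
    unfolding plane_moment_eq_iterated by (intro nn_integral_cong_AE) (auto elim: eventually_mono)
  then show ?thesis by simp
qed

text \<open>Up to a global sign, the normal of the hyperplane separates the four coordinates as \<open>1 + 3\<close> (four ways)
  or as \<open>2 + 2\<close> (three ways).\<close>

lemma nn_integral_hyperplanes_octants: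
  fixes n k :: nat
  defines "H \<equiv> \<lambda>a b c. plane_moment n (vector [a, b, c]) * distance_moment k (vector [a, b, c])"
  shows "(\<integral>\<^sup>+z. plane_moment n z * distance_moment k z \<partial>lborel) =
      (\<integral>\<^sup>+a. \<integral>\<^sup>+b. \<integral>\<^sup>+c. H a b c \<partial>half_line \<partial>half_line \<partial>half_line) +
      3 * (\<integral>\<^sup>+a. \<integral>\<^sup>+b. \<integral>\<^sup>+c. H (- a) (- b) c \<partial>half_line \<partial>half_line \<partial>half_line) +
      3 * (\<integral>\<^sup>+a. \<integral>\<^sup>+b. \<integral>\<^sup>+c. H (- a) b c \<partial>half_line \<partial>half_line \<partial>half_line)"
proof -
  have [measurable]: "(\<lambda>x. H (f x) (g x) (h x)) \<in> borel_measurable M"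
    if [measurable]: "f \<in> borel_measurable M" "g \<in> borel_measurable M" "h \<in> borel_measurable M"
    for f g h and M :: "'z measure"
    unfolding H_def by measurable
  have s: "H b a c = H a b c" "H a c b = H a b c" for a b c
    using plane_moment_swap(1)[of n "vector [a, b, c]"] distance_moment_swap(1)[of k "vector [a, b, c]"]
      plane_moment_swap(2)[of n "vector [a, b, c]"] distance_moment_swap(2)[of k "vector [a, b, c]"]
    by (simp_all add: H_def swap12_def swap23_def)
  define I where "I = (\<lambda>f :: real \<Rightarrow> real \<Rightarrow> real \<Rightarrow> ennreal. \<integral>\<^sup>+a. \<integral>\<^sup>+b. \<integral>\<^sup>+c. f a b c \<partial>half_line \<partial>half_line \<partial>half_line)"
  let ?L = half_line
  have "(\<integral>\<^sup>+z. plane_moment n z * distance_moment k z \<partial>lborel) = (\<integral>\<^sup>+a. \<integral>\<^sup>+b. \<integral>\<^sup>+c. H a b c \<partial>lborel \<partial>lborel \<partial>lborel)"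
    by (subst nn_integral_lborel_vec3) (simp_all add: H_def)
  also have "\<dots> = (\<integral>\<^sup>+a. \<integral>\<^sup>+b. (\<integral>\<^sup>+c. H a b c \<partial>?L) + (\<integral>\<^sup>+c. H a b (- c) \<partial>?L) \<partial>lborel \<partial>lborel)"
  proof -
    have "(\<integral>\<^sup>+c. H a b c \<partial>lborel) = (\<integral>\<^sup>+c. H a b c \<partial>?L) + (\<integral>\<^sup>+c. H a b (- c) \<partial>?L)" for a b
      by (rule nn_integral_half_line_split) measurable
    then show ?thesis by simp
  qed
  also have "\<dots> = (\<integral>\<^sup>+a. ((\<integral>\<^sup>+b. (\<integral>\<^sup>+c. H a b c \<partial>?L) + (\<integral>\<^sup>+c. H a b (- c) \<partial>?L) \<partial>?L) +
       (\<integral>\<^sup>+b. (\<integral>\<^sup>+c. H a (- b) c \<partial>?L) + (\<integral>\<^sup>+c. H a (- b) (- c) \<partial>?L) \<partial>?L)) \<partial>lborel)"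
    by (rule nn_integral_cong, rule nn_integral_half_line_split) measurable
  also have "\<dots> = (\<integral>\<^sup>+a. ((\<integral>\<^sup>+b. (\<integral>\<^sup>+c. H a b c \<partial>?L) + (\<integral>\<^sup>+c. H a b (- c) \<partial>?L) \<partial>?L) +
       (\<integral>\<^sup>+b. (\<integral>\<^sup>+c. H a (- b) c \<partial>?L) + (\<integral>\<^sup>+c. H a (- b) (- c) \<partial>?L) \<partial>?L)) \<partial>?L) +
     (\<integral>\<^sup>+a. ((\<integral>\<^sup>+b. (\<integral>\<^sup>+c. H (- a) b c \<partial>?L) + (\<integral>\<^sup>+c. H (- a) b (- c) \<partial>?L) \<partial>?L) +
       (\<integral>\<^sup>+b. (\<integral>\<^sup>+c. H (- a) (- b) c \<partial>?L) + (\<integral>\<^sup>+c. H (- a) (- b) (- c) \<partial>?L) \<partial>?L)) \<partial>?L)"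
    by (rule nn_integral_half_line_split) measurable
  \<comment> \<open>Of these eight octants, those with equally many minus signs agree by permuting
    coordinates, and the one with three minus signs contributes nothing.\<close>
  also have "\<dots> = I (\<lambda>a b c. H a b c) + I (\<lambda>a b c. H a b (- c)) + I (\<lambda>a b c. H a (- b) c) + I (\<lambda>a b c. H a (- b) (- c)) +
      I (\<lambda>a b c. H (- a) b c) + I (\<lambda>a b c. H (- a) b (- c)) + I (\<lambda>a b c. H (- a) (- b) c) + I (\<lambda>a b c. H (- a) (- b) (- c))"
    unfolding I_def by (simp add: nn_integral_add add.assoc)
  also have "I (\<lambda>a b c. H a b (- c)) = (\<integral>\<^sup>+a. \<integral>\<^sup>+b. \<integral>\<^sup>+c. H (- c) a b \<partial>?L \<partial>?L \<partial>?L)"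
  proof -
    have "H a b (- c) = H (- c) a b" for a b c
      using s(2)[of a "- c" b] s(1)[of "- c" a b] by simp
    then show ?thesis unfolding I_def by simp
  qed
  also have "\<dots> = (\<integral>\<^sup>+a. \<integral>\<^sup>+c. \<integral>\<^sup>+b. H (- c) a b \<partial>?L \<partial>?L \<partial>?L)"
    by (rule nn_integral_cong, rule half_pair.Fubini') measurable
  also have "\<dots> = (\<integral>\<^sup>+c. \<integral>\<^sup>+a. \<integral>\<^sup>+b. H (- c) a b \<partial>?L \<partial>?L \<partial>?L)"
    by (rule half_pair.Fubini') measurable
  also have "\<dots> = I (\<lambda>a b c. H (- a) b c)"
    unfolding I_def ..
  also have "I (\<lambda>a b c. H a (- b) c) = (\<integral>\<^sup>+a. \<integral>\<^sup>+b. \<integral>\<^sup>+c. H (- b) a c \<partial>?L \<partial>?L \<partial>?L)"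
    unfolding I_def by (subst s(1)) (rule refl)
  also have "\<dots> = I (\<lambda>a b c. H (- a) b c)"
    unfolding I_def by (rule half_pair.Fubini') measurable
  also have "I (\<lambda>a b c. H a (- b) (- c)) = (\<integral>\<^sup>+a. \<integral>\<^sup>+b. \<integral>\<^sup>+c. H (- b) (- c) a \<partial>?L \<partial>?L \<partial>?L)"
  proof -
    have "H a (- b) (- c) = H (- b) (- c) a" for a b c
      using s(1)[of a "- b" "- c"] s(2)[of "- b" "- c" a] by simp
    then show ?thesis unfolding I_def by simp
  qed
  also have "\<dots> = (\<integral>\<^sup>+b. \<integral>\<^sup>+a. \<integral>\<^sup>+c. H (- b) (- c) a \<partial>?L \<partial>?L \<partial>?L)"
    by (rule half_pair.Fubini') measurable
  also have "\<dots> = (\<integral>\<^sup>+b. \<integral>\<^sup>+c. \<integral>\<^sup>+a. H (- b) (- c) a \<partial>?L \<partial>?L \<partial>?L)"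
    by (rule nn_integral_cong, rule half_pair.Fubini') measurable
  also have "\<dots> = I (\<lambda>a b c. H (- a) (- b) c)"
    unfolding I_def ..
  also have "I (\<lambda>a b c. H (- a) b (- c)) = (\<integral>\<^sup>+a. \<integral>\<^sup>+b. \<integral>\<^sup>+c. H (- a) (- c) b \<partial>?L \<partial>?L \<partial>?L)"
    unfolding I_def by (subst s(2)) (rule refl)
  also have "\<dots> = I (\<lambda>a b c. H (- a) (- b) c)"
    unfolding I_def by (rule nn_integral_cong, rule half_pair.Fubini') measurable
  also have "I (\<lambda>a b c. H (- a) (- b) (- c)) = I (\<lambda>_ _ _. 0)"
    unfolding I_def by (intro nn_integral_half_line_cong) (simp add: H_def plane_moment_mmm)
  also have "\<dots> = 0" by (simp add: I_def)
  finally have eq: "(\<integral>\<^sup>+z. plane_moment n z * distance_moment k z \<partial>lborel) = I (\<lambda>a b c. H a b c) + I (\<lambda>a b c. H (- a) b c) +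
     I (\<lambda>a b c. H (- a) b c) + I (\<lambda>a b c. H (- a) (- b) c) + I (\<lambda>a b c. H (- a) b c) + I (\<lambda>a b c. H (- a) (- b) c) +
     I (\<lambda>a b c. H (- a) (- b) c) + 0" .
  have "(3::ennreal) = 1 + 1 + 1" by simp
  then have three: "3 * x = x + x + x" for x :: ennreal by (simp only: distrib_right mult_1)
  have "(\<integral>\<^sup>+z. plane_moment n z * distance_moment k z \<partial>lborel) = I (\<lambda>a b c. H a b c) +
      3 * I (\<lambda>a b c. H (- a) (- b) c) + 3 * I (\<lambda>a b c. H (- a) b c)"
    unfolding three eq add_0_right by (simp only: add.assoc add.commute add.left_commute)
  then show ?thesis unfolding I_def .
qed

section \<open>The contribution of the triangular sections\<close>

lemma has_bochner_integral_half_line_inverse_power: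
  "has_bochner_integral half_line (\<lambda>x. 1 / (1 + x) ^ (s + 2)) (1 / (real s + 1))"
proof (rule has_bochner_integral_nn_integral)
  have "(\<integral>\<^sup>+x. ennreal (1 / (1 + x) ^ (s + 2)) \<partial>half_line) = (\<integral>\<^sup>+x. ennreal (1 / (1 + x) ^ (s + 2)) * indicator {0..} x \<partial>lborel)"
    by (subst nn_integral_half_line, measurable, rule nn_integral_cong_AE, use AE_lborel_singleton[of "0::real"] in eventually_elim)
      (auto simp: indicator_def)
  also have "\<dots> = ennreal (0 - (- (1 / ((real s + 1) * (1 + 0) ^ (s + 1)))))"
  proof (rule nn_integral_FTC_atLeast[where F="\<lambda>x. - (1 / ((real s + 1) * (1 + x) ^ (s + 1)))"])
    fix x :: real assume x: "0 \<le> x"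
    have "((\<lambda>x. inverse (1 + x)) has_real_derivative - ((inverse (1 + x))\<^sup>2)) (at x)"
      using x by (auto intro!: derivative_eq_intros simp: power2_eq_square)
    from DERIV_cmult[OF DERIV_power[OF this, of "s + 1"], of "- 1 / (real s + 1)"]
    have "((\<lambda>x. - 1 / (real s + 1) * inverse (1 + x) ^ (s + 1)) has_real_derivative inverse (1 + x) ^ (s + 2)) (at x)"
      by (rule DERIV_cong) (simp add: power_add power2_eq_square add.commute)
    then show "((\<lambda>x. - (1 / ((real s + 1) * (1 + x) ^ (s + 1)))) has_real_derivative 1 / (1 + x) ^ (s + 2)) (at x)"
      by (simp add: field_simps power_inverse)
    show "0 \<le> 1 / (1 + x) ^ (s + 2)" using x by simp
  next
    have "filterlim (\<lambda>x::real. 1 + x) at_top at_top"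
      by (intro filterlim_tendsto_add_at_top[OF tendsto_const] filterlim_ident)
    then have "filterlim (\<lambda>x::real. (1 + x) ^ (s + 1)) at_top at_top"
      by (intro filterlim_pow_at_top) auto
    then have "filterlim (\<lambda>x::real. (real s + 1) * (1 + x) ^ (s + 1)) at_top at_top"
      by (intro filterlim_tendsto_pos_mult_at_top[OF tendsto_const]) auto
    then have "((\<lambda>x::real. 1 / ((real s + 1) * (1 + x) ^ (s + 1))) \<longlongrightarrow> 0) at_top"
      by (intro real_tendsto_divide_at_top[OF tendsto_const])
    then show "((\<lambda>x::real. - (1 / ((real s + 1) * (1 + x) ^ (s + 1)))) \<longlongrightarrow> 0) at_top"
      using tendsto_minus by fastforce
  qed auto
  finally show "(\<integral>\<^sup>+x. ennreal (1 / (1 + x) ^ (s + 2)) \<partial>half_line) = ennreal (1 / (real s + 1))"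
    by simp
qed (use AE_half_line in \<open>auto elim: eventually_mono\<close>)

text \<open>For i + 2 \<le> m this is the Beta integral B(i+1, m-i-1), in the form obtained by
  writing x^i as ((1+x) - 1)^i.\<close>

definition beta_mom :: "nat \<Rightarrow> nat \<Rightarrow> real" where
  "beta_mom m i = (\<Sum>j\<le>i. real (i choose j) * (-1) ^ (i - j) / (real (m - j) - 1))"

lemma has_bochner_integral_beta_mom:
  assumes "i + 2 \<le> m"
  shows "has_bochner_integral half_line (\<lambda>x. x ^ i / (1 + x) ^ m) (beta_mom m i)"
proof -
  have "has_bochner_integral half_line (\<lambda>x. \<Sum>j\<le>i. (real (i choose j) * (-1) ^ (i - j)) * (1 / (1 + x) ^ (m - j)))
     (\<Sum>j\<le>i. (real (i choose j) * (-1) ^ (i - j)) * (1 / (real (m - j) - 1)))"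
  proof (intro has_bochner_integral_sum has_bochner_integral_mult_right)
    fix j assume "j \<in> {..i}"
    then have "m - j = (m - j - 2) + 2" using assms by auto
    moreover have "real (m - j) - 1 = real (m - j - 2) + 1"
      using \<open>j \<in> {..i}\<close> assms by (simp add: of_nat_diff)
    ultimately show "has_bochner_integral half_line (\<lambda>x. 1 / (1 + x) ^ (m - j)) (1 / (real (m - j) - 1))"
      using has_bochner_integral_half_line_inverse_power[of "m - j - 2"] by simp
  qed
  then have "has_bochner_integral half_line (\<lambda>x. \<Sum>j\<le>i. (real (i choose j) * (-1) ^ (i - j)) * (1 / (1 + x) ^ (m - j))) (beta_mom m i)"
    by (simp add: beta_mom_def)
  then show ?thesis
  proof (rule has_bochner_integralI_AE)
    show "AE x in half_line. (\<Sum>j\<le>i. (real (i choose j) * (-1) ^ (i - j)) * (1 / (1 + x) ^ (m - j))) = x ^ i / (1 + x) ^ m"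
      using AE_half_line
    proof eventually_elim
      fix x :: real assume x: "0 < x"
      have "x ^ i = ((1 + x) - 1) ^ i" by simp
      also have "\<dots> = (\<Sum>j\<le>i. real (i choose j) * (1 + x) ^ j * ((-1) ^ (i - j) * 1 ^ (i - j)))"
        by (rule diff_power_binomial)
      finally have "x ^ i / (1 + x) ^ m = (\<Sum>j\<le>i. real (i choose j) * (1 + x) ^ j * ((-1) ^ (i - j) * 1 ^ (i - j)) / (1 + x) ^ m)"
        by (simp add: sum_divide_distrib)
      also have "\<dots> = (\<Sum>j\<le>i. (real (i choose j) * (-1) ^ (i - j)) * (1 / (1 + x) ^ (m - j)))"
      proof (intro sum.cong refl)
        fix j assume "j \<in> {..i}"
        then have "(1 + x) ^ m = (1 + x) ^ (m - j) * (1 + x) ^ j"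
          using assms by (simp flip: power_add)
        then show "real (i choose j) * (1 + x) ^ j * ((-1) ^ (i - j) * 1 ^ (i - j)) / (1 + x) ^ m
           = (real (i choose j) * (-1) ^ (i - j)) * (1 / (1 + x) ^ (m - j))"
          using x by simp
      qed
      finally show "(\<Sum>j\<le>i. (real (i choose j) * (-1) ^ (i - j)) * (1 / (1 + x) ^ (m - j))) = x ^ i / (1 + x) ^ m" ..
    qed
  qed measurable
qed

lemma nn_integral_half_line_triple:
  assumes hb: "has_bochner_integral (half_line \<Otimes>\<^sub>M (half_line \<Otimes>\<^sub>M half_line)) (\<lambda>(a, b, c). f a b c) v"
    and fm: "(\<lambda>(a, b, c). f a b c) \<in> borel_measurable borel"
    and nonneg: "\<And>a b c. 0 < a \<Longrightarrow> 0 < b \<Longrightarrow> 0 < c \<Longrightarrow> 0 \<le> f a b c"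
  shows "(\<integral>\<^sup>+a. \<integral>\<^sup>+b. \<integral>\<^sup>+c. ennreal (f a b c) \<partial>half_line \<partial>half_line \<partial>half_line) = ennreal v" and "0 \<le> v"
proof -
  interpret P: pair_sigma_finite half_line "half_line \<Otimes>\<^sub>M half_line"
    by (intro pair_sigma_finite.intro sigma_finite_pair_measure' sigma_finite_half_line)
  let ?P = "half_line \<Otimes>\<^sub>M (half_line \<Otimes>\<^sub>M half_line)"
  have sets: "sets ?P = sets borel"
  proof -
    have "sets ?P = sets (borel \<Otimes>\<^sub>M (borel \<Otimes>\<^sub>M borel))"
      by (intro sets_pair_measure_cong) auto
    then show ?thesis unfolding borel_prod .
  qed
  have AE2: "AE q in half_line \<Otimes>\<^sub>M half_line. 0 < fst q \<and> 0 < snd q"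
  proof (rule half_pair.AE_pair_measure)
    show "AE x in half_line. AE y in half_line. 0 < fst (x, y) \<and> 0 < snd (x, y)"
      using AE_half_line by eventually_elim (use AE_half_line in \<open>auto elim: eventually_mono\<close>)
  qed measurable
  have AE3: "AE q in ?P. 0 < fst q \<and> 0 < fst (snd q) \<and> 0 < snd (snd q)"
  proof (rule P.AE_pair_measure)
    show "AE x in half_line. AE y in half_line \<Otimes>\<^sub>M half_line. 0 < fst (x, y) \<and> 0 < fst (snd (x, y)) \<and> 0 < snd (snd (x, y))"
      using AE_half_line by eventually_elim (use AE2 in \<open>auto elim: eventually_mono\<close>)
  qed measurable
  have nn: "AE q in ?P. 0 \<le> (\<lambda>(a, b, c). f a b c) q"
    using AE3 by eventually_elim (auto simp: split_def intro: nonneg)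
  have m: "(\<lambda>q. ennreal ((\<lambda>(a, b, c). f a b c) q)) \<in> borel_measurable ?P"
    using fm sets by (simp cong: measurable_cong_sets)
  have "ennreal v = (\<integral>\<^sup>+q. ennreal ((\<lambda>(a, b, c). f a b c) q) \<partial>?P)"
    using hb nn by (subst nn_integral_eq_integral) (auto simp: has_bochner_integral_iff)
  also have "\<dots> = (\<integral>\<^sup>+a. \<integral>\<^sup>+q. ennreal ((\<lambda>(a, b, c). f a b c) (a, q)) \<partial>(half_line \<Otimes>\<^sub>M half_line) \<partial>half_line)"
    by (rule sigma_finite_measure.nn_integral_fst[OF sigma_finite_pair_measure'[OF sigma_finite_half_line sigma_finite_half_line] m, symmetric])
  also have "\<dots> = (\<integral>\<^sup>+a. \<integral>\<^sup>+b. \<integral>\<^sup>+c. ennreal ((\<lambda>(a, b, c). f a b c) (a, b, c)) \<partial>half_line \<partial>half_line \<partial>half_line)"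
    by (intro nn_integral_cong half_line.nn_integral_fst[symmetric] measurable_Pair2[OF m])
  finally show "(\<integral>\<^sup>+a. \<integral>\<^sup>+b. \<integral>\<^sup>+c. ennreal (f a b c) \<partial>half_line \<partial>half_line \<partial>half_line) = ennreal v" by simp
  show "0 \<le> v"
    using hb nn by (auto simp: has_bochner_integral_iff intro!: integral_nonneg_AE)
qed

text \<open>The integral over the positive octant of the distance moment times the power k+4 of
  1/((1+a)(1+b)(1+c)): the exponential term gives (k+4)^-3, and the complete symmetric polynomials
  give products of Beta integrals.\<close>

definition simplicial_value :: "nat \<Rightarrow> real" where
  "simplicial_value k = fact k * (2 / (real k + 4) ^ 3 - (\<Sum>i\<le>k. (-1) ^ i * (\<Sum>j\<le>i. \<Sum>l\<le>i-j.
     beta_mom (k + 4) j * beta_mom (k + 4) l * beta_mom (k + 4) (i-j-l))))"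

text \<open>The product of plane and distance moment is a finite combination of products of
  one-variable functions x^i / (1+x)^m, so the triple integral factorises into Beta
  integrals.\<close>

lemma nn_integral_hyperplanes_ppp:
  fixes k :: nat
  assumes "odd k"
  defines "C \<equiv> det_moment (Suc k) (\<lambda>a b c. fact a * fact b * fact c)"
  assumes "0 \<le> C"
  shows "(\<integral>\<^sup>+a. \<integral>\<^sup>+b. \<integral>\<^sup>+c. plane_moment (Suc k) (vector [a, b, c]) * distance_moment k (vector [a, b, c]) \<partial>half_line \<partial>half_line \<partial>half_line)
    = ennreal (C * simplicial_value k)" and "0 \<le> C * simplicial_value k"
proof -
  define f where "f = (\<lambda>a b c. C * (fact k * (2 * (1 / (1 + a) ^ (k + 5) * (1 / (1 + b) ^ (k + 5) * (1 / (1 + c) ^ (k + 5)))) -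
     (\<Sum>i\<le>k. (-1) ^ i * (\<Sum>j\<le>i. \<Sum>l\<le>i-j. a ^ j / (1 + a) ^ (k + 4) * (b ^ l / (1 + b) ^ (k + 4) * (c ^ (i-j-l) / (1 + c) ^ (k + 4))))))))"
  have f: "plane_moment (Suc k) (vector [a, b, c]) * distance_moment k (vector [a, b, c]) = ennreal (f a b c) \<and> 0 \<le> f a b c"
    if "0 < a" "0 < b" "0 < c" for a b c
  proof -
    define D where "D = (1 / ((1 + a) * (1 + b) * (1 + c))) ^ (k + 4)"
    define v where "v = fact k * (2 / ((1 + a) * (1 + b) * (1 + c)) - (\<Sum>i\<le>k. (-1) ^ i * complete_sum i a b c))"
    have "plane_moment (Suc k) (vector [a, b, c]) = ennreal (D * C)"
    proof -
      have e: "Suc k + 3 = k + 4" and "even (Suc k)" using \<open>odd k\<close> by auto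
      show ?thesis
        using plane_moment_ppp[OF that \<open>even (Suc k)\<close>] unfolding e D_def C_def .
    qed
    moreover have "distance_moment k (vector [a, b, c]) = ennreal v" "0 \<le> v"
      using distance_moment_ppp[of a b c k] that \<open>odd k\<close> by (auto simp: v_def)
    moreover have "0 \<le> D * C" using that \<open>0 \<le> C\<close> by (simp add: D_def)
    moreover have "D * C * v = f a b c"
    proof -
      have eq1: "D * (2 / ((1 + a) * (1 + b) * (1 + c))) = 2 * (1 / (1 + a) ^ (k + 5) * (1 / (1 + b) ^ (k + 5) * (1 / (1 + c) ^ (k + 5))))"
        by (simp add: D_def power_divide power_mult_distrib eval_nat_numeral)
      have eq2: "D * (\<Sum>i\<le>k. (-1) ^ i * complete_sum i a b c) = (\<Sum>i\<le>k. (-1) ^ i * (\<Sum>j\<le>i. \<Sum>l\<le>i-j. a ^ j / (1 + a) ^ (k + 4) * (b ^ l / (1 + b) ^ (k + 4) * (c ^ (i-j-l) / (1 + c) ^ (k + 4)))))"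
        unfolding complete_sum_def sum_distrib_left
        by (intro sum.cong refl) (simp add: D_def power_divide power_mult_distrib)
      have "D * C * v = C * (fact k * (D * (2 / ((1 + a) * (1 + b) * (1 + c))) - D * (\<Sum>i\<le>k. (-1) ^ i * complete_sum i a b c)))"
        unfolding v_def right_diff_distrib[of D, symmetric] by (simp only: ac_simps)
      then show ?thesis unfolding eq1 eq2 f_def .
    qed
    ultimately show ?thesis by (simp add: ennreal_mult[symmetric]) (metis mult_nonneg_nonneg)
  qed
  have s5: "has_bochner_integral half_line (\<lambda>x. 1 / (1 + x) ^ (k + 5)) (1 / (real k + 4))"
    using has_bochner_integral_half_line_inverse_power[of "k + 3"] by (simp add: numeral_eq_Suc add.commute)
  have "has_bochner_integral (half_line \<Otimes>\<^sub>M (half_line \<Otimes>\<^sub>M half_line)) (\<lambda>q. C * (fact k * (2 * ((\<lambda>(a, b, c). 1 / (1 + a) ^ (k + 5) * (1 / (1 + b) ^ (k + 5) * (1 / (1 + c) ^ (k + 5)))) q) -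
     (\<Sum>i\<le>k. (-1) ^ i * (\<Sum>j\<le>i. \<Sum>l\<le>i-j. (\<lambda>(a, b, c). a ^ j / (1 + a) ^ (k + 4) * (b ^ l / (1 + b) ^ (k + 4) * (c ^ (i-j-l) / (1 + c) ^ (k + 4)))) q)))))
    (C * (fact k * (2 * (1 / (real k + 4) * (1 / (real k + 4) * (1 / (real k + 4)))) -
     (\<Sum>i\<le>k. (-1) ^ i * (\<Sum>j\<le>i. \<Sum>l\<le>i-j. beta_mom (k + 4) j * (beta_mom (k + 4) l * beta_mom (k + 4) (i-j-l)))))))"
    by (intro has_bochner_integral_mult_right has_bochner_integral_diff has_bochner_integral_sum has_bochner_integral_triple_times
        sigma_finite_half_line s5 has_bochner_integral_beta_mom) auto
  also have "C * (fact k * (2 * (1 / (real k + 4) * (1 / (real k + 4) * (1 / (real k + 4)))) -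
     (\<Sum>i\<le>k. (-1) ^ i * (\<Sum>j\<le>i. \<Sum>l\<le>i-j. beta_mom (k + 4) j * (beta_mom (k + 4) l * beta_mom (k + 4) (i-j-l))))))
     = C * simplicial_value k"
    by (simp add: simplicial_value_def power3_eq_cube mult.assoc)
  also have "(\<lambda>q. C * (fact k * (2 * ((\<lambda>(a, b, c). 1 / (1 + a) ^ (k + 5) * (1 / (1 + b) ^ (k + 5) * (1 / (1 + c) ^ (k + 5)))) q) -
     (\<Sum>i\<le>k. (-1) ^ i * (\<Sum>j\<le>i. \<Sum>l\<le>i-j. (\<lambda>(a, b, c). a ^ j / (1 + a) ^ (k + 4) * (b ^ l / (1 + b) ^ (k + 4) * (c ^ (i-j-l) / (1 + c) ^ (k + 4)))) q)))))
     = (\<lambda>(a, b, c). f a b c)"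
    by (simp add: f_def split_def)
  finally have hb: "has_bochner_integral (half_line \<Otimes>\<^sub>M (half_line \<Otimes>\<^sub>M half_line)) (\<lambda>(a, b, c). f a b c) (C * simplicial_value k)" .
  have fm: "(\<lambda>(a, b, c). f a b c) \<in> borel_measurable borel"
    unfolding f_def split_def borel_prod[symmetric] by measurable
  note t = nn_integral_half_line_triple[OF hb fm]
  show "0 \<le> C * simplicial_value k" using t(2) f by blast
  have "(\<integral>\<^sup>+a. \<integral>\<^sup>+b. \<integral>\<^sup>+c. plane_moment (Suc k) (vector [a, b, c]) * distance_moment k (vector [a, b, c]) \<partial>half_line \<partial>half_line \<partial>half_line)
     = (\<integral>\<^sup>+a. \<integral>\<^sup>+b. \<integral>\<^sup>+c. ennreal (f a b c) \<partial>half_line \<partial>half_line \<partial>half_line)"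
    by (intro nn_integral_half_line_cong) (simp add: f)
  also have "\<dots> = ennreal (C * simplicial_value k)"
    using t(1) f by blast
  finally show "(\<integral>\<^sup>+a. \<integral>\<^sup>+b. \<integral>\<^sup>+c. plane_moment (Suc k) (vector [a, b, c]) * distance_moment k (vector [a, b, c]) \<partial>half_line \<partial>half_line \<partial>half_line)
    = ennreal (C * simplicial_value k)" .
qed

text \<open>Up to sign the form r + a x + b y - c w is c times a form of the all-positive type in
  which w has taken the place of r.\<close>

lemma distance_moment_mmp:
  assumes "0 < c"
  shows "distance_moment k (vector [-a, -b, c]) = ennreal (c ^ k) * distance_moment k (vector [a / c, b / c, 1 / c])"
proof -
  have "distance_moment k (vector [-a, -b, c]) = (\<integral>\<^sup>+x. \<integral>\<^sup>+y. \<integral>\<^sup>+r. \<integral>\<^sup>+w. ennreal (\<bar>r - (- a * x + - b * y + c * w)\<bar> ^ k) \<partial>exp_law \<partial>exp_law \<partial>exp_law \<partial>exp_law)"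
    unfolding distance_moment_exp_law by (rule nn_integral_cong, rule nn_integral_cong, rule exp_pair.Fubini') measurable
  also have "\<dots> = (\<integral>\<^sup>+x. \<integral>\<^sup>+y. \<integral>\<^sup>+r. \<integral>\<^sup>+w. ennreal (c ^ k) * ennreal (\<bar>w - (a / c * x + b / c * y + 1 / c * r)\<bar> ^ k) \<partial>exp_law \<partial>exp_law \<partial>exp_law \<partial>exp_law)"
  proof -
    have "\<bar>r - (- a * x + - b * y + c * w)\<bar> = c * \<bar>w - (a / c * x + b / c * y + 1 / c * r)\<bar>" for r x y w
    proof -
      have "r - (- a * x + - b * y + c * w) = - (c * (w - (a / c * x + b / c * y + 1 / c * r)))"
        using assms by (simp add: field_simps)
      then show ?thesis using assms by (simp add: abs_mult)
    qed
    then show ?thesis using assms by (simp add: power_mult_distrib ennreal_mult)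
  qed
  also have "\<dots> = ennreal (c ^ k) * distance_moment k (vector [a / c, b / c, 1 / c])"
    unfolding distance_moment_exp_law by (simp add: nn_integral_cmult)
  finally show ?thesis .
qed

text \<open>Exchanging r with the separated coordinate t3 amounts to replacing (a, b, c) by (a/c,
  b/c, 1/c). The Jacobian c^-4, the factor c^(k+4) of the plane moment and the factor c^-k of the
  distance moment multiply to 1.\<close>

lemma nn_integral_hyperplanes_mmp:
  fixes k :: nat
  assumes "odd k"
  shows "(\<integral>\<^sup>+a. \<integral>\<^sup>+b. \<integral>\<^sup>+c. plane_moment (Suc k) (vector [-a, -b, c]) * distance_moment k (vector [-a, -b, c]) \<partial>half_line \<partial>half_line \<partial>half_line)
    = (\<integral>\<^sup>+a. \<integral>\<^sup>+b. \<integral>\<^sup>+c. plane_moment (Suc k) (vector [a, b, c]) * distance_moment k (vector [a, b, c]) \<partial>half_line \<partial>half_line \<partial>half_line)"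
proof -
  define H where "H = (\<lambda>a b c. plane_moment (Suc k) (vector [-a, -b, c]) * distance_moment k (vector [-a, -b, c]))"
  define G where "G = (\<lambda>a b c. plane_moment (Suc k) (vector [a, b, c]) * distance_moment k (vector [a, b, c]))"
  have [measurable]: "(\<lambda>x. H (f x) (g x) (h x)) \<in> borel_measurable M" "(\<lambda>x. G (f x) (g x) (h x)) \<in> borel_measurable M"
    if [measurable]: "f \<in> borel_measurable M" "g \<in> borel_measurable M" "h \<in> borel_measurable M"
    for f g h and M :: "'z measure"
    unfolding H_def G_def by measurable
  let ?L = half_line
  have HG: "ennreal (1 / c\<^sup>2) * (ennreal (1 / c) * (ennreal (1 / c) * H (1 / c * a) (1 / c * b) (1 / c))) = G a b c"
    if pos: "0 < a" "0 < b" "0 < c" for a b c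
  proof -
    let ?C = "det_moment (Suc k) (\<lambda>a b c. fact a * fact b * fact c) :: real"
    have pos': "0 < 1 / c * a" "0 < 1 / c * b" "0 < 1 / c" using pos by auto
    have "(1 / c)\<^sup>2 / ((1 / c * a + 1 / c) * (1 / c * b + 1 / c) * (1 + 1 / c)) = c * (1 / ((1 + a) * (1 + b) * (1 + c)))"
      using pos by (simp add: divide_simps) (simp add: power2_eq_square algebra_simps)
    then have "plane_moment (Suc k) (vector [- (1 / c * a), - (1 / c * b), 1 / c])
       = ennreal ((c * (1 / ((1 + a) * (1 + b) * (1 + c)))) ^ (Suc k + 3) * ?C)"
      using plane_moment_mmp[OF pos', of "Suc k"] \<open>odd k\<close> by simp
    also have "\<dots> = ennreal (c ^ (k + 4)) * plane_moment (Suc k) (vector [a, b, c])"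
    proof -
      have e: "Suc k + 3 = k + 4" and "even (Suc k)" using \<open>odd k\<close> by auto
      show ?thesis
        using plane_moment_ppp[OF pos \<open>even (Suc k)\<close>] pos unfolding e
        by (simp only: power_mult_distrib[of c] mult.assoc ennreal_mult' zero_le_power less_imp_le)
    qed
    finally have p: "plane_moment (Suc k) (vector [- (1 / c * a), - (1 / c * b), 1 / c]) = ennreal (c ^ (k + 4)) * plane_moment (Suc k) (vector [a, b, c])" .
    have d: "distance_moment k (vector [- (1 / c * a), - (1 / c * b), 1 / c]) = ennreal ((1 / c) ^ k) * distance_moment k (vector [a, b, c])"
      using distance_moment_mmp[of "1 / c" k "1 / c * a" "1 / c * b"] pos by simp
    have one: "ennreal (1 / c\<^sup>2) * (ennreal (1 / c) * (ennreal (1 / c) * (ennreal (c ^ (k + 4)) * ennreal ((1 / c) ^ k)))) = 1"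
    proof -
      have "1 / c\<^sup>2 * (1 / c * (1 / c * (c ^ (k + 4) * (1 / c) ^ k))) = 1"
        using pos by (simp add: power_add power_divide eval_nat_numeral)
      then show ?thesis using pos by (simp add: ennreal_mult[symmetric] del: ennreal_1 flip: ennreal_1)
    qed
    have "ennreal (1 / c\<^sup>2) * (ennreal (1 / c) * (ennreal (1 / c) * H (1 / c * a) (1 / c * b) (1 / c)))
       = (ennreal (1 / c\<^sup>2) * (ennreal (1 / c) * (ennreal (1 / c) * (ennreal (c ^ (k + 4)) * ennreal ((1 / c) ^ k))))) * G a b c"
      unfolding H_def G_def p d by (simp only: ac_simps)
    then show ?thesis unfolding one by simp
  qed
  have "(\<integral>\<^sup>+a. \<integral>\<^sup>+b. \<integral>\<^sup>+c. H a b c \<partial>?L \<partial>?L \<partial>?L) = (\<integral>\<^sup>+a. \<integral>\<^sup>+c. \<integral>\<^sup>+b. H a b c \<partial>?L \<partial>?L \<partial>?L)"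
    by (rule nn_integral_cong, rule half_pair.Fubini') measurable
  also have "\<dots> = (\<integral>\<^sup>+c. \<integral>\<^sup>+a. \<integral>\<^sup>+b. H a b c \<partial>?L \<partial>?L \<partial>?L)"
    by (rule half_pair.Fubini') measurable
  also have "\<dots> = (\<integral>\<^sup>+c. ennreal (1 / c\<^sup>2) * (\<integral>\<^sup>+a. \<integral>\<^sup>+b. H a b (1 / c) \<partial>?L \<partial>?L) \<partial>?L)"
    by (rule nn_integral_half_line_inverse) measurable
  also have "\<dots> = (\<integral>\<^sup>+c. ennreal (1 / c\<^sup>2) * (ennreal (1 / c) * (\<integral>\<^sup>+a. \<integral>\<^sup>+b. H (1 / c * a) b (1 / c) \<partial>?L \<partial>?L)) \<partial>?L)"
  proof -
    have "(\<integral>\<^sup>+a. \<integral>\<^sup>+b. H a b (1 / c) \<partial>?L \<partial>?L) = ennreal (1 / c) * (\<integral>\<^sup>+a. \<integral>\<^sup>+b. H (1 / c * a) b (1 / c) \<partial>?L \<partial>?L)" if "0 < c" for c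
    proof (rule nn_integral_half_line_scale)
      show "(\<lambda>a. \<integral>\<^sup>+b. H a b (1 / c) \<partial>?L) \<in> borel_measurable borel" by measurable
    qed (use that in simp)
    then show ?thesis by (intro nn_integral_half_line_cong) simp
  qed
  also have "\<dots> = (\<integral>\<^sup>+c. ennreal (1 / c\<^sup>2) * (ennreal (1 / c) * (\<integral>\<^sup>+a. ennreal (1 / c) * (\<integral>\<^sup>+b. H (1 / c * a) (1 / c * b) (1 / c) \<partial>?L) \<partial>?L)) \<partial>?L)"
  proof -
    have "(\<integral>\<^sup>+b. H (1 / c * a) b (1 / c) \<partial>?L) = ennreal (1 / c) * (\<integral>\<^sup>+b. H (1 / c * a) (1 / c * b) (1 / c) \<partial>?L)" if "0 < c" for a c
    proof (rule nn_integral_half_line_scale)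
      show "(\<lambda>b. H (1 / c * a) b (1 / c)) \<in> borel_measurable borel" by measurable
    qed (use that in simp)
    then show ?thesis by (intro nn_integral_half_line_cong) simp
  qed
  also have "\<dots> = (\<integral>\<^sup>+c. \<integral>\<^sup>+a. \<integral>\<^sup>+b. ennreal (1 / c\<^sup>2) * (ennreal (1 / c) * (ennreal (1 / c) * H (1 / c * a) (1 / c * b) (1 / c))) \<partial>?L \<partial>?L \<partial>?L)"
    by (simp add: nn_integral_cmult)
  also have "\<dots> = (\<integral>\<^sup>+c. \<integral>\<^sup>+a. \<integral>\<^sup>+b. G a b c \<partial>?L \<partial>?L \<partial>?L)"
    by (intro nn_integral_half_line_cong) (simp only: HG)
  also have "\<dots> = (\<integral>\<^sup>+a. \<integral>\<^sup>+c. \<integral>\<^sup>+b. G a b c \<partial>?L \<partial>?L \<partial>?L)"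
    by (rule half_pair.Fubini') measurable
  also have "\<dots> = (\<integral>\<^sup>+a. \<integral>\<^sup>+b. \<integral>\<^sup>+c. G a b c \<partial>?L \<partial>?L \<partial>?L)"
    by (rule nn_integral_cong, rule half_pair.Fubini') measurable
  finally show ?thesis unfolding H_def G_def .
qed

section \<open>The quadrilateral sections and their symmetries\<close>

lemma borel_measurable_compose3:
  fixes f g h :: "'z \<Rightarrow> real" and F :: "real \<Rightarrow> real \<Rightarrow> real \<Rightarrow> ennreal"
  assumes "(\<lambda>(a, b, c). F a b c) \<in> borel_measurable borel"
    and [measurable]: "f \<in> borel_measurable M" "g \<in> borel_measurable M" "h \<in> borel_measurable M"
  shows "(\<lambda>x. F (f x) (g x) (h x)) \<in> borel_measurable M"
proof -
  have "(\<lambda>x. (f x, g x, h x)) \<in> M \<rightarrow>\<^sub>M borel"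
    unfolding borel_prod[symmetric] by measurable
  from measurable_compose[OF this assms(1)] show ?thesis by simp
qed

text \<open>The map (a, b, c) to (1/a, b/a, c/a) has Jacobian a^-4. It describes how the
  coefficients of the hyperplane equation change when it is solved for another coordinate instead of
  r.\<close>

lemma nn_integral_half_line_projective_inversion:
  assumes F: "(\<lambda>(a, b, c). F a b c) \<in> borel_measurable borel"
  shows "(\<integral>\<^sup>+a. \<integral>\<^sup>+b. \<integral>\<^sup>+c. F a b c \<partial>half_line \<partial>half_line \<partial>half_line)
     = (\<integral>\<^sup>+a. \<integral>\<^sup>+b. \<integral>\<^sup>+c. ennreal (1 / a ^ 4) * F (1 / a) (b / a) (c / a) \<partial>half_line \<partial>half_line \<partial>half_line)"
proof -
  note [measurable] = borel_measurable_compose3[OF F]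
  have scale_c: "(\<integral>\<^sup>+c. F a b c \<partial>half_line) = ennreal (1 / r) * (\<integral>\<^sup>+c. F a b (c / r) \<partial>half_line)" if "0 < r" for a b r
    using nn_integral_half_line_scale[of "\<lambda>c. F a b c" "1 / r"] that by simp
  have scale_b: "(\<integral>\<^sup>+b. \<integral>\<^sup>+c. F a b c \<partial>half_line \<partial>half_line) = ennreal (1 / r) * (\<integral>\<^sup>+b. \<integral>\<^sup>+c. F a (b / r) c \<partial>half_line \<partial>half_line)"
    if "0 < r" for a r
    using nn_integral_half_line_scale[of "\<lambda>b. \<integral>\<^sup>+c. F a b c \<partial>half_line" "1 / r"] that by simp
  have "(\<integral>\<^sup>+a. \<integral>\<^sup>+b. \<integral>\<^sup>+c. F a b c \<partial>half_line \<partial>half_line \<partial>half_line)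
     = (\<integral>\<^sup>+a. ennreal (1 / a\<^sup>2) * (\<integral>\<^sup>+b. \<integral>\<^sup>+c. F (1 / a) b c \<partial>half_line \<partial>half_line) \<partial>half_line)"
    by (rule nn_integral_half_line_inverse) measurable
  also have "\<dots> = (\<integral>\<^sup>+a. \<integral>\<^sup>+b. \<integral>\<^sup>+c. ennreal (1 / a ^ 4) * F (1 / a) (b / a) (c / a) \<partial>half_line \<partial>half_line \<partial>half_line)"
  proof (rule nn_integral_half_line_cong)
    fix a :: real assume a: "0 < a"
    have "ennreal (1 / a ^ 4) = ennreal (1 / a\<^sup>2) * (ennreal (1 / a) * ennreal (1 / a))"
      using a by (simp add: ennreal_mult[symmetric] eval_nat_numeral)
    then show "ennreal (1 / a\<^sup>2) * (\<integral>\<^sup>+b. \<integral>\<^sup>+c. F (1 / a) b c \<partial>half_line \<partial>half_line)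
      = (\<integral>\<^sup>+b. \<integral>\<^sup>+c. ennreal (1 / a ^ 4) * F (1 / a) (b / a) (c / a) \<partial>half_line \<partial>half_line)"
      by (simp add: scale_b[OF a] scale_c[OF a, of _ "_ / a"] nn_integral_cmult mult.assoc)
  qed
  finally show ?thesis .
qed

text \<open>The plane moment at (-a, b, c) with denominators cleared: \<sigma> is a b c times the S
  of \<open>plane_moment_mpp\<close>, and the arguments of g are 4\<alpha>(1-\<alpha>) and
  4\<beta>(1-\<beta>) for the two Laplace parameters.\<close>

definition plane_density :: "nat \<Rightarrow> (real \<Rightarrow> real \<Rightarrow> real) \<Rightarrow> real \<Rightarrow> real \<Rightarrow> real \<Rightarrow> real" where
  "plane_density k g a b c = (let \<sigma> = a * b * c + b * c + a * c + a * b in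
     (\<sigma> / ((1 + b) * (1 + c) * (a + b) * (a + c))) ^ (k + 4) *
     g (4 * (1 + b) * (a + c) * (a * b * c) / \<sigma>\<^sup>2) (4 * (1 + c) * (a + b) * (a * b * c) / \<sigma>\<^sup>2))"

text \<open>The plane factor times the positive part of the distance factor only; the negative part
  will be shown to contribute the same amount.\<close>

definition mixed_density :: "nat \<Rightarrow> (real \<Rightarrow> real \<Rightarrow> real) \<Rightarrow> real \<Rightarrow> real \<Rightarrow> real \<Rightarrow> real" where
  "mixed_density k g a b c = plane_density k g a b c * pos_distance k a b c"

lemma plane_density_swap:
  assumes "\<And>x y. g x y = g y x"
  shows "plane_density k g a c b = plane_density k g a b c"
proof -
  have e: "a * b * c + c * b + a * b + a * c = a * b * c + b * c + a * c + a * b"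
    "(1 + c) * (1 + b) * (a + c) * (a + b) = (1 + b) * (1 + c) * (a + b) * (a + c)" "a * c * b = a * b * c"
    by (simp_all add: algebra_simps)
  show ?thesis unfolding plane_density_def Let_def e by (subst assms) (rule refl)
qed

text \<open>Solving the hyperplane equation for t1 instead of r exchanges the two Laplace
  parameters, so the symmetry of g enters.\<close>

lemma plane_density_inversion:
  assumes pos: "0 < a" "0 < b" "0 < c" and g: "\<And>x y. g x y = g y x"
  shows "plane_density k g (1 / a) (b / a) (c / a) = a ^ (k + 4) * plane_density k g a b c"
proof -
  define \<sigma> where "\<sigma> = a * b * c + b * c + a * c + a * b"
  have \<sigma>: "0 < \<sigma>" using pos by (simp add: \<sigma>_def add_pos_pos)
  have 1: "1 / a * (b / a) * (c / a) + b / a * (c / a) + 1 / a * (c / a) + 1 / a * (b / a) = \<sigma> / a ^ 3"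
    using pos by (simp add: \<sigma>_def field_simps eval_nat_numeral)
  have 2: "(1 + b / a) * (1 + c / a) * (1 / a + b / a) * (1 / a + c / a) = (1 + b) * (1 + c) * (a + b) * (a + c) / a ^ 4"
    using pos by (simp add: divide_simps eval_nat_numeral)
  have 3: "\<sigma> / a ^ 3 / ((1 + b) * (1 + c) * (a + b) * (a + c) / a ^ 4) = a * (\<sigma> / ((1 + b) * (1 + c) * (a + b) * (a + c)))"
    using pos by (simp add: eval_nat_numeral)
  have 4: "4 * (1 + b / a) * (1 / a + c / a) * (1 / a * (b / a) * (c / a)) / (\<sigma> / a ^ 3)\<^sup>2 = 4 * (1 + c) * (a + b) * (a * b * c) / \<sigma>\<^sup>2"
    "4 * (1 + c / a) * (1 / a + b / a) * (1 / a * (b / a) * (c / a)) / (\<sigma> / a ^ 3)\<^sup>2 = 4 * (1 + b) * (a + c) * (a * b * c) / \<sigma>\<^sup>2"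
    using pos \<sigma> by (simp_all add: divide_simps eval_nat_numeral) (simp_all add: algebra_simps)
  show ?thesis
    unfolding plane_density_def Let_def 1 2 3 4 power_mult_distrib \<sigma>_def[symmetric]
    by (subst g) simp
qed

text \<open>Solving for t2 exchanges the pair r, t1 with the pair t2, t3; both Laplace parameters
  keep their places.\<close>

lemma plane_density_rotate:
  assumes pos: "0 < a" "0 < b" "0 < c"
  shows "plane_density k g (a / b) (1 / b) (c / b) = b ^ (k + 4) * plane_density k g c b a"
proof -
  define \<sigma> where "\<sigma> = c * b * a + b * a + c * a + c * b"
  have \<sigma>: "0 < \<sigma>" using pos by (simp add: \<sigma>_def add_pos_pos)
  have 1: "a / b * (1 / b) * (c / b) + 1 / b * (c / b) + a / b * (c / b) + a / b * (1 / b) = \<sigma> / b ^ 3"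
    using pos by (simp add: \<sigma>_def field_simps eval_nat_numeral)
  have 2: "(1 + 1 / b) * (1 + c / b) * (a / b + 1 / b) * (a / b + c / b) = (1 + b) * (1 + a) * (c + b) * (c + a) / b ^ 4"
    using pos by (simp add: divide_simps eval_nat_numeral) (simp add: algebra_simps)
  have 3: "\<sigma> / b ^ 3 / ((1 + b) * (1 + a) * (c + b) * (c + a) / b ^ 4) = b * (\<sigma> / ((1 + b) * (1 + a) * (c + b) * (c + a)))"
    using pos by (simp add: eval_nat_numeral)
  have 4: "4 * (1 + 1 / b) * (a / b + c / b) * (a / b * (1 / b) * (c / b)) / (\<sigma> / b ^ 3)\<^sup>2 = 4 * (1 + b) * (c + a) * (c * b * a) / \<sigma>\<^sup>2"
    "4 * (1 + c / b) * (a / b + 1 / b) * (a / b * (1 / b) * (c / b)) / (\<sigma> / b ^ 3)\<^sup>2 = 4 * (1 + a) * (c + b) * (c * b * a) / \<sigma>\<^sup>2"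
    using pos \<sigma> by (simp_all add: divide_simps eval_nat_numeral) (simp_all add: algebra_simps)
  show ?thesis
    unfolding plane_density_def Let_def 1 2 3 4 power_mult_distrib \<sigma>_def[symmetric] by simp
qed

lemma pos_distance_swap: "pos_distance k a c b = pos_distance k a b c"
  by (simp add: pos_distance_def mult.commute)

lemma pos_distance_inversion:
  assumes pos: "0 < a" "0 < b" "0 < c"
  shows "a ^ k * pos_distance k (1 / a) (b / a) (c / a) = pos_distance k a b c"
proof (cases "a = 1")
  case False
  have e: "(1 + b / a) * (1 + c / a) = (a + b) * (a + c) / a\<^sup>2"
    "(1 / a + b / a) * (1 / a + c / a) = (1 + b) * (1 + c) / a\<^sup>2" "1 - 1 / a = - ((1 - a) / a)"
    "(1 / a) ^ (k + 3) = 1 / (a ^ k * a ^ 3)"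
    using pos by (simp_all add: divide_simps eval_nat_numeral)
  have "1 + b \<noteq> 0" "1 + c \<noteq> 0" "a + b \<noteq> 0" "a + c \<noteq> 0" "1 - a \<noteq> 0" "a ^ k \<noteq> 0" "a \<noteq> 0"
    using pos False by auto
  then show ?thesis
    unfolding pos_distance_def e by (simp add: power_add divide_simps eval_nat_numeral) (simp add: algebra_simps)
qed (simp add: pos_distance_def)

lemma mixed_density_swap:
  assumes "\<And>x y. g x y = g y x"
  shows "mixed_density k g a c b = mixed_density k g a b c"
  using plane_density_swap[OF assms] by (simp add: mixed_density_def pos_distance_swap)

text \<open>The weight k+4 of the plane factor and the weight -k of the distance factor leave a^4,
  which cancels the Jacobian of the inversion.\<close>

lemma mixed_density_inversion:
  assumes pos: "0 < a" "0 < b" "0 < c" and g: "\<And>x y. g x y = g y x"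
  shows "mixed_density k g (1 / a) (b / a) (c / a) = a ^ 4 * mixed_density k g a b c"
  unfolding mixed_density_def plane_density_inversion[where g=g, OF assms] pos_distance_inversion[OF pos, of k, symmetric]
  by (simp add: power_add)

lemma mixed_density_one: "mixed_density k g 1 b c = 0"
  by (simp add: mixed_density_def pos_distance_def)

lemma borel_measurable_mixed_density:
  assumes "(\<lambda>(x, y). g x y) \<in> borel_measurable borel"
  shows "(\<lambda>(a, b, c). ennreal (plane_density k g a b c)) \<in> borel_measurable borel"
    "(\<lambda>(a, b, c). ennreal (mixed_density k g a b c)) \<in> borel_measurable borel"
    "(\<lambda>(a, b, c). ennreal (plane_density k g a b c * (b ^ k * pos_distance k (c / b) (1 / b) (a / b)))) \<in> borel_measurable borel"
proof -
  have [measurable]: "(\<lambda>x. g (f x) (h x)) \<in> borel_measurable M"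
    if [measurable]: "f \<in> borel_measurable M" "h \<in> borel_measurable M" for f h and M :: "(real \<times> real \<times> real) measure"
  proof -
    have "(\<lambda>x. (f x, h x)) \<in> M \<rightarrow>\<^sub>M borel"
      unfolding borel_prod[symmetric] by measurable
    from measurable_compose[OF this assms] show ?thesis by simp
  qed
  show "(\<lambda>(a, b, c). ennreal (plane_density k g a b c)) \<in> borel_measurable borel"
    "(\<lambda>(a, b, c). ennreal (mixed_density k g a b c)) \<in> borel_measurable borel"
    "(\<lambda>(a, b, c). ennreal (plane_density k g a b c * (b ^ k * pos_distance k (c / b) (1 / b) (a / b)))) \<in> borel_measurable borel"
    unfolding mixed_density_def plane_density_def pos_distance_def Let_def split_def borel_prod[symmetric] by measurable
qed

lemma plane_moment_mpp_density:
  assumes pos: "0 < a" "0 < b" "0 < c" and "odd k"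
    and g: "\<And>\<alpha> \<beta>. quad_moment (Suc k) \<alpha> \<beta> = g (4 * \<alpha> * (1 - \<alpha>)) (4 * \<beta> * (1 - \<beta>))"
  shows "plane_moment (Suc k) (vector [-a, b, c]) = ennreal (plane_density k g a b c)"
proof -
  define S where "S = 1 + 1 / a + 1 / b + 1 / c"
  define \<sigma> where "\<sigma> = a * b * c + b * c + a * c + a * b"
  have \<sigma>: "0 < \<sigma>" using pos by (simp add: \<sigma>_def add_pos_pos)
  have S: "S = \<sigma> / (a * b * c)"
    using pos by (simp add: S_def \<sigma>_def field_simps)
  have "even (Suc k)" and e: "Suc k + 3 = k + 4" using \<open>odd k\<close> by auto
  have 1: "(1 / a + 1 / c) / S = (a + c) * b / \<sigma>" "(1 / a + 1 / b) / S = (a + b) * c / \<sigma>"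
    using pos \<sigma> unfolding S by (simp_all add: divide_simps)
  have 2: "1 - (a + c) * b / \<sigma> = (1 + b) * (a * c) / \<sigma>" "1 - (a + b) * c / \<sigma> = (1 + c) * (a * b) / \<sigma>"
    using \<sigma> by (simp_all add: divide_simps) (simp_all add: \<sigma>_def algebra_simps)
  have 3: "S / ((1 + 1 / b) * (1 + 1 / c) * (1 / a + 1 / b) * (1 / a + 1 / c) * (a * b * c))
     = \<sigma> / ((1 + b) * (1 + c) * (a + b) * (a + c))"
    using pos \<sigma> unfolding S by (simp add: divide_simps) (simp add: algebra_simps)
  have 4: "4 * ((a + c) * b / \<sigma>) * ((1 + b) * (a * c) / \<sigma>) = 4 * (1 + b) * (a + c) * (a * b * c) / \<sigma>\<^sup>2"
    "4 * ((a + b) * c / \<sigma>) * ((1 + c) * (a * b) / \<sigma>) = 4 * (1 + c) * (a + b) * (a * b * c) / \<sigma>\<^sup>2"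
    by (simp_all add: power2_eq_square)
  show ?thesis
    using plane_moment_mpp[OF pos \<open>even (Suc k)\<close>]
    unfolding S_def[symmetric] e 1 3 g 2 4 plane_density_def Let_def \<sigma>_def[symmetric] .
qed

text \<open>The negative part of the linear form becomes the positive part once the two pairs of
  coordinates are exchanged, which is the projective inversion with respect to b. Hence the factor
  2.\<close>

lemma nn_integral_hyperplanes_mpp:
  assumes "odd k" and gs: "\<And>x y. g x y = g y x" and gm: "(\<lambda>(x, y). g x y) \<in> borel_measurable borel"
    and g: "\<And>\<alpha> \<beta>. quad_moment (Suc k) \<alpha> \<beta> = g (4 * \<alpha> * (1 - \<alpha>)) (4 * \<beta> * (1 - \<beta>))"
  shows "(\<integral>\<^sup>+a. \<integral>\<^sup>+b. \<integral>\<^sup>+c. plane_moment (Suc k) (vector [-a, b, c]) * distance_moment k (vector [-a, b, c]) \<partial>half_line \<partial>half_line \<partial>half_line)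
    = 2 * (\<integral>\<^sup>+a. \<integral>\<^sup>+b. \<integral>\<^sup>+c. ennreal (mixed_density k g a b c) \<partial>half_line \<partial>half_line \<partial>half_line)"
proof -
  let ?L = half_line
  have "0 < k" using \<open>odd k\<close> by (cases k) auto
  define \<Theta> where "\<Theta> = (\<lambda>a b c. ennreal (mixed_density k g a b c))"
  define \<Phi> where "\<Phi> = (\<lambda>a b c. ennreal (plane_density k g a b c * (b ^ k * pos_distance k (c / b) (1 / b) (a / b))))"
  have m\<Theta>: "(\<lambda>(a, b, c). \<Theta> a b c) \<in> borel_measurable borel" and m\<Phi>: "(\<lambda>(a, b, c). \<Phi> a b c) \<in> borel_measurable borel"
    using borel_measurable_mixed_density[OF gm] by (simp_all add: \<Theta>_def \<Phi>_def)
  note [measurable] = borel_measurable_compose3[OF m\<Theta>] borel_measurable_compose3[OF m\<Phi>]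
  have "(\<integral>\<^sup>+a. \<integral>\<^sup>+b. \<integral>\<^sup>+c. plane_moment (Suc k) (vector [-a, b, c]) * distance_moment k (vector [-a, b, c]) \<partial>?L \<partial>?L \<partial>?L)
     = (\<integral>\<^sup>+a. \<integral>\<^sup>+b. \<integral>\<^sup>+c. \<Theta> a b c + \<Phi> a b c \<partial>?L \<partial>?L \<partial>?L)"
  \<comment> \<open>The values a = 1 and c = b, at which the formula for the distance moment has a
    vanishing denominator, form null sets and are removed.\<close>
  proof (rule nn_integral_cong_AE, use AE_half_line AE_half_line_lborel[OF AE_lborel_singleton[of "1::real"]] in eventually_elim)
    fix a :: real assume a: "0 < a" "a \<noteq> 1"
    show "(\<integral>\<^sup>+b. \<integral>\<^sup>+c. plane_moment (Suc k) (vector [-a, b, c]) * distance_moment k (vector [-a, b, c]) \<partial>?L \<partial>?L)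
     = (\<integral>\<^sup>+b. \<integral>\<^sup>+c. \<Theta> a b c + \<Phi> a b c \<partial>?L \<partial>?L)"
    proof (rule nn_integral_half_line_cong, rule nn_integral_cong_AE)
      fix b :: real assume b: "0 < b"
      show "AE c in ?L. plane_moment (Suc k) (vector [-a, b, c]) * distance_moment k (vector [-a, b, c]) = \<Theta> a b c + \<Phi> a b c"
        using AE_half_line AE_half_line_lborel[OF AE_lborel_singleton[of b]]
      proof eventually_elim
        fix c :: real assume c: "0 < c" "c \<noteq> b"
        have p: "0 \<le> pos_distance k a b c" "0 \<le> b ^ k * pos_distance k (c / b) (1 / b) (a / b)"
          using nn_integral_pos_distance(2)[of a b c k] nn_integral_pos_distance(2)[of "c / b" "1 / b" "a / b" k] a b c \<open>0 < k\<close> by auto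
        have d: "distance_moment k (vector [-a, b, c]) = ennreal (pos_distance k a b c) + ennreal (b ^ k * pos_distance k (c / b) (1 / b) (a / b))"
          by (rule distance_moment_mpp) (use a b c \<open>0 < k\<close> in auto)
        show "plane_moment (Suc k) (vector [-a, b, c]) * distance_moment k (vector [-a, b, c]) = \<Theta> a b c + \<Phi> a b c"
          unfolding plane_moment_mpp_density[where g=g, OF a(1) b c(1) \<open>odd k\<close> g] d distrib_left
            ennreal_mult''[OF p(1), symmetric] ennreal_mult''[OF p(2), symmetric] \<Theta>_def \<Phi>_def mixed_density_def ..
      qed
    qed
  qed
  also have "\<dots> = (\<integral>\<^sup>+a. \<integral>\<^sup>+b. \<integral>\<^sup>+c. \<Theta> a b c \<partial>?L \<partial>?L \<partial>?L) + (\<integral>\<^sup>+a. \<integral>\<^sup>+b. \<integral>\<^sup>+c. \<Phi> a b c \<partial>?L \<partial>?L \<partial>?L)"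
    by (simp add: nn_integral_add)
  also have "(\<integral>\<^sup>+a. \<integral>\<^sup>+b. \<integral>\<^sup>+c. \<Phi> a b c \<partial>?L \<partial>?L \<partial>?L) = (\<integral>\<^sup>+b. \<integral>\<^sup>+a. \<integral>\<^sup>+c. \<Phi> a b c \<partial>?L \<partial>?L \<partial>?L)"
    by (rule half_pair.Fubini') measurable
  also have "\<dots> = (\<integral>\<^sup>+b. \<integral>\<^sup>+a. \<integral>\<^sup>+c. ennreal (1 / b ^ 4) * \<Phi> (a / b) (1 / b) (c / b) \<partial>?L \<partial>?L \<partial>?L)"
  proof (rule nn_integral_half_line_projective_inversion)
    show "(\<lambda>(b, a, c). \<Phi> a b c) \<in> borel_measurable borel"
      unfolding split_def borel_prod[symmetric] by measurable
  qed
  also have "\<dots> = (\<integral>\<^sup>+b. \<integral>\<^sup>+a. \<integral>\<^sup>+c. \<Theta> c b a \<partial>?L \<partial>?L \<partial>?L)"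
  proof (intro nn_integral_half_line_cong)
    fix a b c :: real assume pos: "0 < b" "0 < a" "0 < c"
    have "plane_density k g (a / b) (1 / b) (c / b) * ((1 / b) ^ k * pos_distance k (c / b / (1 / b)) (1 / (1 / b)) (a / b / (1 / b)))
       = b ^ 4 * mixed_density k g c b a"
      using pos by (simp add: plane_density_rotate mixed_density_def power_add power_divide)
    then show "ennreal (1 / b ^ 4) * \<Phi> (a / b) (1 / b) (c / b) = \<Theta> c b a"
      unfolding \<Phi>_def \<Theta>_def using pos by (simp add: ennreal_mult'[symmetric] del: times_divide_eq_left divide_divide_eq_right divide_divide_eq_left) simp
  qed
  also have "\<dots> = (\<integral>\<^sup>+b. \<integral>\<^sup>+c. \<integral>\<^sup>+a. \<Theta> c b a \<partial>?L \<partial>?L \<partial>?L)"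
    by (rule nn_integral_cong, rule half_pair.Fubini') measurable
  also have "\<dots> = (\<integral>\<^sup>+c. \<integral>\<^sup>+b. \<integral>\<^sup>+a. \<Theta> c b a \<partial>?L \<partial>?L \<partial>?L)"
    by (rule half_pair.Fubini') measurable
  finally show ?thesis unfolding \<Theta>_def by (simp flip: mult_2)
qed

text \<open>Inversion in a identifies a \<ge> 1 with a \<le> 1, and swapping b and c identifies c >
  b with c < b. Each symmetry contributes a factor 2; the order of integration is chosen so that b
  comes first and bounds c.\<close>

lemma nn_integral_mixed_density_fold:
  assumes gs: "\<And>x y. g x y = g y x" and gm: "(\<lambda>(x, y). g x y) \<in> borel_measurable borel"
  shows "(\<integral>\<^sup>+a. \<integral>\<^sup>+b. \<integral>\<^sup>+c. ennreal (mixed_density k g a b c) \<partial>half_line \<partial>half_line \<partial>half_line)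
    = 4 * (\<integral>\<^sup>+b. \<integral>\<^sup>+a. (\<integral>\<^sup>+c. ennreal (mixed_density k g a b c) * indicator {..b} c \<partial>half_line) * indicator {..1} a \<partial>half_line \<partial>half_line)"
proof -
  let ?L = half_line
  define \<Theta> where "\<Theta> = (\<lambda>a b c. ennreal (mixed_density k g a b c))"
  have m\<Theta>: "(\<lambda>(a, b, c). \<Theta> a b c) \<in> borel_measurable borel"
    using borel_measurable_mixed_density[OF gm] by (simp add: \<Theta>_def)
  note [measurable] = borel_measurable_compose3[OF m\<Theta>]
  have ge: "(\<integral>\<^sup>+a. \<integral>\<^sup>+b. \<integral>\<^sup>+c. \<Theta> a b c * indicator {1..} a \<partial>?L \<partial>?L \<partial>?L) = (\<integral>\<^sup>+a. \<integral>\<^sup>+b. \<integral>\<^sup>+c. \<Theta> a b c * indicator {..1} a \<partial>?L \<partial>?L \<partial>?L)"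
  proof -
    have "(\<integral>\<^sup>+a. \<integral>\<^sup>+b. \<integral>\<^sup>+c. \<Theta> a b c * indicator {1..} a \<partial>?L \<partial>?L \<partial>?L) =
        (\<integral>\<^sup>+a. \<integral>\<^sup>+b. \<integral>\<^sup>+c. ennreal (1 / a ^ 4) * (\<Theta> (1 / a) (b / a) (c / a) * indicator {1..} (1 / a)) \<partial>?L \<partial>?L \<partial>?L)"
    proof (rule nn_integral_half_line_projective_inversion)
      show "(\<lambda>(a, b, c). \<Theta> a b c * indicator {1..} a) \<in> borel_measurable borel"
        unfolding split_def borel_prod[symmetric] by measurable
    qed
    also have "\<dots> = (\<integral>\<^sup>+a. \<integral>\<^sup>+b. \<integral>\<^sup>+c. \<Theta> a b c * indicator {..1} a \<partial>?L \<partial>?L \<partial>?L)"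
    proof (intro nn_integral_half_line_cong)
      fix a b c :: real assume pos: "0 < a" "0 < b" "0 < c"
      have "ennreal (1 / a ^ 4) * \<Theta> (1 / a) (b / a) (c / a) = \<Theta> a b c"
        unfolding \<Theta>_def mixed_density_inversion[where g=g, OF pos gs] using pos by (simp add: ennreal_mult'[symmetric])
      moreover have "indicator {1..} (1 / a) = (indicator {..1} a :: ennreal)"
        using pos by (simp add: indicator_def)
      ultimately show "ennreal (1 / a ^ 4) * (\<Theta> (1 / a) (b / a) (c / a) * indicator {1..} (1 / a)) = \<Theta> a b c * indicator {..1} a"
        by (simp add: mult.assoc[symmetric])
    qed
    finally show ?thesis .
  qed
  have gt: "(\<integral>\<^sup>+b. \<integral>\<^sup>+c. \<Theta> a b c * indicator {..1} a * indicator {b<..} c \<partial>?L \<partial>?L) = (\<integral>\<^sup>+b. \<integral>\<^sup>+c. \<Theta> a b c * indicator {..1} a * indicator {..b} c \<partial>?L \<partial>?L)" for a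
  proof -
    have [measurable]: "(\<lambda>x. indicator {f x<..} (h x) :: ennreal) \<in> borel_measurable M" 
      if [measurable]: "f \<in> borel_measurable M" "h \<in> borel_measurable M" for f h :: "_ \<Rightarrow> real" and M :: "(real \<times> real) measure"
      unfolding indicator_def greaterThan_iff atMost_iff by measurable
    have "(\<integral>\<^sup>+b. \<integral>\<^sup>+c. \<Theta> a b c * indicator {..1} a * indicator {b<..} c \<partial>?L \<partial>?L) = (\<integral>\<^sup>+c. \<integral>\<^sup>+b. \<Theta> a b c * indicator {..1} a * indicator {b<..} c \<partial>?L \<partial>?L)"
      by (rule half_pair.Fubini') measurable
    also have "\<dots> = (\<integral>\<^sup>+b. \<integral>\<^sup>+c. \<Theta> a b c * indicator {..1} a * indicator {..b} c \<partial>?L \<partial>?L)"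
    proof (rule nn_integral_cong, rule nn_integral_cong_AE)
      fix b
      show "AE c in ?L. \<Theta> a c b * indicator {..1} a * indicator {c<..} b = \<Theta> a b c * indicator {..1} a * indicator {..b} c"
        using AE_half_line_lborel[OF AE_lborel_singleton[of b]]
        by eventually_elim (auto simp: \<Theta>_def mixed_density_swap[of g, OF gs, of k a] indicator_def)
    qed
    finally show ?thesis .
  qed
  \<comment> \<open>The two indicator functions overlap at a = 1, but there the density is 0 by
    division by zero, so the splitting holds pointwise.\<close>
  have "(\<integral>\<^sup>+a. \<integral>\<^sup>+b. \<integral>\<^sup>+c. \<Theta> a b c \<partial>?L \<partial>?L \<partial>?L) = (\<integral>\<^sup>+a. \<integral>\<^sup>+b. \<integral>\<^sup>+c. \<Theta> a b c * indicator {..1} a + \<Theta> a b c * indicator {1..} a \<partial>?L \<partial>?L \<partial>?L)"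
    by (intro nn_integral_cong) (auto simp: indicator_def \<Theta>_def mixed_density_one)
  also have "\<dots> = 2 * (\<integral>\<^sup>+a. \<integral>\<^sup>+b. \<integral>\<^sup>+c. \<Theta> a b c * indicator {..1} a \<partial>?L \<partial>?L \<partial>?L)"
    by (simp add: nn_integral_add ge mult_2)
  also have "(\<integral>\<^sup>+a. \<integral>\<^sup>+b. \<integral>\<^sup>+c. \<Theta> a b c * indicator {..1} a \<partial>?L \<partial>?L \<partial>?L)
     = (\<integral>\<^sup>+a. 2 * (\<integral>\<^sup>+b. \<integral>\<^sup>+c. \<Theta> a b c * indicator {..1} a * indicator {..b} c \<partial>?L \<partial>?L) \<partial>?L)"
  proof (rule nn_integral_cong)
    fix a
    have [measurable]: "(\<lambda>x. indicator {f x<..} (h x) :: ennreal) \<in> borel_measurable M" "(\<lambda>x. indicator {..f x} (h x) :: ennreal) \<in> borel_measurable M" 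
      if [measurable]: "f \<in> borel_measurable M" "h \<in> borel_measurable M" for f h :: "_ \<Rightarrow> real" and M :: "(real \<times> real) measure"
      unfolding indicator_def greaterThan_iff atMost_iff by measurable
    have [measurable]: "(\<lambda>b. \<integral>\<^sup>+c. \<Theta> a b c * indicator {..1} a * indicator {..b} c \<partial>?L) \<in> borel_measurable ?L"
      "(\<lambda>b. \<integral>\<^sup>+c. \<Theta> a b c * indicator {..1} a * indicator {b<..} c \<partial>?L) \<in> borel_measurable ?L" by measurable
    have "(\<integral>\<^sup>+b. \<integral>\<^sup>+c. \<Theta> a b c * indicator {..1} a \<partial>?L \<partial>?L)
       = (\<integral>\<^sup>+b. \<integral>\<^sup>+c. \<Theta> a b c * indicator {..1} a * indicator {..b} c + \<Theta> a b c * indicator {..1} a * indicator {b<..} c \<partial>?L \<partial>?L)"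
      by (intro nn_integral_cong) (auto simp: indicator_def)
    also have "\<dots> = (\<integral>\<^sup>+b. (\<integral>\<^sup>+c. \<Theta> a b c * indicator {..1} a * indicator {..b} c \<partial>?L) + (\<integral>\<^sup>+c. \<Theta> a b c * indicator {..1} a * indicator {b<..} c \<partial>?L) \<partial>?L)"
      by (intro nn_integral_cong nn_integral_add) auto
    also have "\<dots> = 2 * (\<integral>\<^sup>+b. \<integral>\<^sup>+c. \<Theta> a b c * indicator {..1} a * indicator {..b} c \<partial>?L \<partial>?L)"
      by (subst nn_integral_add) (auto simp: gt mult_2)
    finally show "(\<integral>\<^sup>+b. \<integral>\<^sup>+c. \<Theta> a b c * indicator {..1} a \<partial>?L \<partial>?L) = 2 * (\<integral>\<^sup>+b. \<integral>\<^sup>+c. \<Theta> a b c * indicator {..1} a * indicator {..b} c \<partial>?L \<partial>?L)" .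
  qed
  also have "\<dots> = 2 * (\<integral>\<^sup>+a. \<integral>\<^sup>+b. (\<integral>\<^sup>+c. \<Theta> a b c * indicator {..b} c \<partial>?L) * indicator {..1} a \<partial>?L \<partial>?L)"
  proof -
    have [measurable]: "(\<lambda>x. indicator {..f x} (h x) :: ennreal) \<in> borel_measurable M"
      if [measurable]: "f \<in> borel_measurable M" "h \<in> borel_measurable M" for f h :: "_ \<Rightarrow> real" and M :: "'z measure"
      unfolding indicator_def greaterThan_iff atMost_iff by measurable
    have [measurable]: "(\<lambda>x. \<integral>\<^sup>+b. \<integral>\<^sup>+c. \<Theta> x b c * indicator {..1} x * indicator {..b} c \<partial>?L \<partial>?L) \<in> borel_measurable ?L"
      by measurable
    have "(\<integral>\<^sup>+c. \<Theta> a b c * indicator {..1} a * indicator {..b} c \<partial>?L) = (\<integral>\<^sup>+c. \<Theta> a b c * indicator {..b} c \<partial>?L) * indicator {..1} a" for a b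
      by (subst nn_integral_multc[symmetric]) (auto simp: ac_simps)
    then show ?thesis by (subst nn_integral_cmult) auto
  qed
  also have "(\<integral>\<^sup>+a. \<integral>\<^sup>+b. (\<integral>\<^sup>+c. \<Theta> a b c * indicator {..b} c \<partial>?L) * indicator {..1} a \<partial>?L \<partial>?L)
     = (\<integral>\<^sup>+b. \<integral>\<^sup>+a. (\<integral>\<^sup>+c. \<Theta> a b c * indicator {..b} c \<partial>?L) * indicator {..1} a \<partial>?L \<partial>?L)"
  proof (rule half_pair.Fubini')
    have [measurable]: "(\<lambda>x. indicator {..f x} (h x) :: ennreal) \<in> borel_measurable M"
      if [measurable]: "f \<in> borel_measurable M" "h \<in> borel_measurable M" for f h :: "_ \<Rightarrow> real" and M :: "((real \<times> real) \<times> real) measure"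
      unfolding indicator_def greaterThan_iff atMost_iff by measurable
    show "(\<lambda>(b, a). (\<integral>\<^sup>+c. \<Theta> a b c * indicator {..b} c \<partial>?L) * indicator {..1} a) \<in> borel_measurable (?L \<Otimes>\<^sub>M ?L)"
      by measurable
  qed
  finally show ?thesis unfolding \<Theta>_def by (simp add: mult.assoc[symmetric])
qed

section \<open>Passage to the unit cube\<close>

definition unit_line :: "real measure" where
  "unit_line = density lborel (indicator {0<..<1})"

lemma sets_unit_line [measurable_cong, simp]: "sets unit_line = sets borel"
  by (simp add: unit_line_def)

lemma sigma_finite_unit_line: "sigma_finite_measure unit_line"
  unfolding unit_line_def
  by (subst sigma_finite_measure.sigma_finite_iff_density_finite[OF sigma_finite_lborel]) (auto simp: indicator_def)

interpretation unit_line: sigma_finite_measure unit_line by (rule sigma_finite_unit_line)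
interpretation unit_pair: pair_sigma_finite unit_line unit_line ..

lemma AE_unit_line: "AE x in unit_line. 0 < x \<and> x < 1"
  unfolding unit_line_def by (subst AE_density) (auto simp: indicator_def)

lemma nn_integral_unit_line:
  assumes "f \<in> borel_measurable borel"
  shows "(\<integral>\<^sup>+x. f x \<partial>unit_line) = (\<integral>\<^sup>+x. f x * indicator {0<..<1} x \<partial>lborel)"
  unfolding unit_line_def using assms by (subst nn_integral_density) (auto simp: mult.commute)

lemma nn_integral_unit_line_cong:
  assumes "\<And>x. 0 < x \<Longrightarrow> x < 1 \<Longrightarrow> f x = g x"
  shows "(\<integral>\<^sup>+x. f x \<partial>unit_line) = (\<integral>\<^sup>+x. g x \<partial>unit_line)"
  by (rule nn_integral_cong_AE, use AE_unit_line in eventually_elim) (use assms in blast)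

lemma nn_integral_unit_line_reflect:
  assumes [measurable]: "f \<in> borel_measurable borel"
  shows "(\<integral>\<^sup>+x. f (1 - x) \<partial>unit_line) = (\<integral>\<^sup>+x. f x \<partial>unit_line)"
  using nn_integral_real_affine[of "\<lambda>x. f x * indicator {0<..<1} x" "-1" 1]
  by (simp add: nn_integral_unit_line indicator_def conj_commute)

text \<open>A monotone parametrisation of a bounded initial segment by the unit interval; it is
  applied to the ranges a \<le> 1 and c \<le> b.\<close>

lemma nn_integral_half_line_unit_subst:
  assumes [measurable]: "f \<in> borel_measurable borel" "g \<in> borel_measurable borel" "g' \<in> borel_measurable borel"
    and "\<And>x. x \<in> {0..1} \<Longrightarrow> (g has_real_derivative g' x) (at x)" "continuous_on {0..1} g'"
    and "\<And>x. x \<in> {0..1} \<Longrightarrow> 0 \<le> g' x" and "g 0 = 0"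
  shows "(\<integral>\<^sup>+x. f x * indicator {..g 1} x \<partial>half_line) = (\<integral>\<^sup>+x. ennreal (g' x) * f (g x) \<partial>unit_line)"
proof -
  have "(\<integral>\<^sup>+x. f x * indicator {..g 1} x \<partial>half_line) = (\<integral>\<^sup>+x. f x * indicator {g 0..g 1} x \<partial>lborel)"
    by (subst nn_integral_half_line, measurable, rule nn_integral_cong_AE, use AE_lborel_singleton[of "0::real"] in eventually_elim)
      (auto simp: indicator_def \<open>g 0 = 0\<close>)
  also have "\<dots> = (\<integral>\<^sup>+x. f (g x) * ennreal (g' x) * indicator {0..1} x \<partial>lborel)"
    by (rule nn_integral_substitution_aux) (use assms in auto)
  also have "\<dots> = (\<integral>\<^sup>+x. ennreal (g' x) * f (g x) \<partial>unit_line)"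
    by (subst nn_integral_unit_line, measurable, rule nn_integral_cong_AE,
        use AE_lborel_singleton[of "0::real"] AE_lborel_singleton[of "1::real"] in eventually_elim)
      (auto simp: indicator_def mult.commute)
  finally show ?thesis .
qed

lemma nn_integral_half_line_odds:
  assumes [measurable]: "f \<in> borel_measurable borel"
  shows "(\<integral>\<^sup>+x. f x \<partial>half_line) = (\<integral>\<^sup>+t. ennreal (1 / (1 - t)\<^sup>2) * f (t / (1 - t)) \<partial>unit_line)"
proof -
  have "(\<integral>\<^sup>+x. f x \<partial>half_line) = (\<integral>\<^sup>+x. f x * indicator {0..} x \<partial>lborel)"
    by (subst nn_integral_half_line, measurable, rule nn_integral_cong_AE, use AE_lborel_singleton[of "0::real"] in eventually_elim)
      (auto simp: indicator_def)
  also have "\<dots> = (\<integral>\<^sup>+t. (f (t / (1 - t)) * ennreal (1 / (1 - t)\<^sup>2)) * indicator {0..<1} t \<partial>lborel)"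
  proof (rule nn_integral_incseq_cong[where A="\<lambda>i. {0..real i + 1}" and B="\<lambda>i. {0..1 - 1 / (real i + 2)}"])
    have mono: "1 / (real j + 2) \<le> 1 / (real i + 2)" if "i \<le> j" for i j
      using that by (intro divide_left_mono) auto
    show "incseq (\<lambda>i. {0..real i + 1})" by (auto simp: incseq_def)
    show "incseq (\<lambda>i. {0..1 - 1 / (real i + 2)})"
      unfolding incseq_def using mono by (auto intro: order_trans)
    show "(\<Union>i. {0..real i + 1}) = {0..}"
    proof (intro set_eqI iffI)
      fix x :: real assume "x \<in> {0..}"
      moreover obtain i :: nat where "x \<le> real i" using real_arch_simple by blast
      ultimately have "x \<in> {0..real i + 1}" by auto
      then show "x \<in> (\<Union>i. {0..real i + 1})" by blast
    qed auto
    show "(\<Union>i. {0..1 - 1 / (real i + 2)}) = {0..<1}"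
    proof (intro set_eqI iffI)
      fix x :: real assume "x \<in> (\<Union>i. {0..1 - 1 / (real i + 2)})"
      then obtain i :: nat where "0 \<le> x" "x \<le> 1 - 1 / (real i + 2)" by auto
      moreover have "0 < 1 / (real i + 2)" by simp
      ultimately have "x < 1" by linarith
      with \<open>0 \<le> x\<close> show "x \<in> {0..<1}" by simp
    next
      fix x :: real assume x: "x \<in> {0..<1}"
      obtain i :: nat where "1 / (1 - x) \<le> real i" using real_arch_simple by blast
      then have "1 / (1 - x) \<le> real i + 2" by simp
      then have "1 / (real i + 2) \<le> 1 - x" using x by (simp add: field_simps)
      then have "x \<in> {0..1 - 1 / (real i + 2)}" using x by auto
      then show "x \<in> (\<Union>i. {0..1 - 1 / (real i + 2)})" by blast
    qed
    fix i :: nat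
    define K where "K = 1 - 1 / (real i + 2)"
    have K: "0 < K" "K < 1" by (simp_all add: K_def field_simps)
    have e: "0 / (1 - 0) = (0::real)" "K / (1 - K) = real i + 1" by (simp_all add: K_def field_simps)
    have "(\<integral>\<^sup>+x. f x * indicator {0 / (1 - 0)..K / (1 - K)} x \<partial>lborel)
        = (\<integral>\<^sup>+x. f (x / (1 - x)) * ennreal (1 / (1 - x)\<^sup>2) * indicator {0..K} x \<partial>lborel)"
    proof (rule nn_integral_substitution_aux[where g="\<lambda>x. x / (1 - x)"])
      show "((\<lambda>x. x / (1 - x)) has_real_derivative 1 / (1 - x)\<^sup>2) (at x)" if "x \<in> {0..K}" for x
        using that K by (auto intro!: derivative_eq_intros simp: power2_eq_square)
      show "continuous_on {0..K} (\<lambda>x. 1 / (1 - x)\<^sup>2)"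
        using K by (auto intro!: continuous_intros)
    qed (use K in auto)
    then show "(\<integral>\<^sup>+x. f x * indicator {0..real i + 1} x \<partial>lborel)
       = (\<integral>\<^sup>+x. (f (x / (1 - x)) * ennreal (1 / (1 - x)\<^sup>2)) * indicator {0..1 - 1 / (real i + 2)} x \<partial>lborel)"
      unfolding e unfolding K_def .
  qed auto
  also have "\<dots> = (\<integral>\<^sup>+t. ennreal (1 / (1 - t)\<^sup>2) * f (t / (1 - t)) \<partial>unit_line)"
    by (subst nn_integral_unit_line, measurable, rule nn_integral_cong_AE,
        use AE_lborel_singleton[of "0::real"] in eventually_elim)
      (auto simp: indicator_def mult.commute)
  finally show ?thesis .
qed

text \<open>The part of the plane density that depends on u and v only. For the polynomials g in
  use, the power of 2 - u - v clears all denominators.\<close>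

definition unit_plane :: "nat \<Rightarrow> (real \<Rightarrow> real \<Rightarrow> real) \<Rightarrow> real \<Rightarrow> real \<Rightarrow> real" where
  "unit_plane k g u v = (2 - u - v) ^ (k + 4) *
     g (4 * (1 - u) * (1 - v) * (1 - u * v) / (2 - u - v)\<^sup>2) (4 * (1 - u) * (1 - v) / (2 - u - v)\<^sup>2)"

text \<open>The remaining dependence on t, a polynomial. The inner sum is the geometric quotient of
  \<xi>^(k+1) - (t(1-u))^(k+1) by u, where \<xi> = t + (1-t) u.\<close>

definition unit_distance :: "nat \<Rightarrow> real \<Rightarrow> real \<Rightarrow> real \<Rightarrow> real" where
  "unit_distance k u v t = t\<^sup>2 * (1 - t) ^ (k + 3) * (t + (1 - t) * u)\<^sup>2 * ((1 - t) + t * v) ^ (k + 3) *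
     ((\<Sum>i\<le>k. (t + (1 - t) * u) ^ i * (t * (1 - u)) ^ (k - i)) * (1 - u * v) + (t * (1 - u)) ^ (k + 1) * (2 - u - v))"

text \<open>The substitution turns every factor of the density into a quotient of simple products: 1
  + b = 1/(1-t), 1 + c = 1/\<zeta>, a + b = t/(\<xi>(1-t)), a + c = t(1-uv)/(\<xi>\<zeta>), 1 - a =
  u/\<xi>. The plane factor contributes k+4 and the distance factor one power of 1 - uv in the
  denominator.\<close>

lemma mixed_density_unit:
  assumes u: "0 < u" "u < 1" and v: "0 < v" "v < 1" and t: "0 < t" "t < 1"
  defines "\<xi> \<equiv> t + (1 - t) * u" and "\<zeta> \<equiv> (1 - t) + t * v"
  shows "1 / (1 - t)\<^sup>2 * (t / \<xi>\<^sup>2 * (t / \<zeta>\<^sup>2 * mixed_density k g (t * (1 - u) / \<xi>) (t / (1 - t)) (t * (1 - v) / \<zeta>)))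
    = fact k * unit_plane k g u v * unit_distance k u v t / (1 - u * v) ^ (k + 5)"
proof -
  define p q \<omega> s where "p = 1 - u" and "q = 1 - v" and "\<omega> = 1 - u * v" and "s = 1 - t"
  have pq: "0 < p" "0 < q" "0 < s" "s \<noteq> 0" "p \<noteq> 0" using u v t by (auto simp: p_def q_def s_def)
  have \<xi>: "0 < \<xi>" "\<xi> \<noteq> 0" using u t by (auto simp: \<xi>_def intro!: add_pos_pos less_imp_neq[symmetric])
  have \<zeta>: "0 < \<zeta>" "\<zeta> \<noteq> 0" using v t by (auto simp: \<zeta>_def intro!: add_pos_pos less_imp_neq[symmetric])
  have "u * v < 1 * 1" using u v by (intro mult_strict_mono) auto
  then have \<omega>: "0 < \<omega>" "\<omega> \<noteq> 0" by (auto simp: \<omega>_def)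
  have w: "2 - u - v = p + q" "0 < p + q" "p + q \<noteq> 0" using u v by (auto simp: p_def q_def)
  note nz = pq \<xi> \<zeta> \<omega> w(2,3) t
  have st: "s + t = 1" by (simp add: s_def)
  define a b c where "a = t * p / \<xi>" and "b = t / s" and "c = t * q / \<zeta>"
  have ab: "1 + b = 1 / s" using nz st by (simp add: b_def field_simps)
  have ac: "1 + c = 1 / \<zeta>" using nz by (simp add: c_def field_simps) (simp add: \<zeta>_def q_def algebra_simps)
  have apb: "a + b = t / (\<xi> * s)" using nz by (simp add: a_def b_def field_simps) (simp add: \<xi>_def s_def p_def algebra_simps)
  have apc: "a + c = t * \<omega> / (\<xi> * \<zeta>)" using nz by (simp add: a_def c_def field_simps) (simp add: \<xi>_def \<zeta>_def \<omega>_def q_def p_def algebra_simps)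
  have a1: "1 - a = u / \<xi>" using nz by (simp add: a_def field_simps) (simp add: \<xi>_def p_def algebra_simps)
  have abc: "a * b * c = t ^ 3 * p * q / (\<xi> * \<zeta> * s)" using nz by (simp add: a_def b_def c_def eval_nat_numeral ac_simps)
  have \<sigma>: "a * b * c + b * c + a * c + a * b = (p + q) * t\<^sup>2 / (s * \<xi> * \<zeta>)"
    using nz by (simp add: a_def b_def c_def field_simps) (simp add: \<xi>_def \<zeta>_def p_def q_def s_def eval_nat_numeral algebra_simps)
  have 1: "(p + q) * t\<^sup>2 / (s * \<xi> * \<zeta>) / (1 / s * (1 / \<zeta>) * (t / (\<xi> * s)) * (t * \<omega> / (\<xi> * \<zeta>))) = (p + q) * s * \<xi> * \<zeta> / \<omega>"
    using nz by (simp add: field_simps eval_nat_numeral)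
  have 2: "4 * (1 / s) * (t * \<omega> / (\<xi> * \<zeta>)) * (t ^ 3 * p * q / (\<xi> * \<zeta> * s)) / ((p + q) * t\<^sup>2 / (s * \<xi> * \<zeta>))\<^sup>2 = 4 * p * q * \<omega> / (p + q)\<^sup>2"
    "4 * (1 / \<zeta>) * (t / (\<xi> * s)) * (t ^ 3 * p * q / (\<xi> * \<zeta> * s)) / ((p + q) * t\<^sup>2 / (s * \<xi> * \<zeta>))\<^sup>2 = 4 * p * q / (p + q)\<^sup>2"
    using nz by (simp_all add: divide_simps eval_nat_numeral)
  have P: "plane_density k g a b c = (s * \<xi> * \<zeta> / \<omega>) ^ (k + 4) * unit_plane k g u v"
    unfolding plane_density_def Let_def \<sigma>
    unfolding ab ac apb apc abc 1 2 unit_plane_def w p_def[symmetric] q_def[symmetric] \<omega>_def[symmetric]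
    by (simp add: power_mult_distrib power_divide ac_simps)
  define B where "B = (\<Sum>i\<le>k. \<xi> ^ i * (t * p) ^ (k - i))"
  \<comment> \<open>A difference of equal powers, with \<xi> - t p = u, provides the factor u needed
    to cancel the denominator 1 - a.\<close>
  have "\<xi> ^ Suc k - (t * p) ^ Suc k = (\<xi> - t * p) * B"
    unfolding B_def diff_power_eq_sum lessThan_Suc_atMost ..
  moreover have "\<xi> - t * p = u" by (simp add: \<xi>_def p_def algebra_simps)
  ultimately have B: "\<xi> ^ (k + 1) = (t * p) ^ (k + 1) + u * B" by simp
  define T where "T = (t * p) ^ (k + 1)"
  \<comment> \<open>Besides the difference of powers this uses \<omega> - p^2 = u (p + q), so that u
    divides the whole numerator.\<close>
  have X: "\<xi> ^ (k + 1) * \<omega> - T * p\<^sup>2 = u * (B * \<omega> + T * (p + q))"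
    unfolding B T_def by (simp add: p_def q_def \<omega>_def power2_eq_square algebra_simps)
  have "pos_distance k a b c = fact k * (1 / (1 / s * (1 / \<zeta>)) - a ^ (k + 3) / (t / (\<xi> * s) * (t * \<omega> / (\<xi> * \<zeta>)))) / (u / \<xi>)"
    unfolding pos_distance_def ab ac apb apc a1 ..
  also have "a ^ (k + 3) = T * (t * p)\<^sup>2 / (\<xi> ^ (k + 1) * \<xi>\<^sup>2)"
    by (simp add: a_def T_def power_divide power_add eval_nat_numeral ac_simps)
  also have "1 / (1 / s * (1 / \<zeta>)) - T * (t * p)\<^sup>2 / (\<xi> ^ (k + 1) * \<xi>\<^sup>2) / (t / (\<xi> * s) * (t * \<omega> / (\<xi> * \<zeta>)))
     = s * \<zeta> * (\<xi> ^ (k + 1) * \<omega> - T * p\<^sup>2) / (\<xi> ^ (k + 1) * \<omega>)"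
    using nz by (simp add: divide_simps power2_eq_square) (simp add: algebra_simps)
  finally have D: "pos_distance k a b c = fact k * (s * \<zeta> * \<xi> * (B * \<omega> + T * (p + q)) / (\<xi> ^ (k + 1) * \<omega>))"
    unfolding X using nz u by simp
  have e: "k + 4 = (k + 1) + 3" "k + 5 = (k + 4) + 1" by simp_all
  have "1 / s\<^sup>2 * (t / \<xi>\<^sup>2 * (t / \<zeta>\<^sup>2 * ((s * \<xi> * \<zeta> / \<omega>) ^ (k + 4) * U * (fact k * (s * \<zeta> * \<xi> * V / (\<xi> ^ (k + 1) * \<omega>))))))
     = fact k * U * (t\<^sup>2 * s ^ (k + 3) * \<xi>\<^sup>2 * \<zeta> ^ (k + 3) * V) / \<omega> ^ (k + 5)" for U V
    using nz by (simp add: power_mult_distrib power_divide power_add divide_simps eval_nat_numeral)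
  from this[of "unit_plane k g u v" "B * \<omega> + T * (p + q)"] show ?thesis
    unfolding mixed_density_def P D a_def[symmetric] b_def[symmetric] c_def[symmetric] unit_distance_def
      w p_def[symmetric] s_def[symmetric] q_def[symmetric] \<omega>_def[symmetric] T_def[symmetric]
    unfolding \<xi>_def[folded s_def, symmetric] \<zeta>_def[folded s_def, symmetric] B_def[symmetric] .
qed

text \<open>First b = t/(1-t); then a = t p/(1-(1-t) p) runs over the interval from 0 to 1 and c = t
  q/(1-t q) over the interval from 0 to b. Finally p = 1-u and q = 1-v.\<close>

lemma nn_integral_mixed_density_unit:
  assumes gm: "(\<lambda>(x, y). g x y) \<in> borel_measurable borel"
  shows "(\<integral>\<^sup>+b. \<integral>\<^sup>+a. (\<integral>\<^sup>+c. ennreal (mixed_density k g a b c) * indicator {..b} c \<partial>half_line) * indicator {..1} a \<partial>half_line \<partial>half_line)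
    = (\<integral>\<^sup>+u. \<integral>\<^sup>+v. \<integral>\<^sup>+t. ennreal (fact k * unit_plane k g u v * unit_distance k u v t / (1 - u * v) ^ (k + 5)) \<partial>unit_line \<partial>unit_line \<partial>unit_line)"
proof -
  let ?L = half_line and ?U = unit_line
  define \<Theta> where "\<Theta> = (\<lambda>a b c. ennreal (mixed_density k g a b c))"
  have m\<Theta>: "(\<lambda>(a, b, c). \<Theta> a b c) \<in> borel_measurable borel"
    using borel_measurable_mixed_density[OF gm] by (simp add: \<Theta>_def)
  note [measurable] = borel_measurable_compose3[OF m\<Theta>]
  have [measurable]: "(\<lambda>x. indicator {..f x} (h x) :: ennreal) \<in> borel_measurable M"
    if [measurable]: "f \<in> borel_measurable M" "h \<in> borel_measurable M" for f h :: "_ \<Rightarrow> real" and M :: "((real \<times> real) \<times> real) measure"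
    unfolding indicator_def greaterThan_iff atMost_iff by measurable
  define \<Psi> where "\<Psi> = (\<lambda>b a. \<integral>\<^sup>+c. \<Theta> a b c * indicator {..b} c \<partial>?L)"
  have [measurable]: "(\<lambda>(b, a). \<Psi> b a) \<in> borel_measurable (borel \<Otimes>\<^sub>M borel)"
    unfolding \<Psi>_def by measurable
  have \<Psi>: "\<Psi> (t / (1 - t)) a = (\<integral>\<^sup>+q. ennreal (t / (1 - t * q)\<^sup>2) * \<Theta> a (t / (1 - t)) (t * q / (1 - t * q)) \<partial>?U)" if t: "0 < t" "t < 1" for t a
  proof -
    have nz: "1 - t * q \<noteq> 0" if "q \<in> {0..1}" for q
    proof -
      have "t * q \<le> t * 1" using that t by (intro mult_left_mono) auto
      then show ?thesis using t by linarith
    qed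
    have "(\<integral>\<^sup>+c. \<Theta> a (t / (1 - t)) c * indicator {..t * 1 / (1 - t * 1)} c \<partial>?L)
       = (\<integral>\<^sup>+q. ennreal (t / (1 - t * q)\<^sup>2) * \<Theta> a (t / (1 - t)) (t * q / (1 - t * q)) \<partial>?U)"
    proof (rule nn_integral_half_line_unit_subst)
      show "((\<lambda>q. t * q / (1 - t * q)) has_real_derivative t / (1 - t * q)\<^sup>2) (at q)" if "q \<in> {0..1}" for q
        using nz[OF that] by (auto intro!: derivative_eq_intros simp: power2_eq_square algebra_simps)
      show "continuous_on {0..1} (\<lambda>q. t / (1 - t * q)\<^sup>2)"
        using nz by (auto intro!: continuous_intros)
    qed (use t in \<open>auto\<close>)
    then show ?thesis by (simp add: \<Psi>_def)
  qed
  have A: "(\<integral>\<^sup>+a. \<Psi> b a * indicator {..1} a \<partial>?L) = (\<integral>\<^sup>+p. ennreal (t / (1 - (1 - t) * p)\<^sup>2) * \<Psi> b (t * p / (1 - (1 - t) * p)) \<partial>?U)" if t: "0 < t" "t < 1" for t b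
  proof -
    have nz: "1 - (1 - t) * p \<noteq> 0" if "p \<in> {0..1}" for p
    proof -
      have "(1 - t) * p \<le> (1 - t) * 1" using that t by (intro mult_left_mono) auto
      also have "\<dots> < 1" using t by simp
      finally show ?thesis by simp
    qed
    have "(\<integral>\<^sup>+a. \<Psi> b a * indicator {..t * 1 / (1 - (1 - t) * 1)} a \<partial>?L)
       = (\<integral>\<^sup>+p. ennreal (t / (1 - (1 - t) * p)\<^sup>2) * \<Psi> b (t * p / (1 - (1 - t) * p)) \<partial>?U)"
    proof (rule nn_integral_half_line_unit_subst)
      show "((\<lambda>p. t * p / (1 - (1 - t) * p)) has_real_derivative t / (1 - (1 - t) * p)\<^sup>2) (at p)" if "p \<in> {0..1}" for p
        using nz[OF that] by (auto intro!: derivative_eq_intros simp: power2_eq_square) (simp add: algebra_simps)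
      show "continuous_on {0..1} (\<lambda>p. t / (1 - (1 - t) * p)\<^sup>2)"
        using nz by (auto intro!: continuous_intros)
    qed (use t in \<open>auto\<close>)
    then show ?thesis using t by simp
  qed
  define \<Omega> where "\<Omega> = (\<lambda>t p q. ennreal (1 / (1 - t)\<^sup>2) * (ennreal (t / (1 - (1 - t) * p)\<^sup>2) * (ennreal (t / (1 - t * q)\<^sup>2) *
    \<Theta> (t * p / (1 - (1 - t) * p)) (t / (1 - t)) (t * q / (1 - t * q)))))"
  have [measurable]: "(\<lambda>x. \<Omega> (f x) (h x) (l x)) \<in> borel_measurable M"
    if [measurable]: "f \<in> borel_measurable M" "h \<in> borel_measurable M" "l \<in> borel_measurable M" for f h l and M :: "'z measure"
    unfolding \<Omega>_def by measurable
  have "(\<integral>\<^sup>+b. \<integral>\<^sup>+a. \<Psi> b a * indicator {..1} a \<partial>?L \<partial>?L) = (\<integral>\<^sup>+t. ennreal (1 / (1 - t)\<^sup>2) * (\<integral>\<^sup>+a. \<Psi> (t / (1 - t)) a * indicator {..1} a \<partial>?L) \<partial>?U)"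
    by (rule nn_integral_half_line_odds) measurable
  also have "\<dots> = (\<integral>\<^sup>+t. ennreal (1 / (1 - t)\<^sup>2) * (\<integral>\<^sup>+p. ennreal (t / (1 - (1 - t) * p)\<^sup>2) * \<Psi> (t / (1 - t)) (t * p / (1 - (1 - t) * p)) \<partial>?U) \<partial>?U)"
    by (rule nn_integral_unit_line_cong) (simp add: A)
  also have "\<dots> = (\<integral>\<^sup>+t. \<integral>\<^sup>+p. \<integral>\<^sup>+q. \<Omega> t p q \<partial>?U \<partial>?U \<partial>?U)"
    by (rule nn_integral_unit_line_cong) (simp add: \<Psi> \<Omega>_def nn_integral_cmult)
  \<comment> \<open>Reflection of p and q brings in the variables u and v, in which the only
    remaining denominator is a power of 1 - uv.\<close>
  also have "\<dots> = (\<integral>\<^sup>+t. \<integral>\<^sup>+p. \<integral>\<^sup>+q. \<Omega> t p (1 - q) \<partial>?U \<partial>?U \<partial>?U)"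
    by (intro nn_integral_cong nn_integral_unit_line_reflect[symmetric]) measurable
  also have "\<dots> = (\<integral>\<^sup>+t. \<integral>\<^sup>+p. \<integral>\<^sup>+q. \<Omega> t (1 - p) (1 - q) \<partial>?U \<partial>?U \<partial>?U)"
    by (intro nn_integral_cong nn_integral_unit_line_reflect[symmetric, where f="\<lambda>p. \<integral>\<^sup>+q. \<Omega> _ p (1 - q) \<partial>?U"]) measurable
  also have "\<dots> = (\<integral>\<^sup>+u. \<integral>\<^sup>+t. \<integral>\<^sup>+v. \<Omega> t (1 - u) (1 - v) \<partial>?U \<partial>?U \<partial>?U)"
    by (rule unit_pair.Fubini') measurable
  also have "\<dots> = (\<integral>\<^sup>+u. \<integral>\<^sup>+v. \<integral>\<^sup>+t. \<Omega> t (1 - u) (1 - v) \<partial>?U \<partial>?U \<partial>?U)"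
    by (rule nn_integral_cong, rule unit_pair.Fubini') measurable
  also have "\<dots> = (\<integral>\<^sup>+u. \<integral>\<^sup>+v. \<integral>\<^sup>+t. ennreal (fact k * unit_plane k g u v * unit_distance k u v t / (1 - u * v) ^ (k + 5)) \<partial>?U \<partial>?U \<partial>?U)"
  proof (intro nn_integral_unit_line_cong)
    fix u v t :: real assume uvt: "0 < u" "u < 1" "0 < v" "v < 1" "0 < t" "t < 1"
    have e: "1 - (1 - t) * (1 - u) = t + (1 - t) * u" "1 - t * (1 - v) = (1 - t) + t * v"
      by (simp_all add: algebra_simps)
    show "\<Omega> t (1 - u) (1 - v) = ennreal (fact k * unit_plane k g u v * unit_distance k u v t / (1 - u * v) ^ (k + 5))"
      unfolding mixed_density_unit[OF uvt, symmetric] \<Omega>_def \<Theta>_def e using uvt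
      by (simp add: ennreal_mult' del: times_divide_eq_left times_divide_eq_right)
  qed
  finally show ?thesis unfolding \<Psi>_def \<Theta>_def .
qed

section \<open>Integrating out t\<close>

text \<open>The Beta integral by induction on b: one factor 1 - x is split off, and the difference
  of the two resulting values has the required form.\<close>

lemma has_bochner_integral_unit_line_beta:
  "has_bochner_integral unit_line (\<lambda>x. x ^ a * (1 - x) ^ b) (fact a * fact b / fact (a + b + 1))"
proof (induction b arbitrary: a)
  case 0
  have "has_bochner_integral unit_line (\<lambda>x. x ^ a) (1 / (real a + 1))"
  proof (rule has_bochner_integral_nn_integral)
    have "(\<integral>\<^sup>+x. ennreal (x ^ a) \<partial>unit_line) = (\<integral>\<^sup>+x. ennreal (x ^ a) * indicator {0..1} x \<partial>lborel)"
      by (subst nn_integral_unit_line, measurable, rule nn_integral_cong_AE,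
          use AE_lborel_singleton[of "0::real"] AE_lborel_singleton[of "1::real"] in eventually_elim)
        (auto simp: indicator_def)
    also have "\<dots> = ennreal (1 ^ Suc a / real (Suc a) - 0 ^ Suc a / real (Suc a))"
    proof (rule nn_integral_FTC_Icc)
      show "((\<lambda>x. x ^ Suc a / real (Suc a)) has_real_derivative x ^ a) (at x)" for x
        by (auto intro!: derivative_eq_intros simp del: power_Suc of_nat_Suc)
    qed auto
    finally show "(\<integral>\<^sup>+x. ennreal (x ^ a) \<partial>unit_line) = ennreal (1 / (real a + 1))" by (simp add: add.commute)
  qed (use AE_unit_line in \<open>auto elim: eventually_mono\<close>)
  then show ?case by (simp add: add.commute)
next
  case (Suc b)
  have "has_bochner_integral unit_line (\<lambda>x. x ^ a * (1 - x) ^ b - x ^ Suc a * (1 - x) ^ b)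
     (fact a * fact b / fact (a + b + 1) - fact (Suc a) * fact b / fact (Suc a + b + 1))"
    by (intro has_bochner_integral_diff Suc.IH)
  moreover have "x ^ a * (1 - x) ^ b - x ^ Suc a * (1 - x) ^ b = x ^ a * (1 - x) ^ Suc b" for x :: real
    by (simp add: algebra_simps)
  moreover have "fact a * fact b / fact (a + b + 1) - fact (Suc a) * fact b / fact (Suc a + b + 1)
      = (fact a * fact (Suc b) / fact (a + Suc b + 1) :: real)"
    by (simp add: divide_simps) (simp add: algebra_simps)
  ultimately show ?case by simp
qed

text \<open>The numerators left when both binomials in \<open>has_bochner_integral_beta_poly\<close>
  are expanded. All Beta integrals that occur have the same denominator (m+n+a+b+1)!, which is kept
  outside.\<close>

definition beta_poly :: "nat \<Rightarrow> nat \<Rightarrow> nat \<Rightarrow> nat \<Rightarrow> real \<Rightarrow> real \<Rightarrow> real" where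
  "beta_poly a b m n u v = (\<Sum>i\<le>m. \<Sum>j\<le>n. (real (m choose i) * real (n choose j) * (fact (m - i + j + a) * fact (i + (n - j) + b))) * u ^ i * v ^ j)"

lemma has_bochner_integral_beta_poly:
  "has_bochner_integral unit_line (\<lambda>t. t ^ a * (1 - t) ^ b * ((t + (1 - t) * u) ^ m * ((1 - t) + t * v) ^ n))
     (beta_poly a b m n u v / fact (m + n + a + b + 1))"
proof -
  have "has_bochner_integral unit_line (\<lambda>t. \<Sum>i\<le>m. \<Sum>j\<le>n. (real (m choose i) * real (n choose j) * u ^ i * v ^ j) * (t ^ (m - i + j + a) * (1 - t) ^ (i + (n - j) + b)))
    (\<Sum>i\<le>m. \<Sum>j\<le>n. (real (m choose i) * real (n choose j) * u ^ i * v ^ j) *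
       (fact (m - i + j + a) * fact (i + (n - j) + b) / fact (m - i + j + a + (i + (n - j) + b) + 1)))"
    by (intro has_bochner_integral_sum has_bochner_integral_mult_right has_bochner_integral_unit_line_beta)
  also have "(\<Sum>i\<le>m. \<Sum>j\<le>n. (real (m choose i) * real (n choose j) * u ^ i * v ^ j) *
       (fact (m - i + j + a) * fact (i + (n - j) + b) / fact (m - i + j + a + (i + (n - j) + b) + 1)))
     = beta_poly a b m n u v / fact (m + n + a + b + 1)"
    unfolding beta_poly_def sum_divide_distrib
  proof (intro sum.cong refl)
    fix i j assume "i \<in> {..m}" "j \<in> {..n}"
    then have "m - i + j + a + (i + (n - j) + b) + 1 = m + n + a + b + 1" by auto
    then show "real (m choose i) * real (n choose j) * u ^ i * v ^ j * (fact (m - i + j + a) * fact (i + (n - j) + b) / fact (m - i + j + a + (i + (n - j) + b) + 1))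
      = real (m choose i) * real (n choose j) * (fact (m - i + j + a) * fact (i + (n - j) + b)) * u ^ i * v ^ j / fact (m + n + a + b + 1)"
      by (simp only: times_divide_eq_right ac_simps)
  qed
  also have "(\<lambda>t. \<Sum>i\<le>m. \<Sum>j\<le>n. (real (m choose i) * real (n choose j) * u ^ i * v ^ j) * (t ^ (m - i + j + a) * (1 - t) ^ (i + (n - j) + b)))
     = (\<lambda>t. t ^ a * (1 - t) ^ b * ((t + (1 - t) * u) ^ m * ((1 - t) + t * v) ^ n))"
  proof
    fix t :: real
    have "t ^ a * (1 - t) ^ b * ((t + (1 - t) * u) ^ m * ((1 - t) + t * v) ^ n)
      = t ^ a * (1 - t) ^ b * ((\<Sum>i\<le>m. real (m choose i) * ((1 - t) * u) ^ i * t ^ (m - i)) * (\<Sum>j\<le>n. real (n choose j) * (t * v) ^ j * (1 - t) ^ (n - j)))"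
      by (simp only: binomial_ring[symmetric] add.commute)
    also have "\<dots> = (\<Sum>i\<le>m. \<Sum>j\<le>n. (real (m choose i) * real (n choose j) * u ^ i * v ^ j) * (t ^ (m - i + j + a) * (1 - t) ^ (i + (n - j) + b)))"
      unfolding sum_product unfolding sum_distrib_left
      by (intro sum.cong refl) (simp only: power_add power_mult_distrib ac_simps)
    finally show "(\<Sum>i\<le>m. \<Sum>j\<le>n. (real (m choose i) * real (n choose j) * u ^ i * v ^ j) * (t ^ (m - i + j + a) * (1 - t) ^ (i + (n - j) + b)))
     = t ^ a * (1 - t) ^ b * ((t + (1 - t) * u) ^ m * ((1 - t) + t * v) ^ n)"
      by (rule sym)
  qed
  finally show ?thesis .
qed

text \<open>The t-integral of \<open>unit_distance\<close> multiplied by (3k+12)!. The terms of the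
  first sum have Beta denominator (3k+11)!, hence the extra factor 3k+12.\<close>

definition unit_distance_moment :: "nat \<Rightarrow> real \<Rightarrow> real \<Rightarrow> real" where
  "unit_distance_moment k u v =
     (3 * real k + 12) * ((1 - u * v) * (\<Sum>i\<le>k. (1 - u) ^ (k - i) * beta_poly (2 + (k - i)) (k + 3) (2 + i) (k + 3) u v)) +
     (1 - u) ^ (k + 1) * (2 - u - v) * beta_poly (k + 3) (k + 3) 2 (k + 3) u v"

lemma has_bochner_integral_unit_distance:
  "has_bochner_integral unit_line (unit_distance k u v) (unit_distance_moment k u v / fact (3 * k + 12))"
proof -
  let ?B = "\<lambda>a m t. t ^ a * (1 - t) ^ (k + 3) * ((t + (1 - t) * u) ^ m * ((1 - t) + t * v) ^ (k + 3))"
  have "has_bochner_integral unit_line (\<lambda>t. (1 - u * v) * (\<Sum>i\<le>k. (1 - u) ^ (k - i) * ?B (2 + (k - i)) (2 + i) t)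
      + (1 - u) ^ (k + 1) * (2 - u - v) * ?B (k + 3) 2 t)
     ((1 - u * v) * (\<Sum>i\<le>k. (1 - u) ^ (k - i) * (beta_poly (2 + (k - i)) (k + 3) (2 + i) (k + 3) u v / fact ((2 + i) + (k + 3) + (2 + (k - i)) + (k + 3) + 1)))
      + (1 - u) ^ (k + 1) * (2 - u - v) * (beta_poly (k + 3) (k + 3) 2 (k + 3) u v / fact (2 + (k + 3) + (k + 3) + (k + 3) + 1)))"
    by (intro has_bochner_integral_add has_bochner_integral_sum has_bochner_integral_mult_right has_bochner_integral_beta_poly)
  also have "(\<lambda>t. (1 - u * v) * (\<Sum>i\<le>k. (1 - u) ^ (k - i) * ?B (2 + (k - i)) (2 + i) t)
      + (1 - u) ^ (k + 1) * (2 - u - v) * ?B (k + 3) 2 t) = unit_distance k u v"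
  proof
    fix t
    have "(1 - u * v) * (\<Sum>i\<le>k. (1 - u) ^ (k - i) * (t ^ (2 + (k - i)) * (1 - t) ^ (k + 3) * (x ^ (2 + i) * y ^ (k + 3))))
        + (1 - u) ^ (k + 1) * (2 - u - v) * (t ^ (k + 3) * (1 - t) ^ (k + 3) * (x ^ 2 * y ^ (k + 3)))
      = t\<^sup>2 * (1 - t) ^ (k + 3) * x\<^sup>2 * y ^ (k + 3) * ((\<Sum>i\<le>k. x ^ i * (t * (1 - u)) ^ (k - i)) * (1 - u * v) + (t * (1 - u)) ^ (k + 1) * (2 - u - v))" for x y
    proof -
      have "(\<Sum>i\<le>k. (1 - u) ^ (k - i) * (t ^ (2 + (k - i)) * (1 - t) ^ (k + 3) * (x ^ (2 + i) * y ^ (k + 3))))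
         = t\<^sup>2 * (1 - t) ^ (k + 3) * x\<^sup>2 * y ^ (k + 3) * (\<Sum>i\<le>k. x ^ i * (t * (1 - u)) ^ (k - i))"
        unfolding sum_distrib_left
        by (intro sum.cong refl) (simp only: power_add power_mult_distrib ac_simps)
      moreover have "t ^ (k + 3) = t\<^sup>2 * t ^ (k + 1)" by (simp add: eval_nat_numeral)
      ultimately show ?thesis
        by (simp only: distrib_left power_mult_distrib ac_simps)
    qed
    then show "(1 - u * v) * (\<Sum>i\<le>k. (1 - u) ^ (k - i) * ?B (2 + (k - i)) (2 + i) t)
      + (1 - u) ^ (k + 1) * (2 - u - v) * ?B (k + 3) 2 t = unit_distance k u v t"
      unfolding unit_distance_def .
  qed
  also have "((1 - u * v) * (\<Sum>i\<le>k. (1 - u) ^ (k - i) * (beta_poly (2 + (k - i)) (k + 3) (2 + i) (k + 3) u v / fact ((2 + i) + (k + 3) + (2 + (k - i)) + (k + 3) + 1)))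
      + (1 - u) ^ (k + 1) * (2 - u - v) * (beta_poly (k + 3) (k + 3) 2 (k + 3) u v / fact (2 + (k + 3) + (k + 3) + (k + 3) + 1)))
     = unit_distance_moment k u v / fact (3 * k + 12)"
  proof -
    have sum: "(\<Sum>i\<le>k. (1 - u) ^ (k - i) * (beta_poly (2 + (k - i)) (k + 3) (2 + i) (k + 3) u v / fact ((2 + i) + (k + 3) + (2 + (k - i)) + (k + 3) + 1)))
      = (\<Sum>i\<le>k. (1 - u) ^ (k - i) * beta_poly (2 + (k - i)) (k + 3) (2 + i) (k + 3) u v) / fact (3 * k + 11)"
      unfolding sum_divide_distrib
    proof (intro sum.cong refl)
      fix i assume "i \<in> {..k}"
      then have "(2 + i) + (k + 3) + (2 + (k - i)) + (k + 3) + 1 = 3 * k + 11" by auto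
      then show "(1 - u) ^ (k - i) * (beta_poly (2 + (k - i)) (k + 3) (2 + i) (k + 3) u v / fact ((2 + i) + (k + 3) + (2 + (k - i)) + (k + 3) + 1))
         = (1 - u) ^ (k - i) * beta_poly (2 + (k - i)) (k + 3) (2 + i) (k + 3) u v / fact (3 * k + 11)"
        by (simp only: times_divide_eq_right)
    qed
    have e: "2 + (k + 3) + (k + 3) + (k + 3) + 1 = 3 * k + 12" by simp
    have fact: "(fact (3 * k + 12) :: real) = (3 * real k + 12) * fact (3 * k + 11)"
      by (simp add: fact_reduce)
    have "W * (S / r) + Q * (b / ((3 * real k + 12) * r)) = ((3 * real k + 12) * (W * S) + Q * b) / ((3 * real k + 12) * r)"
      if "r \<noteq> 0" for W S Q b r :: real
    proof -
      have "3 * real k + 12 \<noteq> 0" by (smt (verit) of_nat_0_le_iff)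
      with that show ?thesis by (simp add: divide_simps)
    qed
    then show ?thesis
      unfolding sum e fact unit_distance_moment_def by simp
  qed
  finally show ?thesis .
qed

section \<open>From the double integral to a series\<close>

text \<open>The binomial series with negative integer exponent, its coefficients rewritten as
  ordinary binomial coefficients.\<close>

lemma inverse_power_sums:
  fixes x :: real
  assumes "\<bar>x\<bar> < 1"
  shows "(\<lambda>m. real ((m + s) choose s) * x ^ m) sums (1 / (1 - x) ^ (s + 1))"
proof -
  have "(\<lambda>m. (- real (s + 1) gchoose m) * (- x) ^ m) sums (1 + - x) powr (- real (s + 1))"
    by (rule gen_binomial_real) (use assms in simp)
  also have "(1 + - x) powr (- real (s + 1)) = 1 / (1 - x) ^ (s + 1)"
    using assms by (subst powr_minus_divide, subst powr_realpow) auto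
  also have "(\<lambda>m. (- real (s + 1) gchoose m) * (- x) ^ m) = (\<lambda>m. real ((m + s) choose s) * x ^ m)"
  proof
    fix m
    have "(real m + real s) gchoose m = real ((m + s) choose m)"
      by (simp add: binomial_gbinomial)
    also have "(m + s) choose m = (m + s) choose s"
      using binomial_symmetric[of m "m + s"] by simp
    finally have "(real m + real s) gchoose m = real ((m + s) choose s)" .
    then have "(- real (s + 1) gchoose m) = (- 1) ^ m * real ((m + s) choose s)"
      by (subst gbinomial_negated_upper) (simp add: algebra_simps)
    then show "(- real (s + 1) gchoose m) * (- x) ^ m = real ((m + s) choose s) * x ^ m"
      by (simp add: power_minus[of x] ac_simps)
  qed
  finally show ?thesis .
qed

text \<open>A polynomial in two variables as a sparse list of coefficients with exponents, so that
  its moments can be computed from explicit data.\<close>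

definition bipoly :: "(real \<times> nat \<times> nat) list \<Rightarrow> real \<Rightarrow> real \<Rightarrow> real" where
  "bipoly L u v = (\<Sum>(c, i, j)\<leftarrow>L. c * u ^ i * v ^ j)"

text \<open>The integral of (u v)^m times the polynomial over the unit square, written for real m to
  exhibit it as a rational function of m.\<close>

definition bipoly_mom :: "(real \<times> nat \<times> nat) list \<Rightarrow> real \<Rightarrow> real" where
  "bipoly_mom L m = (\<Sum>(c, i, j)\<leftarrow>L. c * (1 / (m + real (i + 1)) * (1 / (m + real (j + 1)))))"

lemma has_bochner_integral_bipoly:
  "has_bochner_integral (unit_line \<Otimes>\<^sub>M unit_line) (\<lambda>(u, v). (u * v) ^ m * bipoly L u v) (bipoly_mom L (real m))"
proof (induction L)
  case Nil
  have "has_bochner_integral (unit_line \<Otimes>\<^sub>M unit_line) (\<lambda>_. 0) (0::real)" by (rule has_bochner_integral_zero)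
  then show ?case by (simp add: bipoly_def bipoly_mom_def split_def)
next
  case (Cons q L)
  obtain c i j where q: "q = (c, i, j)" by (cases q)
  have b: "has_bochner_integral unit_line (\<lambda>x. x ^ a) (1 / (real a + 1))" for a
    using has_bochner_integral_unit_line_beta[of a 0] by (simp add: add.commute)
  have p: "has_bochner_integral (unit_line \<Otimes>\<^sub>M unit_line) (\<lambda>(u, v). u ^ (m + i) * v ^ (m + j)) (1 / (real (m + i) + 1) * (1 / (real (m + j) + 1)))"
    using has_bochner_integral_pair_times[OF sigma_finite_unit_line sigma_finite_unit_line b[of "m + i"] b[of "m + j"]] by (simp add: split_def)
  have "has_bochner_integral (unit_line \<Otimes>\<^sub>M unit_line) (\<lambda>p. c * (\<lambda>(u, v). u ^ (m + i) * v ^ (m + j)) p + (\<lambda>(u, v). (u * v) ^ m * bipoly L u v) p)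
     (c * (1 / (real (m + i) + 1) * (1 / (real (m + j) + 1))) + bipoly_mom L (real m))"
    by (intro has_bochner_integral_add has_bochner_integral_mult_right Cons p)
  then show ?case
    by (simp add: q bipoly_def bipoly_mom_def split_def power_add power_mult_distrib algebra_simps)
qed

text \<open>The negative power of 1 - uv is expanded in powers of uv. All terms are nonnegative on
  the open square, so summation and integration may be exchanged.\<close>

lemma nn_integral_bipoly_over_power:
  assumes nonneg: "\<And>u v. 0 < u \<Longrightarrow> u < 1 \<Longrightarrow> 0 < v \<Longrightarrow> v < 1 \<Longrightarrow> 0 \<le> bipoly L u v"
    and sums: "(\<lambda>m. real ((m + s) choose s) * bipoly_mom L (real m)) sums S"
  shows "(\<integral>\<^sup>+u. \<integral>\<^sup>+v. ennreal (bipoly L u v / (1 - u * v) ^ (s + 1)) \<partial>unit_line \<partial>unit_line) = ennreal S" and "0 \<le> S"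
proof -
  let ?P = "unit_line \<Otimes>\<^sub>M unit_line"
  have [measurable]: "(\<lambda>x. bipoly L (f x) (h x)) \<in> borel_measurable M"
    if [measurable]: "f \<in> borel_measurable M" "h \<in> borel_measurable M" for f h and M :: "'z measure"
    unfolding bipoly_def by (induction L) (auto simp: split_def)
  have AE: "AE q in ?P. (0 < fst q \<and> fst q < 1) \<and> 0 < snd q \<and> snd q < 1"
  proof (rule unit_pair.AE_pair_measure)
    show "AE x in unit_line. AE y in unit_line. (0 < fst (x, y) \<and> fst (x, y) < 1) \<and> 0 < snd (x, y) \<and> snd (x, y) < 1"
      using AE_unit_line by eventually_elim (use AE_unit_line in \<open>auto elim: eventually_mono\<close>)
  qed measurable
  define C where "C = (\<lambda>m. real ((m + s) choose s))"
  have C: "0 \<le> C m" for m by (simp add: C_def)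
  have mom: "(\<integral>\<^sup>+q. ennreal (C m * ((fst q * snd q) ^ m * bipoly L (fst q) (snd q))) \<partial>?P) = ennreal (C m * bipoly_mom L (real m))
      \<and> 0 \<le> C m * bipoly_mom L (real m)" for m
  proof -
    have hb: "has_bochner_integral ?P (\<lambda>q. C m * ((fst q * snd q) ^ m * bipoly L (fst q) (snd q))) (C m * bipoly_mom L (real m))"
      using has_bochner_integral_mult_right[OF has_bochner_integral_bipoly[of m L], of "C m"] by (simp add: split_def)
    have nn: "AE q in ?P. 0 \<le> C m * ((fst q * snd q) ^ m * bipoly L (fst q) (snd q))"
      using AE by eventually_elim (auto intro!: mult_nonneg_nonneg nonneg C)
    show ?thesis
      using nn_integral_eq_integral[OF integrable.intros[OF hb] nn] integral_nonneg_AE[OF nn]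
      unfolding has_bochner_integral_integral_eq[OF hb] by blast
  qed
  have "(\<integral>\<^sup>+u. \<integral>\<^sup>+v. ennreal (bipoly L u v / (1 - u * v) ^ (s + 1)) \<partial>unit_line \<partial>unit_line)
     = (\<integral>\<^sup>+q. ennreal (bipoly L (fst q) (snd q) / (1 - fst q * snd q) ^ (s + 1)) \<partial>?P)"
    by (subst unit_line.nn_integral_fst[symmetric]) auto
  also have "\<dots> = (\<integral>\<^sup>+q. (\<Sum>m. ennreal (C m * ((fst q * snd q) ^ m * bipoly L (fst q) (snd q)))) \<partial>?P)"
  proof (rule nn_integral_cong_AE, use AE in eventually_elim)
    fix q :: "real \<times> real" assume q: "(0 < fst q \<and> fst q < 1) \<and> 0 < snd q \<and> snd q < 1"
    have "fst q * snd q < 1 * 1" using q by (intro mult_strict_mono) auto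
    then have "\<bar>fst q * snd q\<bar> < 1" using q by simp
    from sums_mult2[OF inverse_power_sums[OF this], of s "bipoly L (fst q) (snd q)"]
    have "(\<lambda>m. C m * ((fst q * snd q) ^ m * bipoly L (fst q) (snd q))) sums (bipoly L (fst q) (snd q) / (1 - fst q * snd q) ^ (s + 1))"
      by (simp add: C_def mult.assoc)
    then show "ennreal (bipoly L (fst q) (snd q) / (1 - fst q * snd q) ^ (s + 1)) = (\<Sum>m. ennreal (C m * ((fst q * snd q) ^ m * bipoly L (fst q) (snd q))))"
      by (intro suminf_ennreal_eq[symmetric]) (use q in \<open>auto intro!: mult_nonneg_nonneg nonneg C\<close>)
  qed
  also have "\<dots> = (\<Sum>m. \<integral>\<^sup>+q. ennreal (C m * ((fst q * snd q) ^ m * bipoly L (fst q) (snd q))) \<partial>?P)"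
    by (rule nn_integral_suminf) measurable
  also have "\<dots> = (\<Sum>m. ennreal (C m * bipoly_mom L (real m)))"
    using mom by simp
  also have "\<dots> = ennreal S"
    using sums mom by (intro suminf_ennreal_eq) (auto simp: C_def)
  finally show "(\<integral>\<^sup>+u. \<integral>\<^sup>+v. ennreal (bipoly L u v / (1 - u * v) ^ (s + 1)) \<partial>unit_line \<partial>unit_line) = ennreal S" .
  show "0 \<le> S"
    using sums mom by (intro sums_le[OF _ sums_zero sums]) (auto simp: C_def)
qed

text \<open>Double poles give tails of the series for pi^2/6. A simple pole alone would diverge; as
  the coefficients \<beta> add up to zero, each 1/(m+r+1) may be replaced by its difference with
  1/(m+1), which telescopes to a harmonic number.\<close>

lemma partial_fraction_sums:
  fixes L :: "(real \<times> real \<times> nat) list"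
  assumes "(\<Sum>(\<alpha>, \<beta>, r)\<leftarrow>L. \<beta>) = 0"
  shows "(\<lambda>m. \<Sum>(\<alpha>, \<beta>, r)\<leftarrow>L. \<alpha> * (1 / (real m + real (Suc r)))\<^sup>2 + \<beta> * (1 / (real m + real (Suc r)))) sums
    (\<Sum>(\<alpha>, \<beta>, r)\<leftarrow>L. \<alpha> * (pi\<^sup>2 / 6 - (\<Sum>i<r. (1 / (real i + 1))\<^sup>2)) - \<beta> * (\<Sum>i<r. 1 / (real i + 1)))"
proof -
  have sq: "(\<lambda>m. (1 / (real m + real (Suc r)))\<^sup>2) sums (pi\<^sup>2 / 6 - (\<Sum>i<r. (1 / (real i + 1))\<^sup>2))" for r
  proof -
    have "(\<lambda>m. (1 / (real m + 1))\<^sup>2) sums (pi\<^sup>2 / 6)"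
      using inverse_squares_sums by (simp add: power_divide add.commute)
    from sums_split_initial_segment[OF this, of r] show ?thesis
      by (simp add: algebra_simps)
  qed
  have lin: "(\<lambda>m. 1 / (real m + real (Suc r)) - 1 / (real m + 1)) sums (- (\<Sum>i<r. 1 / (real i + 1)))" for r
  proof (induction r)
    case (Suc r)
    have "(\<lambda>m. 1 / (real m + real (Suc r))) \<longlonglongrightarrow> 0"
      by real_asymp
    from telescope_sums[OF this]
    have "(\<lambda>m. 1 / (real m + real (Suc (Suc r))) - 1 / (real m + real (Suc r))) sums (- (1 / (real r + 1)))"
      by (simp add: algebra_simps)
    from sums_add[OF Suc this] show ?case by simp
  qed simp
  have "(\<lambda>m. \<Sum>(\<alpha>, \<beta>, r)\<leftarrow>L. \<alpha> * (1 / (real m + real (Suc r)))\<^sup>2 + \<beta> * (1 / (real m + real (Suc r)) - 1 / (real m + 1))) sums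
    (\<Sum>(\<alpha>, \<beta>, r)\<leftarrow>L. \<alpha> * (pi\<^sup>2 / 6 - (\<Sum>i<r. (1 / (real i + 1))\<^sup>2)) + \<beta> * (- (\<Sum>i<r. 1 / (real i + 1))))"
  proof (induction L)
    case (Cons q L)
    obtain \<alpha> \<beta> r where q: "q = (\<alpha>, \<beta>, r)" by (cases q)
    show ?case
      unfolding q list.map sum_list.Cons prod.case
      by (intro sums_add sums_mult sq lin Cons.IH)
  qed simp
  moreover have "(\<Sum>(\<alpha>, \<beta>, r)\<leftarrow>L. \<alpha> * (1 / (x + real (Suc r)))\<^sup>2 + \<beta> * (1 / (x + real (Suc r)) - 1 / (x + 1)))
     = (\<Sum>(\<alpha>, \<beta>, r)\<leftarrow>L. \<alpha> * (1 / (x + real (Suc r)))\<^sup>2 + \<beta> * (1 / (x + real (Suc r))))" for x :: real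
  proof -
    have "(\<Sum>(\<alpha>, \<beta>, r)\<leftarrow>L. \<alpha> * (1 / (x + real (Suc r)))\<^sup>2 + \<beta> * (1 / (x + real (Suc r)) - 1 / (x + 1)))
      = (\<Sum>(\<alpha>, \<beta>, r)\<leftarrow>L. \<alpha> * (1 / (x + real (Suc r)))\<^sup>2 + \<beta> * (1 / (x + real (Suc r)))) - (\<Sum>(\<alpha>, \<beta>, r)\<leftarrow>L. \<beta>) * (1 / (x + 1))" for L :: "(real \<times> real \<times> nat) list"
      by (induction L) (auto simp: algebra_simps)
    then show ?thesis by (simp add: assms)
  qed
  ultimately show ?thesis by simp
qed

lemma unit_distance_nonneg:
  assumes "0 < u" "u < 1" "0 < v" "v < 1" "0 < t" "t < 1"
  shows "0 \<le> unit_distance k u v t"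
proof -
  have "u * v < 1 * 1" using assms by (intro mult_strict_mono) auto
  then have "0 \<le> 1 - u * v" "0 \<le> 2 - u - v" "0 \<le> t + (1 - t) * u" "0 \<le> (1 - t) + t * v" "0 \<le> t * (1 - u)" "0 \<le> 1 - t"
    using assms by (auto intro!: add_nonneg_nonneg)
  then show ?thesis
    unfolding unit_distance_def by (intro mult_nonneg_nonneg add_nonneg_nonneg sum_nonneg zero_le_power) (use assms in auto)
qed

lemma unit_distance_moment_nonneg:
  assumes "0 < u" "u < 1" "0 < v" "v < 1"
  shows "0 \<le> unit_distance_moment k u v"
proof -
  have "0 \<le> unit_distance_moment k u v / fact (3 * k + 12)"
  proof -
    have "AE t in unit_line. 0 \<le> unit_distance k u v t"
      using AE_unit_line by eventually_elim (auto intro: unit_distance_nonneg assms)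
    from integral_nonneg_AE[OF this] show ?thesis
      unfolding has_bochner_integral_integral_eq[OF has_bochner_integral_unit_distance] .
  qed
  then have "0 \<le> unit_distance_moment k u v / fact (3 * k + 12) * fact (3 * k + 12)" by (intro mult_nonneg_nonneg) auto
  then show ?thesis by simp
qed

text \<open>The arguments of g lie in the unit interval because 4(1-u)(1-v) is at most the square of
  (1-u) + (1-v), and 1 - uv lies between 0 and 1.\<close>

lemma unit_plane_nonneg:
  assumes uv: "0 < u" "u < 1" "0 < v" "v < 1"
    and g: "\<And>x y. 0 \<le> x \<Longrightarrow> x \<le> 1 \<Longrightarrow> 0 \<le> y \<Longrightarrow> y \<le> 1 \<Longrightarrow> 0 \<le> g x y"
  shows "0 \<le> unit_plane k g u v"
proof -
  have "u * v < 1 * 1" using uv by (intro mult_strict_mono) auto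
  then have \<omega>: "0 \<le> 1 - u * v" "1 - u * v \<le> 1" using uv by auto
  have w: "0 < 2 - u - v" using uv by simp
  have "0 \<le> (u - v)\<^sup>2" by simp
  then have le: "4 * (1 - u) * (1 - v) \<le> (2 - u - v)\<^sup>2" by (simp add: power2_eq_square algebra_simps)
  have nn: "0 \<le> 4 * (1 - u) * (1 - v)" using uv by simp
  have "4 * (1 - u) * (1 - v) * (1 - u * v) \<le> 4 * (1 - u) * (1 - v) * 1"
    using nn \<omega> by (intro mult_left_mono) auto
  with le have "4 * (1 - u) * (1 - v) * (1 - u * v) \<le> (2 - u - v)\<^sup>2" by simp
  then have "0 \<le> g (4 * (1 - u) * (1 - v) * (1 - u * v) / (2 - u - v)\<^sup>2) (4 * (1 - u) * (1 - v) / (2 - u - v)\<^sup>2)"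
    using le nn \<omega> w by (intro g) (auto simp: divide_simps)
  then show ?thesis
    unfolding unit_plane_def using w by simp
qed

text \<open>The factor 8 is 2 for the two parts of the linear form times 4 for the folding. D is a
  common numerical factor split off from the polynomial L.\<close>

lemma nn_integral_hyperplanes_mpp_series:
  assumes "odd k" and gs: "\<And>x y. g x y = g y x" and gm: "(\<lambda>(x, y). g x y) \<in> borel_measurable borel"
    and g: "\<And>\<alpha> \<beta>. quad_moment (Suc k) \<alpha> \<beta> = g (4 * \<alpha> * (1 - \<alpha>)) (4 * \<beta> * (1 - \<beta>))"
    and gn: "\<And>x y. 0 \<le> x \<Longrightarrow> x \<le> 1 \<Longrightarrow> 0 \<le> y \<Longrightarrow> y \<le> 1 \<Longrightarrow> 0 \<le> g x y"
    and "0 < D" and poly: "\<And>u v. 0 < u \<Longrightarrow> u < 1 \<Longrightarrow> 0 < v \<Longrightarrow> v < 1 \<Longrightarrow>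
        unit_plane k g u v * unit_distance_moment k u v = D * bipoly L u v"
    and sums: "(\<lambda>m. real ((m + (k + 4)) choose (k + 4)) * bipoly_mom L (real m)) sums S"
  shows "(\<integral>\<^sup>+a. \<integral>\<^sup>+b. \<integral>\<^sup>+c. plane_moment (Suc k) (vector [-a, b, c]) * distance_moment k (vector [-a, b, c]) \<partial>half_line \<partial>half_line \<partial>half_line)
    = ennreal (8 * (fact k * D / fact (3 * k + 12)) * S)" and "0 \<le> S"
proof -
  have nonneg: "0 \<le> bipoly L u v" if uv: "0 < u" "u < 1" "0 < v" "v < 1" for u v
  proof -
    have "0 \<le> D * bipoly L u v"
      unfolding poly[OF uv, symmetric] by (intro mult_nonneg_nonneg unit_plane_nonneg unit_distance_moment_nonneg uv gn)
    then show ?thesis using \<open>0 < D\<close> by (simp add: zero_le_mult_iff)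
  qed
  show "0 \<le> S" by (rule nn_integral_bipoly_over_power(2)[OF _ sums]) (rule nonneg)
  have bip: "(\<integral>\<^sup>+u. \<integral>\<^sup>+v. ennreal (bipoly L u v / (1 - u * v) ^ (k + 4 + 1)) \<partial>unit_line \<partial>unit_line) = ennreal S"
    by (rule nn_integral_bipoly_over_power(1)[OF _ sums]) (rule nonneg)
  have inner: "(\<integral>\<^sup>+t. ennreal (fact k * unit_plane k g u v * unit_distance k u v t / (1 - u * v) ^ (k + 5)) \<partial>unit_line)
     = ennreal (fact k * D / fact (3 * k + 12)) * ennreal (bipoly L u v / (1 - u * v) ^ (k + 4 + 1))"
    if uv: "0 < u" "u < 1" "0 < v" "v < 1" for u v
  proof -
    define K where "K = fact k * unit_plane k g u v / (1 - u * v) ^ (k + 5)"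
    have "u * v < 1 * 1" using uv by (intro mult_strict_mono) auto
    then have K: "0 \<le> K" unfolding K_def by (simp add: unit_plane_nonneg uv gn)
    have hb: "has_bochner_integral unit_line (\<lambda>t. K * unit_distance k u v t) (K * (unit_distance_moment k u v / fact (3 * k + 12)))"
      by (intro has_bochner_integral_mult_right has_bochner_integral_unit_distance)
    have "AE t in unit_line. 0 \<le> K * unit_distance k u v t"
      using AE_unit_line by eventually_elim (auto intro!: mult_nonneg_nonneg unit_distance_nonneg uv K)
    from nn_integral_eq_integral[OF integrable.intros[OF hb] this]
    have "(\<integral>\<^sup>+t. ennreal (K * unit_distance k u v t) \<partial>unit_line) = ennreal (K * (unit_distance_moment k u v / fact (3 * k + 12)))"
      unfolding has_bochner_integral_integral_eq[OF hb] .
    also have "K * (unit_distance_moment k u v / fact (3 * k + 12)) = fact k * (unit_plane k g u v * unit_distance_moment k u v) / fact (3 * k + 12) / (1 - u * v) ^ (k + 5)"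
      by (simp add: K_def ac_simps)
    also have "\<dots> = fact k * D / fact (3 * k + 12) * (bipoly L u v / (1 - u * v) ^ (k + 4 + 1))"
    proof -
      have e: "k + 4 + 1 = k + 5" by simp
      show ?thesis unfolding poly[OF uv] e by simp
    qed
    also have "ennreal \<dots> = ennreal (fact k * D / fact (3 * k + 12)) * ennreal (bipoly L u v / (1 - u * v) ^ (k + 4 + 1))"
      using \<open>0 < D\<close> by (intro ennreal_mult') simp
    finally show ?thesis by (simp add: K_def)
  qed
  have [measurable]: "(\<lambda>x. bipoly L (f x) (h x)) \<in> borel_measurable M"
    if [measurable]: "f \<in> borel_measurable M" "h \<in> borel_measurable M" for f h and M :: "'z measure"
    unfolding bipoly_def by (induction L) (auto simp: split_def)
  have "(\<integral>\<^sup>+u. \<integral>\<^sup>+v. \<integral>\<^sup>+t. ennreal (fact k * unit_plane k g u v * unit_distance k u v t / (1 - u * v) ^ (k + 5)) \<partial>unit_line \<partial>unit_line \<partial>unit_line)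
     = (\<integral>\<^sup>+u. \<integral>\<^sup>+v. ennreal (fact k * D / fact (3 * k + 12)) * ennreal (bipoly L u v / (1 - u * v) ^ (k + 4 + 1)) \<partial>unit_line \<partial>unit_line)"
    by (intro nn_integral_unit_line_cong inner)
  also have "\<dots> = ennreal (fact k * D / fact (3 * k + 12)) * (\<integral>\<^sup>+u. \<integral>\<^sup>+v. ennreal (bipoly L u v / (1 - u * v) ^ (k + 4 + 1)) \<partial>unit_line \<partial>unit_line)"
    by (simp add: nn_integral_cmult)
  also have "\<dots> = ennreal (fact k * D / fact (3 * k + 12) * S)"
    unfolding bip using \<open>0 < D\<close> by (intro ennreal_mult'[symmetric]) simp
  finally have "(\<integral>\<^sup>+a. \<integral>\<^sup>+b. \<integral>\<^sup>+c. plane_moment (Suc k) (vector [-a, b, c]) * distance_moment k (vector [-a, b, c]) \<partial>half_line \<partial>half_line \<partial>half_line)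
    = 2 * (4 * ennreal (fact k * D / fact (3 * k + 12) * S))"
    unfolding nn_integral_hyperplanes_mpp[where g=g, OF \<open>odd k\<close> gs gm g] nn_integral_mixed_density_fold[where g=g, OF gs gm] nn_integral_mixed_density_unit[OF gm]
    by simp
  also have "\<dots> = ennreal 8 * ennreal (fact k * D / fact (3 * k + 12) * S)"
    by (simp add: mult.assoc[symmetric])
  also have "\<dots> = ennreal (8 * (fact k * D / fact (3 * k + 12)) * S)"
    by (simp only: mult.assoc ennreal_mult'[symmetric] zero_le_numeral)
  finally show "(\<integral>\<^sup>+a. \<integral>\<^sup>+b. \<integral>\<^sup>+c. plane_moment (Suc k) (vector [-a, b, c]) * distance_moment k (vector [-a, b, c]) \<partial>half_line \<partial>half_line \<partial>half_line)
    = ennreal (8 * (fact k * D / fact (3 * k + 12)) * S)" .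
qed

section \<open>Partial fractions and the explicit polynomials\<close>

text \<open>Coefficient of the double pole of \<open>bipoly_mom\<close> at m = -(r+1): only
  monomials with both exponents equal to r produce one.\<close>

definition diag_coeff :: "(real \<times> nat \<times> nat) list \<Rightarrow> nat \<Rightarrow> real" where
  "diag_coeff L r = (\<Sum>(c, i, j)\<leftarrow>L. if i = r \<and> j = r then c else 0)"

text \<open>Coefficient of the simple pole at m = -(r+1), from splitting 1/((m+i+1)(m+j+1)) for
  distinct exponents i and j.\<close>

definition off_diag_coeff :: "(real \<times> nat \<times> nat) list \<Rightarrow> nat \<Rightarrow> real" where
  "off_diag_coeff L r = (\<Sum>(c, i, j)\<leftarrow>L. if i = r then if j = r then 0 else c / (real j - real i)
     else if j = r then c / (real i - real j) else 0)"

lemma bipoly_mom_partial_fractions: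
  assumes "0 \<le> m" and "list_all (\<lambda>(c, i, j). i < N \<and> j < N) L"
  shows "bipoly_mom L m = (\<Sum>r<N. diag_coeff L r * (1 / (m + real (Suc r)))\<^sup>2 + off_diag_coeff L r * (1 / (m + real (Suc r))))"
  using assms(2)
proof (induction L)
  case Nil
  show ?case by (simp add: bipoly_mom_def diag_coeff_def off_diag_coeff_def)
next
  case (Cons q L)
  obtain c i j where q: "q = (c, i, j)" by (cases q)
  with Cons have ij: "i < N" "j < N" by auto
  define x where "x = (\<lambda>r. 1 / (m + real (Suc r)))"
  define a where "a = (\<lambda>r. if i = r \<and> j = r then c else 0)"
  define b where "b = (\<lambda>r. if i = r then if j = r then 0 else c / (real j - real i) else if j = r then c / (real i - real j) else 0)"
  have "c * (x i * x j) = (\<Sum>r<N. a r * (x r)\<^sup>2 + b r * x r)"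
  proof (cases "i = j")
    case True
    have "(\<Sum>r<N. a r * (x r)\<^sup>2 + b r * x r) = (\<Sum>r<N. if r = i then c * (x i)\<^sup>2 else 0)"
      by (intro sum.cong) (auto simp: a_def b_def True)
    then show ?thesis using ij True by (simp add: power2_eq_square)
  next
    case False
    have "(\<Sum>r<N. a r * (x r)\<^sup>2 + b r * x r) = (\<Sum>r<N. (if r = i then c / (real j - real i) * x i else 0) + (if r = j then c / (real i - real j) * x j else 0))"
      using False by (intro sum.cong) (auto simp: a_def b_def)
    also have "\<dots> = c / (real j - real i) * x i + c / (real i - real j) * x j"
      using ij by (simp add: sum.distrib)
    also have "\<dots> = c * (x i * x j)"
    proof -
      have "m + real i + 1 \<noteq> 0" "m + real j + 1 \<noteq> 0" "real j - real i \<noteq> 0" "real i - real j \<noteq> 0"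
        using assms(1) False by auto
      then show ?thesis by (simp add: x_def divide_simps) (simp add: algebra_simps)
    qed
    finally show ?thesis ..
  qed
  moreover have "bipoly_mom (q # L) m = c * (x i * x j) + bipoly_mom L m"
    by (simp add: bipoly_mom_def q x_def add.commute)
  moreover have "diag_coeff (q # L) r = a r + diag_coeff L r" "off_diag_coeff (q # L) r = b r + off_diag_coeff L r" for r
    by (simp_all add: diag_coeff_def off_diag_coeff_def q a_def b_def)
  moreover have "bipoly_mom L m = (\<Sum>r<N. diag_coeff L r * (x r)\<^sup>2 + off_diag_coeff L r * x r)"
    using Cons by (simp add: x_def)
  ultimately have "bipoly_mom (q # L) m = (\<Sum>r<N. diag_coeff (q # L) r * (x r)\<^sup>2 + off_diag_coeff (q # L) r * x r)"
    by (simp add: sum.distrib[symmetric] distrib_right add_ac)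
  then show ?case unfolding x_def .
qed

text \<open>With y = m+r+1 and x = 1/y, division of C by y^2 with remainder y c1 + c0 shows how
  multiplication by C acts on a pole part: new coefficients of x^2 and x, and a polynomial
  rest.\<close>

lemma partial_fraction_mult:
  fixes C :: real
  assumes "C = y\<^sup>2 * Q + y * c1 + c0" and "y * x = 1"
  shows "C * (d * x\<^sup>2 + e * x) = (d * c0) * x\<^sup>2 + (d * c1 + e * c0) * x + (d * Q + e * (y * Q + c1))"
proof -
  have "C * (d * x\<^sup>2 + e * x) = (d * c0) * x\<^sup>2 + (d * c1 * (y * x) + e * c0) * x + (d * Q * (y * x)\<^sup>2 + e * (y * x) * (y * Q + c1))"
    unfolding assms(1) by (simp add: power2_eq_square algebra_simps)
  then show ?thesis unfolding assms(2) by simp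
qed

lemma fact_table: "fact 2 = (2 :: real)" "fact 3 = (6 :: real)" "fact 4 = (24 :: real)" "fact 5 = (120 :: real)" "fact 6 = (720 :: real)" "fact 7 = (5040 :: real)" "fact 8 = (40320 :: real)" "fact 9 = (362880 :: real)" "fact 10 = (3628800 :: real)" "fact 11 = (39916800 :: real)" "fact 12 = (479001600 :: real)" "fact 13 = (6227020800 :: real)" "fact 14 = (87178291200 :: real)" "fact 15 = (1307674368000 :: real)" "fact 16 = (20922789888000 :: real)" "fact 17 = (355687428096000 :: real)" "fact 18 = (6402373705728000 :: real)" "fact 19 = (121645100408832000 :: real)" "fact 20 = (2432902008176640000 :: real)" "fact 21 = (51090942171709440000 :: real)" "fact 22 = (1124000727777607680000 :: real)" "fact 23 = (25852016738884976640000 :: real)"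
  by (simp_all add: fact_numeral)

lemma sum_atMost_7_8:
  fixes f :: "nat \<Rightarrow> real"
  shows "sum f {..7} = f 0 + f 1 + f 2 + f 3 + f 4 + f 5 + f 6 + f 7"
    "sum f {..8} = f 0 + f 1 + f 2 + f 3 + f 4 + f 5 + f 6 + f 7 + f 8"
  by (simp_all add: numeral_eq_Suc)

lemma binomial_table_7_8:
  fixes n :: nat
  shows "7 choose 2 = (21 :: nat)" "7 choose 3 = (35 :: nat)" "7 choose 4 = (35 :: nat)" "7 choose 5 = (21 :: nat)" "7 choose 6 = (7 :: nat)" "8 choose 2 = (28 :: nat)" "8 choose 3 = (56 :: nat)" "8 choose 4 = (70 :: nat)" "8 choose 5 = (56 :: nat)" "8 choose 6 = (28 :: nat)" "8 choose 7 = (8 :: nat)"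
  by (simp_all add: numeral_eq_Suc)

text \<open>The Beta polynomials are evaluated one by one and then combined; the large constant is a
  common factor, and 21 in the proof is 3k+12.\<close>

lemma unit_distance_moment_3:
  "unit_distance_moment 3 u v = 438939648000 * (550 + 2200 * v + 4482 * v^2 + 5910 * v^3 + 5280 * v^4 + 2970 * v^5 + 715 * v^6 - 143 * v^7 + 2200 * u + 5775 * u * v + 6846 * u * v^2 + 3570 * u * v^3 - 1260 * u * v^4 - 3465 * u * v^5 - 2255 * u * v^6 - 429 * u * v^7 + 6743 * u^2 + 13629 * u^2 * v + 13125 * u^2 * v^2 + 6860 * u^2 * v^3 + 1050 * u^2 * v^4 - 1302 * u^2 * v^5 - 1331 * u^2 * v^6 - 660 * u^2 * v^7 + 17215 * u^3 + 26180 * u^3 * v + 18165 * u^3 * v^2 + 4200 * u^3 * v^3 - 4550 * u^3 * v^4 - 5775 * u^3 * v^5 - 3095 * u^3 * v^6 - 660 * u^3 * v^7 + 30151 * u^4 + 25872 * u^4 * v + 1050 * u^4 * v^2 - 15855 * u^4 * v^3 - 16905 * u^4 * v^4 - 9702 * u^4 * v^5 - 3179 * u^4 * v^6 - 450 * u^4 * v^7 + 27841 * u^5 - 3465 * u^5 * v - 28434 * u^5 * v^2 - 28385 * u^5 * v^3 - 16485 * u^5 * v^4 - 6237 * u^5 * v^5 - 1485 * u^5 * v^6 - 198 * u^5 * v^7 + 715 * u^6 - 27126 * u^6 * v - 26202 * u^6 * v^2 - 14400 * u^6 * v^3 - 5440 * u^6 * v^4 - 1485 * u^6 * v^5 - 308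 * u^6 * v^6 - 44 * u^6 * v^7 - 143 * u^7 - 429 * u^7 * v - 660 * u^7 * v^2 - 660 * u^7 * v^3 - 450 * u^7 * v^4 - 198 * u^7 * v^5 - 44 * u^7 * v^6)"
proof -
  have b5: "beta_poly 5 6 2 6 u v = 2414168064000 + 9656672256000 * v + 19752284160000 * v^2 + 26336378880000 * v^3 + 24141680640000 * v^4 + 14485008384000 * v^5 + 4483454976000 * v^6 + (8966909952000 * u + 28970016768000 * u * v + 48283361280000 * u * v^2 + 52672757760000 * u * v^3 + 39504568320000 * u * v^4 + 19313344512000 * u * v^5 + 4828336128000 * u * v^6) + (10461394944000 * u^2 + 26900729856000 * u^2 * v + 36212520960000 * u^2 * v^2 + 32188907520000 * u^2 * v^3 + 19752284160000 * u^2 * v^4 + 7900913664000 * u^2 * v^5 + 1609445376000 * u^2 * v^6)"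
    by (simp add: beta_poly_def sum_atMost_expand sum_atMost_7_8 binomial_table binomial_table_7_8 fact_table)
  have b4: "beta_poly 4 6 3 6 u v = 2414168064000 + 9656672256000 * v + 19752284160000 * v^2 + 26336378880000 * v^3 + 24141680640000 * v^4 + 14485008384000 * v^5 + 4483454976000 * v^6 + (13450364928000 * u + 43455025152000 * u * v + 72425041920000 * u * v^2 + 79009136640000 * u * v^3 + 59256852480000 * u * v^4 + 28970016768000 * u * v^5 + 7242504192000 * u * v^6) + (31384184832000 * u^2 + 80702189568000 * u^2 * v + 108637562880000 * u^2 * v^2 + 96566722560000 * u^2 * v^3 + 59256852480000 * u^2 * v^4 + 23702740992000 * u^2 * v^5 + 4828336128000 * u^2 * v^6) + (31384184832000 * u^3 + 62768369664000 * u^3 * v + 67251824640000 * u^3 * v^2 + 48283361280000 * u^3 * v^3 + 24141680640000 * u^3 * v^4 + 7900913664000 * u^3 * v^5 + 1316818944000 * u^3 * v^6)"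
    by (simp add: beta_poly_def sum_atMost_expand sum_atMost_7_8 binomial_table binomial_table_7_8 fact_table)
  have b3: "beta_poly 3 6 4 6 u v = 2414168064000 + 9656672256000 * v + 19752284160000 * v^2 + 26336378880000 * v^3 + 24141680640000 * v^4 + 14485008384000 * v^5 + 4483454976000 * v^6 + (17933819904000 * u + 57940033536000 * u * v + 96566722560000 * u * v^2 + 105345515520000 * u * v^3 + 79009136640000 * u * v^4 + 38626689024000 * u * v^5 + 9656672256000 * u * v^6) + (62768369664000 * u^2 + 161404379136000 * u^2 * v + 217275125760000 * u^2 * v^2 + 193133445120000 * u^2 * v^3 + 118513704960000 * u^2 * v^4 + 47405481984000 * u^2 * v^5 + 9656672256000 * u^2 * v^6) + (125536739328000 * u^3 + 251073478656000 * u^3 * v + 269007298560000 * u^3 * v^2 + 193133445120000 * u^3 * v^3 + 96566722560000 * u^3 * v^4 + 31603654656000 * u^3 * v^5 + 5267275776000 * u^3 * v^6) + (125536739328000 * u^4 + 188305108992000 * u^4 * v + 156920924160000 * u^4 * v^2 + 89669099520000 * u^4 * v^3 + 36212520960000 * u^4 * v^4 + 9656672256000 * u^4 * v^5 + 1316818944000 * u^4 * v^6)"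
    by (simp add: beta_poly_def sum_atMost_expand sum_atMost_7_8 binomial_table binomial_table_7_8 fact_table)
  have b2: "beta_poly 2 6 5 6 u v = 2414168064000 + 9656672256000 * v + 19752284160000 * v^2 + 26336378880000 * v^3 + 24141680640000 * v^4 + 14485008384000 * v^5 + 4483454976000 * v^6 + (22417274880000 * u + 72425041920000 * u * v + 120708403200000 * u * v^2 + 131681894400000 * u * v^3 + 98761420800000 * u * v^4 + 48283361280000 * u * v^5 + 12070840320000 * u * v^6) + (104613949440000 * u^2 + 269007298560000 * u^2 * v + 362125209600000 * u^2 * v^2 + 321889075200000 * u^2 * v^3 + 197522841600000 * u^2 * v^4 + 79009136640000 * u^2 * v^5 + 16094453760000 * u^2 * v^6) + (313841848320000 * u^3 + 627683696640000 * u^3 * v + 672518246400000 * u^3 * v^2 + 482833612800000 * u^3 * v^3 + 241416806400000 * u^3 * v^4 + 79009136640000 * u^3 * v^5 + 13168189440000 * u^3 * v^6) + (627683696640000 * u^4 + 941525544960000 * u^4 * v + 784604620800000 * u^4 * v^2 + 448345497600000 * u^4 * v^3 + 181062604800000 * u^4 * v^4 + 48283361280000 * u^4 * v^5 + 6584094720000 * u^4 * v^6) + (711374856192000 * u^5 + 753220435968000 * u^5 * v + 470762772480000 * u^5 * v^2 + 209227898880000 * u^5 * v^3 + 67251824640000 * u^5 * v^4 + 14485008384000 * u^5 * v^5 + 1609445376000 * u^5 * v^6)"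
    by (simp add: beta_poly_def sum_atMost_expand sum_atMost_7_8 binomial_table binomial_table_7_8 fact_table)
  have b6: "beta_poly 6 6 2 6 u v = 19313344512000 + 86910050304000 * v + 197522841600000 * v^2 + 289700167680000 * v^3 + 289700167680000 * v^4 + 188305108992000 * v^5 + 62768369664000 * v^6 + (62768369664000 * u + 231760134144000 * u * v + 434550251520000 * u * v^2 + 526727577600000 * u * v^3 + 434550251520000 * u * v^4 + 231760134144000 * u * v^5 + 62768369664000 * u * v^6) + (62768369664000 * u^2 + 188305108992000 * u^2 * v + 289700167680000 * u^2 * v^2 + 289700167680000 * u^2 * v^3 + 197522841600000 * u^2 * v^4 + 86910050304000 * u^2 * v^5 + 19313344512000 * u^2 * v^6)"
    by (simp add: beta_poly_def sum_atMost_expand sum_atMost_7_8 binomial_table binomial_table_7_8 fact_table)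
  have "unit_distance_moment 3 u v = 21 * ((1 - u * v) * ((1 - u) ^ 3 * beta_poly 5 6 2 6 u v + (1 - u) ^ 2 * beta_poly 4 6 3 6 u v + (1 - u) ^ 1 * beta_poly 3 6 4 6 u v + (1 - u) ^ 0 * beta_poly 2 6 5 6 u v)) + (1 - u) ^ 4 * (2 - u - v) * beta_poly 6 6 2 6 u v"
    by (simp add: unit_distance_moment_def sum_atMost_expand) (simp add: eval_nat_numeral)
  then show ?thesis
    unfolding b5 b4 b3 b2 b6 by algebra
qed

text \<open>As for k = 3, now with 3k+12 = 27.\<close>

lemma unit_distance_moment_5:
  "unit_distance_moment 5 u v = 7592461994557440000 * (182 + 910 * v + 2332 * v^2 + 3982 * v^3 + 4939 * v^4 + 4543 * v^5 + 3010 * v^6 + 1288 * v^7 + 238 * v^8 - 34 * v^9 + 910 * u + 3276 * u * v + 5688 * u * v^2 + 5775 * u * v^3 + 2871 * u * v^4 - 990 * u * v^5 - 3066 * u * v^6 - 2583 * u * v^7 - 1050 * u * v^8 - 136 * u * v^9 + 4402 * u^2 + 13968 * u^2 * v + 22932 * u^2 * v^2 + 25368 * u^2 * v^3 + 20790 * u^2 * v^4 + 13068 * u^2 * v^5 + 6132 * u^2 * v^6 + 1728 * u^2 * v^7 - 123 * u^2 * v^8 - 280 * u^2 * v^9 + 16402 * u^3 + 42000 * u^3 * v + 54348 * u^3 * v^2 + 43680 * u^3 * v^3 + 19950 * u^3 * v^4 - 462 * u^3 * v^5 - 8820 * u^3 * v^6 - 7248 * u^3 * v^7 - 2835 * u^3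 * v^8 - 385 * u^3 * v^9 + 45304 * u^4 + 86706 * u^4 * v + 78750 * u^4 * v^2 + 34440 * u^4 * v^3 - 6930 * u^4 * v^4 - 23184 * u^4 * v^5 - 18816 * u^4 * v^6 - 8820 * u^4 * v^7 - 2490 * u^4 * v^8 - 385 * u^4 * v^9 + 98728 * u^5 + 133560 * u^5 * v + 75168 * u^5 * v^2 - 462 * u^5 * v^3 - 37674 * u^5 * v^4 - 36288 * u^5 * v^5 - 20580 * u^5 * v^6 - 7938 * u^5 * v^7 - 2058 * u^5 * v^8 - 286 * u^5 * v^9 + 164470 * u^6 + 131484 * u^6 * v + 6132 * u^6 * v^2 - 70920 * u^6 * v^3 - 76776 * u^6 * v^4 - 49560 * u^6 * v^5 - 22764 * u^6 * v^6 - 7512 * u^6 * v^7 - 1605 * u^6 * v^8 - 154 * u^6 * v^9 + 162748 * u^7 - 2583 * u^7 * v - 132822 * u^7 * v^2 - 141798 * u^7 * v^3 - 92655 * u^7 * v^4 - 44163 * u^7 * v^5 - 15792 * u^7 * v^6 - 4068 * u^7 * v^7 - 672 * u^7 * v^8 - 55 * u^7 * v^9 + 238 * u^8 - 162510 * u^8 * v - 161583 * u^8 * v^2 - 97020 * u^8 * v^3 - 42855 * u^8 * v^4 - 14478 * u^8 * v^5 - 3675 * u^8 * v^6 - 672 * u^8 * v^7 - 90 * u^8 * v^8 - 10 * u^8 * v^9 - 34 * u^9 - 136 * u^9 * v - 280 * u^9 * v^2 - 385 * u^9 * v^3 - 385 * u^9 * v^4 - 286 * u^9 * v^5 - 154 *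 u^9 * v^6 - 55 * u^9 * v^7 - 10 * u^9 * v^8)"
proof -
  have b7: "beta_poly 7 8 2 8 u v = 7592461994557440000 + 37962309972787200000 * v + 97436595596820480000 * v^2 + 167034163880263680000 * v^3 + 208792704850329600000 * v^4 + 194873191193640960000 * v^5 + 132868084904755200000 * v^6 + 60739695956459520000 * v^7 + 14341317100830720000 * v^8 + (28682634201661440000 * u + 121479391912919040000 * u * v + 265736169809510400000 * u * v^2 + 389746382387281920000 * u * v^3 + 417585409700659200000 * u * v^4 + 334068327760527360000 * u * v^5 + 194873191193640960000 * u * v^6 + 75924619945574400000 * u * v^7 + 15184923989114880000 * u * v^8) + (32267963476869120000 * u^2 + 114730536806645760000 * u^2 * v + 212588935847608320000 * u^2 * v^2 + 265736169809510400000 * u^2 * v^3 + 243591488992051200000 * u^2 * v^4 + 167034163880263680000 * u^2 * v^5 + 83517081940131840000 * u^2 * v^6 + 27839027313377280000 * u^2 * v^7 + 4745288746598400000 * u^2 * v^8)"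
    by (simp add: beta_poly_def sum_atMost_expand sum_atMost_7_8 binomial_table binomial_table_7_8 fact_table)
  have b6: "beta_poly 6 8 3 8 u v = 7592461994557440000 + 37962309972787200000 * v + 97436595596820480000 * v^2 + 167034163880263680000 * v^3 + 208792704850329600000 * v^4 + 194873191193640960000 * v^5 + 132868084904755200000 * v^6 + 60739695956459520000 * v^7 + 14341317100830720000 * v^8 + (43023951302492160000 * u + 182219087869378560000 * u * v + 398604254714265600000 * u * v^2 + 584619573580922880000 * u * v^3 + 626378114550988800000 * u * v^4 + 501102491640791040000 * u * v^5 + 292309786790461440000 * u * v^6 + 113886929918361600000 * u * v^7 + 22777385983672320000 * u * v^8) + (96803890430607360000 * u^2 + 344191610419937280000 * u^2 * v + 637766807542824960000 * u^2 * v^2 + 797208509428531200000 * u^2 * v^3 + 730774466976153600000 * u^2 * v^4 + 501102491640791040000 * u^2 * v^5 + 250551245820395520000 * u^2 * v^6 + 83517081940131840000 * u^2 * v^7 + 14235866239795200000 * u^2 * v^8) + (87584472294359040000 * u^3 + 258143707814952960000 * u^3 * v + 401556878823260160000 * u^3 * v^2 + 425177871695216640000 * u^3 * v^3 + 332170212261888000000 * u^3 * v^4 + 194873191193640960000 * u^3 * v^5 + 83517081940131840000 * u^3 * v^6 + 23862023411466240000 * u^3 * v^7 + 3479878414172160000 * u^3 * v^8)"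
    by (simp add: beta_poly_def sum_atMost_expand sum_atMost_7_8 binomial_table binomial_table_7_8 fact_table)
  have b5: "beta_poly 5 8 4 8 u v = 7592461994557440000 + 37962309972787200000 * v + 97436595596820480000 * v^2 + 167034163880263680000 * v^3 + 208792704850329600000 * v^4 + 194873191193640960000 * v^5 + 132868084904755200000 * v^6 + 60739695956459520000 * v^7 + 14341317100830720000 * v^8 + (57365268403322880000 * u + 242958783825838080000 * u * v + 531472339619020800000 * u * v^2 + 779492764774563840000 * u * v^3 + 835170819401318400000 * u * v^4 + 668136655521054720000 * u * v^5 + 389746382387281920000 * u * v^6 + 151849239891148800000 * u * v^7 + 30369847978229760000 * u * v^8) + (193607780861214720000 * u^2 + 688383220839874560000 * u^2 * v + 1275533615085649920000 * u^2 * v^2 + 1594417018857062400000 * u^2 * v^3 + 1461548933952307200000 * u^2 * v^4 + 1002204983281582080000 * u^2 * v^5 + 501102491640791040000 * u^2 * v^6 + 167034163880263680000 * u^2 * v^7 + 28471732479590400000 * u^2 * v^8) + (350337889177436160000 * u^3 + 1032574831259811840000 * u^3 * v + 1606227515293040640000 * u^3 * v^2 + 1700711486780866560000 * u^3 * v^3 + 1328680849047552000000 * u^3 * v^4 + 779492764774563840000 * u^3 * v^5 + 334068327760527360000 * u^3 * v^6 + 95448093645864960000 * u^3 * v^7 + 13919513656688640000 * u^3 * v^8) + (291948240981196800000 * u^4 + 700675778354872320000 * u^4 * v + 903502977352335360000 * u^4 * v^2 + 803113757646520320000 * u^4 * v^3 + 531472339619020800000 * u^4 * v^4 + 265736169809510400000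 * u^4 * v^5 + 97436595596820480000 * u^4 * v^6 + 23862023411466240000 * u^4 * v^7 + 2982752926433280000 * u^4 * v^8)"
    by (simp add: beta_poly_def sum_atMost_expand sum_atMost_7_8 binomial_table binomial_table_7_8 fact_table)
  have b4: "beta_poly 4 8 5 8 u v = 7592461994557440000 + 37962309972787200000 * v + 97436595596820480000 * v^2 + 167034163880263680000 * v^3 + 208792704850329600000 * v^4 + 194873191193640960000 * v^5 + 132868084904755200000 * v^6 + 60739695956459520000 * v^7 + 14341317100830720000 * v^8 + (71706585504153600000 * u + 303698479782297600000 * u * v + 664340424523776000000 * u * v^2 + 974365955968204800000 * u * v^3 + 1043963524251648000000 * u * v^4 + 835170819401318400000 * u * v^5 + 487182977984102400000 * u * v^6 + 189811549863936000000 * u * v^7 + 37962309972787200000 * u * v^8) + (322679634768691200000 * u^2 + 1147305368066457600000 * u^2 * v + 2125889358476083200000 * u^2 * v^2 + 2657361698095104000000 * u^2 * v^3 + 2435914889920512000000 * u^2 * v^4 + 1670341638802636800000 * u^2 * v^5 + 835170819401318400000 * u^2 * v^6 + 278390273133772800000 * u^2 * v^7 + 47452887465984000000 * u^2 * v^8) + (875844722943590400000 * u^3 + 2581437078149529600000 * u^3 * v + 4015568788232601600000 * u^3 * v^2 + 4251778716952166400000 * u^3 * v^3 + 3321702122618880000000 * u^3 * v^4 + 1948731911936409600000 * u^3 * v^5 + 835170819401318400000 * u^3 * v^6 + 238620234114662400000 * u^3 * v^7 + 34798784141721600000 * u^3 * v^8) + (1459741204905984000000 * u^4 + 3503378891774361600000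 * u^4 * v + 4517514886761676800000 * u^4 * v^2 + 4015568788232601600000 * u^4 * v^3 + 2657361698095104000000 * u^4 * v^4 + 1328680849047552000000 * u^4 * v^5 + 487182977984102400000 * u^4 * v^6 + 119310117057331200000 * u^4 * v^7 + 14913764632166400000 * u^4 * v^8) + (1226182612121026560000 * u^5 + 2335585927849574400000 * u^5 * v + 2452365224242053120000 * u^5 * v^2 + 1807005954704670720000 * u^5 * v^3 + 1003892197058150400000 * u^5 * v^4 + 425177871695216640000 * u^5 * v^5 + 132868084904755200000 * u^5 * v^6 + 27839027313377280000 * u^5 * v^7 + 2982752926433280000 * u^5 * v^8)"
    by (simp add: beta_poly_def sum_atMost_expand sum_atMost_7_8 binomial_table binomial_table_7_8 fact_table)
  have b3: "beta_poly 3 8 6 8 u v = 7592461994557440000 + 37962309972787200000 * v + 97436595596820480000 * v^2 + 167034163880263680000 * v^3 + 208792704850329600000 * v^4 + 194873191193640960000 * v^5 + 132868084904755200000 * v^6 + 60739695956459520000 * v^7 + 14341317100830720000 * v^8 + (86047902604984320000 * u + 364438175738757120000 * u * v + 797208509428531200000 * u * v^2 + 1169239147161845760000 * u * v^3 + 1252756229101977600000 * u * v^4 + 1002204983281582080000 * u * v^5 + 584619573580922880000 * u * v^6 + 227773859836723200000 * u * v^7 + 45554771967344640000 * u * v^8) + (484019452153036800000 * u^2 + 1720958052099686400000 * u^2 * v + 3188834037714124800000 * u^2 * v^2 + 3986042547142656000000 * u^2 * v^3 + 3653872334880768000000 * u^2 * v^4 + 2505512458203955200000 * u^2 * v^5 +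 1252756229101977600000 * u^2 * v^6 + 417585409700659200000 * u^2 * v^7 + 71179331198976000000 * u^2 * v^8) + (1751689445887180800000 * u^3 + 5162874156299059200000 * u^3 * v + 8031137576465203200000 * u^3 * v^2 + 8503557433904332800000 * u^3 * v^3 + 6643404245237760000000 * u^3 * v^4 + 3897463823872819200000 * u^3 * v^5 + 1670341638802636800000 * u^3 * v^6 + 477240468229324800000 * u^3 * v^7 + 69597568283443200000 * u^3 * v^8) + (4379223614717952000000 * u^4 + 10510136675323084800000 * u^4 * v + 13552544660285030400000 * u^4 * v^2 + 12046706364697804800000 * u^4 * v^3 + 7972085094285312000000 * u^4 * v^4 + 3986042547142656000000 * u^4 * v^5 + 1461548933952307200000 * u^4 * v^6 + 357930351171993600000 * u^4 * v^7 + 44741293896499200000 * u^4 * v^8) + (7357095672726159360000 * u^5 + 14013515567097446400000 * u^5 * v + 14714191345452318720000 * u^5 * v^2 + 10842035728228024320000 * u^5 * v^3 + 6023353182348902400000 * u^5 * v^4 + 2551067230171299840000 * u^5 * v^5 + 797208509428531200000 * u^5 * v^6 + 167034163880263680000 * u^5 * v^7 + 17896517558599680000 * u^5 * v^8) + (6744004366665646080000 * u^6 + 9809460896968212480000 * u^6 * v + 8174550747473510400000 * u^6 * v^2 + 4904730448484106240000 * u^6 * v^3 + 2258757443380838400000 * u^6 * v^4 + 803113757646520320000 * u^6 * v^5 + 212588935847608320000 * u^6 * v^6 + 37962309972787200000 * u^6 * v^7 + 3479878414172160000 * u^6 * v^8)"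
    by (simp add: beta_poly_def sum_atMost_expand sum_atMost_7_8 binomial_table binomial_table_7_8 fact_table)
  have b2: "beta_poly 2 8 7 8 u v = 7592461994557440000 + 37962309972787200000 * v + 97436595596820480000 * v^2 + 167034163880263680000 * v^3 + 208792704850329600000 * v^4 + 194873191193640960000 * v^5 + 132868084904755200000 * v^6 + 60739695956459520000 * v^7 + 14341317100830720000 * v^8 + (100389219705815040000 * u + 425177871695216640000 * u * v + 930076594333286400000 * u * v^2 + 1364112338355486720000 * u * v^3 + 1461548933952307200000 * u * v^4 + 1169239147161845760000 * u * v^5 + 682056169177743360000 * u * v^6 + 265736169809510400000 * u * v^7 + 53147233961902080000 * u * v^8) + (677627233014251520000 * u^2 + 2409341272939560960000 * u^2 * v + 4464367652799774720000 * u^2 * v^2 + 5580459565999718400000 * u^2 * v^3 + 5115421268833075200000 * u^2 * v^4 + 3507717441485537280000 * u^2 * v^5 + 1753858720742768640000 * u^2 * v^6 + 584619573580922880000 * u^2 * v^7 + 99651063678566400000 * u^2 * v^8) + (3065456530302566400000 * u^3 + 9035029773523353600000 * u^3 * v + 14054490758814105600000 * u^3 * v^2 + 14881225509332582400000 * u^3 * v^3 + 11625957429166080000000 * u^3 * v^4 + 6820561691777433600000 * u^3 * v^5 + 2923097867904614400000 * u^3 * v^6 + 835170819401318400000 * u^3 * v^7 + 121795744496025600000 * u^3 * v^8) + (10218188434341888000000 * u^4 + 24523652242420531200000 * u^4 * v + 31622604207331737600000 * u^4 * v^2 + 28108981517628211200000 * u^4 * v^3 + 18601531886665728000000 * u^4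 * v^4 + 9300765943332864000000 * u^4 * v^5 + 3410280845888716800000 * u^4 * v^6 + 835170819401318400000 * u^4 * v^7 + 104396352425164800000 * u^4 * v^8) + (25749834854541557760000 * u^5 + 49047304484841062400000 * u^5 * v + 51499669709083115520000 * u^5 * v^2 + 37947125048798085120000 * u^5 * v^3 + 21081736138221158400000 * u^5 * v^4 + 8928735305599549440000 * u^5 * v^5 + 2790229782999859200000 * u^5 * v^6 + 584619573580922880000 * u^5 * v^7 + 62637811455098880000 * u^5 * v^8) + (47208030566659522560000 * u^6 + 68666226278777487360000 * u^6 * v + 57221855232314572800000 * u^6 * v^2 + 34333113139388743680000 * u^6 * v^3 + 15811302103665868800000 * u^6 * v^4 + 5621796303525642240000 * u^6 * v^5 + 1488122550933258240000 * u^6 * v^6 + 265736169809510400000 * u^6 * v^7 + 24359148899205120000 * u^6 * v^8) + (51704033477769953280000 * u^7 + 53952034933325168640000 * u^7 * v + 34333113139388743680000 * u^7 * v^2 + 16349101494947020800000 * u^7 * v^3 + 6130913060605132800000 * u^7 * v^4 + 1807005954704670720000 * u^7 * v^5 + 401556878823260160000 * u^7 * v^6 + 60739695956459520000 * u^7 * v^7 + 4745288746598400000 * u^7 * v^8)"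
    by (simp add: beta_poly_def sum_atMost_expand sum_atMost_7_8 binomial_table binomial_table_7_8 fact_table)
  have b8: "beta_poly 8 8 2 8 u v = 75924619945574400000 + 417585409700659200000 * v + 1169239147161845760000 * v^2 + 2171444130443427840000 * v^3 + 2923097867904614400000 * v^4 + 2923097867904614400000 * v^5 + 2125889358476083200000 * v^6 + 1032574831259811840000 * v^7 + 258143707814952960000 * v^8 + (258143707814952960000 * u + 1214793919129190400000 * u * v + 2923097867904614400000 * u * v^2 + 4676956588647383040000 * u * v^3 + 5428610326108569600000 * u * v^4 + 4676956588647383040000 * u * v^5 + 2923097867904614400000 * u * v^6 + 1214793919129190400000 * u * v^7 + 258143707814952960000 * u * v^8) + (258143707814952960000 * u^2 + 1032574831259811840000 * u^2 * v + 2125889358476083200000 * u^2 * v^2 + 2923097867904614400000 * u^2 * v^3 + 2923097867904614400000 * u^2 * v^4 + 2171444130443427840000 * u^2 * v^5 + 1169239147161845760000 * u^2 * v^6 + 417585409700659200000 * u^2 * v^7 + 75924619945574400000 * u^2 * v^8)"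
    by (simp add: beta_poly_def sum_atMost_expand sum_atMost_7_8 binomial_table binomial_table_7_8 fact_table)
  have "unit_distance_moment 5 u v = 27 * ((1 - u * v) * ((1 - u) ^ 5 * beta_poly 7 8 2 8 u v + (1 - u) ^ 4 * beta_poly 6 8 3 8 u v + (1 - u) ^ 3 * beta_poly 5 8 4 8 u v + (1 - u) ^ 2 * beta_poly 4 8 5 8 u v + (1 - u) ^ 1 * beta_poly 3 8 6 8 u v + (1 - u) ^ 0 * beta_poly 2 8 7 8 u v)) + (1 - u) ^ 6 * (2 - u - v) * beta_poly 8 8 2 8 u v"
    by (simp add: unit_distance_moment_def sum_atMost_expand) (simp add: eval_nat_numeral)
  then show ?thesis
    unfolding b7 b6 b5 b4 b3 b2 b8 by algebra
qed

definition quad_poly_4 :: "real \<Rightarrow> real \<Rightarrow> real" where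
  "quad_poly_4 x y = 51840 - 42120 * x * y + 4860 * x * y * (x + y)"
definition quad_poly_6 :: "real \<Rightarrow> real \<Rightarrow> real" where
  "quad_poly_6 x y = 1559900160 - 2551772160 * x * y + 683665920 * x * y * (x + y) - 48988800 * x * y * (x^2 + y^2) - 47355840 * x^2 * y^2"

lemma sum_lessThan_expand:
  fixes f :: "nat \<Rightarrow> real"
  shows "sum f {..<15} = f 0 + f 1 + f 2 + f 3 + f 4 + f 5 + f 6 + f 7 + f 8 + f 9 + f 10 + f 11 + f 12 + f 13 + f 14"
    "sum f {..<19} = f 0 + f 1 + f 2 + f 3 + f 4 + f 5 + f 6 + f 7 + f 8 + f 9 + f 10 + f 11 + f 12 + f 13 + f 14 + f 15 + f 16 + f 17 + f 18"
  by (simp_all add: numeral_eq_Suc)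

lemma partial_fraction_distrib:
  fixes C :: real
  shows "C * (a + (d * x\<^sup>2 + e * x)) = C * a + C * (d * x\<^sup>2 + e * x)"
  by (rule distrib_left)

lemma harmonic_table:
  "(\<Sum>i<0. 1 / (real i + 1)) = 0" "(\<Sum>i<0. (1 / (real i + 1))\<^sup>2) = 0" "(\<Sum>i<1. 1 / (real i + 1)) = 1" "(\<Sum>i<1. (1 / (real i + 1))\<^sup>2) = 1" "(\<Sum>i<2. 1 / (real i + 1)) = 3 / 2" "(\<Sum>i<2. (1 / (real i + 1))\<^sup>2) = 5 / 4" "(\<Sum>i<3. 1 / (real i + 1)) = 11 / 6" "(\<Sum>i<3. (1 / (real i + 1))\<^sup>2) = 49 / 36" "(\<Sum>i<4. 1 / (real i + 1)) = 25 / 12" "(\<Sum>i<4. (1 / (real i + 1))\<^sup>2) = 205 / 144" "(\<Sum>i<5. 1 / (real i + 1)) = 137 / 60" "(\<Sum>i<5. (1 / (real i + 1))\<^sup>2) = 5269 / 3600" "(\<Sum>i<6. 1 / (real i + 1)) = 49 / 20" "(\<Sum>i<6. (1 / (real i + 1))\<^sup>2) = 5369 / 3600" "(\<Sum>i<7. 1 / (real i + 1)) = 363 / 140" "(\<Sum>i<7. (1 / (real i + 1))\<^sup>2) = 266681 / 176400" "(\<Sum>i<8. 1 / (real i + 1)) = 761 / 280" "(\<Sum>i<8. (1 / (real i + 1))\<^sup>2) = 1077749 / 705600" "(\<Sum>i<9. 1 / (real i + 1)) = 7129 / 2520" "(\<Sum>i<9. (1 / (real i + 1))\<^sup>2) =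 9778141 / 6350400" "(\<Sum>i<10. 1 / (real i + 1)) = 7381 / 2520" "(\<Sum>i<10. (1 / (real i + 1))\<^sup>2) = 1968329 / 1270080" "(\<Sum>i<11. 1 / (real i + 1)) = 83711 / 27720" "(\<Sum>i<11. (1 / (real i + 1))\<^sup>2) = 239437889 / 153679680" "(\<Sum>i<12. 1 / (real i + 1)) = 86021 / 27720" "(\<Sum>i<12. (1 / (real i + 1))\<^sup>2) = 240505109 / 153679680" "(\<Sum>i<13. 1 / (real i + 1)) = 1145993 / 360360" "(\<Sum>i<13. (1 / (real i + 1))\<^sup>2) = 40799043101 / 25971865920" "(\<Sum>i<14. 1 / (real i + 1)) = 1171733 / 360360" "(\<Sum>i<14. (1 / (real i + 1))\<^sup>2) = 40931552621 / 25971865920" "(\<Sum>i<15. 1 / (real i + 1)) = 1195757 / 360360" "(\<Sum>i<15. (1 / (real i + 1))\<^sup>2) = 205234915681 / 129859329600" "(\<Sum>i<16. 1 / (real i + 1)) = 2436559 / 720720" "(\<Sum>i<16. (1 / (real i + 1))\<^sup>2) = 822968714749 / 519437318400" "(\<Sum>i<17. 1 / (real i + 1)) = 42142223 / 12252240" "(\<Sum>i<17. (1 / (real i + 1))\<^sup>2) = 238357395880861 / 150117385017600" "(\<Sum>i<18. 1 / (real i + 1)) = 14274301 / 4084080" "(\<Sum>i<18. (1 / (real i + 1))\<^sup>2) = 238820721143261 / 150117385017600"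
  by (simp_all add: lessThan_nat_numeral lessThan_Suc power_divide)

text \<open>The expanded product of the plane and distance polynomials for k = 3 after removal of
  the common factor; both exponents are at most 14.\<close>

definition bipoly_3 :: "(real \<times> nat \<times> nat) list" where
  "bipoly_3 = [(26400, 0, 0), (13200, 0, 1), (2836, 0, 2), (-2346, 0, 3), (-3188, 0, 4), (-1860, 0, 5), (-3894, 0, 6), (-12056, 0, 7), (-14058, 0, 8), (9915, 0, 9), (33745, 0, 10), (-41349, 0, 11), (17193, 0, 12), (-2717, 0, 13), (143, 0, 14), (13200, 1, 0), (-184800, 1, 1), (-87218, 1, 2), (-14670, 1, 3), (17685, 1, 4), (19660, 1, 5), (18105, 1, 6), (51744, 1, 7), (91399, 1, 8), (2514, 1, 9), (-176640, 1, 10), (139255, 1, 11), (-32538, 1, 12), (-891, 1, 13), (429, 1, 14), (111364, 2, 0), (-141482, 2, 1), (539150, 2, 2), (235892, 2, 3), (36559, 2, 4), (-37634, 2, 5), (-58935, 2, 6), (-129580, 2, 7), (-243693, 2, 8), (-82826, 2, 9), (414177, 2, 10), (-286028, 2, 11), (68765, 2, 12), (-3905, 2, 13), (660, 2, 14), (160446, 3, 0), (-828630, 3, 1), (588608, 3, 2), (-832500, 3, 3), (-332340, 3, 4), (-79466, 3, 5), (18543, 3, 6), (194140, 3, 7), (447935, 3, 8), (241260, 3, 9), (-661397, 3, 10), (418118, 3, 11), (-86373, 3, 12), (-2240, 3, 13), (660, 3, 14), (-61974, 4, 0), (-789492, 4, 1), (2268166, 4, 2), (-1164388, 4, 3), (779488,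 4, 4), (298752, 4, 5), (133415, 4, 6), (-73108, 4, 7), (-505991, 4, 8), (-435086, 4, 9), (718275, 4, 10), (-413205, 4, 11), (79000, 4, 12), (-316, 4, 13), (450, 4, 14), (-420145, 5, 0), (1150160, 5, 1), (620317, 5, 2), (-2308812, 5, 3), (995140, 5, 4), (-670590, 5, 5), (-289186, 5, 6), (-51452, 5, 7), (357668, 5, 8), (463308, 5, 9), (-547485, 5, 10), (292661, 5, 11), (-51277, 5, 12), (189, 5, 13), (198, 5, 14), (20977, 6, 0), (1838210, 6, 1), (-3694623, 6, 2), (1657768, 6, 3), (-547146, 6, 4), (45442, 6, 5), (790756, 6, 6), (314558, 6, 7), (-200158, 6, 8), (-414433, 6, 9), (283395, 6, 10), (-99402, 6, 11), (6790, 6, 12), (406, 6, 13), (44, 6, 14), (1728914, 7, 0), (-5270650, 7, 1), (4968975, 7, 2), (-3079788, 7, 3), (1082263, 7, 4), (1870398, 7, 5), (-594364, 7, 6), (-746584, 7, 7), (-192720, 7, 8), (257250, 7, 9), (-11779, 7, 10), (-13632, 7, 11), (3683, 7, 12), (618, 7, 13), (-3446256, 8, 0), (6010697, 8, 1), (-4749866, 8, 2), (1623655, 8, 3), (4221760, 8, 4), (-3565167, 8, 5), (-736015, 8, 6), (300178, 8, 7), (351580, 8, 8), (25030, 8, 9), (-46493, 8, 10), (18342, 8, 11), (-5451, 8, 12), (590, 8, 13), (3075831, 9, 0), (-1964556, 9, 1), (-761126, 9, 2), (5792015, 9, 3), (-8228753, 9, 4), (1835735, 9, 5), (718328, 9,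 6), (230118, 9, 7), (-20190, 9, 8), (-28594, 9, 9), (16270, 9, 10), (-14878, 9, 11), (-1470, 9, 12), (500, 9, 13), (-1395207, 10, 0), (-1411146, 10, 1), (3204251, 10, 2), (-6293548, 10, 3), (4971216, 10, 4), (-443479, 10, 5), (120603, 10, 6), (44746, 10, 7), (-21622, 10, 8), (-33472, 10, 9), (-32094, 10, 10), (-4954, 10, 11), (3602, 10, 12), (396, 10, 13), (281974, 11, 0), (1380544, 11, 1), (-1685587, 11, 2), (2850954, 11, 3), (-1769805, 11, 4), (313010, 11, 5), (-101663, 11, 6), (-140248, 11, 7), (-69837, 11, 8), (-14878, 11, 9), (8612, 11, 10), (7260, 11, 11), (132, 11, 12), (264, 11, 13), (-7678, 12, 0), (-380732, 12, 1), (245123, 12, 2), (-520485, 12, 3), (255358, 12, 4), (-44494, 12, 5), (-13559, 12, 6), (19510, 12, 7), (21681, 12, 8), (12096, 12, 9), (3602, 12, 10), (132, 12, 11), (528, 12, 12), (-2717, 13, 0), (23980, 13, 1), (20966, 13, 2), (9065, 13, 3), (1945, 13, 4), (189, 13, 5), (406, 13, 6), (618, 13, 7), (590, 13, 8), (500, 13, 9), (396, 13, 10), (264, 13, 11), (143, 14, 0), (429, 14, 1), (660, 14, 2), (660, 14, 3), (450, 14, 4), (198, 14, 5), (44, 14, 6)]"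

text \<open>The constant is 51840 * 438939648000, where 51840 is the common factor of the three
  coefficients of the plane polynomial and the other number comes from
  \<open>unit_distance_moment_3\<close>.\<close>

lemma unit_plane_distance_3:
  assumes "u < 1" "v < 1"
  shows "unit_plane 3 quad_poly_4 u v * unit_distance_moment 3 u v = 22754631352320000 * bipoly bipoly_3 u v"
proof -
  define p q \<omega> w where "p = 1 - u" and "q = 1 - v" and "\<omega> = 1 - u * v" and "w = 2 - u - v"
  note defs = this
  have "w \<noteq> 0" using assms by (simp add: defs)
  \<comment> \<open>The arguments of g have denominator w^2, so cubic terms in each pair X, Y need
    w^6 at most and w^7 clears them all.\<close>
  then have plane: "unit_plane 3 quad_poly_4 u v = 51840 * w^7 - 673920 * p^2*q^2*\<omega> * w^3 + 311040 * p^3*q^3*\<omega>*(1 + \<omega>) * w"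
    unfolding unit_plane_def quad_poly_4_def defs[symmetric] by (simp add: field_simps eval_nat_numeral)
  show ?thesis
    unfolding plane unit_distance_moment_3 bipoly_def bipoly_3_def list.map sum_list.Cons sum_list.Nil prod.case defs
    by algebra
qed

lemma bipoly_3_coeffs:
  "diag_coeff bipoly_3 0 = 26400" "diag_coeff bipoly_3 1 = -184800" "diag_coeff bipoly_3 2 = 539150" "diag_coeff bipoly_3 3 = -832500" "diag_coeff bipoly_3 4 = 779488" "diag_coeff bipoly_3 5 = -670590" "diag_coeff bipoly_3 6 = 790756" "diag_coeff bipoly_3 7 = -746584" "diag_coeff bipoly_3 8 = 351580" "diag_coeff bipoly_3 9 = -28594" "diag_coeff bipoly_3 10 = -32094" "diag_coeff bipoly_3 11 = 7260" "diag_coeff bipoly_3 12 = 528" "diag_coeff bipoly_3 13 = 0" "diag_coeff bipoly_3 14 = 0"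
  "off_diag_coeff bipoly_3 0 = 2802333 / 35" "off_diag_coeff bipoly_3 1 = -2868333 / 5" "off_diag_coeff bipoly_3 2 = 58997408 / 35" "off_diag_coeff bipoly_3 3 = -17785254 / 7" "off_diag_coeff bipoly_3 4 = 67058832 / 35" "off_diag_coeff bipoly_3 5 = -92725333 / 210" "off_diag_coeff bipoly_3 6 = -392071 / 3" "off_diag_coeff bipoly_3 7 = -27243422 / 105" "off_diag_coeff bipoly_3 8 = 1312550 / 3" "off_diag_coeff bipoly_3 9 = -21282446 / 105" "off_diag_coeff bipoly_3 10 = 1061891 / 21" "off_diag_coeff bipoly_3 11 = -4715672 / 105" "off_diag_coeff bipoly_3 12 = 3121423 / 105" "off_diag_coeff bipoly_3 13 = -31823 / 6" "off_diag_coeff bipoly_3 14 = -3230 / 7"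
  by (simp_all add: diag_coeff_def off_diag_coeff_def bipoly_3_def)

text \<open>Multiplication by the binomial coefficient, a polynomial in m with zeros at -1, ..., -7,
  reduces the double poles there to simple ones. The double poles at -8, ..., -13 survive and
  produce pi^2.\<close>

lemma bipoly_3_series:
  "(\<lambda>m. real ((m + 7) choose 7) * bipoly_mom bipoly_3 (real m)) sums (4859036611 / 44100 + 316 / 3 * pi\<^sup>2)"
proof -
  \<comment> \<open>The pole coefficients of the full summand: (\<alpha>, \<beta>, r) stands for
    \<alpha>/(m+r+1)^2 + \<beta>/(m+r+1).\<close>
  define L :: "(real \<times> real \<times> nat) list" where "L = [(0, 26400 / 7, 0), (0, 4400, 1), (0, 107830 / 21, 2), (0, 41625 / 7, 3), (0, 779488 / 105, 4), (0, 111765 / 7, 5), (0, 790756 / 7, 6), (746584, -176014072 / 105, 7), (-2812640, 27963188 / 21, 8), (1029384, 207508699 / 35, 9), (3851280, -72012818 / 7, 10), (-2395800, 119451189 / 7, 11), (-418176, -812055816 / 35, 12), (0, 9101378, 13), (0, 11085360 / 7, 14)]"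
  have eq: "real ((m + 7) choose 7) * bipoly_mom bipoly_3 (real m)
     = (\<Sum>(\<alpha>, \<beta>, r)\<leftarrow>L. \<alpha> * (1 / (real m + real (Suc r)))\<^sup>2 + \<beta> * (1 / (real m + real (Suc r))))" for m
  proof -
    define x where "x = (\<lambda>r. 1 / (real m + real (Suc r)))"
    have x: "(real m + (real r + 1)) * x r = 1" for r
    proof -
      have "real m + (real r + 1) \<noteq> 0" by linarith
      then show ?thesis by (simp add: x_def add.commute add.left_commute)
    qed
    define C where "C = (real m + 1)*(real m + 2)*(real m + 3)*(real m + 4)*(real m + 5)*(real m + 6)*(real m + 7)"
    have C: "real ((m + 7) choose 7) = C / 5040"
    proof -
      have "fact (m + 7) = C * fact m"
        by (simp add: C_def eval_nat_numeral algebra_simps)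
      then show ?thesis by (simp add: binomial_fact C_def fact_numeral)
    qed
    have "bipoly_mom bipoly_3 (real m) = (\<Sum>r<15. diag_coeff bipoly_3 r * (x r)\<^sup>2 + off_diag_coeff bipoly_3 r * x r)"
      unfolding x_def by (rule bipoly_mom_partial_fractions) (simp_all add: bipoly_3_def)
    also have "\<dots> = ((26400) * (x 0)^2 + (2802333 / 35) * x 0) + ((-184800) * (x 1)^2 + (-2868333 / 5) * x 1) + ((539150) * (x 2)^2 + (58997408 / 35) * x 2) + ((-832500) * (x 3)^2 + (-17785254 / 7) * x 3) + ((779488) * (x 4)^2 + (67058832 / 35) * x 4) + ((-670590) * (x 5)^2 + (-92725333 / 210) * x 5) + ((790756) * (x 6)^2 + (-392071 / 3) * x 6) + ((-746584) * (x 7)^2 + (-27243422 / 105) * x 7) + ((351580) * (x 8)^2 + (1312550 / 3) * x 8) + ((-28594) * (x 9)^2 + (-21282446 / 105) * x 9) + ((-32094) * (x 10)^2 + (1061891 / 21) * x 10) + ((7260) * (x 11)^2 + (-4715672 / 105) * x 11) + ((528) * (x 12)^2 + (3121423 / 105) * x 12) + ((0) * (x 13)^2 + (-31823 / 6) * x 13) + ((0) * (x 14)^2 + (-3230 / 7) * x 14)"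
      unfolding sum_lessThan_expand bipoly_3_coeffs ..
    finally have mom: "bipoly_mom bipoly_3 (real m) = \<dots>" .

    \<comment> \<open>For every pole, C is divided by (m+r+1)^2 with remainder. The last constant is
      the value of C at m = -(r+1), which is zero for r < 7, and the one before it is the derivative
      there.\<close>
    have x0: "(real m + 1) * x 0 = 1" using x[of 0] by simp
    have "C = (real m + 1)\<^sup>2 * ((4320) + (3708) * (real m) + (1396) * (real m)^2 + (269) * (real m)^3 + (26) * (real m)^4 + (1) * (real m)^5) + (real m + 1) * (720) + (0)"
      unfolding C_def by algebra
    note r0 = partial_fraction_mult[OF this, where x="x 0" and d="26400" and e="2802333 / 35", OF x0]

    have x1: "(real m + 2) * x 1 = 1" using x[of 1] by simp
    have "C = (real m + 2)\<^sup>2 * ((1320) + (1977) * (real m) + (976) * (real m)^2 + (222) * (real m)^3 + (24) * (real m)^4 + (1) * (real m)^5) + (real m + 2) * (-120) + (0)"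
      unfolding C_def by algebra
    note r1 = partial_fraction_mult[OF this, where x="x 1" and d="-184800" and e="-2868333 / 5", OF x1]

    have x2: "(real m + 3) * x 2 = 1" using x[of 2] by simp
    have "C = (real m + 3)\<^sup>2 * ((544) + (1084) * (real m) + (676) * (real m)^2 + (181) * (real m)^3 + (22) * (real m)^4 + (1) * (real m)^5) + (real m + 3) * (48) + (0)"
      unfolding C_def by algebra
    note r2 = partial_fraction_mult[OF this, where x="x 2" and d="539150" and e="58997408 / 35", OF x2]

    have x3: "(real m + 4) * x 3 = 1" using x[of 3] by simp
    have "C = (real m + 4)\<^sup>2 * ((324) + (657) * (real m) + (472) * (real m)^2 + (146) * (real m)^3 + (20) * (real m)^4 + (1) * (real m)^5) + (real m + 4) * (-36) + (0)"
      unfolding C_def by algebra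
    note r3 = partial_fraction_mult[OF this, where x="x 3" and d="-832500" and e="-17785254 / 7", OF x3]

    have x4: "(real m + 5) * x 4 = 1" using x[of 4] by simp
    have "C = (real m + 5)\<^sup>2 * ((192) + (444) * (real m) + (340) * (real m)^2 + (117) * (real m)^3 + (18) * (real m)^4 + (1) * (real m)^5) + (real m + 5) * (48) + (0)"
      unfolding C_def by algebra
    note r4 = partial_fraction_mult[OF this, where x="x 4" and d="779488" and e="67058832 / 35", OF x4]

    have x5: "(real m + 6) * x 5 = 1" using x[of 5] by simp
    have "C = (real m + 6)\<^sup>2 * ((160) + (313) * (real m) + (256) * (real m)^2 + (94) * (real m)^3 + (16) * (real m)^4 + (1) * (real m)^5) + (real m + 6) * (-120) + (0)"
      unfolding C_def by algebra
    note r5 = partial_fraction_mult[OF this, where x="x 5" and d="-670590" and e="-92725333 / 210", OF x5]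

    have x6: "(real m + 7) * x 6 = 1" using x[of 6] by simp
    have "C = (real m + 7)\<^sup>2 * ((252) * (real m) + (196) * (real m)^2 + (77) * (real m)^3 + (14) * (real m)^4 + (1) * (real m)^5) + (real m + 7) * (720) + (0)"
      unfolding C_def by algebra
    note r6 = partial_fraction_mult[OF this, where x="x 6" and d="790756" and e="-392071 / 3", OF x6]

    have x7: "(real m + 8) * x 7 = 1" using x[of 7] by simp
    have "C = (real m + 8)\<^sup>2 * ((-1476) + (369) * (real m) + (136) * (real m)^2 + (66) * (real m)^3 + (12) * (real m)^4 + (1) * (real m)^5) + (real m + 8) * (13068) + (-5040)"
      unfolding C_def by algebra
    note r7 = partial_fraction_mult[OF this, where x="x 7" and d="-746584" and e="-27243422 / 105", OF x7]

    have x8: "(real m + 9) * x 8 = 1" using x[of 8] by simp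
    have "C = (real m + 9)\<^sup>2 * ((-7136) + (892) * (real m) + (52) * (real m)^2 + (61) * (real m)^3 + (10) * (real m)^4 + (1) * (real m)^5) + (real m + 9) * (69264) + (-40320)"
      unfolding C_def by algebra
    note r8 = partial_fraction_mult[OF this, where x="x 8" and d="351580" and e="1312550 / 3", OF x8]

    have x9: "(real m + 10) * x 9 = 1" using x[of 9] by simp
    have "C = (real m + 10)\<^sup>2 * ((-22248) + (2169) * (real m) + (-80) * (real m)^2 + (62) * (real m)^3 + (8) * (real m)^4 + (1) * (real m)^5) + (real m + 10) * (241128) + (-181440)"
      unfolding C_def by algebra
    note r9 = partial_fraction_mult[OF this, where x="x 9" and d="-28594" and e="-21282446 / 105", OF x9]

    have x10: "(real m + 11) * x 10 = 1" using x[of 10] by simp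
    have "C = (real m + 11)\<^sup>2 * ((-55200) + (4668) * (real m) + (-284) * (real m)^2 + (69) * (real m)^3 + (6) * (real m)^4 + (1) * (real m)^5) + (real m + 11) * (662640) + (-604800)"
      unfolding C_def by algebra
    note r10 = partial_fraction_mult[OF this, where x="x 10" and d="-32094" and e="1061891 / 21", OF x10]

    have x11: "(real m + 12) * x 11 = 1" using x[of 11] by simp
    have "C = (real m + 12)\<^sup>2 * ((-118220) + (8977) * (real m) + (-584) * (real m)^2 + (82) * (real m)^3 + (4) * (real m)^4 + (1) * (real m)^5) + (real m + 12) * (1557660) + (-1663200)"
      unfolding C_def by algebra
    note r11 = partial_fraction_mult[OF this, where x="x 11" and d="7260" and e="-4715672 / 105", OF x11]

    have x12: "(real m + 13) * x 12 = 1" using x[of 12] by simp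
    have "C = (real m + 13)\<^sup>2 * ((-228096) + (15804) * (real m) + (-1004) * (real m)^2 + (101) * (real m)^3 + (2) * (real m)^4 + (1) * (real m)^5) + (real m + 13) * (3272688) + (-3991680)"
      unfolding C_def by algebra
    note r12 = partial_fraction_mult[OF this, where x="x 12" and d="528" and e="3121423 / 105", OF x12]

    have x13: "(real m + 14) * x 13 = 1" using x[of 13] by simp
    have "C = (real m + 14)\<^sup>2 * ((-406896) + (25977) * (real m) + (-1568) * (real m)^2 + (126) * (real m)^3 + (1) * (real m)^5) + (real m + 14) * (6314664) + (-8648640)"
      unfolding C_def by algebra
    note r13 = partial_fraction_mult[OF this, where x="x 13" and d="0" and e="-31823 / 6", OF x13]

    have x14: "(real m + 15) * x 14 = 1" using x[of 14] by simp
    have "C = (real m + 15)\<^sup>2 * ((-682688) + (40444) * (real m) + (-2300) * (real m)^2 + (157) * (real m)^3 + (-2) * (real m)^4 + (1) * (real m)^5) + (real m + 15) * (11393808) + (-17297280)"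
      unfolding C_def by algebra
    note r14 = partial_fraction_mult[OF this, where x="x 14" and d="0" and e="-3230 / 7", OF x14]

    have "real ((m + 7) choose 7) * bipoly_mom bipoly_3 (real m) = 1 / 5040 * (C * (((26400) * (x 0)^2 + (2802333 / 35) * x 0) + ((-184800) * (x 1)^2 + (-2868333 / 5) * x 1) + ((539150) * (x 2)^2 + (58997408 / 35) * x 2) + ((-832500) * (x 3)^2 + (-17785254 / 7) * x 3) + ((779488) * (x 4)^2 + (67058832 / 35) * x 4) + ((-670590) * (x 5)^2 + (-92725333 / 210) * x 5) + ((790756) * (x 6)^2 + (-392071 / 3) * x 6) + ((-746584) * (x 7)^2 + (-27243422 / 105) * x 7) + ((351580) * (x 8)^2 + (1312550 / 3) * x 8) + ((-28594) * (x 9)^2 + (-21282446 / 105) * x 9) + ((-32094) * (x 10)^2 + (1061891 / 21) * x 10) + ((7260) * (x 11)^2 + (-4715672 / 105) * x 11) + ((528) * (x 12)^2 + (3121423 / 105) * x 12) + ((0) * (x 13)^2 + (-31823 / 6) * x 13) + ((0) * (x 14)^2 + (-3230 / 7) * x 14)))"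
      unfolding C mom by simp
    \<comment> \<open>The polynomial rests of the fifteen divisions add up to zero, so only pole
      terms remain.\<close>
    also have "\<dots> = ((0) * (x 0)^2 + (26400 / 7) * x 0) + ((0) * (x 1)^2 + (4400) * x 1) + ((0) * (x 2)^2 + (107830 / 21) * x 2) + ((0) * (x 3)^2 + (41625 / 7) * x 3) + ((0) * (x 4)^2 + (779488 / 105) * x 4) + ((0) * (x 5)^2 + (111765 / 7) * x 5) + ((0) * (x 6)^2 + (790756 / 7) * x 6) + ((746584) * (x 7)^2 + (-176014072 / 105) * x 7) + ((-2812640) * (x 8)^2 + (27963188 / 21) * x 8) + ((1029384) * (x 9)^2 + (207508699 / 35) * x 9) + ((3851280) * (x 10)^2 + (-72012818 / 7) * x 10) + ((-2395800) * (x 11)^2 + (119451189 / 7) * x 11) + ((-418176) * (x 12)^2 + (-812055816 / 35) * x 12) + ((0) * (x 13)^2 + (9101378) * x 13) + ((0) * (x 14)^2 + (11085360 / 7) * x 14)"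
      unfolding partial_fraction_distrib r0 r1 r2 r3 r4 r5 r6 r7 r8 r9 r10 r11 r12 r13 r14 by algebra
    also have "\<dots> = (\<Sum>(\<alpha>, \<beta>, r)\<leftarrow>L. \<alpha> * (x r)\<^sup>2 + \<beta> * x r)"
      unfolding L_def list.map sum_list.Cons sum_list.Nil prod.case by (simp only: add.assoc add_0_right)
    finally show ?thesis unfolding x_def .
  qed
  have "(\<Sum>(\<alpha>, \<beta>, r)\<leftarrow>L. \<beta>) = 0"
    unfolding L_def by simp
  from partial_fraction_sums[OF this]
  have "(\<lambda>m. real ((m + 7) choose 7) * bipoly_mom bipoly_3 (real m)) sums
      (\<Sum>(\<alpha>, \<beta>, r)\<leftarrow>L. \<alpha> * (pi\<^sup>2 / 6 - (\<Sum>i<r. (1 / (real i + 1))\<^sup>2)) - \<beta> * (\<Sum>i<r. 1 / (real i + 1)))"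
    unfolding eq[symmetric] .
  also have "(\<Sum>(\<alpha>, \<beta>, r)\<leftarrow>L. \<alpha> * (pi\<^sup>2 / 6 - (\<Sum>i<r. (1 / (real i + 1))\<^sup>2)) - \<beta> * (\<Sum>i<r. 1 / (real i + 1))) = 4859036611 / 44100 + 316 / 3 * pi\<^sup>2"
    unfolding L_def list.map sum_list.Cons sum_list.Nil prod.case harmonic_table by algebra
  finally show ?thesis .
qed

text \<open>The analogue of \<open>bipoly_3\<close> for k = 5, with exponents at most 18.\<close>

definition bipoly_5 :: "(real \<times> nat \<times> nat) list" where
  "bipoly_5 = [(5540080, 0, 0), (2770040, 0, 1), (5721608, 0, 2), (7197392, 0, 3), (2923184, 0, 4), (-4226020, 0, 5), (-8221420, 0, 6), (-6048616, 0, 7), (-216556, 0, 8), (4004138, 0, 9), (3232382, 0, 10), (-1697764, 0, 11), (-5787532, 0, 12), (-1111903, 0, 13), (10892063, 0, 14), (-8843902, 0, 15), (2821844, 0, 16), (-342550, 0, 17), (13702, 0, 18), (2770040, 1, 0), (-49860720, 1, 1), (-26406144, 1, 2), (-52970256, 1, 3), (-58365216, 1, 4), (-12010248, 1, 5), (48022680, 1, 6), (67474368, 1, 7), (34025334, 1, 8), (-14933772, 1, 9), (-32564340, 1, 10), (-4440708, 1, 11), (37773600, 1, 12), (24034014, 1, 13), (-68018652, 1, 14), (40123188, 1, 15), (-7897977, 1, 16), (-81444, 1, 17), (54808, 1, 18), (68732408, 2, 0), (-57911544, 2, 1), (252763056, 2, 2), (138925692, 2, 3), (198956988, 2, 4),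 (161932320, 2, 5), (-40514568, 2, 6), (-221998032, 2, 7), (-207422994, 2, 8), (-35127918, 2, 9), (99254232, 2, 10), (52403643, 2, 11), (-112373373, 2, 12), (-109648728, 2, 13), (230194890, 2, 14), (-128844495, 2, 15), (26774244, 2, 16), (-1155351, 2, 17), (112840, 2, 18), (101713592, 3, 0), (-651572856, 3, 1), (406721592, 3, 2), (-891928128, 3, 3), (-471145128, 3, 4), (-349275624, 3, 5), (-76538520, 3, 6), (346577976, 3, 7), (507718806, 3, 8), (235998546, 3, 9), (-135732660, 3, 10), (-143031660, 3, 11), (237559782, 3, 12), (302858442, 3, 13), (-558490698, 3, 14), (295168272, 3, 15), (-53761929, 3, 16), (-465885, 3, 17), (155155, 3, 18), (205791464, 4, 0), (-1071539136, 4, 1), (2767839408, 4, 2), (-1468578768, 4, 3), (2191111272, 4, 4), (1033530336, 4, 5), (136094976, 4, 6), (-560334024, 4, 7), (-861803634, 4, 8), (-510544014, 4, 9), (125814456, 4, 10), (243980226, 4, 11), (-407209686, 4, 12), (-621201348, 4, 13), (1010563992, 4, 14), (-505723956, 4, 15), (89591049, 4, 16), (-510393, 4, 17), (155155, 4, 18), (345417680, 5, 0), (-2131375608, 5, 1), (4995051120, 5, 2), (-6901198224, 5, 3), (3158364636, 5, 4), (-3684653784, 5, 5), (-1456773084, 5, 6), (585138564, 5, 7), (1409940888, 5, 8), (943882410, 5, 9), (-74935278, 5, 10), (-387167796, 5, 11), (536039742, 5, 12), (999435078, 5, 13), (-1405269396, 5, 14), (668612172, 5, 15), (-114559092, 5,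 16), (-235191, 5, 17), (115258, 5, 18), (8011520, 6, 0), (-2265243720, 6, 1), (7817818152, 6, 2), (-11823697440, 6, 3), (10491390036, 6, 4), (-4223336364, 6, 5), (4169986416, 6, 6), (1280623122, 6, 7), (-1155234810, 6, 8), (-1408323510, 6, 9), (-218977044, 6, 10), (474194712, 6, 11), (-486014262, 6, 12), (-1264587222, 6, 13), (1494575124, 6, 14), (-662305662, 6, 15), (106895292, 6, 16), (90633, 6, 17), (62062, 6, 18), (-1062717376, 7, 0), (3140083008, 7, 1), (348183468, 7, 2), (-7006914864, 7, 3), (9771267816, 7, 4), (-7580804436, 7, 5), (3282915492, 7, 6), (-3009856968, 7, 7), (-622715322, 7, 8), (820201614, 7, 9), (356684157, 7, 10), (-386970318, 7, 11), (317330754, 7, 12), (1254437361, 7, 13), (-1194618645, 7, 14), (477655140, 7, 15), (-71166897, 7, 16), (63096, 7, 17), (22165, 7, 18), (42930524, 8, 0), (5694688734, 8, 1), (-13441529154, 8, 2), (13585678656, 8, 3), (-14282042124, 8, 4), (10442848533, 8, 5), (-2347195665, 8, 6), (-906611682, 8, 7), (1131214968, 8, 8), (100174593, 8, 9), (76341948, 8, 10), (485602827, 8, 11), (-57310179, 8, 12), (-996245544, 8, 13), (667231746, 8, 14), (-222412455, 8, 15), (27326904, 8, 16), (-1485, 8, 17), (4030, 8, 18), (7817649698, 9, 0), (-31485251412, 9, 1), (59355339372, 9, 2), (-86390973984, 9, 3), (80005366236, 9, 4), (-29401651050, 9, 5), (-3200200380, 9, 6), (4269154884, 9, 7), (-524725287,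 9, 8), (997328, 9, 9), (-31394219, 9, 10), (-521976614, 9, 11), (-277887494, 9, 12), (543958711, 9, 13), (-200913689, 9, 14), (44377696, 9, 15), (-1232849, 9, 16), (58228, 9, 17), (-25220632558, 10, 0), (78313422870, 10, 1), (-150962017968, 10, 2), (183690369975, 10, 3), (-92579515389, 10, 4), (-12519131508, 10, 5), (29154842526, 10, 6), (-11260946583, 10, 7), (532410558, 10, 8), (648451741, 10, 9), (-70048944, 10, 10), (143389071, 10, 11), (271374255, 10, 12), (-154745388, 10, 13), (-3806082, 10, 14), (24425985, 10, 15), (-7279182, 10, 16), (131796, 10, 17), (39274712006, 11, 0), (-95491029798, 11, 1), (164450183868, 11, 2), (-127438153620, 11, 3), (-27879747714, 11, 4), (95016956634, 11, 5), (-65636744928, 11, 6), (20089215072, 11, 7), (2613210927, 11, 8), (-806285939, 11, 9), (-481131999, 11, 10), (-146911464, 11, 11), (-123060726, 11, 12), (32703588, 11, 13), (54794898, 11, 14), (-27029436, 11, 15), (1687140, 11, 16), (174456, 11, 17), (-35841592342, 12, 0), (59667265860, 12, 1), (-83787646998, 12, 2), (-8842553178, 12, 3), (139271720394, 12, 4), (-149694106758, 12, 5), (90679549188, 12, 6), (-16318580286, 12, 7), (-5057910609, 12, 8), (-973131149, 12, 9), (80354655, 12, 10), (184756554, 12, 11), (133902384, 12, 12), (27225102, 12, 13), (-41944020, 12, 14), (2906280, 12, 15), (1783728, 12, 16), (153000, 12, 17), (19938350432, 13, 0), (-12105325566, 13, 1), (2041778862, 13, 2), (89665476732, 13, 3),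 (-163096896528, 13, 4), (143077768398, 13, 5), (-71636390022, 13, 6), (4102004916, 13, 7), (1453984476, 13, 8), (839120011, 13, 9), (432546732, 13, 10), (137590488, 13, 11), (-9848598, 13, 12), (-28083528, 13, 13), (6918552, 13, 14), (2932848, 13, 15), (-1585980, 13, 16), (93600, 13, 17), (-6522600292, 14, 0), (-7448974182, 14, 1), (19888676460, 14, 2), (-70756131978, 14, 3), (95186507742, 14, 4), (-73526284296, 14, 5), (29468919444, 14, 6), (-130763880, 14, 7), (1202496486, 14, 8), (594742561, 14, 9), (75855798, 14, 10), (-77105502, 14, 11), (-55283100, 14, 12), (-16480728, 14, 13), (-6614928, 14, 14), (-2773260, 14, 15), (1217880, 14, 16), (48600, 14, 17), (1097318558, 15, 0), (5363970678, 15, 1), (-9132015555, 15, 2), (25050457662, 15, 3), (-28945019256, 15, 4), (20770631607, 15, 5), (-7552005687, 15, 6), (570001980, 15, 7), (-441217665, 15, 8), (-497419964, 15, 9), (-264301755, 15, 10), (-87241596, 15, 11), (-13860720, 15, 12), (2932848, 15, 13), (3933540, 15, 14), (2378160, 15, 15), (16200, 15, 16), (32400, 15, 17), (-62246536, 16, 0), (-1179128817, 16, 1), (1198462554, 16, 2), (-3625364769, 16, 3), (3635979219, 16, 4), (-2535786342, 16, 5), (852041472, 16, 6), (-62056827, 16, 7), (-13062936, 16, 8), (58830271, 16, 9), (59565258, 16, 10), (35146620, 16, 11), (15197328, 16, 12), (5120820, 16, 13), (1217880, 16, 14), (16200, 16, 15), (64800, 16, 16), (-342550, 17, 0), (64986936,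 17, 1), (63913029, 17, 2), (37490670, 17, 3), (15756702, 17, 4), (4770069, 17, 5), (924843, 17, 6), (63096, 17, 7), (-1485, 17, 8), (58228, 17, 9), (131796, 17, 10), (174456, 17, 11), (153000, 17, 12), (93600, 17, 13), (48600, 17, 14), (32400, 17, 15), (13702, 18, 0), (54808, 18, 1), (112840, 18, 2), (155155, 18, 3), (155155, 18, 4), (115258, 18, 5), (62062, 18, 6), (22165, 18, 7), (4030, 18, 8)]"

text \<open>The constant is 3870720 * 7592461994557440000: the common factor of the coefficients of
  the plane polynomial times the one in \<open>unit_distance_moment_5\<close>. Here w^9 clears the
  denominators, which are at most w^8.\<close>

lemma unit_plane_distance_5:
  assumes "u < 1" "v < 1"
  shows "unit_plane 5 quad_poly_6 u v * unit_distance_moment 5 u v = 29388294491573374156800000 * bipoly bipoly_5 u v"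
proof -
  define p q \<omega> w where "p = 1 - u" and "q = 1 - v" and "\<omega> = 1 - u * v" and "w = 2 - u - v"
  note defs = this
  have "w \<noteq> 0" using assms by (simp add: defs)
  then have plane: "unit_plane 5 quad_poly_6 u v = 1559900160 * w^9 - 40828354560 * p^2*q^2*\<omega> * w^5 + 43754618880 * p^3*q^3*\<omega>*(1 + \<omega>) * w^3 - 12541132800 * p^4*q^4*\<omega>*(1+\<omega>^2) * w - 12123095040 * p^4*q^4*\<omega>^2*w"
    unfolding unit_plane_def quad_poly_6_def defs[symmetric] by (simp add: field_simps eval_nat_numeral)
  show ?thesis
    unfolding plane unit_distance_moment_5 bipoly_def bipoly_5_def list.map sum_list.Cons sum_list.Nil prod.case defs
    by algebra
qed

lemma bipoly_5_coeffs:
  "diag_coeff bipoly_5 0 = 5540080" "diag_coeff bipoly_5 1 = -49860720" "diag_coeff bipoly_5 2 = 252763056" "diag_coeff bipoly_5 3 = -891928128" "diag_coeff bipoly_5 4 = 2191111272" "diag_coeff bipoly_5 5 = -3684653784" "diag_coeff bipoly_5 6 = 4169986416" "diag_coeff bipoly_5 7 = -3009856968" "diag_coeff bipoly_5 8 = 1131214968" "diag_coeff bipoly_5 9 = 997328" "diag_coeff bipoly_5 10 = -70048944" "diag_coeff bipoly_5 11 = -146911464" "diag_coeff bipoly_5 12 = 133902384" "diag_coeff bipoly_5 13 = -28083528" "diag_coeff bipoly_5 14 = -6614928" "diag_coeff bipoly_5 15 = 2378160" "diag_coeff bipoly_5 16 = 64800" "diag_coeff bipoly_5 17 = 0" "diag_coeff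 bipoly_5 18 = 0"
  "off_diag_coeff bipoly_5 0 = 150897624673 / 1260" "off_diag_coeff bipoly_5 1 = -151285430273 / 140" "off_diag_coeff bipoly_5 2 = 147908732473 / 35" "off_diag_coeff bipoly_5 3 = -139547148893 / 15" "off_diag_coeff bipoly_5 4 = 125340067303 / 10" "off_diag_coeff bipoly_5 5 = -106276745363 / 10" "off_diag_coeff bipoly_5 6 = 209350155967 / 35" "off_diag_coeff bipoly_5 7 = -103341080154 / 35" "off_diag_coeff bipoly_5 8 = 11844695640 / 7" "off_diag_coeff bipoly_5 9 = -32885172010 / 63" "off_diag_coeff bipoly_5 10 = -1118749846 / 5" "off_diag_coeff bipoly_5 11 = 96697529 / 5" "off_diag_coeff bipoly_5 12 = 2709346811 / 6" "off_diag_coeff bipoly_5 13 = -44397680791 / 70" "off_diag_coeff bipoly_5 14 = 18706634827 / 35" "off_diag_coeff bipoly_5 15 = -10384355788 / 35" "off_diag_coeff bipoly_5 16 = 13294559343 / 140" "off_diag_coeff bipoly_5 17 = -255664713 / 20" "off_diag_coeff bipoly_5 18 = -880555 / 9"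
  by (simp_all add: diag_coeff_def off_diag_coeff_def bipoly_5_def)

text \<open>As for k = 3, with a binomial factor that vanishes at -1, ..., -9; the surviving double
  poles are at -10, ..., -17.\<close>

lemma bipoly_5_series:
  "(\<lambda>m. real ((m + 9) choose 9) * bipoly_mom bipoly_5 (real m)) sums (2008761134237 / 12960 + -48136 / 3 * pi\<^sup>2)"
proof -
  define L :: "(real \<times> real \<times> nat) list" where "L = [(0, 5540080 / 9, 0), (0, 692510, 1), (0, 1003028, 2), (0, 5309096 / 3, 3), (0, 17389772 / 5, 4), (0, 7310821, 5), (0, 115832956 / 7, 6), (0, 41803569, 7), (0, 125690552, 8), (-997328, 55104867988 / 105, 9), (700489440, 886277800, 10), (8080130520, -13344480140, 11), (-29458524480, -185802010658 / 3, 12), (20079722520, 6040540079299 / 14, 13), (13243085856, -1082841851790, 14), (-11902690800, 1495297138934, 15), (-741312000, -7600399532196 / 7, 16), (0, 621520917303 / 2, 17), (0, 42812584100 / 9, 18)]"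
  have eq: "real ((m + 9) choose 9) * bipoly_mom bipoly_5 (real m)
     = (\<Sum>(\<alpha>, \<beta>, r)\<leftarrow>L. \<alpha> * (1 / (real m + real (Suc r)))\<^sup>2 + \<beta> * (1 / (real m + real (Suc r))))" for m
  proof -
    define x where "x = (\<lambda>r. 1 / (real m + real (Suc r)))"
    have x: "(real m + (real r + 1)) * x r = 1" for r
    proof -
      have "real m + (real r + 1) \<noteq> 0" by linarith
      then show ?thesis by (simp add: x_def add.commute add.left_commute)
    qed
    define C where "C = (real m + 1)*(real m + 2)*(real m + 3)*(real m + 4)*(real m + 5)*(real m + 6)*(real m + 7)*(real m + 8)*(real m + 9)"
    have C: "real ((m + 9) choose 9) = C / 362880"
    proof -
      have "fact (m + 9) = C * fact m"
        by (simp add: C_def eval_nat_numeral algebra_simps)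
      then show ?thesis by (simp add: binomial_fact C_def fact_numeral)
    qed
    have "bipoly_mom bipoly_5 (real m) = (\<Sum>r<19. diag_coeff bipoly_5 r * (x r)\<^sup>2 + off_diag_coeff bipoly_5 r * x r)"
      unfolding x_def by (rule bipoly_mom_partial_fractions) (simp_all add: bipoly_5_def)
    also have "\<dots> = ((5540080) * (x 0)^2 + (150897624673 / 1260) * x 0) + ((-49860720) * (x 1)^2 + (-151285430273 / 140) * x 1) + ((252763056) * (x 2)^2 + (147908732473 / 35) * x 2) + ((-891928128) * (x 3)^2 + (-139547148893 / 15) * x 3) + ((2191111272) * (x 4)^2 + (125340067303 / 10) * x 4) + ((-3684653784) * (x 5)^2 + (-106276745363 / 10) * x 5) + ((4169986416) * (x 6)^2 + (209350155967 / 35) * x 6) + ((-3009856968) * (x 7)^2 + (-103341080154 / 35) * x 7) + ((1131214968) * (x 8)^2 + (11844695640 / 7) * x 8) + ((997328) * (x 9)^2 + (-32885172010 / 63) * x 9) + ((-70048944) * (x 10)^2 + (-1118749846 / 5) * x 10) + ((-146911464) * (x 11)^2 + (96697529 / 5) * x 11) + ((133902384) * (x 12)^2 + (2709346811 / 6) * x 12) + ((-28083528) * (x 13)^2 + (-44397680791 / 70) * x 13) + ((-6614928) * (x 14)^2 + (18706634827 / 35) * x 14) + ((2378160) * (x 15)^2 + (-10384355788 / 35) * x 15) + ((64800) * (x 16)^2 + (13294559343 / 140) * x 16) + ((0) * (x 17)^2 + (-255664713 / 20) * x 17) + ((0) * (x 18)^2 + (-880555 / 9) * x 18)"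
      unfolding sum_lessThan_expand bipoly_5_coeffs ..
    finally have mom: "bipoly_mom bipoly_5 (real m) = \<dots>" .

    have x0: "(real m + 1) * x 0 = 1" using x[of 0] by simp
    have "C = (real m + 1)\<^sup>2 * ((322560) + (341136) * (real m) + (167868) * (real m)^2 + (46808) * (real m)^3 + (7841) * (real m)^4 + (783) * (real m)^5 + (43) * (real m)^6 + (1) * (real m)^7) + (real m + 1) * (40320) + (0)"
      unfolding C_def by algebra
    note r0 = partial_fraction_mult[OF this, where x="x 0" and d="5540080" and e="150897624673 / 1260", OF x0]

    have x1: "(real m + 2) * x 1 = 1" using x[of 1] by simp
    have "C = (real m + 2)\<^sup>2 * ((93240) + (164664) * (real m) + (105201) * (real m)^2 + (34553) * (real m)^3 + (6478) * (real m)^4 + (702) * (real m)^5 + (41) * (real m)^6 + (1) * (real m)^7) + (real m + 2) * (-5040) + (0)"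
      unfolding C_def by algebra
    note r1 = partial_fraction_mult[OF this, where x="x 1" and d="-49860720" and e="-151285430273 / 140", OF x1]

    have x2: "(real m + 3) * x 2 = 1" using x[of 2] by simp
    have "C = (real m + 3)\<^sup>2 * ((39840) + (87344) * (real m) + (67644) * (real m)^2 + (25608) * (real m)^3 + (5337) * (real m)^4 + (627) * (real m)^5 + (39) * (real m)^6 + (1) * (real m)^7) + (real m + 3) * (1440) + (0)"
      unfolding C_def by algebra
    note r2 = partial_fraction_mult[OF this, where x="x 2" and d="252763056" and e="147908732473 / 35", OF x2]

    have x3: "(real m + 4) * x 3 = 1" using x[of 3] by simp
    have "C = (real m + 4)\<^sup>2 * ((22860) + (52776) * (real m) + (45477) * (real m)^2 + (19193) * (real m)^3 + (4394) * (real m)^4 + (558) * (real m)^5 + (37) * (real m)^6 + (1) * (real m)^7) + (real m + 4) * (-720) + (0)"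
      unfolding C_def by algebra
    note r3 = partial_fraction_mult[OF this, where x="x 3" and d="-891928128" and e="-139547148893 / 15", OF x3]

    have x4: "(real m + 5) * x 4 = 1" using x[of 4] by simp
    have "C = (real m + 5)\<^sup>2 * ((14400) + (35280) * (real m) + (32220) * (real m)^2 + (14648) * (real m)^3 + (3625) * (real m)^4 + (495) * (real m)^5 + (35) * (real m)^6 + (1) * (real m)^7) + (real m + 5) * (576) + (0)"
      unfolding C_def by algebra
    note r4 = partial_fraction_mult[OF this, where x="x 4" and d="2191111272" and e="125340067303 / 10", OF x4]

    have x5: "(real m + 6) * x 5 = 1" using x[of 5] by simp
    have "C = (real m + 6)\<^sup>2 * ((10200) + (25136) * (real m) + (23913) * (real m)^2 + (11433) * (real m)^3 + (3006) * (real m)^4 + (438) * (real m)^5 + (33) * (real m)^6 + (1) * (real m)^7) + (real m + 6) * (-720) + (0)"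
      unfolding C_def by algebra
    note r5 = partial_fraction_mult[OF this, where x="x 5" and d="-3684653784" and e="-106276745363 / 10", OF x5]

    have x6: "(real m + 7) * x 6 = 1" using x[of 6] by simp
    have "C = (real m + 7)\<^sup>2 * ((7200) + (18864) * (real m) + (18396) * (real m)^2 + (9128) * (real m)^3 + (2513) * (real m)^4 + (387) * (real m)^5 + (31) * (real m)^6 + (1) * (real m)^7) + (real m + 7) * (1440) + (0)"
      unfolding C_def by algebra
    note r6 = partial_fraction_mult[OF this, where x="x 6" and d="4169986416" and e="209350155967 / 35", OF x6]

    have x7: "(real m + 8) * x 7 = 1" using x[of 7] by simp
    have "C = (real m + 8)\<^sup>2 * ((6300) + (14544) * (real m) + (14589) * (real m)^2 + (7433) * (real m)^3 + (2122) * (real m)^4 + (342) * (real m)^5 + (29) * (real m)^6 + (1) * (real m)^7) + (real m + 8) * (-5040) + (0)"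
      unfolding C_def by algebra
    note r7 = partial_fraction_mult[OF this, where x="x 7" and d="-3009856968" and e="-103341080154 / 35", OF x7]

    have x8: "(real m + 9) * x 8 = 1" using x[of 8] by simp
    have "C = (real m + 9)\<^sup>2 * ((12176) * (real m) + (11772) * (real m)^2 + (6168) * (real m)^3 + (1809) * (real m)^4 + (303) * (real m)^5 + (27) * (real m)^6 + (1) * (real m)^7) + (real m + 9) * (40320) + (0)"
      unfolding C_def by algebra
    note r8 = partial_fraction_mult[OF this, where x="x 8" and d="1131214968" and e="11844695640 / 7", OF x8]

    have x9: "(real m + 10) * x 9 = 1" using x[of 9] by simp
    have "C = (real m + 10)\<^sup>2 * ((-95400) + (19080) * (real m) + (8865) * (real m)^2 + (5273) * (real m)^3 + (1550) * (real m)^4 + (270) * (real m)^5 + (25) * (real m)^6 + (1) * (real m)^7) + (real m + 10) * (1026576) + (-362880)"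
      unfolding C_def by algebra
    note r9 = partial_fraction_mult[OF this, where x="x 9" and d="997328" and e="-32885172010 / 63", OF x9]

    have x10: "(real m + 11) * x 10 = 1" using x[of 10] by simp
    have "C = (real m + 11)\<^sup>2 * ((-603360) + (60336) * (real m) + (3708) * (real m)^2 + (4808) * (real m)^3 + (1321) * (real m)^4 + (243) * (real m)^5 + (23) * (real m)^6 + (1) * (real m)^7) + (real m + 11) * (6999840) + (-3628800)"
      unfolding C_def by algebra
    note r10 = partial_fraction_mult[OF this, where x="x 10" and d="-70048944" and e="-1118749846 / 5", OF x10]

    have x11: "(real m + 12) * x 11 = 1" using x[of 11] by simp
    have "C = (real m + 12)\<^sup>2 * ((-2386740) + (194264) * (real m) + (-7659) * (real m)^2 + (4953) * (real m)^3 + (1098) * (real m)^4 + (222) * (real m)^5 + (21) * (real m)^6 + (1) * (real m)^7) + (real m + 12) * (30334320) + (-19958400)"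
      unfolding C_def by algebra
    note r11 = partial_fraction_mult[OF this, where x="x 11" and d="-146911464" and e="96697529 / 5", OF x11]

    have x12: "(real m + 13) * x 12 = 1" using x[of 12] by simp
    have "C = (real m + 13)\<^sup>2 * ((-7323840) + (532944) * (real m) + (-31716) * (real m)^2 + (6008) * (real m)^3 + (857) * (real m)^4 + (207) * (real m)^5 + (19) * (real m)^6 + (1) * (real m)^7) + (real m + 13) * (101378880) + (-79833600)"
      unfolding C_def by algebra
    note r12 = partial_fraction_mult[OF this, where x="x 12" and d="133902384" and e="2709346811 / 6", OF x12]

    have x13: "(real m + 14) * x 13 = 1" using x[of 13] by simp
    have "C = (real m + 14)\<^sup>2 * ((-19001160) + (1267776) * (real m) + (-78183) * (real m)^2 + (8393) * (real m)^3 + (574) * (real m)^4 + (198) * (real m)^5 + (17) * (real m)^6 + (1) * (real m)^7) + (real m + 14) * (284574960) + (-259459200)"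
      unfolding C_def by algebra
    note r13 = partial_fraction_mult[OF this, where x="x 13" and d="-28083528" and e="-44397680791 / 70", OF x13]

    have x14: "(real m + 15) * x 14 = 1" using x[of 14] by simp
    have "C = (real m + 15)\<^sup>2 * ((-43663200) + (2700080) * (real m) + (-160740) * (real m)^2 + (12648) * (real m)^3 + (225) * (real m)^4 + (195) * (real m)^5 + (15) * (real m)^6 + (1) * (real m)^7) + (real m + 15) * (703404576) + (-726485760)"
      unfolding C_def by algebra
    note r14 = partial_fraction_mult[OF this, where x="x 14" and d="-6614928" and e="18706634827 / 35", OF x14]

    have x15: "(real m + 16) * x 15 = 1" using x[of 15] by simp
    have "C = (real m + 16)\<^sup>2 * ((-91459620) + (5276736) * (real m) + (-297747) * (real m)^2 + (19433) * (real m)^3 + (-214) * (real m)^4 + (198) * (real m)^5 + (13) * (real m)^6 + (1) * (real m)^7) + (real m + 16) * (1576890000) + (-1816214400)"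
      unfolding C_def by algebra
    note r15 = partial_fraction_mult[OF this, where x="x 15" and d="2378160" and e="-10384355788 / 35", OF x15]

    have x16: "(real m + 17) * x 16 = 1" using x[of 16] by simp
    have "C = (real m + 17)\<^sup>2 * ((-178030080) + (9630864) * (real m) + (-512964) * (real m)^2 + (29528) * (real m)^3 + (-767) * (real m)^4 + (207) * (real m)^5 + (11) * (real m)^6 + (1) * (real m)^7) + (real m + 17) * (3270729600) + (-4151347200)"
      unfolding C_def by algebra
    note r16 = partial_fraction_mult[OF this, where x="x 16" and d="64800" and e="13294559343 / 140", OF x16]

    have x17: "(real m + 18) * x 17 = 1" using x[of 17] by simp
    have "C = (real m + 18)\<^sup>2 * ((-326467080) + (16627544) * (real m) + (-836271) * (real m)^2 + (43833) * (real m)^3 + (-1458) * (real m)^4 + (222) * (real m)^5 + (9) * (real m)^6 + (1) * (real m)^7) + (real m + 18) * (6366517200) + (-8821612800)"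
      unfolding C_def by algebra
    note r17 = partial_fraction_mult[OF this, where x="x 17" and d="0" and e="-255664713 / 20", OF x17]

    have x18: "(real m + 19) * x 18 = 1" using x[of 18] by simp
    have "C = (real m + 19)\<^sup>2 * ((-569697120) + (27414576) * (real m) + (-1304388) * (real m)^2 + (63368) * (real m)^3 + (-2311) * (real m)^4 + (243) * (real m)^5 + (7) * (real m)^6 + (1) * (real m)^7) + (real m + 19) * (11752855200) + (-17643225600)"
      unfolding C_def by algebra
    note r18 = partial_fraction_mult[OF this, where x="x 18" and d="0" and e="-880555 / 9", OF x18]

    have "real ((m + 9) choose 9) * bipoly_mom bipoly_5 (real m) = 1 / 362880 * (C * (((5540080) * (x 0)^2 + (150897624673 / 1260) * x 0) + ((-49860720) * (x 1)^2 + (-151285430273 / 140) * x 1) + ((252763056) * (x 2)^2 + (147908732473 / 35) * x 2) + ((-891928128) * (x 3)^2 + (-139547148893 / 15) * x 3) + ((2191111272) * (x 4)^2 + (125340067303 / 10) * x 4) + ((-3684653784) * (x 5)^2 + (-106276745363 / 10) * x 5) + ((4169986416) * (x 6)^2 + (209350155967 / 35) * x 6) + ((-3009856968) * (x 7)^2 + (-103341080154 / 35) * x 7) + ((1131214968) * (x 8)^2 + (11844695640 / 7) * x 8) + ((997328) * (x 9)^2 + (-32885172010 / 63) * x 9) + ((-70048944) * (x 10)^2 + (-1118749846 / 5) * x 10) + ((-146911464) * (x 11)^2 + (96697529 / 5) * x 11) + ((133902384) * (x 12)^2 + (2709346811 / 6) * x 12) + ((-28083528) * (x 13)^2 + (-44397680791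 / 70) * x 13) + ((-6614928) * (x 14)^2 + (18706634827 / 35) * x 14) + ((2378160) * (x 15)^2 + (-10384355788 / 35) * x 15) + ((64800) * (x 16)^2 + (13294559343 / 140) * x 16) + ((0) * (x 17)^2 + (-255664713 / 20) * x 17) + ((0) * (x 18)^2 + (-880555 / 9) * x 18)))"
      unfolding C mom by simp
    \<comment> \<open>Again the polynomial rests of all nineteen divisions cancel.\<close>
    also have "\<dots> = ((0) * (x 0)^2 + (5540080 / 9) * x 0) + ((0) * (x 1)^2 + (692510) * x 1) + ((0) * (x 2)^2 + (1003028) * x 2) + ((0) * (x 3)^2 + (5309096 / 3) * x 3) + ((0) * (x 4)^2 + (17389772 / 5) * x 4) + ((0) * (x 5)^2 + (7310821) * x 5) + ((0) * (x 6)^2 + (115832956 / 7) * x 6) + ((0) * (x 7)^2 + (41803569) * x 7) + ((0) * (x 8)^2 + (125690552) * x 8) + ((-997328) * (x 9)^2 + (55104867988 / 105) * x 9) + ((700489440) * (x 10)^2 + (886277800) * x 10) + ((8080130520) * (x 11)^2 + (-13344480140) * x 11) + ((-29458524480) * (x 12)^2 + (-185802010658 / 3) * x 12) + ((20079722520) * (x 13)^2 + (6040540079299 / 14) * x 13) + ((13243085856) * (x 14)^2 + (-1082841851790) * x 14) + ((-11902690800) * (x 15)^2 + (1495297138934) * x 15) + ((-741312000) * (x 16)^2 + (-7600399532196 / 7) * x 16) + ((0) * (x 17)^2 + (621520917303 / 2) * x 17) + ((0) * (x 18)^2 + (42812584100 / 9) * x 18)"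
      unfolding partial_fraction_distrib r0 r1 r2 r3 r4 r5 r6 r7 r8 r9 r10 r11 r12 r13 r14 r15 r16 r17 r18 by algebra
    also have "\<dots> = (\<Sum>(\<alpha>, \<beta>, r)\<leftarrow>L. \<alpha> * (x r)\<^sup>2 + \<beta> * x r)"
      unfolding L_def list.map sum_list.Cons sum_list.Nil prod.case by (simp only: add.assoc add_0_right)
    finally show ?thesis unfolding x_def .
  qed
  have "(\<Sum>(\<alpha>, \<beta>, r)\<leftarrow>L. \<beta>) = 0"
    unfolding L_def by simp
  from partial_fraction_sums[OF this]
  have "(\<lambda>m. real ((m + 9) choose 9) * bipoly_mom bipoly_5 (real m)) sums
      (\<Sum>(\<alpha>, \<beta>, r)\<leftarrow>L. \<alpha> * (pi\<^sup>2 / 6 - (\<Sum>i<r. (1 / (real i + 1))\<^sup>2)) - \<beta> * (\<Sum>i<r. 1 / (real i + 1)))"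
    unfolding eq[symmetric] .
  also have "(\<Sum>(\<alpha>, \<beta>, r)\<leftarrow>L. \<alpha> * (pi\<^sup>2 / 6 - (\<Sum>i<r. (1 / (real i + 1))\<^sup>2)) - \<beta> * (\<Sum>i<r. 1 / (real i + 1))) = 2008761134237 / 12960 + -48136 / 3 * pi\<^sup>2"
    unfolding L_def list.map sum_list.Cons sum_list.Nil prod.case harmonic_table by algebra
  finally show ?thesis .
qed

section \<open>Assembly of the two moments\<close>

text \<open>With m = xy in the unit interval, order four is clear because 42120 m < 51840. In order
  six, x^2 + y^2 \<le> x + y, 2m \<le> x + y and 2m - 1 \<le> m^2 bound the polynomial below by a
  linear function of m that is positive on the unit interval.\<close>

lemma quad_poly_nonneg:
  assumes "0 \<le> x" "x \<le> 1" "0 \<le> y" "y \<le> 1"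
  shows "0 \<le> quad_poly_4 x y" and "0 \<le> quad_poly_6 x y"
proof -
  define m where "m = x * y"
  have m: "0 \<le> m" "m \<le> 1" "m \<le> x" "m \<le> y"
    using assms by (auto simp: m_def intro: mult_le_one mult_left_le mult_left_le_one_le)
  have "0 \<le> 4860 * (m * (x + y))" using assms m by simp
  moreover have "quad_poly_4 x y = 51840 - 42120 * m + 4860 * (m * (x + y))"
    by (simp add: quad_poly_4_def m_def)
  ultimately show "0 \<le> quad_poly_4 x y" using m by linarith
  have "x\<^sup>2 + y\<^sup>2 \<le> x + y" using assms by (simp add: power2_eq_square add_mono mult_left_le)
  then have 1: "m * (x\<^sup>2 + y\<^sup>2) \<le> m * (x + y)" using m by (intro mult_left_mono)
  have 2: "m * (2 * m) \<le> m * (x + y)" using m by (intro mult_left_mono) auto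
  have "0 \<le> (m - 1)\<^sup>2" by simp
  then have 3: "2 * m - 1 \<le> m * m" by (simp add: power2_eq_square algebra_simps)
  have "quad_poly_6 x y = 1559900160 - 2551772160 * m + 683665920 * (m * (x + y)) - 48988800 * (m * (x\<^sup>2 + y\<^sup>2)) - 47355840 * (m * m)"
    by (simp add: quad_poly_6_def m_def power2_eq_square)
  then show "0 \<le> quad_poly_6 x y" using 1 2 3 m by linarith
qed

lemma quad_moment_quad_poly:
  "quad_moment (Suc 3) \<alpha> \<beta> = quad_poly_4 (4 * \<alpha> * (1 - \<alpha>)) (4 * \<beta> * (1 - \<beta>))"
  "quad_moment (Suc 5) \<alpha> \<beta> = quad_poly_6 (4 * \<alpha> * (1 - \<alpha>)) (4 * \<beta> * (1 - \<beta>))"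
  using quad_moment_4[OF refl refl, of \<alpha> \<beta>] quad_moment_6[OF refl refl, of \<alpha> \<beta>]
  by (simp_all add: quad_poly_4_def quad_poly_6_def)

lemma quad_poly_commute: "quad_poly_4 x y = quad_poly_4 y x" "quad_poly_6 x y = quad_poly_6 y x"
  unfolding quad_poly_4_def quad_poly_6_def by algebra+

lemma quad_poly_measurable:
  "(\<lambda>(x, y). quad_poly_4 x y) \<in> borel_measurable borel" "(\<lambda>(x, y). quad_poly_6 x y) \<in> borel_measurable borel"
  unfolding quad_poly_4_def quad_poly_6_def split_def borel_prod[symmetric] by measurable

lemma simplicial_values: "simplicial_value 3 = 37193/1543500" "simplicial_value 5 = 9119/47628"
  by (simp_all add: simplicial_value_def beta_mom_def sum_atMost_expand binomial_table fact_numeral)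

text \<open>Of the seven ways a hyperplane can separate the four coordinates, four are triangular
  with the same value C * \<open>simplicial_value k\<close> and three are quadrilateral with value
  V; the prefactor combines the uniform densities 6 with the Gamma factors (k+3)!.\<close>

lemma volumetric_moment_simplex3_value:
  fixes T :: "(real^3) set"
  assumes "3 simplex T" "odd k"
  defines "C \<equiv> det_moment (Suc k) (\<lambda>a b c. fact a * fact b * fact c)"
  assumes "0 \<le> C"
    and mpp: "(\<integral>\<^sup>+a. \<integral>\<^sup>+b. \<integral>\<^sup>+c. plane_moment (Suc k) (vector [-a, b, c]) * distance_moment k (vector [-a, b, c]) \<partial>half_line \<partial>half_line \<partial>half_line) = ennreal V"
    and "0 \<le> V"
  shows "volumetric_moment k T = 6 ^ 4 / fact (k + 3) ^ 4 * (4 * (C * simplicial_value k) + 3 * V)"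
proof -
  define J where "J = (\<integral>\<^sup>+a. (\<integral>\<^sup>+b. (\<integral>\<^sup>+c. (\<integral>\<^sup>+d. ennreal (\<bar>triple (b - a) (c - a) (d - a)\<bar> ^ k)
       * indicator std3 d \<partial>lborel) * indicator std3 c \<partial>lborel) * indicator std3 b \<partial>lborel) * indicator std3 a \<partial>lborel)"
  define W where "W = C * simplicial_value k"
  have ppp: "(\<integral>\<^sup>+a. \<integral>\<^sup>+b. \<integral>\<^sup>+c. plane_moment (Suc k) (vector [a, b, c]) * distance_moment k (vector [a, b, c]) \<partial>half_line \<partial>half_line \<partial>half_line) = ennreal W"
    and W: "0 \<le> W"
    using nn_integral_hyperplanes_ppp[OF \<open>odd k\<close>] \<open>0 \<le> C\<close> by (auto simp: W_def C_def)
  have "fact (k + 3) ^ 4 * J = ennreal W + 3 * ennreal W + 3 * ennreal V"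
    unfolding J_def nn_integral_det4_std3_exponential nn_integral_det4_hyperplane nn_integral_hyperplanes_octants
      nn_integral_hyperplanes_mmp[OF \<open>odd k\<close>] ppp mpp ..
  also have "\<dots> = ennreal (4 * W + 3 * V)"
  proof -
    have "ennreal W + 3 * ennreal W + 3 * ennreal V = ennreal W + ennreal (3 * W) + ennreal (3 * V)"
      by (simp add: ennreal_mult')
    also have "\<dots> = ennreal (W + 3 * W + 3 * V)" using W \<open>0 \<le> V\<close> by (simp flip: ennreal_plus)
    finally show ?thesis by simp
  qed
  finally have J: "fact (k + 3) ^ 4 * J = ennreal (4 * W + 3 * V)" .
  have "(fact (k + 3) ^ 4 :: ennreal) = ennreal (fact (k + 3) ^ 4)"
  proof -
    have "(fact (k + 3) :: ennreal) = ennreal (fact (k + 3))"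
      by (metis ennreal_of_nat_eq_real_of_nat of_nat_fact)
    then show ?thesis by (simp only: ennreal_power fact_ge_zero)
  qed
  then have "ennreal (1 / fact (k + 3) ^ 4) * (fact (k + 3) ^ 4 * J) = J"
    by (simp add: mult.assoc[symmetric] ennreal_mult'[symmetric])
  then have "J = ennreal (1 / fact (k + 3) ^ 4) * ennreal (4 * W + 3 * V)"
    unfolding J by (rule sym)
  also have "\<dots> = ennreal (1 / fact (k + 3) ^ 4 * (4 * W + 3 * V))"
    by (rule ennreal_mult'[symmetric]) simp
  finally have "J = ennreal (1 / fact (k + 3) ^ 4 * (4 * W + 3 * V))" .
  then have "6 ^ 4 * J = ennreal (6 ^ 4) * ennreal (1 / fact (k + 3) ^ 4 * (4 * W + 3 * V))"
    by simp
  also have "\<dots> = ennreal (6 ^ 4 * (1 / fact (k + 3) ^ 4 * (4 * W + 3 * V)))"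
    by (rule ennreal_mult'[symmetric]) simp
  finally have "6 ^ 4 * J = ennreal (6 ^ 4 * (1 / fact (k + 3) ^ 4 * (4 * W + 3 * V)))" .
  then have "volumetric_moment k T = 6 ^ 4 * (1 / fact (k + 3) ^ 4 * (4 * W + 3 * V))"
    unfolding volumetric_moment_simplex3[OF assms(1)] J_def[symmetric] using W \<open>0 \<le> V\<close> by simp
  then show ?thesis by (simp add: W_def)
qed

theorem mainTheorem2:
  fixes T :: "(real ^ 3) set"
  assumes "3 simplex T"
  shows "volumetric_moment 3 T = 733 / 12600000 + 79 * pi ^ 2 / 2424922500
       \<and> volumetric_moment 5 T = 5125739 / 4356374400000 - 547 * pi ^ 2 / 8943995970000"
proof
  define S3 where "S3 = 4859036611 / 44100 + 316 / 3 * pi\<^sup>2"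
  have series: "(\<lambda>m. real ((m + (3 + 4)) choose (3 + 4)) * bipoly_mom bipoly_3 (real m)) sums S3"
    using bipoly_3_series by (simp add: S3_def)
  have mpp: "(\<integral>\<^sup>+a. \<integral>\<^sup>+b. \<integral>\<^sup>+c. plane_moment (Suc 3) (vector [-a, b, c]) * distance_moment 3 (vector [-a, b, c]) \<partial>half_line \<partial>half_line \<partial>half_line)
      = ennreal (8 * (fact 3 * 22754631352320000 / fact (3 * 3 + 12)) * S3)" and S: "0 \<le> S3"
    by (rule nn_integral_hyperplanes_mpp_series[where k=3 and D=22754631352320000 and g=quad_poly_4 and L=bipoly_3],
        simp, rule quad_poly_commute, rule quad_poly_measurable, rule quad_moment_quad_poly, erule (3) quad_poly_nonneg,
        simp, rule unit_plane_distance_3, assumption, assumption, rule series)+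
  have C: "det_moment (Suc 3) (\<lambda>a b c. fact a * fact b * fact c) = 51840"
    using det_moment_4_fact by simp
  have C0: "0 \<le> det_moment (Suc 3) (\<lambda>a b c. fact a * fact b * fact c)"
    unfolding C by simp
  \<comment> \<open>Here 51840 is the triangular determinant moment of order k+1 = 4, and (3k+12)! =
    21! normalises the t-integral.\<close>
  have "volumetric_moment 3 T = 6 ^ 4 / fact (3 + 3) ^ 4 * (4 * (51840 * simplicial_value 3) + 3 * (8 * (fact 3 * 22754631352320000 / fact (3 * 3 + 12)) * S3))"
    unfolding C[symmetric] by (rule volumetric_moment_simplex3_value[OF assms _ C0 mpp]) (use S in simp_all)
  then show "volumetric_moment 3 T = 733 / 12600000 + 79 * pi ^ 2 / 2424922500"
    by (simp add: simplicial_values S3_def fact_numeral) algebra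
next
  define S5 where "S5 = 2008761134237 / 12960 + -48136 / 3 * pi\<^sup>2"
  have series: "(\<lambda>m. real ((m + (5 + 4)) choose (5 + 4)) * bipoly_mom bipoly_5 (real m)) sums S5"
    using bipoly_5_series by (simp add: S5_def)
  have mpp: "(\<integral>\<^sup>+a. \<integral>\<^sup>+b. \<integral>\<^sup>+c. plane_moment (Suc 5) (vector [-a, b, c]) * distance_moment 5 (vector [-a, b, c]) \<partial>half_line \<partial>half_line \<partial>half_line)
      = ennreal (8 * (fact 5 * 29388294491573374156800000 / fact (3 * 5 + 12)) * S5)" and S: "0 \<le> S5"
    by (rule nn_integral_hyperplanes_mpp_series[where k=5 and D=29388294491573374156800000 and g=quad_poly_6 and L=bipoly_5],
        simp, rule quad_poly_commute, rule quad_poly_measurable, rule quad_moment_quad_poly, erule (3) quad_poly_nonneg,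
        simp, rule unit_plane_distance_5, assumption, assumption, rule series)+
  have C: "det_moment (Suc 5) (\<lambda>a b c. fact a * fact b * fact c) = 1559900160"
    using det_moment_6_fact by simp
  have C0: "0 \<le> det_moment (Suc 5) (\<lambda>a b c. fact a * fact b * fact c)"
    unfolding C by simp
  \<comment> \<open>Correspondingly, 1559900160 is the triangular determinant moment of order 6, and
    the normalising factorial is 27!.\<close>
  have "volumetric_moment 5 T = 6 ^ 4 / fact (5 + 3) ^ 4 * (4 * (1559900160 * simplicial_value 5) + 3 * (8 * (fact 5 * 29388294491573374156800000 / fact (3 * 5 + 12)) * S5))"
    unfolding C[symmetric] by (rule volumetric_moment_simplex3_value[OF assms _ C0 mpp]) (use S in simp_all)
  then show "volumetric_moment 5 T = 5125739 / 4356374400000 - 547 * pi ^ 2 / 8943995970000"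
    by (simp add: simplicial_values S5_def fact_numeral) algebra
qed

end
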